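(* Let $0<\sigma<1$ and $C>0$, and put $c=\min\{\sigma,1-\sigma\}/6$ and $c'=\min\{\sigma,1-\sigma\}/5$. For every $\epsilon\in(0,1)$ there is a constant $K=K(\epsilon,C,\sigma)>0$ such that for every $\delta\in(0,1)$ and every $(\delta,\sigma,C)$-set $A\subset[1,2]$, all of the following four inequalities hold (one for each choice of sign in each line): $$N_\delta(A\pm A)+N_\delta(AA)\ \ge\ K^{-1}\,\delta^{\epsilon}\,\delta^{-\sigma-c},$$ $$N_\delta(A\pm A)+N_\delta(A/A)\ \ge\ K^{-1}\,\delta^{\epsilon}\,\delta^{-\sigma-c'}.$$
   Context: For $\delta>0$, $\sigma\in(0,1)$, $C>0$, a finite non-empty $\delta$-separated set $A\subset\mathbb{R}$ is called a $(\delta,\sigma,C)$-set if $|A\cap B(x,r)|\le C r^\sigma |A|$ for all $x\in\mathbb{R}$ and all $r\ge\delta$. Here $|\cdot|$ denotes cardinality and $B(x,r)$ is the ball of radius $r$ centred at $x$. For bounded $E\subset\mathbb{R}$, $N_\delta(E)$ is the least number of intervals of length $\delta$ needed to cover $E$. Notation: $A+A=\{a+b:a,b\in A\}$, $A-A=\{a-b:a,b\in A\}$, $AA=\{ab:a,b\in A\}$, $A/A=\{a/b:a,b\in A\}$. *)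

theory Defs
  imports "HOL-Analysis.Analysis"
begin

definition delta_separated :: "real \<Rightarrow> real set \<Rightarrow> bool" where
  "delta_separated \<delta> A \<longleftrightarrow> (\<forall>a\<in>A. \<forall>b\<in>A. a \<noteq> b \<longrightarrow> dist a b \<ge> \<delta>)"

text \<open>
  Balls are taken to be closed. As the bound is required for all \<open>r \<ge> \<delta>\<close> and is continuous
  in \<open>r\<close>, open balls give the same notion.
\<close>

definition delta_sigma_set :: "real \<Rightarrow> real \<Rightarrow> real \<Rightarrow> real set \<Rightarrow> bool" where
  "delta_sigma_set \<delta> \<sigma> C A \<longleftrightarrow>
     finite A \<and> A \<noteq> {} \<and> delta_separated \<delta> A \<and>
     (\<forall>x r. r \<ge> \<delta> \<longrightarrow> real (card (A \<inter> cball x r)) \<le> C * r powr \<sigma> * real (card A))"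

text \<open>
  An interval of length \<open>\<delta>\<close> is represented by its left endpoint. Intervals are closed; every
  interval of length \<open>\<delta>\<close> lies in a closed one of the same length, so admitting the other kinds
  would not change the minimum. For \<open>\<delta> > 0\<close> and bounded \<open>E\<close> a finite cover exists, so the
  \<open>LEAST\<close> is attained; otherwise the value is unspecified.
\<close>

definition covering_number :: "real \<Rightarrow> real set \<Rightarrow> nat" where
  "covering_number \<delta> E =
     (LEAST n. \<exists>X. finite X \<and> card X = n \<and> E \<subseteq> (\<Union>x\<in>X. {x..x + \<delta>}))"

end

theory Submission
  imports Defs
begin

text \<open>
Give \<open>X = A \<times> A\<close> (for sums, \<open>A\<close> is first joined with \<open>- A\<close>) its uniform measure. For every
\<open>\<tau> < 2 min {\<sigma>, 1/2}\<close> almost every pair of points of \<open>X\<close> spans a line whose \<open>\<delta>\<close>-neighbourhood has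
mass below \<open>\<delta> powr \<tau>\<close>, so a typical point of \<open>X\<close> sees about \<open>\<delta> powr (- \<tau>)\<close> directions. A direction
is a quotient of two sums (differences) of elements \<open>a, b, x, y\<close> of \<open>A\<close>, and it does not change when all
four are divided by \<open>x\<close> or multiplied by some \<open>u \<in> A\<close>. Sorting the tuples by the \<open>\<delta>\<close>-cells of
\<open>(a/x, b/x, y/x)\<close>, or of \<open>(au, bu, xu, yu)\<close>, one finds each of these directions represented by many pairs
of cells of \<open>A \<plusminus> A\<close>. This bounds \<open>\<delta> powr (- \<tau>) |A|^4\<close> by \<open>N(A \<plusminus> A)^2 N(A/A)^3\<close> and
\<open>\<delta> powr (- \<tau>) |A|^5\<close> by \<open>N(A \<plusminus> A)^2 N(AA)^4\<close>, up to constants.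

The exponent \<open>\<tau>\<close> is reached by bootstrapping from \<open>\<sigma> / 2\<close>. If tubes are thin for an exponent slightly below
\<open>\<tau>\<close> but heavy at the smallest scale for one slightly above it, then Kaufman's argument, applied with one
endpoint fixed, controls the mass of typical tubes near their points, and rescaling a suitable tube
gives a family of lines that violates a discretised form of Bourgain's projection theorem. In that
theorem, the Balog-Szemeredi-Gowers theorem and Pluennecke's inequality turn small projections into an
integer set \<open>V\<close> for which all \<open>t V\<close>, \<open>t\<close> in a Frostman set, lie near few translates of \<open>V - V\<close>. The set of
such \<open>t\<close> is almost closed under ring operations, which make it grow, while an energy estimate keeps it small.
\<close>

subsection \<open>Sumset inequalities\<close>

text \<open>The denominators \<open>6\<close> and \<open>5\<close> count factors. Put
  \<open>T = N(A +- A) + N(AA)\<close>. As \<open>|A|\<close> is at least of order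
  \<open>delta powr (- \<sigma>)\<close>, the last bound gives
  \<open>T ^ 6 >= delta powr (- \<tau> - 5 * \<sigma>)\<close> up to constants; for quotients it is
  a fifth power and \<open>- \<tau> - 4 * \<sigma>\<close>. Either way the gain over \<sigma> is
  \<open>(\<tau> - \<sigma>) / p\<close>, and \<open>\<tau> - \<sigma>\<close> tends to \<open>2 *
  min \<sigma> (1 / 2) - \<sigma> = min \<sigma> (1 - \<sigma>)\<close>. The trivial tube estimate,
  one vertical fibre at a time, reaches only \<open>\<tau> < \<sigma>\<close> and yields nothing, so
  all of the gain comes from the bootstrapping. What could stop it is a configuration resembling a
  plane over an approximate subring of the reals; hence the need for ring growth. The gain of one
  bootstrapping step is not controlled from below, so a supremum argument is used. Losses stay
  harmless because only a fixed number \<open>J\<close> of scales \<open>l powr (- j)\<close>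
  occurs, with \<open>l = delta powr (- 1 / J)\<close>: constants, factors depending on
  \<open>J\<close> and the number of mass profiles are each below one factor
  \<open>l\<close>.\<close>

definition sumset :: "'a::ab_group_add set => 'a set => 'a set" where
 "sumset A B = (%(a, b). a + b) ` (A \<times> B)"

definition diffset :: "'a::ab_group_add set => 'a set => 'a set" where
 "diffset A B = (%(a, b). a - b) ` (A \<times> B)"

primrec nsum :: "nat => 'a::ab_group_add set => 'a set" where
 "nsum 0 J = {0}"
| "nsum (Suc n) J = sumset J (nsum n J)"

lemma finite_sumset [simp]: "finite A ==> finite B ==> finite (sumset A B)"
 by (simp add: sumset_def)

lemma finite_diffset [simp]: "finite A ==> finite B ==> finite (diffset A B)"
 by (simp add: diffset_def)

lemma finite_nsum [simp]: "finite J ==> finite (nsum n J)"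
 by (induction n) auto

lemma sumsetI: "a \<in> A ==> b \<in> B ==> a + b \<in> sumset A B"
 by (force simp: sumset_def)

lemma sumsetE: "x \<in> sumset A B ==> (!!a b. x = a + b ==> a \<in> A ==> b \<in> B ==> P) ==> P"
 by (force simp: sumset_def)

lemma diffsetI: "a \<in> A ==> b \<in> B ==> a - b \<in> diffset A B"
 by (force simp: diffset_def)

lemma diffsetE: "x \<in> diffset A B ==> (!!a b. x = a - b ==> a \<in> A ==> b \<in> B ==> P) ==> P"
 by (force simp: diffset_def)

text \<open>The induction adds one \<open>c\<close> at a time. \<open>Z\<close> collects the
  \<open>x\<close> for which \<open>x + B + c\<close> already lies in \<open>X + B + C\<close>, so
  at most \<open>|X + B| - |Z + B|\<close> new sums appear, while \<open>X + C\<close> gains at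
  least \<open>|X| - |Z|\<close> elements. Minimality of the ratio of \<open>X\<close> compares the
  two.\<close>

lemma petridis:
 fixes X B C :: "'a::ab_group_add set"
 assumes fin: "finite X" "finite B" "finite C"
  and minr: "!!Z. Z <= X ==> card (sumset X B) * card Z <= card (sumset Z B) * card X"
 shows "card (sumset (sumset X B) C) * card X <= card (sumset X B) * card (sumset X C)"
 using fin(3)
proof (induction C)
 case empty
 then show ?case by (simp add: sumset_def)
next
 case (insert c C)
 let ?S = "sumset X B"
 define Z where "Z = {x \<in> X. ALL b:B. x + b + c \<in> sumset ?S C}"
 have ZX: "Z <= X" "finite Z" using fin by (auto simp: Z_def)
 let ?sh = "%x. x + c"
 have "sumset ?S (insert c C) <= sumset ?S C Un ?sh ` (?S - sumset Z B)"
 proof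
  fix y assume "y \<in> sumset ?S (insert c C)"
  then obtain s d where y: "y = s + d" "s \<in> ?S" "d = c | d \<in> C" by (rule sumsetE) auto
  show "y \<in> sumset ?S C Un ?sh ` (?S - sumset Z B)"
  proof (cases "d \<in> C | s \<in> sumset Z B")
   case True
   then show ?thesis using y by (auto intro: sumsetI elim!: sumsetE simp: Z_def)
  next
   case False
   then show ?thesis using y by auto
  qed
 qed
 then have "card (sumset ?S (insert c C)) <= card (sumset ?S C Un ?sh ` (?S - sumset Z B))"
  using fin insert by (intro card_mono) auto
 also have "... <= card (sumset ?S C) + card (?sh ` (?S - sumset Z B))" by (rule card_Un_le)
 also have "card (?sh ` (?S - sumset Z B)) = card (?S - sumset Z B)"
  by (intro card_image) (auto simp: inj_on_def)
 also have "card (?S - sumset Z B) = card ?S - card (sumset Z B)"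
  using ZX fin by (intro card_Diff_subset) (auto simp: sumset_def)
 finally have up: "card (sumset ?S (insert c C)) <= card (sumset ?S C) + (card ?S - card (sumset Z B))" .
 have "sumset X C Un ?sh ` (X - Z) <= sumset X (insert c C)"
  by (auto intro: sumsetI elim!: sumsetE)
 moreover have "sumset X C Int ?sh ` (X - Z) = {}"
 proof -
  have "x \<in> Z" if "x \<in> X" "x + c \<in> sumset X C" for x
  proof -
   from that(2) obtain x' d where d: "x + c = x' + d" "x' \<in> X" "d \<in> C" by (auto elim!: sumsetE)
   have "x + b + c = (x' + b) + d" for b using d(1) by simp
   then have "ALL b:B. x + b + c \<in> sumset (sumset X B) C" using d by (auto simp only: intro!: sumsetI)
   then show ?thesis using that(1) by (simp add: Z_def)
  qed
  then show ?thesis by auto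
 qed
 ultimately have "card (sumset X C) + card (?sh ` (X - Z)) <= card (sumset X (insert c C))"
  using fin insert by (subst card_Un_disjoint [symmetric]) (auto intro!: card_mono)
 moreover have "card (?sh ` (X - Z)) = card X - card Z"
  using ZX by (subst card_image) (auto simp: inj_on_def card_Diff_subset)
 ultimately have low: "card (sumset X C) + (card X - card Z) <= card (sumset X (insert c C))" by simp
 have Zle: "card Z <= card X" "card (sumset Z B) <= card ?S"
  using ZX fin by (auto intro!: card_mono simp: sumset_def)
 have "card (sumset ?S (insert c C)) * card X
   <= card (sumset ?S C) * card X + (card ?S * card X - card (sumset Z B) * card X)"
  using mult_right_mono [OF up, of "card X"] by (simp add: algebra_simps)
 also have "... <= card ?S * card (sumset X C) + (card ?S * card X - card ?S * card Z)"
  using insert.IH minr [OF ZX(1)] by simp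
 also have "... = card ?S * (card (sumset X C) + (card X - card Z))"
  by (simp add: algebra_simps)
 also have "... <= card ?S * card (sumset X (insert c C))" using low by simp
 finally show ?case .
qed

lemma sumset_assoc: "sumset (sumset A B) C = sumset A (sumset B C)"
 by (auto elim!: sumsetE) (metis add.assoc sumsetI)+

text \<open>A subset minimising \<open>|X + J| / |X|\<close> satisfies the hypothesis of
  \<open>petridis\<close>; it is chosen before \<open>n\<close>, so one \<open>X\<close> serves for
  all \<open>n\<close>.\<close>

lemma plunnecke:
 fixes X0 J :: "'a::ab_group_add set" and K :: real
 assumes "finite X0" "X0 ~= {}" "finite J"
  and K: "card (sumset X0 J) <= K * card X0"
 obtains X where "X <= X0" "X ~= {}" "!!n. real (card (sumset X (nsum n J))) <= K ^ n * card X"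
proof -
 let ?r = "%X. real (card (sumset X J)) / card X"
 let ?F = "{X. X <= X0 & X ~= {}}"
 have "finite ?F" "?F ~= {}" using assms by auto
 then obtain X where X: "X \<in> ?F" "!!Z. Z \<in> ?F ==> ?r X <= ?r Z"
  using arg_min_if_finite[of ?F ?r] by (metis (no_types, lifting) not_le)
 have fX: "finite X" "card X > 0" using X assms by (auto simp: card_gt_0_iff intro: finite_subset)
 have K0: "card X0 > 0" using assms by auto
 have "?r X <= ?r X0" using X(2)[of X0] assms by simp
 also have "... <= K" using K K0 by (simp add: divide_le_eq)
 finally have XK: "card (sumset X J) <= K * card X" using fX by (simp add: divide_le_eq)
 have Kn: "K >= 0"
  using K K0 by (metis (full_types) le_less_trans linorder_not_less mult_neg_pos of_nat_0_less_iff of_nat_0_le_iff)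
 have minr: "card (sumset X J) * card Z <= card (sumset Z J) * card X" if "Z <= X" for Z
 proof (cases "Z = {}")
  case False
  have fZ: "card Z > 0" using fX that False by (auto simp: card_gt_0_iff intro: finite_subset)
  have "?r X <= ?r Z" using X that False by auto
  then have "real (card (sumset X J)) * card Z <= real (card (sumset Z J)) * card X"
   using fX fZ by (simp add: field_simps)
  then show ?thesis by (metis of_nat_le_iff of_nat_mult)
 qed simp
 have "real (card (sumset X (nsum n J))) <= K ^ n * card X" for n
 proof (induction n)
  case 0
  have "sumset X {0} = X" by (force simp: sumset_def)
  then show ?case by simp
 next
  case (Suc n)
  have "card (sumset X (nsum (Suc n) J)) * card X <= card (sumset X J) * card (sumset X (nsum n J))"
   using petridis[OF fX(1) assms(3) _ minr, of "nsum n J"] assms by (simp add: sumset_assoc)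
  then have "real (card (sumset X (nsum (Suc n) J)) * card X) <= real (card (sumset X J) * card (sumset X (nsum n J)))"
   by linarith
  also have "... <= (K * card X) * (K ^ n * card X)"
   using XK Suc by (simp only: of_nat_mult) (intro mult_mono, auto)
  finally show ?case using fX by simp
 qed
 then show thesis using that X by auto
qed

text \<open>Each difference \<open>d\<close> gets one fixed representation \<open>f d - g d\<close>.
  From \<open>(x + f d, x + g d)\<close> one recovers \<open>d\<close> by subtraction and then
  \<open>x\<close>, so the map is injective.\<close>

lemma ruzsa_triangle:
 fixes X B C :: "'a::ab_group_add set"
 assumes "finite X" "finite B" "finite C"
 shows "card (diffset B C) * card X <= card (sumset X B) * card (sumset X C)"
proof -
 have "ALL d:diffset B C. EX b c. b \<in> B & c \<in> C & d = b - c" by (auto elim!: diffsetE)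
 then obtain f g where fg: "!!d. d \<in> diffset B C ==> f d \<in> B & g d \<in> C & d = f d - g d" by metis
 let ?h = "%(d, x). (x + f d, x + g d)"
 have "inj_on ?h (diffset B C \<times> X)"
 proof (intro inj_onI, clarify)
  fix d x d' x' assume a: "d \<in> diffset B C" "d' \<in> diffset B C" "x + f d = x' + f d'" "x + g d = x' + g d'"
  have "d = (x + f d) - (x + g d)" using fg[OF a(1)] by simp
  also have "... = d'" unfolding a using fg[OF a(2)] by simp
  finally show "d = d' & x = x'" using a by auto
 qed
 then have "card (diffset B C \<times> X) = card (?h ` (diffset B C \<times> X))" by (simp add: card_image)
 also have "... <= card (sumset X B \<times> sumset X C)"
  using assms fg by (intro card_mono) (auto intro: sumsetI)
 finally show ?thesis by (simp add: card_cartesian_product)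
qed

text \<open>A maximal pairwise disjoint subfamily does it. This greedy covering is applied to
  translates in \<open>ruzsa_covering\<close> and to families of floor cells in
  \<open>covers_good\<close>.\<close>

lemma disjoint_subfamily:
 fixes C :: "'i => 'b set"
 assumes "finite Y" "finite Z" "!!y. y \<in> Y ==> C y <= Z" "!!y. y \<in> Y ==> n <= card (C y)"
 obtains Y' where "Y' <= Y" "card Y' * n <= card Z"
  "ALL y:Y. n > 0 --> (EX y':Y'. C y Int C y' ~= {})"
proof -
 define F where "F = {W. W <= Y & (ALL a:W. ALL b:W. a ~= b --> C a Int C b = {})}"
 have "finite F" "{} \<in> F" using assms(1) by (auto simp: F_def)
 from finite_has_maximal2[OF this] obtain W where W0: "W \<in> F" "!!V. V \<in> F ==> W <= V ==> W = V"
  by auto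
 have W: "W <= Y" "!!a b. a \<in> W ==> b \<in> W ==> a ~= b ==> C a Int C b = {}"
  using W0(1) unfolding F_def by auto
 have fW: "finite W" using W(1) assms(1) by (rule finite_subset)
 have "card W * n = (\<Sum>w\<in>W. n)" by simp
 also have "... <= (\<Sum>w\<in>W. card (C w))" using W(1) assms(4) by (intro sum_mono) auto
 also have "... = card (\<Union>w\<in>W. C w)"
  using W fW finite_subset[OF assms(3) assms(2)] by (intro card_UN_disjoint[symmetric]) auto
 also have "... <= card Z" using W(1) assms(2,3) by (intro card_mono) auto
 finally have c: "card W * n <= card Z" .
 have "EX y':W. C y Int C y' ~= {}" if y: "y \<in> Y" and n: "n > 0" for y
 proof (rule ccontr)
  assume no: "~ ?thesis"
  have "C y ~= {}" using assms(4)[OF y] n by auto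
  then have "y \<notin> W" using no by auto
  moreover have "insert y W \<in> F" using W y no by (auto simp: F_def)
  ultimately show False using W0(2)[of "insert y W"] by auto
 qed
 then show thesis using that[of W] W(1) c by simp
qed

lemma ruzsa_covering:
 fixes S J :: "'a::ab_group_add set"
 assumes "finite S" "finite J" "J ~= {}"
 obtains G where "G <= S" "card G * card J <= card (sumset S J)"
  "ALL s:S. EX g:G. EX a:J. EX b:J. s = g + a - b"
proof -
 let ?C = "%s. (%j. s + j) ` J"
 have "card (?C s) = card J" for s by (intro card_image) (auto simp: inj_on_def)
 then obtain G where G: "G <= S" "card G * card J <= card (sumset S J)"
  "ALL y:S. card J > 0 --> (EX y':G. ?C y Int ?C y' ~= {})"
  by (rule_tac disjoint_subfamily[of S "sumset S J" ?C "card J"])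
   (use assms in \<open>auto intro: sumsetI simp: that\<close>)
 have J0: "card J > 0" using assms by auto
 have "EX g:G. EX a:J. EX b:J. s = g + a - b" if "s \<in> S" for s
 proof -
  from G(3) that J0 have "EX y':G. ?C s Int ?C y' ~= {}" by simp
  then obtain g a b where "g \<in> G" "a \<in> J" "b \<in> J" "s + b = g + a" by auto
  then show ?thesis by (metis add_diff_cancel)
 qed
 then show thesis using that G by simp
qed

text \<open>Pluennecke bounds \<open>5 J\<close> and \<open>4 J\<close>, and the triangle inequality
  their difference, whence \<open>K ^ (5 + 4)\<close>. As \<open>(4 J - 4 J) + J\<close> lies in
  \<open>5 J - 4 J\<close>, Ruzsa covering applies. Four summands of each sign are what
  \<open>covers_difprod\<close> and \<open>covers_good\<close> have to fold back.\<close>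

lemma sumset_cover:
 fixes U J :: "'a::ab_group_add set" and K :: real
 assumes fin: "finite U" "U ~= {}" "finite J" "J ~= {}" and K: "card (sumset U J) <= K * card U"
 obtains G where "card (diffset (nsum 5 J) (nsum 4 J)) <= K ^ 9 * card U"
  "finite G" "card G * card J <= K ^ 9 * card U"
  "ALL s:diffset (nsum 4 J) (nsum 4 J). EX g:G. EX a:J. EX b:J. s = g + a - b"
proof -
 obtain X where X: "X <= U" "X ~= {}" "!!n. real (card (sumset X (nsum n J))) <= K ^ n * card X"
  using plunnecke[OF fin(1,2,3) K] by auto
 have fX: "finite X" "card X > 0" using X fin by (auto simp: card_gt_0_iff intro: finite_subset)
 let ?S = "diffset (nsum 4 J) (nsum 4 J)"
 have "sumset ?S J <= diffset (nsum 5 J) (nsum 4 J)"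
 proof
  fix x assume "x \<in> sumset ?S J"
  then obtain a b c where x: "x = (a - b) + c" "a \<in> nsum 4 J" "b \<in> nsum 4 J" "c \<in> J"
   by (auto elim!: sumsetE diffsetE)
  have "nsum 5 J = sumset J (nsum 4 J)" by (simp add: numeral_eq_Suc)
  then have "c + a \<in> nsum 5 J" using x by (auto intro: sumsetI)
  moreover have "x = (c + a) - b" using x by simp
  ultimately show "x \<in> diffset (nsum 5 J) (nsum 4 J)" using x(3) by (simp add: diffsetI)
 qed
 then have "card (sumset ?S J) <= card (diffset (nsum 5 J) (nsum 4 J))"
  using fin by (intro card_mono) auto
 moreover obtain G where G: "G <= ?S" "card G * card J <= card (sumset ?S J)"
  "ALL s:?S. EX g:G. EX a:J. EX b:J. s = g + a - b"
  using ruzsa_covering[OF finite_diffset[OF finite_nsum finite_nsum, OF fin(3) fin(3)] fin(3,4)] by blast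
 ultimately have GD: "real (card G * card J) <= card (diffset (nsum 5 J) (nsum 4 J))"
  unfolding of_nat_le_iff by simp
 have "card (diffset (nsum 5 J) (nsum 4 J)) * card X <= card (sumset X (nsum 5 J)) * card (sumset X (nsum 4 J))"
  using fX fin by (intro ruzsa_triangle) auto
 then have "real (card (diffset (nsum 5 J) (nsum 4 J)) * card X) <= card (sumset X (nsum 5 J)) * card (sumset X (nsum 4 J))"
  by linarith
 also have "... <= (K ^ 5 * card X) * (K ^ 4 * card X)"
  unfolding of_nat_mult by (intro mult_mono X(3)) (auto intro: order_trans[OF _ X(3)])
 finally have "real (card (diffset (nsum 5 J) (nsum 4 J))) * card X <= (K ^ 9 * card X) * card X"
  by (simp add: algebra_simps flip: power_add)
 then have "real (card (diffset (nsum 5 J) (nsum 4 J))) <= K ^ 9 * card X" using fX by simp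
 also have "... <= K ^ 9 * card U"
 proof -
  have "0 <= K * card X" using order_trans[OF of_nat_0_le_iff X(3)[of 1]] by simp
  then have "0 <= K" using fX(2) by (metis mult_less_0_iff not_le of_nat_0_less_iff)
  then show ?thesis using X(1) fin(1) by (auto intro!: mult_left_mono card_mono)
 qed
 finally have "real (card (diffset (nsum 5 J) (nsum 4 J))) <= K ^ 9 * card U" .
 moreover from this GD have "real (card G) * card J <= K ^ 9 * card U" by simp
 moreover have "finite G" using G(1) fin(3) by (metis finite_diffset finite_nsum finite_subset)
 ultimately show thesis using that[of G] G(3) by simp
qed

lemma double_count:
 assumes "finite X" "finite Y"
 shows "(\<Sum>x\<in>X. card {y\<in>Y. R x y}) = (\<Sum>y\<in>Y. card {x\<in>X. R x y})"
proof -
 have c: "card {y\<in>S. P y} = (\<Sum>y\<in>S. if P y then 1 else 0)" if "finite S" for S and P :: "'z => bool"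
  using that by (simp add: sum.If_cases Int_def)
 show ?thesis unfolding c[OF assms(1)] c[OF assms(2)] by (rule sum.swap)
qed

subsection \<open>The Balog-Szemeredi-Gowers theorem\<close>

lemma sum_const_le:
 fixes c :: real
 assumes "finite A" "B <= A" "0 <= c"
 shows "(\<Sum>x\<in>B. c) <= card A * c"
 using assms by (simp add: mult_right_mono card_mono)

lemma card_rel_bound:
 assumes "finite X" "finite Y"
 shows "card {(x, y). x \<in> X & y \<in> Y & R x y} = (\<Sum>x\<in>X. card {y \<in> Y. R x y})"
proof -
 have "{(x, y). x \<in> X & y \<in> Y & R x y} = (SIGMA x:X. {y \<in> Y. R x y})" by auto
 then show ?thesis using assms by simp
qed

text \<open>Among the vertices of large degree, the neighbours of a suitable \<open>y0\<close> are
  numerous, and few pairs of them have few common neighbours. Discarding those in many such bad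
  pairs leaves \<open>A'\<close>. Then \<open>a\<close> in \<open>A'\<close> and \<open>b\<close> in
  \<open>B'\<close> are joined through any neighbour \<open>a1\<close> of \<open>b\<close> that
  shares many neighbours with \<open>a\<close>: these are the paths of length three.\<close>

lemma bsg_graph:
 fixes A :: "'a set" and B :: "'b set" and K :: real
 assumes fin: "finite A" "finite B" "G <= A \<times> B" and K: "1 <= K"
  and ne: "A ~= {}" "B ~= {}" and dense: "card A * card B <= K * card G"
 obtains A' B' where "A' <= A" "B' <= B" "card A <= 8 * K * card A'"
  "card A * card B <= 32 * K^2 * card (G Int A' \<times> B')"
  "ALL b:B'. card A' <= 4 * K * card {a \<in> A'. (a, b) \<in> G}"
  "ALL a:A'. ALL b:B'. card A * card B
    <= 2 ^ 14 * K ^ 5 * card {(a1, b1). (a, b1) \<in> G & (a1, b1) \<in> G & (a1, b) \<in> G}"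
proof -
 define a where "a = real (card A)"
 define b where "b = real (card B)"
 have pos: "a > 0" "b > 0" using fin ne by (auto simp: a_def b_def)
 have finG: "finite G" using fin by (meson finite_SigmaI finite_subset)
 let ?deg = "%x. card {y \<in> B. (x, y) \<in> G}"
 define A1 where "A1 = {x \<in> A. b / (2 * K) <= ?deg x}"
 have fA1: "finite A1" using fin by (simp add: A1_def)
 let ?N = "%y. {x \<in> A1. (x, y) \<in> G}"
 have cG: "real (card G) = (\<Sum>x\<in>A. real (?deg x))"
 proof -
  have "G = {(x, y). x \<in> A & y \<in> B & (x, y) \<in> G}" using fin by auto
  then have "card G = (\<Sum>x\<in>A. ?deg x)" using card_rel_bound[OF fin(1,2), of "%x y. (x, y) \<in> G"] by simp
  then show ?thesis by simp
 qed
 have "(\<Sum>x\<in>A - A1. real (?deg x)) <= (\<Sum>x\<in>A - A1. b / (2 * K))"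
  by (intro sum_mono) (auto simp: A1_def)
 also have "... <= a * (b / (2 * K))"
  using fin K pos unfolding a_def by (intro sum_const_le) auto
 finally have low: "(\<Sum>x\<in>A - A1. real (?deg x)) <= a * b / (2 * K)" by simp
 have "a * b / K <= card G" using dense K by (simp add: a_def b_def divide_le_eq mult.commute)
 also have "... = (\<Sum>x\<in>A1. real (?deg x)) + (\<Sum>x\<in>A - A1. real (?deg x))"
  unfolding cG using fin by (subst sum.subset_diff[of A1]) (auto simp: A1_def)
 finally have "a * b / (2 * K) <= (\<Sum>x\<in>A1. real (?deg x))" using low by simp
 also have "... = (\<Sum>y\<in>B. real (card (?N y)))"
  using double_count[OF fA1 fin(2), of "%x y. (x, y) \<in> G"] by (simp flip: of_nat_sum)
 finally have S1: "a * b / (2 * K) <= (\<Sum>y\<in>B. real (card (?N y)))" .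
 have "(a * b / (2 * K))^2 <= (\<Sum>y\<in>B. real (card (?N y)))^2"
  using S1 pos K by (intro power_mono) auto
 also have "... <= (\<Sum>y\<in>B. (real (card (?N y)))^2) * b"
  unfolding b_def by (rule sum_squared_le_sum_of_squares)
 finally have S2: "a^2 * b / (4 * K^2) <= (\<Sum>y\<in>B. (real (card (?N y)))^2)"
  using pos K by (simp add: field_simps power2_eq_square)
 \<comment> \<open>With \<open>e * (32 * K) * (8 * K^2) = 1\<close>, bad pairs weighted by
   \<open>32 * K\<close> cost at most half of the second moment in \<open>S2\<close>.\<close>
 define e where "e = 1 / (256 * K ^ 3)"
 let ?co = "%x x'. card {y \<in> B. (x, y) \<in> G & (x', y) \<in> G}"
 define Bd where "Bd = {(x, x'). x \<in> A & x' \<in> A & ?co x x' < e * b}"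
 have Bd: "Bd <= A \<times> A" by (auto simp: Bd_def)
 have fBd: "finite Bd" using fin(1) by (intro finite_subset[OF Bd]) simp
 have cBd: "real (card Bd) <= a^2"
  using card_mono[OF _ Bd] fin by (simp add: a_def card_cartesian_product power2_eq_square flip: of_nat_mult)
 let ?bad = "%y. card {p \<in> Bd. fst p \<in> ?N y & snd p \<in> ?N y}"
 have "(\<Sum>y\<in>B. real (?bad y)) = (\<Sum>p\<in>Bd. real (card {y \<in> B. fst p \<in> ?N y & snd p \<in> ?N y}))"
  using double_count[OF fin(2) fBd, of "%y p. fst p \<in> ?N y & snd p \<in> ?N y"] by (simp flip: of_nat_sum)
 also have "... <= (\<Sum>p\<in>Bd. e * b)"
 proof (intro sum_mono)
  fix p assume p: "p \<in> Bd"
  have "card {y \<in> B. fst p \<in> ?N y & snd p \<in> ?N y} <= ?co (fst p) (snd p)"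
   using fin by (intro card_mono) auto
  then show "real (card {y \<in> B. fst p \<in> ?N y & snd p \<in> ?N y}) <= e * b"
   using p by (auto simp: Bd_def)
 qed
 also have "... = card Bd * (e * b)" by simp
 also have "... <= a^2 * (e * b)" using cBd pos K by (intro mult_right_mono) (auto simp: e_def)
 finally have S3: "(\<Sum>y\<in>B. real (?bad y)) <= a^2 * (e * b)" .
 have eK: "e * (32 * K) * (8 * K^2) = 1" using K by (simp add: e_def power2_eq_square power3_eq_cube)
 \<comment> \<open>Averaging the squared neighbourhood size minus the weighted number of bad pairs:
   one lower bound at \<open>y0\<close> makes the neighbourhood large and its bad pairs few.\<close>
 have "EX y:B. a^2 / (8 * K^2) <= (real (card (?N y)))^2 - 32 * K * ?bad y"
 proof (rule ccontr)
  assume "~ ?thesis"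
  then have "(\<Sum>y\<in>B. (real (card (?N y)))^2 - 32 * K * ?bad y) < (\<Sum>y\<in>B. a^2 / (8 * K^2))"
   using fin ne by (intro sum_strict_mono) auto
  also have "... = a^2 * b / (8 * K^2)" by (simp add: b_def)
  finally have 1: "(\<Sum>y\<in>B. (real (card (?N y)))^2) < 32 * K * (\<Sum>y\<in>B. real (?bad y)) + a^2 * b / (8 * K^2)"
   by (simp add: sum_subtractf flip: sum_distrib_left)
  have "32 * K * (\<Sum>y\<in>B. real (?bad y)) <= 32 * K * (a^2 * (e * b))" using S3 K by simp
  also have "... = a^2 * b / (8 * K^2)" using eK K by (simp add: field_simps)
  finally have "(\<Sum>y\<in>B. (real (card (?N y)))^2) < a^2 * b / (8 * K^2) + a^2 * b / (8 * K^2)" using 1 by linarith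
  also have "... = a^2 * b / (4 * K^2)" by simp
  finally show False using S2 by simp
 qed
 then obtain y0 where y0: "y0 \<in> B" "a^2 / (8 * K^2) <= (real (card (?N y0)))^2 - 32 * K * ?bad y0" by auto
 define N where "N = ?N y0"
 define n where "n = real (card N)"
 have fN: "finite N" "N <= A1" using fA1 by (auto simp: N_def)
 have n2: "a^2 / (8 * K^2) + 32 * K * ?bad y0 <= n^2" using y0 by (simp add: n_def N_def)
 have "(a / (4 * K))^2 <= a^2 / (8 * K^2)" using K by (simp add: field_simps)
 also have "... <= n^2"
 proof -
  have "0 <= 32 * K * ?bad y0" using K by simp
  with n2 show ?thesis by simp
 qed
 finally have n_ge: "a / (4 * K) <= n" by (rule power2_le_imp_le) (simp add: n_def)
 have "0 < a / (4 * K)" using pos K by simp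
 with n_ge have npos: "n > 0" by simp
 let ?bp = "%x. card {x' \<in> N. (x, x') \<in> Bd}"
 have "real (?bad y0) = (\<Sum>x\<in>N. real (?bp x))"
 proof -
  have "{p \<in> Bd. fst p \<in> N & snd p \<in> N} = {(x, x'). x \<in> N & x' \<in> N & (x, x') \<in> Bd}" by auto
  then show ?thesis using card_rel_bound[OF fN(1) fN(1), of "%x x'. (x, x') \<in> Bd"] by (simp add: N_def)
 qed
 then have "32 * K * ?bad y0 = 32 * K * (\<Sum>x\<in>N. real (?bp x))" by simp
 moreover have "0 <= a^2 / (8 * K^2)" by simp
 ultimately have bad0: "32 * K * (\<Sum>x\<in>N. real (?bp x)) <= n^2"
  using n2 by linarith
 define A' where "A' = {x \<in> N. ?bp x <= n / (16 * K)}"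
 define a' where "a' = real (card A')"
 have A': "A' <= N" "finite A'" using fN by (auto simp: A'_def)
 have "(n - a') * (n / (16 * K)) = (\<Sum>x\<in>N - A'. n / (16 * K))"
  using A' fN by (simp add: card_Diff_subset n_def a'_def card_mono)
 also have "... <= (\<Sum>x\<in>N - A'. real (?bp x))" by (intro sum_mono) (auto simp: A'_def)
 also have "... <= (\<Sum>x\<in>N. real (?bp x))" using fN by (intro sum_mono2) auto
 also have "... <= n^2 / (32 * K)" using bad0 K by (simp add: field_simps)
 finally have "(n - a') * (n / (16 * K)) <= (n / 2) * (n / (16 * K))" by (simp add: power2_eq_square)
 then have a'_ge: "n / 2 <= a'" using npos K by (simp add: field_simps)
 define B' where "B' = {y \<in> B. a' / (4 * K) <= card {x \<in> A'. (x, y) \<in> G}}"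
 have B': "B' <= B" "finite B'" using fin by (auto simp: B'_def)
 have 1: "A' <= A" using A' fN by (auto simp: A1_def)
 have 2: "card A <= 8 * K * card A'"
 proof -
  have "a <= 4 * K * n" using n_ge K by (simp add: field_simps)
  also have "... <= 4 * K * (2 * a')" using a'_ge K by simp
  finally show ?thesis by (simp add: a_def a'_def)
 qed
 have a'pos: "a' > 0" using a'_ge npos by simp
 have "a' * (b / (2 * K)) = (\<Sum>x\<in>A'. b / (2 * K))" by (simp add: a'_def)
 also have "... <= (\<Sum>x\<in>A'. real (?deg x))" using A' fN by (intro sum_mono) (auto simp: A1_def)
 also have "... = (\<Sum>y\<in>B. real (card {x \<in> A'. (x, y) \<in> G}))"
  using double_count[OF A'(2) fin(2), of "%x y. (x, y) \<in> G"] by (simp flip: of_nat_sum)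
 also have "... = (\<Sum>y\<in>B'. real (card {x \<in> A'. (x, y) \<in> G})) + (\<Sum>y\<in>B - B'. real (card {x \<in> A'. (x, y) \<in> G}))"
  using fin B' by (subst sum.subset_diff[of B']) auto
 also have "(\<Sum>y\<in>B - B'. real (card {x \<in> A'. (x, y) \<in> G})) <= (\<Sum>y\<in>B - B'. a' / (4 * K))"
  by (intro sum_mono) (auto simp: B'_def)
 also have "... <= b * (a' / (4 * K))"
  using fin K a'pos by (auto simp: b_def intro!: mult_right_mono divide_right_mono card_mono)
 also have "(\<Sum>y\<in>B'. real (card {x \<in> A'. (x, y) \<in> G})) = card (G Int A' \<times> B')"
 proof -
  have "G Int A' \<times> B' = {(x, y). x \<in> A' & y \<in> B' & (x, y) \<in> G}" by auto
  then have "card (G Int A' \<times> B') = (\<Sum>x\<in>A'. card {y \<in> B'. (x, y) \<in> G})"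
   using card_rel_bound[OF A'(2) B'(2), of "%x y. (x, y) \<in> G"] by simp
  then show ?thesis using double_count[OF A'(2) B'(2), of "%x y. (x, y) \<in> G"] by simp
 qed
 finally have "a' * b / (4 * K) <= card (G Int A' \<times> B')" by (simp add: field_simps)
 then have "a' * b <= 4 * K * card (G Int A' \<times> B')" using K by (simp add: field_simps)
 moreover have "a * b <= (8 * K * a') * b"
  using 2 pos by (intro mult_right_mono) (auto simp: a_def a'_def)
 moreover have "8 * K * (a' * b) <= 8 * K * (4 * K * card (G Int A' \<times> B'))" if "a' * b <= 4 * K * card (G Int A' \<times> B')"
  using K that by simp
 ultimately have 3: "a * b <= 32 * K^2 * card (G Int A' \<times> B')"
  by (simp add: power2_eq_square)
 have 4: "card A' <= 4 * K * card {x \<in> A'. (x, y) \<in> G}" if "y \<in> B'" for y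
  using that K by (simp add: B'_def a'_def field_simps)
 have 5: "card A * card B <= 2 ^ 14 * K ^ 5 * card {(a1, b1). (x, b1) \<in> G & (a1, b1) \<in> G & (a1, y) \<in> G}"
  if x: "x \<in> A'" and y: "y \<in> B'" for x y
 proof -
  let ?P = "{(a1, b1). (x, b1) \<in> G & (a1, b1) \<in> G & (a1, y) \<in> G}"
  \<comment> \<open>Neighbours of \<open>y\<close> in \<open>A'\<close> that form no bad pair with
    \<open>x\<close>. At least half of the guaranteed number survives, since \<open>x\<close> is in
    at most \<open>n / (16 * K)\<close> bad pairs.\<close>
  define W where "W = {x' \<in> A'. (x', y) \<in> G} - {x' \<in> N. (x, x') \<in> Bd}"
  have fW: "finite W" using A' by (simp add: W_def)
  have "n / (8 * K) <= a' / (4 * K)" using a'_ge K by (simp add: field_simps)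
  also have "... <= card {x' \<in> A'. (x', y) \<in> G}" using y by (simp add: B'_def)
  also have "card {x' \<in> A'. (x', y) \<in> G} <= card W + ?bp x"
  proof -
   have "card {x' \<in> A'. (x', y) \<in> G} <= card (W Un {x' \<in> N. (x, x') \<in> Bd})"
    using fN A' by (intro card_mono) (auto simp: W_def)
   also have "... <= card W + ?bp x" by (rule card_Un_le)
   finally show ?thesis .
  qed
  finally have "n / (8 * K) <= card W + ?bp x" by simp
  moreover have "?bp x <= n / (16 * K)" using x by (simp add: A'_def)
  ultimately have W: "n / (16 * K) <= card W" by simp
  have "(SIGMA x':W. {y' \<in> B. (x, y') \<in> G & (x', y') \<in> G}) <= ?P" by (auto simp: W_def)
  moreover have "finite ?P" by (rule_tac finite_subset[of _ "A \<times> B"]) (use fin in auto)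
  ultimately have "card (SIGMA x':W. {y' \<in> B. (x, y') \<in> G & (x', y') \<in> G}) <= card ?P"
   by (intro card_mono)
  then have "(\<Sum>x'\<in>W. ?co x x') <= card ?P" using fW fin by simp
  then have "(\<Sum>x'\<in>W. real (?co x x')) <= card ?P" by (simp flip: of_nat_sum)
  moreover have "(\<Sum>x'\<in>W. e * b) <= (\<Sum>x'\<in>W. real (?co x x'))"
   using x A' 1 by (intro sum_mono) (auto simp: W_def Bd_def)
  ultimately have P: "card W * (e * b) <= card ?P" by simp
  have "a / (64 * K^2) <= n / (16 * K)" using n_ge K by (simp add: field_simps power2_eq_square)
  then have "a / (64 * K^2) * (e * b) <= card W * (e * b)"
   using W pos K by (intro mult_right_mono) (auto simp: e_def)
  with P have Q: "a / (64 * K^2) * (e * b) <= card ?P" by simp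
  have "a / (64 * K^2) * (e * b) * (2 ^ 14 * K ^ 5) = a * b"
   using K by (simp add: e_def)
  then have "a * b <= card ?P * (2 ^ 14 * K ^ 5)"
   using mult_right_mono[OF Q, of "2 ^ 14 * K ^ 5"] K by simp
  then show ?thesis unfolding a_def b_def of_nat_mult by (simp only: mult.commute)
 qed
 show thesis by (rule that[OF 1 B'(1) 2 3[unfolded a_def b_def, folded of_nat_mult]]) (use 4 5 in blast)+
qed

subsection \<open>Covering numbers\<close>

text \<open>Comparable to the covering number up to constants, but the cardinality of an image, so
  that fibre counts and pigeonholing apply directly. \<open>ncell_le_covering\<close> returns to
  covering numbers at the end.\<close>

definition ncell :: "real => real set => nat" where
 "ncell r E = card ((%x. \<lfloor>x / r\<rfloor>) ` E)"

definition separated :: "real => real set => bool" where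
 "separated r S \<longleftrightarrow> (ALL x:S. ALL y:S. x ~= y --> r <= abs (x - y))"

lemma separatedD: "separated r S ==> x \<in> S ==> y \<in> S ==> abs (x - y) < r ==> x = y"
 by (force simp: separated_def)

lemma separated_subset: "separated r S ==> S' <= S ==> separated r S'"
 by (auto simp: separated_def)

lemma same_cell: "r > 0 ==> \<lfloor>x / r\<rfloor> = \<lfloor>y / r\<rfloor> ==> abs (x - y) < (r::real)"
proof -
 assume r: "r > 0" and eq: "\<lfloor>x / r\<rfloor> = \<lfloor>y / r\<rfloor>"
 have "abs (x / r - y / r) < 1" using eq by linarith
 then have "abs (x - y) / r < 1" using r by (simp add: abs_divide flip: diff_divide_distrib)
 then show ?thesis using r by simp
qed

lemma ncell_mono: "finite E ==> E' <= E ==> ncell r E' <= ncell r E"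
 unfolding ncell_def by (intro card_mono) auto

lemma ncell_pos: "finite E ==> E ~= {} ==> 1 <= ncell r E"
 unfolding ncell_def by (simp add: Suc_le_eq card_gt_0_iff)

lemma card_separated: "r > 0 ==> separated r S ==> ncell r S = card S"
 unfolding ncell_def by (intro card_image inj_onI) (metis same_cell separatedD)

lemma card_separated_le: "r > 0 ==> separated r S ==> S <= E ==> finite E ==> card S <= ncell r E"
 using card_separated ncell_mono by metis

text \<open>Points of adjacent cells may be close. So representatives are taken either from the
  cells of even index or from those of odd index, whichever are more numerous; hence the factor
  \<open>2\<close>.\<close>

lemma separated_subset_exists:
 assumes "r > 0" "finite E"
 obtains S where "S <= E" "separated r S" "ncell r E <= 2 * card S"
proof -
 let ?f = "%x. \<lfloor>x / r\<rfloor>"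
 define g where "g = inv_into E ?f"
 note result = that
 have main: thesis if Z: "Z <= ?f ` E" "ncell r E <= 2 * card Z"
  and par: "!!a b. a \<in> Z ==> b \<in> Z ==> a ~= b ==> abs (a - b) >= 2" for Z
 proof -
  have gz: "g z \<in> E" "?f (g z) = z" if "z \<in> Z" for z
  proof -
   have "z \<in> ?f ` E" using that Z(1) by auto
   then show "g z \<in> E" "?f (g z) = z" unfolding g_def by (rule inv_into_into, rule f_inv_into_f)
  qed
  have "inj_on g Z" using gz by (metis inj_onI)
  then have c: "card (g ` Z) = card Z" by (rule card_image)
  have "separated r (g ` Z)" unfolding separated_def
  proof clarify
   fix a b assume ab: "a \<in> Z" "b \<in> Z" "g a ~= g b"
   then have "abs (a - b) >= 2" using par by auto
   then have "abs (?f (g a) - ?f (g b)) >= 2" using gz ab by simp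
   then have "abs (g a / r - g b / r) >= 1" by linarith
   then have "abs (g a - g b) / r >= 1" using assms by (simp add: abs_divide flip: diff_divide_distrib)
   then show "r <= abs (g a - g b)" using assms by simp
  qed
  then show thesis using result[of "g ` Z"] gz(1) c Z(2) by auto
 qed
 let ?Z0 = "{z \<in> ?f ` E. even z}" and ?Z1 = "{z \<in> ?f ` E. odd z}"
 have "card (?f ` E) = card (?Z0 Un ?Z1)" by (rule arg_cong[of _ _ card]) auto
 also have "... <= card ?Z0 + card ?Z1" by (rule card_Un_le)
 finally have "ncell r E <= card ?Z0 + card ?Z1" by (simp add: ncell_def)
 then consider "ncell r E <= 2 * card ?Z0" | "ncell r E <= 2 * card ?Z1" by force
 then show thesis
 proof cases
  case 1
  show ?thesis by (rule main[OF _ 1]) (auto, presburger)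
 next
  case 2
  show ?thesis by (rule main[OF _ 2]) (auto, presburger)
 qed
qed

lemma card_floor_interval:
 assumes "!!x. x \<in> S ==> a <= x & x <= b" "r > 0" "a <= b"
 shows "real (card ((%x. \<lfloor>x / r\<rfloor>) ` S)) <= (b - a) / r + 2"
proof -
 have "(%x. \<lfloor>x / r\<rfloor>) ` S <= {\<lfloor>a / r\<rfloor>..\<lfloor>b / r\<rfloor>}"
  using assms by (auto intro!: floor_mono divide_right_mono)
 then have "card ((%x. \<lfloor>x / r\<rfloor>) ` S) <= card {\<lfloor>a / r\<rfloor>..\<lfloor>b / r\<rfloor>}" by (intro card_mono) auto
 then have "real (card ((%x. \<lfloor>x / r\<rfloor>) ` S)) <= real_of_int (\<lfloor>b / r\<rfloor> - \<lfloor>a / r\<rfloor> + 1)"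
 proof -
  have "a / r <= b / r" using assms by (simp add: divide_right_mono)
  then have "\<lfloor>a / r\<rfloor> <= \<lfloor>b / r\<rfloor>" by linarith
  then show ?thesis using \<open>card _ <= card _\<close> by simp
 qed
 also have "... <= b / r - a / r + 2" by linarith
 also have "... = (b - a) / r + 2" by (simp add: diff_divide_distrib)
 finally show ?thesis .
qed

text \<open>The points of \<open>E\<close> assigned to one \<open>R\<close>-cell of
  \<open>E'\<close> lie in an interval of length \<open>R + 2 * t\<close>, which meets few cells of
  size \<open>r\<close>.\<close>

lemma ncell_transfer:
 assumes "finite E" "finite E'" "r > 0" "R > 0" "t >= 0"
  and near: "!!x. x \<in> E ==> EX y:E'. abs (x - y) <= t"
 shows "real (ncell r E) <= ((R + 2 * t) / r + 2) * ncell R E'"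
proof -
 from near obtain f where f: "!!x. x \<in> E ==> f x \<in> E' & abs (x - f x) <= t" by metis
 let ?Z = "(%x. \<lfloor>x / R\<rfloor>) ` E'"
 let ?E = "%z. {x \<in> E. \<lfloor>f x / R\<rfloor> = z}"
 have b: "real (ncell r (?E z)) <= (R + 2 * t) / r + 2" for z
 proof -
  have "real (ncell r (?E z)) <= ((of_int z * R + R + t) - (of_int z * R - t)) / r + 2"
   unfolding ncell_def
  proof (rule card_floor_interval)
   fix x assume "x \<in> ?E z"
   then have x: "x \<in> E" "\<lfloor>f x / R\<rfloor> = z" by auto
   then have "of_int z <= f x / R" "f x / R < of_int z + 1" by auto
   then have "of_int z * R <= f x" "f x <= of_int z * R + R"
    using assms by (simp_all add: field_simps)
   then show "of_int z * R - t <= x & x <= of_int z * R + R + t" using f[OF x(1)] by auto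
  qed (use assms in auto)
  then show ?thesis by simp
 qed
 have "(%x. \<lfloor>x / r\<rfloor>) ` E <= (\<Union>z\<in>?Z. (%x. \<lfloor>x / r\<rfloor>) ` ?E z)" using f by auto
 then have "ncell r E <= card (\<Union>z\<in>?Z. (%x. \<lfloor>x / r\<rfloor>) ` ?E z)"
  unfolding ncell_def using assms by (intro card_mono) auto
 also have "... <= (\<Sum>z\<in>?Z. ncell r (?E z))" unfolding ncell_def using assms by (intro card_UN_le) auto
 finally have "real (ncell r E) <= (\<Sum>z\<in>?Z. real (ncell r (?E z)))" by (simp flip: of_nat_sum)
 also have "... <= (\<Sum>z\<in>?Z. (R + 2 * t) / r + 2)" by (intro sum_mono b)
 also have "... = ((R + 2 * t) / r + 2) * ncell R E'" by (simp add: ncell_def)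
 finally show ?thesis .
qed

lemma ncell_refine:
 assumes "finite E" "r > 0" "R > 0"
 shows "real (ncell r E) <= (R / r + 2) * ncell R E"
 using ncell_transfer[OF assms(1,1,2,3), of 0] by simp

lemma separated_sumset:
 assumes r: "r > 0" and P: "separated r P" "!!x. x \<in> P ==> abs (x - y) <= H" and S: "separated (2 * H + r) S"
 shows "inj_on (%(p, s). p + s) (P \<times> S)" "separated r (sumset P S)"
proof -
 have *: "p = p' & s = s'" if "p \<in> P" "p' \<in> P" "s \<in> S" "s' \<in> S" "abs ((p + s) - (p' + s')) < r" for p p' s s'
 proof -
  have "abs (p - y) <= H" "abs (p' - y) <= H" using P(2) that by auto
  then have "abs (s - s') < 2 * H + r" using that(5) by simp
  then have "s = s'" using S that separatedD by simp
  then have "abs (p - p') < r" using that by simp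
  then show ?thesis using \<open>s = s'\<close> P(1) that separatedD by simp
 qed
 show "inj_on (%(p, s). p + s) (P \<times> S)"
 proof (intro inj_onI, clarify)
  fix p s p' s' assume "p \<in> P" "s \<in> S" "p' \<in> P" "s' \<in> S" "p + s = p' + s'"
  then show "p = p' & s = s'" using *[of p p' s s'] r by simp
 qed
 show "separated r (sumset P S)" unfolding separated_def
 proof (intro ballI impI, rule ccontr)
  fix x x' assume x: "x \<in> sumset P S" "x' \<in> sumset P S" "x ~= x'" "~ r <= abs (x - x')"
  then show False using * by (elim sumsetE) (metis linorder_not_le)
 qed
qed

text \<open>Translates of a set of radius \<open>H\<close> by points \<open>2 * H + r\<close> apart
  stay \<open>r\<close> apart. Read as an upper bound for \<open>card P\<close>, this turns a bound
  on a sumset into a bound on clusters.\<close>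

lemma ncell_sum_ge:
 assumes r: "r > 0" and fin: "finite F" and P: "separated r P" "!!x. x \<in> P ==> abs (x - y) <= H"
  and S: "finite E" "H >= 0" and F: "!!p s. p \<in> P ==> s \<in> E ==> p + s \<in> F"
 shows "card P * ncell (2 * H + r) E <= 2 * ncell r F"
proof -
 have "0 < 2 * H + r" using r S by simp
 then obtain S' where S': "S' <= E" "separated (2 * H + r) S'" "ncell (2 * H + r) E <= 2 * card S'"
  using separated_subset_exists[OF _ S(1)] by auto
 note ss = separated_sumset[OF r P S'(2)]
 have "card P * card S' = card (sumset P S')"
  using card_image[OF ss(1)] by (simp add: sumset_def card_cartesian_product)
 also have "... <= ncell r F"
  using ss(2) S'(1) by (intro card_separated_le r fin) (auto elim!: sumsetE intro: F)
 finally have "card P * (2 * card S') <= 2 * ncell r F" by simp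
 with mult_le_mono2[OF S'(3), of "card P"] show ?thesis by linarith
qed

subsection \<open>Growth under ring operations\<close>

text \<open>One operation that, once \<open>0\<close> and \<open>1\<close> are present, produces
  products, differences and negatives while keeping the old elements; iterating it exhausts the
  generated ring.\<close>

definition difprod :: "real set => real set" where
 "difprod E = (%(x, y, z, w). x * y - z * w) ` (E \<times> E \<times> E \<times> E)"

lemma difprodI: "x \<in> E ==> y \<in> E ==> z \<in> E ==> w \<in> E ==> x * y - z * w \<in> difprod E"
 by (force simp: difprod_def)

lemma difprodE: "s \<in> difprod E ==>
  (!!x y z w. s = x * y - z * w ==> x \<in> E ==> y \<in> E ==> z \<in> E ==> w \<in> E ==> P) ==> P"
 by (force simp: difprod_def)

lemma finite_difprod [simp]: "finite E ==> finite (difprod E)"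
 by (simp add: difprod_def)

lemma difprod_basics:
 assumes "0 \<in> E" "1 \<in> E"
 shows "E <= difprod E" "x \<in> E ==> y \<in> E ==> x - y \<in> difprod E" "x \<in> E ==> - x \<in> difprod E"
  "0 \<in> difprod E" "1 \<in> difprod E"
 using difprodI[of _ E 1 _ 1] assms by force+

text \<open>The function \<open>x powr (1 + b)\<close> is almost linear, so splitting an exponent
  into \<open>eta\<close> and \<open>1 - eta\<close> loses only \<open>2 * b\<close> in
  \<open>quotient_step\<close>.\<close>

lemma mult_one_minus_powr_le:
 fixes x b :: real
 assumes "0 <= x" "x <= 1" "0 <= b"
 shows "x - x powr (1 + b) <= b"
proof (cases "x = 0")
 case False
 then have x: "x > 0" using assms by simp
 have "1 + b * ln x <= x powr b" using x by (simp add: powr_def)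
 then have "x * (1 + b * ln x) <= x * x powr b" using x by simp
 moreover have "x * x powr b = x powr (1 + b)" using x by (simp add: powr_add)
 moreover have "- ln x <= 1 / x"
  using ln_le_minus_one[of "1 / x"] x by (simp add: ln_div)
 then have "x * (- ln x) <= 1" using x by (simp add: field_simps)
 then have "b * (x * (- ln x)) <= b * 1" using assms by (intro mult_left_mono) auto
 ultimately show ?thesis by (simp add: algebra_simps)
qed (use assms in simp)

lemma card_le_fibres:
 fixes K M :: real
 assumes "finite P" "card (f ` P) <= M" "0 <= K" "!!p. p \<in> P ==> card {p' \<in> P. f p' = f p} <= K"
 shows "card P <= M * K"
proof -
 have "card P = card (\<Union>z\<in>f ` P. {p \<in> P. f p = z})" by (rule arg_cong[of _ _ card]) auto
 also have "... = (\<Sum>z\<in>f ` P. card {p \<in> P. f p = z})"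
  using assms(1) by (intro card_UN_disjoint) auto
 finally have "card P = (\<Sum>z\<in>f ` P. card {p \<in> P. f p = z})" .
 then have "real (card P) = (\<Sum>z\<in>f ` P. real (card {p \<in> P. f p = z}))" by simp
 also have "... <= (\<Sum>z\<in>f ` P. K)" using assms(4) by (intro sum_mono) auto
 also have "... <= M * K" using assms by (auto intro: mult_right_mono)
 finally show ?thesis .
qed

text \<open>The inverse branches of the doubling map halve an error; these are the estimates for one
  step in \<open>quotients_dense\<close>.\<close>

lemma halving:
 fixes q t t' w s k q' :: real
 shows "abs (q - t') <= s ==> abs (q / 2 - t' / 2) <= s / 2" "abs (q - t') <= s ==> abs ((q + 1) / 2 - (t' + 1) / 2) <= s / 2"
  "abs (q' - w) <= k ==> abs (w - t) <= (2 * k + s) / 2 ==> abs (q' - t) <= 2 * k + s / 2"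
 unfolding abs_le_iff by argo+

text \<open>Elements \<open>q = (a - b) / (c - d)\<close> with denominators of size at least \<open>rho powr theta1\<close> turn out to be dense in
the unit interval, too many to be compatible with the covering number of the iterated difference-product set.\<close>

locale ring_gap =
 fixes E :: "real set" and rho alpha b eps theta1 theta2 T :: real
 assumes fin: "finite E" and E01: "0 \<in> E" "1 \<in> E" and ET: "!!e. e \<in> E ==> abs e <= T"
  and T1: "1 <= T" "T <= rho powr (-eps)" and rho: "0 < rho" "rho < 1" and big: "1000 <= rho powr (-eps)"
  and par: "0 < alpha" "alpha < 1" "0 < b" "b <= 1" "0 < eps" "eps <= 1/4" "0 < theta1" "theta1 <= 1/4" "0 < theta2" "theta2 <= 1/2"
  and low: "!!theta. 0 <= theta ==> theta <= 1 ==> rho powr (eps - alpha * theta powr (1 + b)) <= ncell (rho powr theta) E"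
  and up: "ncell rho (difprod (difprod (difprod (difprod E)))) <= rho powr (- alpha - eps)"
  and c1: "4 * b * alpha + 30 * eps < alpha * theta1 powr (1 + b)"
  and c2: "8 * alpha * theta1 + 30 * eps < alpha * theta2 powr (1 + b)"
  and c3: "theta2 + 2 * theta1 + alpha + 10 * eps < 1"
begin

abbreviation pw :: "real => real" where "pw x == rho powr x"
abbreviation D4 :: "real set" where "D4 == difprod (difprod (difprod (difprod E)))"
abbreviation W :: "real => real set" where "W w == (%(x, y). x + w * y) ` (E \<times> E)"

lemma pw_add: "pw x * pw y = pw (x + y)" by (simp add: powr_add)
lemma pw_mono: "x <= y ==> pw y <= pw x" using rho by (intro powr_mono') auto
lemma pw_less: "x < y ==> pw y < pw x" using rho by (intro powr_less_mono') auto
lemma pw_pos: "pw x > 0" using rho by simp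
lemma pw_le1: "0 <= x ==> pw x <= 1" using pw_mono[of 0 x] rho by simp

lemma T_sq: "T^2 <= pw (- 2 * eps)"
proof -
 have "T * T <= pw (-eps) * pw (-eps)" using T1 by (intro mult_mono) auto
 then show ?thesis unfolding pw_add by (simp add: power2_eq_square)
qed

text \<open>This explains the four rounds in \<open>D4\<close>: differences appear after one round,
  doubling or adding two of them takes a second, \<open>u * x + v * y\<close> a third, and the shift
  by \<open>z\<close> a fourth.\<close>

lemma affine_mem:
 assumes "c \<in> E" "d \<in> E" "a \<in> E" "a' \<in> E" "x \<in> E" "y \<in> E" "z \<in> E"
  and u: "u = c - d | u = 2 * (c - d)" and v: "v = a - a' | v = (a - a') + (c - d) | v = u"
 shows "u * x + v * y + z \<in> D4"
proof -
 note B1 = difprod_basics[OF E01]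
 note B2 = difprod_basics[OF B1(4,5)]
 note B3 = difprod_basics[OF B2(4,5)]
 note B4 = difprod_basics[OF B3(4,5)]
 have m1: "c - d \<in> difprod E" "d - c \<in> difprod E" "a' - a \<in> difprod E" using assms B1 by auto
 have m: "c - d \<in> difprod (difprod E)" "d - c \<in> difprod (difprod E)" "a' - a \<in> difprod (difprod E)"
  using m1 B2(1) by auto
 have m2: "(c - d) - (d - c) \<in> difprod (difprod E)" "(d - c) - (c - d) \<in> difprod (difprod E)"
  "(a' - a) - (c - d) \<in> difprod (difprod E)" by (intro B2(2) m1)+
 have e: "(c - d) - (d - c) = 2 * (c - d)" "(d - c) - (c - d) = - (2 * (c - d))" "d - c = - (c - d)"
  "a' - a = - (a - a')" "(a' - a) - (c - d) = - ((a - a') + (c - d))" by auto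
 have u2: "u \<in> difprod (difprod E)" "- u \<in> difprod (difprod E)" using u m m2 unfolding e by auto
 have "- v = a' - a | - v = (a' - a) - (c - d) | - v = - u" using v by auto
 then have v2: "- v \<in> difprod (difprod E)" using m(3) m2(3) u2(2) by auto
 have xy: "x \<in> difprod (difprod E)" "y \<in> difprod (difprod E)" "- z \<in> difprod (difprod (difprod E))"
  using assms(5-7) B1(1,3) B2(1) B3(1) by auto
 have "u * x - (- v) * y \<in> difprod (difprod (difprod E))" using u2 v2 xy by (intro difprodI)
 from B4(2)[OF this xy(3)] show ?thesis by simp
qed

text \<open>The set \<open>u * (E + w * E) + E\<close> lies in \<open>D4\<close>. Its first summand
  has diameter about \<open>T * u\<close>, so \<open>ncell_sum_ge\<close> divides the small count of
  \<open>D4\<close> at scale \<open>rho\<close> by the count of \<open>E\<close> at a scale near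
  \<open>min 1 u = rho powr eta\<close>.\<close>

lemma ncell_W:
 assumes u: "0 < u" "u <= 4 * T" and w: "abs w <= 2" and eta: "0 <= eta" "eta <= 1" "pw eta = min 1 u"
  and mem: "!!x y z. x \<in> E ==> y \<in> E ==> z \<in> E ==> u * (x + w * y) + z \<in> D4"
 shows "ncell (rho / u) (W w) <= pw (- alpha - 5 * eps + alpha * eta powr (1 + b))"
proof -
 have ru: "rho / u > 0" using rho u by simp
 have fW: "finite (W w)" using fin by simp
 obtain S where S: "S <= W w" "separated (rho / u) S" "ncell (rho / u) (W w) <= 2 * card S"
  using separated_subset_exists[OF ru fW] by auto
 let ?P = "(*) u ` S"
 have cP: "card ?P = card S" using u by (intro card_image) (auto simp: inj_on_def)
 have sP: "separated rho ?P" unfolding separated_def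
 proof clarify
  fix x y assume "x \<in> S" "y \<in> S" "u * x ~= u * y"
  then have "rho / u <= abs (x - y)" using S(2) by (auto simp: separated_def)
  then have "rho <= u * abs (x - y)" using u by (simp add: field_simps)
  also have "... = abs (u * x - u * y)" using u by (simp add: abs_mult flip: right_diff_distrib)
  finally show "rho <= abs (u * x - u * y)" .
 qed
 have bW: "abs s <= 3 * T" if "s \<in> S" for s
 proof -
  have "s \<in> W w" using S(1) that by auto
  then obtain x y where xy: "x \<in> E" "y \<in> E" "s = x + w * y" by auto
  have "abs (w * y) <= 2 * T" unfolding abs_mult using w ET[OF xy(2)] by (intro mult_mono) auto
  then show ?thesis using ET[OF xy(1)] xy(3) by simp
 qed
 have "card ?P * ncell (2 * (3 * T * u) + rho) E <= 2 * ncell rho D4"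
 proof (rule ncell_sum_ge[where y = 0])
  show "abs (x - 0) <= 3 * T * u" if "x \<in> ?P" for x
  proof -
   obtain s where s: "s \<in> S" "x = u * s" using \<open>x \<in> ?P\<close> by auto
   have "u * abs s <= u * (3 * T)" using bW[OF s(1)] u by simp
   then show ?thesis using s u by (simp add: abs_mult)
  qed
  show "p + s \<in> D4" if "p \<in> ?P" "s \<in> E" for p s
   using that S(1) mem by auto
 qed (use rho fin sP u T1 in auto)
 then have "real (card S) * ncell (2 * (3 * T * u) + rho) E <= 2 * ncell rho D4"
  unfolding cP by (metis of_nat_mono of_nat_mult of_nat_numeral)
 also have "... <= 2 * pw (- alpha - eps)" using up by simp
 finally have 1: "real (card S) * ncell (6 * T * u + rho) E <= 2 * pw (- alpha - eps)" by (simp add: mult.assoc)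
 have us: "u <= 4 * T * pw eta" using u T1 eta(3) by (auto simp: min_def)
 have rs: "rho <= pw eta" using pw_mono[OF eta(2)] by simp
 have "6 * T * u <= 6 * T * (4 * T * pw eta)" using us T1 by simp
 then have "6 * T * u + rho <= (24 * T^2 + 1) * pw eta" using rs by (simp add: power2_eq_square algebra_simps)
 then have "(6 * T * u + rho) / pw eta <= 24 * T^2 + 1" by (simp add: divide_le_eq)
 moreover have "1 <= T^2" using T1 by simp
 ultimately have "(6 * T * u + rho) / pw eta + 2 <= 27 * T^2" by simp
 then have "((6 * T * u + rho) / pw eta + 2) * ncell (6 * T * u + rho) E <= 27 * T^2 * ncell (6 * T * u + rho) E"
  by (intro mult_right_mono) auto
 moreover have "real (ncell (pw eta) E) <= ((6 * T * u + rho) / pw eta + 2) * ncell (6 * T * u + rho) E"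
  using u rho by (intro ncell_refine fin pw_pos add_pos_pos mult_pos_pos) auto
 ultimately have 2: "pw (eps - alpha * eta powr (1 + b)) <= 27 * T^2 * ncell (6 * T * u + rho) E"
  using low[OF eta(1,2)] by simp
 have "card S * pw (eps - alpha * eta powr (1 + b)) <= card S * (27 * T^2 * ncell (6 * T * u + rho) E)"
  using 2 by (intro mult_left_mono) auto
 also have "... = 27 * T^2 * (card S * ncell (6 * T * u + rho) E)" by simp
 also have "... <= 27 * T^2 * (2 * pw (- alpha - eps))" using 1 by (intro mult_left_mono) auto
 also have "... <= (27 * pw (- 2 * eps)) * (2 * pw (- alpha - eps))" using T_sq by (intro mult_right_mono) auto
 also have "... = 54 * (pw (- 2 * eps) * pw (- alpha - eps))" by simp
 also have "... = 54 * pw (- alpha - 3 * eps)" unfolding pw_add by (simp add: algebra_simps)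
 finally have "card S * pw (eps - alpha * eta powr (1 + b)) * pw (- eps + alpha * eta powr (1 + b))
   <= 54 * pw (- alpha - 3 * eps) * pw (- eps + alpha * eta powr (1 + b))"
  by (intro mult_right_mono) auto
 then have 3: "card S <= 54 * pw (- alpha - 4 * eps + alpha * eta powr (1 + b))"
  using rho by (simp add: pw_add algebra_simps)
 have "ncell (rho / u) (W w) <= 2 * real (card S)" using S(3) by simp
 also have "... <= 108 * pw (- alpha - 4 * eps + alpha * eta powr (1 + b))" using 3 by simp
 also have "... <= pw (- eps) * pw (- alpha - 4 * eps + alpha * eta powr (1 + b))"
  using big by (intro mult_right_mono) auto
 also have "... = pw (- alpha - 5 * eps + alpha * eta powr (1 + b))" unfolding pw_add by (simp add: algebra_simps)
 finally show ?thesis .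
qed

text \<open>A cluster of \<open>S\<close> in a ball of radius \<open>pw theta\<close>, translated by
  separated points of \<open>E\<close>, fits into \<open>E + E = W 1\<close>. Since \<open>E\<close>
  has many cells at scale \<open>pw theta\<close>, smallness of \<open>E + E\<close> forces the
  cluster to be small.\<close>

lemma ball_bound:
 fixes M :: real
 assumes r: "0 < r" "r <= pw theta" and S: "separated r S" "S <= E" and M: "ncell r (W 1) <= M"
  and th: "0 <= theta" "theta <= 1"
 shows "card (S Int {x - pw theta..x + pw theta}) <= M * pw (alpha * theta powr (1 + b) - 2 * eps)"
proof -
 let ?P = "S Int {x - pw theta..x + pw theta}" and ?R = "2 * pw theta + r"
 have fW: "finite (W 1)" using fin by simp
 have "card ?P * ncell ?R E <= 2 * ncell r (W 1)"
 proof (rule ncell_sum_ge[where y = x, OF r(1) fW])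
  show "p + s \<in> W 1" if "p \<in> ?P" "s \<in> E" for p s
   using that S(2) by auto
  show "separated r ?P" using S(1) by (rule separated_subset) simp
  show "abs (p - x) <= pw theta" if "p \<in> ?P" for p using that by auto
  show "0 <= pw theta" by simp
 qed (rule fin)
 from of_nat_mono[OF this, where 'a = real] have "real (card ?P) * ncell ?R E <= 2 * ncell r (W 1)" by simp
 then have 1: "real (card ?P) * ncell ?R E <= 2 * M" using M by simp
 have "?R / pw theta <= 3" using r by (simp add: divide_le_eq)
 then have "(?R / pw theta + 2) * ncell ?R E <= 5 * real (ncell ?R E)" by (intro mult_right_mono) auto
 moreover have "real (ncell (pw theta) E) <= (?R / pw theta + 2) * ncell ?R E"
  using r by (intro ncell_refine fin) auto
 ultimately have 2: "pw (eps - alpha * theta powr (1 + b)) <= 5 * real (ncell ?R E)" using low[OF th] by simp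
 have "card ?P * pw (eps - alpha * theta powr (1 + b)) <= card ?P * (5 * real (ncell ?R E))"
  using 2 by (intro mult_left_mono) auto
 also have "... <= 10 * M" using 1 by linarith
 also have "... <= pw (- eps) * M" using big M by (intro mult_right_mono) linarith+
 finally have "card ?P * pw (eps - alpha * theta powr (1 + b)) * pw (- eps + alpha * theta powr (1 + b))
   <= pw (- eps) * M * pw (- eps + alpha * theta powr (1 + b))"
  by (intro mult_right_mono) auto
 also have "... = M * (pw (- eps) * pw (- eps + alpha * theta powr (1 + b)))" by simp
 also have "... = M * pw (alpha * theta powr (1 + b) - 2 * eps)" unfolding pw_add by simp
 finally show ?thesis using rho by (simp add: mult.assoc pw_add)
qed

lemma card_sep_ge:
 assumes r: "0 < r" "r <= pw theta" and S: "ncell r E <= 2 * card S" and th: "0 <= theta" "theta <= 1"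
 shows "pw (2 * eps - alpha * theta powr (1 + b)) <= card S"
proof -
 have "r / pw theta <= 1" using r pw_pos[of theta] by simp
 then have "(r / pw theta + 2) * ncell r E <= 3 * real (ncell r E)" by (intro mult_right_mono) auto
 moreover have "real (ncell (pw theta) E) <= (r / pw theta + 2) * ncell r E"
  using r by (intro ncell_refine fin) auto
 moreover have "real (ncell r E) <= 2 * real (card S)" using S by simp
 ultimately have 1: "pw (eps - alpha * theta powr (1 + b)) <= 6 * card S" using low[OF th] by simp
 have "pw (2 * eps - alpha * theta powr (1 + b)) * pw (- eps) = pw (eps - alpha * theta powr (1 + b))"
  unfolding pw_add by simp
 moreover have "pw (2 * eps - alpha * theta powr (1 + b)) * 1000 <= pw (2 * eps - alpha * theta powr (1 + b)) * pw (- eps)"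
  using big by (intro mult_left_mono) auto
 ultimately show ?thesis using 1 by simp
qed

text \<open>Pigeonhole for \<open>x + w * y\<close> on \<open>S\<close> times \<open>S\<close>: some
  cell has more than \<open>K\<close> preimages. In it \<open>y\<close> determines \<open>x\<close>,
  and \<open>ball_bound\<close> forbids all these \<open>y\<close> to lie in one interval of radius
  \<open>pw theta1\<close>. Two preimages with distant \<open>y\<close> exhibit \<open>w\<close> as
  a quotient of differences up to \<open>r / pw theta1\<close>.\<close>

lemma quotient_step:
 assumes u: "pw theta1 <= u" "u <= 4 * T" and w: "abs w <= 2"
  and mem: "!!x y z. x \<in> E ==> y \<in> E ==> z \<in> E ==> u * (x + w * y) + z \<in> D4"
  and mem1: "!!x y z. x \<in> E ==> y \<in> E ==> z \<in> E ==> u * (x + 1 * y) + z \<in> D4"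
 shows "EX a:E. EX a':E. EX c:E. EX d:E. pw theta1 <= c - d & abs ((a - a') / (c - d) - w) <= pw (1 - 2 * theta1)"
proof -
 define r where "r = rho / u"
 have u0: "u > 0" using u pw_pos[of theta1] by linarith
 have r0: "r > 0" using rho u0 by (simp add: r_def)
 define eta where "eta = log rho (min 1 u)"
 have peta: "pw eta = min 1 u" using rho u0 by (simp add: eta_def)
 have "pw theta1 <= pw eta" using peta u pw_le1[of theta1] par by simp
 then have eta1: "eta <= theta1" using pw_less[of theta1 eta] by force
 have "pw eta <= pw 0" using peta rho by simp
 then have eta0: "0 <= eta" using pw_less[of eta 0] by force
 have eta: "0 <= eta" "eta <= 1" using eta0 eta1 par by auto
 define p where "p = 1 + b"
 define M where "M = pw (- alpha - 5 * eps + alpha * eta powr p)"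
 have MW: "ncell r (W w) <= M" "ncell r (W 1) <= M"
  unfolding r_def M_def p_def using ncell_W[OF u0 u(2) w eta peta mem] ncell_W[OF u0 u(2) _ eta peta mem1] by auto
 have "r <= rho / pw eta" unfolding r_def peta using rho u0 by (intro divide_left_mono) auto
 also have "... = pw (1 - eta)" using rho by (simp add: powr_diff)
 finally have reta: "r <= pw (1 - eta)" .
 have r1: "r <= pw theta1" using reta pw_mono[of theta1 "1 - eta"] eta1 par by simp
 obtain S where S: "S <= E" "separated r S" "ncell r E <= 2 * card S"
  using separated_subset_exists[OF r0 fin] by auto
 have fS: "finite S" using S fin finite_subset by auto
 define n where "n = real (card S)"
 have n: "pw (2 * eps - alpha * (1 - eta) powr p) <= n"
  unfolding n_def p_def using eta by (intro card_sep_ge[OF r0 reta S(3)]) auto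
 define K where "K = M * pw (alpha * theta1 powr p - 2 * eps)"
 have K: "card (S Int {x - pw theta1..x + pw theta1}) <= K" for x
  unfolding K_def p_def using par by (intro ball_bound[OF r0 r1 S(2,1) MW(2)]) auto
 have "M * K = pw (2 * (- alpha - 5 * eps + alpha * eta powr p) + (alpha * theta1 powr p - 2 * eps))"
  unfolding K_def M_def mult.assoc[symmetric] pw_add by (simp add: algebra_simps)
 \<comment> \<open>Here \<open>c1\<close> enters: the powers of \<open>eta\<close> and
   \<open>1 - eta\<close> add up to \<open>1\<close> except for \<open>2 * b\<close>, and
   \<open>alpha * theta1 powr (1 + b)\<close> pays for this and for the \<open>eps\<close>
   terms.\<close>
 also have "... < pw (2 * (2 * eps - alpha * (1 - eta) powr p))"
 proof (rule pw_less)
  have "eta - eta powr p <= b" "(1 - eta) - (1 - eta) powr p <= b"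
   unfolding p_def using eta par by (auto intro!: mult_one_minus_powr_le)
  then have "1 - eta powr p - (1 - eta) powr p <= 2 * b" by simp
  then have "alpha * (1 - eta powr p - (1 - eta) powr p) <= alpha * (2 * b)" using par by simp
  then show "2 * (2 * eps - alpha * (1 - eta) powr p) < 2 * (- alpha - 5 * eps + alpha * eta powr p) + (alpha * theta1 powr p - 2 * eps)"
   using c1 par by (simp add: p_def algebra_simps)
 qed
 also have "... = pw (2 * eps - alpha * (1 - eta) powr p) * pw (2 * eps - alpha * (1 - eta) powr p)"
  unfolding pw_add by simp
 also have "... <= n * n" using n by (intro mult_mono) (auto simp: n_def)
 finally have nMK: "M * K < n * n" .
 let ?f = "%(x, y). \<lfloor>(x + w * y) / r\<rfloor>"
 have "EX p:S \<times> S. K < card {p' \<in> S \<times> S. ?f p' = ?f p}"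
 proof (rule ccontr)
  assume no: "~ ?thesis"
  have "?f ` (S \<times> S) <= (%x. \<lfloor>x / r\<rfloor>) ` W w" using S(1) by force
  then have "card (?f ` (S \<times> S)) <= ncell r (W w)" unfolding ncell_def using fin by (intro card_mono) auto
  then have "card (?f ` (S \<times> S)) <= M" using MW(1) by simp
  moreover have "0 <= K" using K[of 0] by simp
  moreover have "card {p' \<in> S \<times> S. ?f p' = ?f p} <= K" if "p \<in> S \<times> S" for p
   using no that by force
  ultimately have "card (S \<times> S) <= M * K" using fS by (intro card_le_fibres[of _ ?f]) auto
  then show False using nMK by (simp add: card_cartesian_product n_def)
 qed
 then obtain x0 y0 where p0: "x0 \<in> S" "y0 \<in> S" and F: "K < card {p' \<in> S \<times> S. ?f p' = ?f (x0, y0)}" by auto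
 let ?F = "{p' \<in> S \<times> S. ?f p' = ?f (x0, y0)}"
 have dist: "abs ((x - x') + w * (y - y')) < r" if "(x, y) \<in> ?F" "(x', y') \<in> ?F" for x y x' y'
 proof -
  have "\<lfloor>(x + w * y) / r\<rfloor> = \<lfloor>(x' + w * y') / r\<rfloor>" using that by simp
  from same_cell[OF r0 this] show ?thesis by (simp add: algebra_simps)
 qed
 have "EX p:?F. pw theta1 <= abs (snd p - y0)"
 proof (rule ccontr)
  assume no: "~ ?thesis"
  have "inj_on snd ?F"
  proof (intro inj_onI)
   fix p q assume pq: "p \<in> ?F" "q \<in> ?F" "snd p = snd q"
   obtain x y x' where e: "p = (x, y)" "q = (x', y)" using pq(3) by (metis prod.collapse)
   have "abs (x - x') < r" using dist[of x y x' y] pq e by simp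
   moreover have "x \<in> S" "x' \<in> S" using pq e by auto
   ultimately show "p = q" using e S(2) separatedD by simp
  qed
  then have "card ?F = card (snd ` ?F)" by (simp add: card_image)
  also have "... <= card (S Int {y0 - pw theta1..y0 + pw theta1})"
  proof (intro card_mono)
   show "snd ` ?F <= S Int {y0 - pw theta1..y0 + pw theta1}"
   proof
    fix y assume "y \<in> snd ` ?F"
    then obtain p where p: "p \<in> ?F" "y = snd p" by auto
    then have "abs (y - y0) < pw theta1" using no by force
    moreover have "y \<in> S" using p by auto
    ultimately show "y \<in> S Int {y0 - pw theta1..y0 + pw theta1}" by auto
   qed
  qed (use fS in auto)
  finally show False using K[of y0] F by simp
 qed
 then obtain x y where xy: "(x, y) \<in> ?F" "pw theta1 <= abs (y - y0)" by auto
 have xyE: "x \<in> E" "y \<in> E" "x0 \<in> E" "y0 \<in> E" using xy p0 S(1) by auto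
 have d: "abs ((x - x0) + w * (y - y0)) < r" by (rule dist[OF xy(1)]) (use p0 in simp)
 have rr: "r / pw theta1 <= pw (1 - 2 * theta1)"
 proof -
  have "r <= rho / pw theta1" unfolding r_def using u rho u0 by (intro divide_left_mono) auto
  then have "r / pw theta1 <= rho / pw theta1 / pw theta1" by (intro divide_right_mono) (auto intro: less_imp_le)
  also have "... = pw (1 - theta1 - theta1)" unfolding powr_diff using rho by simp
  also have "... = pw (1 - 2 * theta1)" by simp
  finally show ?thesis .
 qed
 have concl: "abs ((a - a') / (c - d) - w) <= pw (1 - 2 * theta1)"
  if "pw theta1 <= c - d" "abs ((a - a') - w * (c - d)) < r" for a a' c d
 proof -
  have cd: "c - d > 0" using that(1) pw_pos[of theta1] by linarith
  then have "(a - a') / (c - d) - w = ((a - a') - w * (c - d)) / (c - d)" by (simp add: field_simps)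
  then have "abs ((a - a') / (c - d) - w) = abs ((a - a') - w * (c - d)) / (c - d)" using cd by simp
  also have "... <= r / pw theta1" using that pw_pos by (intro frac_le) auto
  finally show ?thesis using rr by simp
 qed
 show ?thesis
 proof (cases "y > y0")
  case True
  have "(x0 - x) - w * (y - y0) = - ((x - x0) + w * (y - y0))" by simp
  then have e: "abs ((x0 - x) - w * (y - y0)) < r" using d by simp
  have "pw theta1 <= y - y0" using True xy(2) by simp
  with concl[OF this e] xyE show ?thesis by auto
 next
  case False
  have e: "abs ((x - x0) - w * (y0 - y)) < r" using d by (simp add: algebra_simps)
  have "pw theta1 <= y0 - y" using False xy(2) by simp
  with concl[OF this e] xyE show ?thesis by auto
 qed
qed

text \<open>If \<open>q\<close> is a quotient, then \<open>q / 2\<close> and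
  \<open>(q + 1) / 2\<close> have the form \<open>v / u\<close> with \<open>u\<close>,
  \<open>v\<close> admissible in \<open>affine_mem\<close>, and \<open>quotient_step\<close> returns
  a quotient within \<open>kappa\<close> of them. These maps are the inverse branches of doubling,
  so following the binary digits of \<open>t\<close> halves the initial error each time, while the
  added errors sum to at most \<open>2 * kappa\<close>.\<close>

lemma quotients_dense:
 assumes t: "0 <= t" "t <= 1"
 shows "EX a:E. EX a':E. EX c:E. EX d:E. pw theta1 <= c - d & abs ((a - a') / (c - d) - t) <= 3 * pw (1 - 2 * theta1)"
proof -
 define kappa where "kappa = pw (1 - 2 * theta1)"
 define Q where "Q = {q. EX a:E. EX a':E. EX c:E. EX d:E. pw theta1 <= c - d & q = (a - a') / (c - d)}"
 have kap: "kappa <= 1 / 2" "0 < kappa"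
 proof -
  have "kappa <= pw eps" unfolding kappa_def using par by (intro pw_mono) auto
  moreover have "pw eps * pw (- eps) = 1" using rho by (simp add: pw_add)
  then have "pw eps * 1000 <= 1" using big mult_left_mono[of 1000 "pw (- eps)" "pw eps"] by simp
  ultimately show "kappa <= 1 / 2" by simp
  show "0 < kappa" unfolding kappa_def by (rule pw_pos)
 qed
 have step: "EX q':Q. abs (q' - w) <= kappa" if q: "q \<in> Q" "abs q <= 2" and w: "w = q / 2 | w = (q + 1) / 2" for q w
 proof -
  obtain a a' c d where e: "a \<in> E" "a' \<in> E" "c \<in> E" "d \<in> E" and cd: "pw theta1 <= c - d" and qe: "q = (a - a') / (c - d)"
   using q by (auto simp: Q_def)
  have cd0: "c - d > 0" using cd pw_pos[of theta1] by linarith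
  let ?u = "2 * (c - d)"
  define v where "v = ?u * w"
  have v: "v = a - a' | v = (a - a') + (c - d)"
   using w cd0 unfolding v_def qe by (auto simp: field_simps)
  have "abs c <= T" "abs d <= T" using ET e by auto
  then have uT: "?u <= 4 * T" by simp
  have "EX a:E. EX a':E. EX c:E. EX d:E. pw theta1 <= c - d & abs ((a - a') / (c - d) - w) <= pw (1 - 2 * theta1)"
  proof (rule quotient_step)
   have "c - d <= ?u" using cd0 by simp
   with cd show "pw theta1 <= ?u" by simp
   show "abs w <= 2" using w q(2) by auto
   show "?u * (x + w * y) + z \<in> D4" if "x \<in> E" "y \<in> E" "z \<in> E" for x y z
   proof -
    have "?u * (x + w * y) + z = ?u * x + v * y + z" by (simp add: v_def algebra_simps)
    then show ?thesis using affine_mem[OF e(3,4,1,2) that, of ?u v] v by auto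
   qed
   show "?u * (x + 1 * y) + z \<in> D4" if "x \<in> E" "y \<in> E" "z \<in> E" for x y z
    using affine_mem[OF e(3,4,1,2) that, of ?u ?u] by (simp add: algebra_simps)
  qed (rule uT)
  then show ?thesis unfolding Q_def kappa_def by blast
 qed
 have base: "0 \<in> Q"
 proof -
  have "pw theta1 <= 1 - 0" using pw_le1[of theta1] par by simp
  then show ?thesis unfolding Q_def using E01 by force
 qed
 have "ALL t. 0 <= t & t <= 1 --> (EX q:Q. abs (q - t) <= 2 * kappa + (1/2) ^ n)" for n
 proof (induction n)
  case 0
  show ?case using base kap by force
 next
  case (Suc n)
  show ?case
  proof (intro allI impI)
   fix t :: real assume t: "0 <= t & t <= 1"
   obtain t' where t': "0 <= t'" "t' <= 1" and tt: "t = t' / 2 | t = (t' + 1) / 2"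
   proof (cases "t <= 1 / 2")
    case True
    then show thesis using that[of "2 * t"] t by auto
   next
    case False
    then show thesis using that[of "2 * t - 1"] t by auto
   qed
   obtain q where q: "q \<in> Q" "abs (q - t') <= 2 * kappa + (1/2) ^ n" using Suc t' by auto
   have "(1/2::real) ^ n <= 1" by (simp add: power_le_one)
   then have q2: "abs q <= 3" using q(2) t' kap by simp
   show "EX q:Q. abs (q - t) <= 2 * kappa + (1/2) ^ Suc n"
   proof (cases "abs q <= 2")
    case True
    obtain w where w: "w = q / 2 | w = (q + 1) / 2" "abs (w - t) <= (2 * kappa + (1/2) ^ n) / 2"
     using tt
    proof
     assume "t = t' / 2"
     then have "abs (q / 2 - t) <= (2 * kappa + (1/2) ^ n) / 2" using halving(1)[OF q(2)] by auto
     then show thesis using that by blast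
    next
     assume "t = (t' + 1) / 2"
     then have "abs ((q + 1) / 2 - t) <= (2 * kappa + (1/2) ^ n) / 2" using halving(2)[OF q(2)] by blast
     then show thesis using that by blast
    qed
    obtain q' where q': "q' \<in> Q" "abs (q' - w) <= kappa" using step[OF q(1) True w(1)] by auto
    have "abs (q' - t) <= 2 * kappa + (1/2) ^ Suc n" using halving(3)[OF q'(2) w(2)] by simp
    then show ?thesis using q'(1) by auto
   next
    \<comment> \<open>A quotient beyond \<open>2\<close> forces the error bound above
      \<open>1\<close>. At the first step the quotient near \<open>1 / 2\<close> serves instead;
      later this cannot happen, because \<open>2 * kappa < 1 / 2\<close>.\<close>
    case False
    have k2: "2 * kappa + (1/2) ^ n > 1" using False q(2) t' by simp
    have "abs (0 - t) <= 1" using t by simp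
    show ?thesis
    proof (cases n)
     case 0
     obtain q' where q': "q' \<in> Q" "abs (q' - 1 / 2) <= kappa"
      using step[OF base, of "1 / 2"] by auto
     have "abs (q' - t) <= 2 * kappa + (1/2) ^ Suc n" using q'(2) t 0 by auto
     then show ?thesis using q'(1) by auto
    next
     case (Suc m)
     then have "(1/2::real) ^ n <= 1 / 2" by (simp add: power_le_one)
     then have "abs q <= 2 * kappa + 1 / 2 + t'" using q(2) t' by simp
     moreover have "2 * kappa < 1 / 2"
     proof -
      have "kappa <= pw eps" unfolding kappa_def using par by (intro pw_mono) auto
      moreover have "pw eps * pw (- eps) = 1" using rho by (simp add: pw_add)
      then have "pw eps * 1000 <= 1" using big mult_left_mono[of 1000 "pw (- eps)" "pw eps"] by simp
      ultimately show ?thesis by simp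
     qed
     ultimately show ?thesis using False t' by simp
    qed
   qed
  qed
 qed
 note ind = this
 obtain n where n: "(1/2::real) ^ n < kappa" using kap real_arch_pow_inv[of kappa "1/2"] by auto
 obtain q where "q \<in> Q" "abs (q - t) <= 2 * kappa + (1/2) ^ n" using ind[of n] t by auto
 then have "q \<in> Q" "abs (q - t) <= 3 * kappa" using n by auto
 then show ?thesis unfolding Q_def kappa_def by auto
qed

end

section \<open>Energy of projections of a product set\<close>

lemma card_grid_interval:
 fixes kappa c H :: real
 assumes "kappa > 0" "H >= 0"
 shows "card {k. k < (m::nat) & abs (real k * kappa - c) <= H} <= 2 * H / kappa + 1"
proof (cases "{k. k < m & abs (real k * kappa - c) <= H} = {}")
 case False
 let ?S = "{k. k < m & abs (real k * kappa - c) <= H}"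
 have f: "finite ?S" by simp
 let ?a = "Min ?S" and ?b = "Max ?S"
 have ab: "?a \<in> ?S" "?b \<in> ?S" using f False Min_in Max_in by blast+
 have "?S <= {?a..?b}" by auto
 then have "card ?S <= card {?a..?b}" by (intro card_mono) auto
 moreover have "?a <= ?b" using f ab by simp
 ultimately have "real (card ?S) <= real ?b - real ?a + 1" by simp
 moreover have "(real ?b - real ?a) * kappa <= 2 * H" using ab by (simp add: algebra_simps abs_le_iff)
 then have "real ?b - real ?a <= 2 * H / kappa" using assms by (simp add: pos_le_divide_eq)
 ultimately show ?thesis by simp
next
 case True
 show ?thesis unfolding True using assms by simp
qed

lemma card_equal_pairs_ge:
 assumes "finite P"
 shows "(real (card P))^2 <= card (f ` P) * card {(p, q). p \<in> P & q \<in> P & f p = f q}"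
proof -
 let ?c = "%z. card {p \<in> P. f p = z}"
 have "card P = card (\<Union>z\<in>f ` P. {p \<in> P. f p = z})" by (rule arg_cong[of _ _ card]) auto
 also have "... = (\<Sum>z\<in>f ` P. ?c z)" using assms by (intro card_UN_disjoint) auto
 finally have 1: "real (card P) = (\<Sum>z\<in>f ` P. real (?c z))" by simp
 have "{(p, q). p \<in> P & q \<in> P & f p = f q} = (\<Union>z\<in>f ` P. {p \<in> P. f p = z} \<times> {p \<in> P. f p = z})" by auto
 moreover have "card (\<Union>z\<in>f ` P. {p \<in> P. f p = z} \<times> {p \<in> P. f p = z}) = (\<Sum>z\<in>f ` P. card ({p \<in> P. f p = z} \<times> {p \<in> P. f p = z}))"
  using assms by (intro card_UN_disjoint) auto
 ultimately have 2: "real (card {(p, q). p \<in> P & q \<in> P & f p = f q}) = (\<Sum>z\<in>f ` P. (real (?c z))^2)"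
  by (simp add: card_cartesian_product power2_eq_square)
 have "(\<Sum>z\<in>f ` P. real (?c z))^2 <= (\<Sum>z\<in>f ` P. (real (?c z))^2) * card (f ` P)"
  by (rule sum_squared_le_sum_of_squares)
 then show ?thesis unfolding 1[symmetric] 2[symmetric] of_nat_mult by (simp only: mult.commute)
qed

lemma equal_pairs_split:
 "{(P, Q). P \<in> X & Q \<in> X & g P = g Q} <= {(P, Q). P \<in> X & Q \<in> X & (g P = g Q & ~ R P Q)}
  Un {PQ \<in> {(P, Q). P \<in> X & Q \<in> X & R P Q}. g (fst PQ) = g (snd PQ)}"
 by auto

text \<open>Pairs of points with equal image are counted over all \<open>i\<close>. Cauchy-Schwarz
  gives at least \<open>n ^ 4 / M\<close> of them for each \<open>i\<close>; those with close second
  coordinates number at most \<open>n^2 * K\<close>; every other pair coincides for at most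
  \<open>B\<close> indices.\<close>

lemma energy_count:
 fixes S :: "real set" and f :: "'i => real \<times> real => 'c" and M K B h :: real
 assumes B0: "0 <= B" and fin: "finite I" "finite S" "S ~= {}" and M: "M > 0" "!!i. i \<in> I ==> card (f i ` (S \<times> S)) <= M"
  and K: "!!y. y \<in> S ==> card {y' \<in> S. abs (y - y') < h} <= K"
  and inj: "!!i x x' y. i \<in> I ==> x \<in> S ==> x' \<in> S ==> y \<in> S ==> f i (x, y) = f i (x', y) ==> x = x'"
  and B: "!!x y x' y'. x \<in> S ==> y \<in> S ==> x' \<in> S ==> y' \<in> S ==> h <= abs (y - y') ==>
   card {i \<in> I. f i (x, y) = f i (x', y')} <= B"
 shows "card I * ((real (card S))^2 - M * K) <= M * (real (card S))^2 * B"
proof -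
 define n where "n = real (card S)"
 have n0: "n > 0" using fin by (simp add: n_def card_gt_0_iff)
 let ?SS = "S \<times> S"
 let ?far = "%(P::real \<times> real) (Q::real \<times> real). h <= abs (snd P - snd Q)"
 let ?A = "{(P, Q). P \<in> ?SS & Q \<in> ?SS & ?far P Q}"
 have AS: "?A <= ?SS \<times> ?SS" by auto
 then have fA: "finite ?A" by (rule finite_subset) (use fin in simp)
 have far: "n^2 * (n^2 - M * K) <= M * card {PQ \<in> ?A. f i (fst PQ) = f i (snd PQ)}" if i: "i \<in> I" for i
 proof -
  let ?B = "{(P, Q). P \<in> ?SS & Q \<in> ?SS & f i P = f i Q}"
  let ?near = "{(P, Q). P \<in> ?SS & Q \<in> ?SS & (f i P = f i Q & ~ ?far P Q)}"
  let ?far' = "{PQ \<in> ?A. f i (fst PQ) = f i (snd PQ)}"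
  have "(n^2)^2 = (real (card ?SS))^2" by (simp add: n_def card_cartesian_product power2_eq_square)
  also have "... <= card (f i ` ?SS) * card ?B" using fin by (intro card_equal_pairs_ge) auto
  also have "... <= M * card ?B" using M(2)[OF i] unfolding of_nat_mult by (intro mult_right_mono) auto
  finally have 1: "(n^2)^2 <= M * card ?B" .
  have "?near <= ?SS \<times> ?SS" by auto
  then have "finite ?near" by (rule finite_subset) (use fin in simp)
  then have "card ?B <= card (?near Un ?far')"
   using fA by (intro card_mono[OF _ equal_pairs_split]) simp
  then have "card ?B <= card ?near + card ?far'" using card_Un_le[of ?near ?far'] by simp
  moreover have "real (card ?near) <= n^2 * K"
  proof -
   have "card {Q \<in> ?SS. f i P = f i Q & ~ ?far P Q} <= K" if P: "P \<in> ?SS" for P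
   proof -
    let ?F = "{Q \<in> ?SS. f i P = f i Q & ~ ?far P Q}"
    have "inj_on snd ?F"
    proof (intro inj_onI)
     fix A B assume AB: "A \<in> ?F" "B \<in> ?F" "snd A = snd B"
     obtain x y x' where e: "A = (x, y)" "B = (x', y)" using AB(3) by (metis prod.collapse)
     have "f i (x, y) = f i (x', y)" using AB(1,2) unfolding e by simp
     then have "x = x'" using inj[OF i, of x x' y] AB(1,2) unfolding e by simp
     then show "A = B" using e by simp
    qed
    then have "card ?F = card (snd ` ?F)" by (simp add: card_image)
    also have "... <= card {y' \<in> S. abs (snd P - y') < h}"
    proof (intro card_mono)
     show "snd ` ?F <= {y' \<in> S. abs (snd P - y') < h}"
     by auto
    qed (use fin in auto)
    finally show ?thesis using K[of "snd P"] P by auto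
   qed
   then have "(\<Sum>P\<in>?SS. real (card {Q \<in> ?SS. f i P = f i Q & ~ ?far P Q})) <= (\<Sum>P\<in>?SS. K)"
    by (intro sum_mono)
   moreover have "card ?near = (\<Sum>P\<in>?SS. card {Q \<in> ?SS. f i P = f i Q & ~ ?far P Q})"
    using fin by (intro card_rel_bound) auto
   ultimately show ?thesis by (simp add: n_def card_cartesian_product power2_eq_square)
  qed
  ultimately have "real (card ?B) <= n^2 * K + card ?far'" by simp
  then have "M * card ?B <= M * (n^2 * K + card ?far')" using M by simp
  then show ?thesis using 1 by (simp add: algebra_simps)
 qed
 have "card I * (n^2 * (n^2 - M * K)) = (\<Sum>i\<in>I. n^2 * (n^2 - M * K))" by simp
 also have "... <= (\<Sum>i\<in>I. M * real (card {PQ \<in> ?A. f i (fst PQ) = f i (snd PQ)}))"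
  using far by (intro sum_mono) auto
 also have "... = M * (\<Sum>PQ\<in>?A. real (card {i \<in> I. f i (fst PQ) = f i (snd PQ)}))"
  unfolding sum_distrib_left[symmetric]
  using double_count[OF fin(1) fA, of "%i PQ. f i (fst PQ) = f i (snd PQ)"] by (simp flip: of_nat_sum)
 also have "... <= M * (\<Sum>PQ\<in>?A. B)"
 proof (intro mult_left_mono sum_mono)
  fix PQ assume "PQ \<in> ?A"
  then show "real (card {i \<in> I. f i (fst PQ) = f i (snd PQ)}) <= B"
   using B[of "fst (fst PQ)" "snd (fst PQ)" "fst (snd PQ)" "snd (snd PQ)"] by auto
 qed (use M in simp)
 also have "... = M * (card ?A * B)" by simp
 also have "... <= M * (n ^ 4 * B)"
 proof -
  have "card ?A <= card (?SS \<times> ?SS)" using fin AS by (intro card_mono) simp_all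
  then have "real (card ?A) <= n ^ 4" by (simp add: n_def card_cartesian_product power_numeral_reduce flip: of_nat_mult)
  then show ?thesis using M B0 by (intro mult_left_mono mult_right_mono) auto
 qed
 finally have "n^2 * (card I * (n^2 - M * K)) <= n^2 * (M * n^2 * B)"
  by (simp add: algebra_simps)
 then show ?thesis using n0 unfolding n_def[symmetric] by simp
qed

section \<open>Dense quotients against the energy bound\<close>

context ring_gap begin

text \<open>Every \<open>t\<close> in the unit interval is near a quotient, so
  \<open>E + t * E\<close> has at most \<open>M\<close> cells for all \<open>t\<close> in a grid of
  step \<open>kappa\<close>. By \<open>energy_count\<close> at most about
  \<open>M / pw theta2\<close> values of \<open>t\<close> allow this, but the grid has about
  \<open>1 / kappa\<close>. With \<open>M\<close> near \<open>rho powr (- alpha)\<close> this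
  contradicts \<open>alpha < 1\<close>, in the quantitative form \<open>c3\<close>;
  \<open>c2\<close> makes the close pairs negligible.\<close>

lemma contradiction: False
proof -
 define p where "p = 1 + b"
 define kappa where "kappa = pw (1 - 2 * theta1)"
 define M where "M = pw (- alpha - 7 * eps)"
 have k0: "kappa > 0" unfolding kappa_def by (rule pw_pos)
 have M0: "M > 0" unfolding M_def by (rule pw_pos)
 have WM: "ncell kappa (W t) <= M" if t: "0 <= t" "t <= 1" for t
 proof -
  obtain a a' c d where e: "a \<in> E" "a' \<in> E" "c \<in> E" "d \<in> E" and cd: "pw theta1 <= c - d"
   and qt: "abs ((a - a') / (c - d) - t) <= 3 * kappa" using quotients_dense[OF t] unfolding kappa_def by auto
  define q where "q = (a - a') / (c - d)"
  define u where "u = c - d"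
  have u0: "u > 0" using cd pw_pos[of theta1] unfolding u_def by linarith
  have "abs c <= T" "abs d <= T" using ET e by auto
  then have uT: "u <= 4 * T" unfolding u_def by simp
  have k1: "3 * kappa <= 1"
  proof -
   have "kappa <= pw eps" unfolding kappa_def using par by (intro pw_mono) auto
   moreover have "pw eps * pw (- eps) = 1" using rho by (simp add: pw_add)
   then have "pw eps * 1000 <= 1" using big mult_left_mono[of 1000 "pw (- eps)" "pw eps"] by simp
   ultimately show ?thesis by simp
  qed
  have q2: "abs q <= 2" using qt t k1 unfolding q_def by linarith
  define eta where "eta = log rho (min 1 u)"
  have peta: "pw eta = min 1 u" using rho u0 by (simp add: eta_def)
  have "pw theta1 <= pw eta" using peta cd pw_le1[of theta1] par by (simp add: u_def)
  then have eta1: "eta <= theta1" using pw_less[of theta1 eta] by force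
  have "pw eta <= pw 0" using peta rho by simp
  then have eta0: "0 <= eta" using pw_less[of eta 0] by force
  have "ncell (rho / u) (W q) <= pw (- alpha - 5 * eps + alpha * eta powr (1 + b))"
  proof (rule ncell_W[OF u0 uT q2 eta0 _ peta])
   show "u * (x + q * y) + z \<in> D4" if "x \<in> E" "y \<in> E" "z \<in> E" for x y z
   proof -
    have "u * q = a - a'" using u0 by (simp add: q_def u_def)
    then have "u * (x + q * y) + z = u * x + (a - a') * y + z" by (simp add: distrib_left)
    then show ?thesis using affine_mem[OF e(3,4,1,2) that, of u "a - a'"] by (simp add: u_def)
   qed
  qed (use eta1 par in auto)
  also have "... <= pw (- alpha - 5 * eps)" using par by (intro pw_mono) auto
  finally have 1: "ncell (rho / u) (W q) <= pw (- alpha - 5 * eps)" .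
  have ru: "rho / u <= kappa"
  proof -
   have "rho / u <= rho / pw theta1" using cd u0 rho by (intro divide_left_mono) (auto simp: u_def)
   also have "... = pw (1 - theta1)" unfolding powr_diff using rho by simp
   also have "... <= kappa" unfolding kappa_def using par by (intro pw_mono) auto
   finally show ?thesis .
  qed
  have "real (ncell kappa (W t)) <= ((rho / u + 2 * (3 * kappa * T)) / kappa + 2) * ncell (rho / u) (W q)"
  proof (rule ncell_transfer)
   fix x assume "x \<in> W t"
   then obtain e1 e2 where ee: "e1 \<in> E" "e2 \<in> E" "x = e1 + t * e2" by auto
   have "x - (e1 + q * e2) = - ((q - t) * e2)" using ee by (simp add: algebra_simps)
   then have "abs (x - (e1 + q * e2)) = abs (q - t) * abs e2" by (simp only: abs_minus_cancel abs_mult)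
   also have "... <= 3 * kappa * T" using qt ET[OF ee(2)] k0 unfolding q_def by (intro mult_mono) auto
   finally show "EX y:W q. abs (x - y) <= 3 * kappa * T" using ee by force
  qed (use fin rho u0 k0 T1 in auto)
  also have "... <= (9 * T) * ncell (rho / u) (W q)"
  proof (intro mult_right_mono)
   have "(rho / u + 2 * (3 * kappa * T)) / kappa = rho / u / kappa + 6 * T" using k0 by (simp add: add_divide_distrib)
   also have "rho / u / kappa <= 1" using ru unfolding divide_le_eq_1_pos[OF k0] .
   finally show "(rho / u + 2 * (3 * kappa * T)) / kappa + 2 <= 9 * T" using T1 by simp
  qed simp
  also have "... <= (9 * T) * pw (- alpha - 5 * eps)" using 1 T1 by simp
  also have "... <= (pw (- eps) * pw (- eps)) * pw (- alpha - 5 * eps)"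
   using big T1 by (intro mult_right_mono mult_mono) auto
  also have "... = M" unfolding M_def pw_add by (simp add: algebra_simps)
  finally show ?thesis .
 qed
 obtain S where S: "S <= E" "separated kappa S" "ncell kappa E <= 2 * card S"
  using separated_subset_exists[OF k0 fin] by auto
 have fS: "finite S" using S fin finite_subset by auto
 define n where "n = real (card S)"
 have n: "pw (2 * eps - alpha * (1 - 2 * theta1) powr p) <= n"
  unfolding n_def p_def using par by (intro card_sep_ge[OF k0 _ S(3)]) (auto simp: kappa_def)
 have n0: "n > 0" using n pw_pos less_le_trans by blast
 define K where "K = M * pw (alpha * theta2 powr p - 2 * eps)"
 have kth: "kappa <= pw theta2" unfolding kappa_def using par by (intro pw_mono) auto
 have K: "card (S Int {x - pw theta2..x + pw theta2}) <= K" for x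
  unfolding K_def p_def using par WM[of 1] by (intro ball_bound[OF k0 kth S(2,1)]) auto
 have MK: "2 * (M * K) <= n^2"
 proof -
  \<comment> \<open>As \<open>1 + b <= 2\<close>, the power is at least the square, which is at
    least its linear part.\<close>
  have th: "1 - 2 * (2 * theta1) <= (1 - 2 * theta1) powr p"
  proof -
   have "(1 - 2 * theta1)^2 = (1 - 2 * theta1) powr 2" using par by simp
   also have "... <= (1 - 2 * theta1) powr p" unfolding p_def using par by (intro powr_mono') auto
   finally have "(1 - 2 * theta1)^2 <= (1 - 2 * theta1) powr p" .
   moreover have "(1 - 2 * theta1)^2 = 1 - 2 * (2 * theta1) + 4 * theta1^2" by (simp add: power2_eq_square algebra_simps)
   moreover have "0 <= 4 * theta1^2" by simp
   ultimately show ?thesis by linarith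
  qed
  have "M * K = pw (2 * (- alpha - 7 * eps) + (alpha * theta2 powr p - 2 * eps))"
   unfolding K_def M_def mult.assoc[symmetric] pw_add by (simp add: algebra_simps)
  also have "... <= pw (2 * (2 * eps - alpha * (1 - 2 * theta1) powr p) + eps)"
  proof (rule pw_mono)
   have "alpha * (1 - 2 * (2 * theta1)) <= alpha * (1 - 2 * theta1) powr p" using th par by simp
   then show "2 * (2 * eps - alpha * (1 - 2 * theta1) powr p) + eps <= 2 * (- alpha - 7 * eps) + (alpha * theta2 powr p - 2 * eps)"
    using c2 par by (simp add: p_def algebra_simps)
  qed
  finally have "M * K * pw (- eps) <= pw (2 * (2 * eps - alpha * (1 - 2 * theta1) powr p) + eps) * pw (- eps)"
   by (intro mult_right_mono) auto
  also have "... = pw (2 * eps - alpha * (1 - 2 * theta1) powr p) * pw (2 * eps - alpha * (1 - 2 * theta1) powr p)"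
   unfolding pw_add by simp
  also have "... <= n * n" using n n0 by (intro mult_mono) (auto intro: less_imp_le)
  finally have "M * K * pw (- eps) <= n^2" by (simp add: power2_eq_square)
  moreover have "0 <= M * K" using M0 by (simp add: K_def)
  then have "M * K * 2 <= M * K * pw (- eps)" using big by (intro mult_left_mono) auto
  ultimately show ?thesis by simp
 qed
 define m where "m = nat \<lfloor>1 / kappa\<rfloor>"
 have k_half: "kappa <= 1 / 2"
 proof -
  have "kappa <= pw eps" unfolding kappa_def using par by (intro pw_mono) auto
  moreover have "pw eps * pw (- eps) = 1" using rho by (simp add: pw_add)
  then have "pw eps * 1000 <= 1" using big mult_left_mono[of 1000 "pw (- eps)" "pw eps"] by simp
  ultimately show ?thesis by simp
 qed
 have m: "real m <= 1 / kappa" "1 / (2 * kappa) <= m"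
 proof -
  have "1 / kappa >= 2" using k_half k0 by (simp add: field_simps)
  then have "0 <= \<lfloor>1 / kappa\<rfloor>" by linarith
  then have "real m = of_int \<lfloor>1 / kappa\<rfloor>" unfolding m_def by simp
  moreover have "1 / (2 * kappa) = (1 / kappa) / 2" by simp
  ultimately show "real m <= 1 / kappa" "1 / (2 * kappa) <= m" using \<open>1 / kappa >= 2\<close> by linarith+
 qed
 let ?f = "%k. %(x, y). \<lfloor>(x + (real k * kappa) * y) / kappa\<rfloor>"
 have few: "card {k \<in> {..<m}. ?f k (x, y) = ?f k (x', y')} <= 3 / pw theta2" if far: "pw theta2 <= abs (y - y')" for x y x' y'
 proof -
  have y0: "abs (y - y') > 0" using far pw_pos[of theta2] by auto
  let ?c = "- (x - x') / (y - y')" and ?H = "kappa / pw theta2"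
  have "{k \<in> {..<m}. ?f k (x, y) = ?f k (x', y')} <= {k. k < m & abs (real k * kappa - ?c) <= ?H}"
  proof
   fix k assume "k \<in> {k \<in> {..<m}. ?f k (x, y) = ?f k (x', y')}"
   then have k: "k < m" and "\<lfloor>(x + (real k * kappa) * y) / kappa\<rfloor> = \<lfloor>(x' + (real k * kappa) * y') / kappa\<rfloor>"
    by auto
   from same_cell[OF k0 this(2)] have "abs ((x + (real k * kappa) * y) - (x' + (real k * kappa) * y')) < kappa" .
   moreover have "(x + (real k * kappa) * y) - (x' + (real k * kappa) * y') = (real k * kappa - ?c) * (y - y')"
    using y0 by (simp add: field_simps)
   ultimately have "abs (real k * kappa - ?c) * abs (y - y') < kappa" by fastforce
   then have "abs (real k * kappa - ?c) <= kappa / abs (y - y')" using y0 by (simp add: pos_le_divide_eq)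
   also have "... <= ?H" using far y0 k0 pw_pos by (intro divide_left_mono) auto
   finally show "k \<in> {k. k < m & abs (real k * kappa - ?c) <= ?H}" using k by simp
  qed
  then have "card {k \<in> {..<m}. ?f k (x, y) = ?f k (x', y')} <= card {k. k < m & abs (real k * kappa - ?c) <= ?H}"
   by (intro card_mono) auto
  then have "real (card {k \<in> {..<m}. ?f k (x, y) = ?f k (x', y')}) <= 2 * ?H / kappa + 1"
   using card_grid_interval[OF k0, of ?H m ?c] k0 by simp
  also have "... = 2 / pw theta2 + 1" using k0 by simp
  also have "... <= 3 / pw theta2" using pw_le1[of theta2] pw_pos[of theta2] par by (simp add: field_simps)
  finally show ?thesis .
 qed
 have "real (card {..<m}) * ((real (card S))^2 - M * K) <= M * (real (card S))^2 * (3 / pw theta2)"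
 proof (rule energy_count[where f = ?f and h = "pw theta2"])
  show "card (?f k ` (S \<times> S)) <= M" if k: "k \<in> {..<m}" for k
  proof -
   let ?t = "real k * kappa"
   have "real k * kappa <= m * kappa" using k k0 by simp
   also have "... <= 1" using m(1) k0 by (simp add: field_simps)
   finally have t: "0 <= ?t" "?t <= 1" using k0 by auto
   have "?f k ` (S \<times> S) <= (%x. \<lfloor>x / kappa\<rfloor>) ` W ?t" using S(1) by force
   then have "card (?f k ` (S \<times> S)) <= ncell kappa (W ?t)" unfolding ncell_def using fin by (intro card_mono) auto
   then show ?thesis using WM[OF t] by simp
  qed
  show "card {y' \<in> S. abs (y - y') < pw theta2} <= K" for y
  proof -
   have "card {y' \<in> S. abs (y - y') < pw theta2} <= card (S Int {y - pw theta2..y + pw theta2})"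
    using fS by (intro card_mono) auto
   then show ?thesis using K[of y] by simp
  qed
  fix k x x' y assume xy: "x \<in> S" "x' \<in> S" "?f k (x, y) = ?f k (x', y)"
  then have "\<lfloor>(x + (real k * kappa) * y) / kappa\<rfloor> = \<lfloor>(x' + (real k * kappa) * y) / kappa\<rfloor>" by simp
  from same_cell[OF k0 this] have "abs (x - x') < kappa" by simp
  then show "x = x'" using xy(1,2) S(2) separatedD by simp
 qed (use M0 fS n0 few pw_pos in \<open>auto simp: n_def\<close>)
 then have 1: "real m * (n^2 - M * K) <= M * n^2 * (3 / pw theta2)" by (simp add: n_def)
 have "real m * (n^2 / 2) <= real m * (n^2 - M * K)" using MK by (intro mult_left_mono) auto
 with 1 have 2: "real m * (n^2 / 2) <= M * n^2 * (3 / pw theta2)" by simp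
 have "real m * (n^2 / 2) = n^2 * (real m * (1 / 2))" "M * n^2 * (3 / pw theta2) = n^2 * (M * (3 / pw theta2))" by auto
 with 2 have "n^2 * (real m * (1 / 2)) <= n^2 * (M * (3 / pw theta2))" by linarith
 moreover have "0 < n^2" using n0 by simp
 ultimately have "real m * (1 / 2) <= M * (3 / pw theta2)" by (simp only: mult_le_cancel_left_pos)
 then have "real m * (1 / (2 * M)) <= 3 / pw theta2" using M0 by (simp add: field_simps)
 moreover have "1 / (2 * kappa) * (1 / (2 * M)) <= real m * (1 / (2 * M))"
  using m(2) M0 by (intro mult_right_mono) auto
 ultimately have "1 / (4 * (kappa * M)) <= 3 / pw theta2" by simp
 then have "pw theta2 <= 12 * (kappa * M)" using k0 M0 pw_pos[of theta2] by (simp add: field_simps)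
 also have "... <= pw (- eps) * (kappa * M)" using big k0 M0 by simp
 also have "... = pw (- eps + ((1 - 2 * theta1) + (- alpha - 7 * eps)))" unfolding kappa_def M_def by (simp only: pw_add)
 also have "... < pw theta2" using c3 par by (intro pw_less) auto
 finally show False by simp
qed

end

section \<open>Iterated difference-products and the choice of a stage and a scale\<close>

lemma difprod_pow:
 assumes "finite E" "0 \<in> E" "1 \<in> E" "!!e. e \<in> E ==> abs e <= L" "1 <= L"
 shows "finite ((difprod ^^ k) E) & 0 \<in> (difprod ^^ k) E & 1 \<in> (difprod ^^ k) E
  & E <= (difprod ^^ k) E & (ALL e:(difprod ^^ k) E. abs e <= (2 * L) ^ (2 ^ k) / 2)"
proof (induction k)
 case (Suc k)
 let ?F = "(difprod ^^ k) E" and ?T = "(2 * L) ^ (2 ^ k) / 2"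
 have IH: "finite ?F" "0 \<in> ?F" "1 \<in> ?F" "E <= ?F" "!!e. e \<in> ?F ==> abs e <= ?T" using Suc by auto
 note B = difprod_basics[OF IH(2,3)]
 have "abs s <= (2 * L) ^ (2 ^ Suc k) / 2" if sF: "s \<in> difprod ?F" for s
 proof -
  obtain x y z w where e: "s = x * y - z * w" "x \<in> ?F" "y \<in> ?F" "z \<in> ?F" "w \<in> ?F"
   using difprodE[OF sF] by metis
  have "0 <= ?T" using assms(5) by simp
  then have "abs (x * y) <= ?T * ?T" "abs (z * w) <= ?T * ?T"
   unfolding abs_mult by (intro mult_mono IH(5) e abs_ge_zero; assumption)+
  then have "abs s <= ?T * ?T + ?T * ?T" unfolding e(1) by linarith
  also have "... = (2 * L) ^ (2 ^ Suc k) / 2" by (simp add: power_mult power2_eq_square mult.commute[of 2])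
  finally show ?thesis .
 qed
 then show ?case using IH B by auto
qed (use assms in simp)

lemma slow_growth:
 fixes A :: "nat => real" and e :: real
 assumes "0 <= A 0" "A N <= c" "c < N * e"
 shows "EX k<N. A (Suc k) <= A k + e"
proof (rule ccontr)
 assume no: "~ ?thesis"
 have "n <= N ==> n * e <= A n" for n
 proof (induction n)
  case (Suc n)
  then have "A (Suc n) > A n + e" using no by (meson Suc_le_eq linorder_not_le)
  then show ?case using Suc by (simp add: algebra_simps)
 qed (use assms in simp)
 from this[of N] show False using assms by simp
qed

text \<open>Write the count of stage \<open>E k\<close> at scale \<open>rho powr s\<close> as
  \<open>rho powr (- e k s)\<close>, and let \<open>A k\<close> be the infimum of
  \<open>e k s / s powr (1 + b)\<close>. If growth fails, all \<open>A k\<close> stay below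
  \<open>tau\<close>, so one step hardly increases \<open>A\<close>. At a scale \<open>x\<close>
  nearly attaining the infimum for \<open>E (Suc k)\<close>, the set \<open>E k\<close> meets the
  lower bounds of \<open>ring_gap\<close> at all coarser scales, and four more rounds meet the upper
  bound.\<close>

theorem ring_growth:
 fixes ppi tau :: real
 assumes pi: "0 < ppi" "ppi <= 1" and tau: "0 < tau" "tau < 1"
 shows "EX m eta rho0. 0 < eta & 0 < rho0 & rho0 < 1 & (ALL rho L R. 0 < rho --> rho < rho0 --> 1 <= L --> L <= rho powr (-eta) -->
   finite R --> 0 \<in> R --> 1 \<in> R --> (ALL e:R. abs e <= L) -->
   (ALL r. rho <= r --> r <= 1 --> r powr (-ppi) <= L * ncell r R) -->
   (EX k<=m. rho powr (-tau) < ncell rho ((difprod ^^ k) R)))"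
proof -
 \<comment> \<open>The chain is arranged so that \<open>c1\<close>, \<open>c2\<close>,
   \<open>c3\<close> of \<open>ring_gap\<close> hold for every \<open>alpha\<close> between
   \<open>alpha0\<close> and \<open>tau\<close>: \<open>theta2\<close> is measured against
   \<open>1 - tau\<close>, \<open>theta1\<close> against \<open>theta2^2\<close>, and
   \<open>b\<close> and \<open>eps\<close> against \<open>theta1^2\<close>.\<close>
 define theta2 where "theta2 = (1 - tau) / 4"
 define theta1 where "theta1 = theta2^2 / 32"
 define b where "b = theta1^2 / 8"
 define alpha0 where "alpha0 = ppi^2 / 8"
 define eps where "eps = alpha0 * theta1^2 / 100"
 define x0 where "x0 = (ppi / 4) powr (1 / b)"
 define N where "N = nat \<lceil>2 / eps\<rceil> + 1"
 define m where "m = 4 * N"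
 \<comment> \<open>The first bound keeps the elements of all stages, of size at most
   \<open>(2 * L) ^ (2 ^ m)\<close>, below \<open>r powr (- eps)\<close>. The second gives
   \<open>s0 <= eps * x0\<close>, so that the scales left out of the infimum are covered by the
   slack \<open>eps\<close>.\<close>
 define eta where "eta = min (x0 * eps / (2 * 2 ^ m)) (ppi * eps * x0 / 2)"
 define rho0 where "rho0 = min (1 / 2) (min (1000 powr (- 1 / (x0 * eps))) (2 powr (- 1 / eta)))"
 have t2: "0 < theta2" "theta2 <= 1 / 4" using tau by (auto simp: theta2_def)
 have "theta2^2 <= (1/4)^2" using t2 by simp
 then have t1: "0 < theta1" "theta1 <= 1 / 500" using t2 by (auto simp: theta1_def power2_eq_square)
 have "theta1^2 <= 1^2" using t1 by (intro power_mono) auto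
 then have bb: "0 < b" "b <= 1" using t1 by (auto simp: b_def)
 have "ppi^2 <= 1^2" using pi by (intro power_mono) auto
 then have a0: "0 < alpha0" "alpha0 <= 1 / 8" using pi by (auto simp: alpha0_def)
 have t12: "theta1^2 <= theta1" "theta1 <= theta2"
  using t1 t2 by (auto simp: power2_eq_square theta1_def)
 have "alpha0 * theta1^2 <= (1/8) * theta1" using a0 t12 by (intro mult_mono) auto
 then have ep: "0 < eps" "eps <= theta1 / 800" using a0 t1 by (auto simp: eps_def)
 have x0: "0 < x0" "x0 <= 1" using pi bb by (auto simp: x0_def powr_le1)
 have eta: "0 < eta" "eta <= x0 * eps / (2 * 2 ^ m)" "eta <= ppi * eps * x0 / 2" using x0 ep pi by (auto simp: eta_def)
 have r0: "0 < rho0" "rho0 < 1" by (auto simp: rho0_def)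
 have N: "1 < real N * (eps / 2)"
 proof -
  have "2 / eps < real N" unfolding N_def by linarith
  then show ?thesis using ep by (simp add: field_simps)
 qed
 have main: "EX k<=m. rho powr (-tau) < ncell rho ((difprod ^^ k) R)"
  if rho: "0 < rho" "rho < rho0" and L: "1 <= L" "L <= rho powr (-eta)" and R: "finite R" "0 \<in> R" "1 \<in> R" "ALL e:R. abs e <= L"
   and fr: "ALL r. rho <= r --> r <= 1 --> r powr (-ppi) <= L * ncell r R" for rho L :: real and R
 proof (rule ccontr)
  assume "~ ?thesis"
  then have small: "ncell rho ((difprod ^^ k) R) <= rho powr (-tau)" if "k <= m" for k
   using that by auto
  have rho1: "rho < 1" using rho r0 by simp
  have pm: "rho powr y <= rho powr x" if "x <= y" for x y using that rho rho1 by (intro powr_mono') auto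
  define E where "E = (%k. (difprod ^^ (4 * k)) R)"
  have E_Suc: "E (Suc k) = difprod (difprod (difprod (difprod (E k))))" for k
   by (simp add: E_def numeral_eq_Suc)
  have E: "finite (E k)" "0 \<in> E k" "1 \<in> E k" "R <= E k" "e \<in> E k ==> abs e <= (2 * L) ^ (2 ^ (4 * k)) / 2" for k e
   using difprod_pow[OF R(1-3) _ L(1), of "4 * k"] R(4) unfolding E_def by auto
  have E_sub: "E k <= E (Suc k)" for k
  proof -
   note D1 = difprod_basics[OF E(2,3), of k]
   note D2 = difprod_basics[OF D1(4,5)]
   note D3 = difprod_basics[OF D2(4,5)]
   note D4 = difprod_basics[OF D3(4,5)]
   show ?thesis unfolding E_Suc using D1(1) D2(1) D3(1) D4(1) by simp
  qed
  define e where "e = (%k s. - log rho (ncell (rho powr s) (E k)))"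
  have n1: "1 <= real (ncell r (E k))" for r k using ncell_pos[OF E(1)] E(2) by auto
  have ncell_e: "real (ncell (rho powr s) (E k)) = rho powr (- e k s)" for k s
   unfolding e_def using n1[of "rho powr s" k] rho rho1 by simp
  have e_le: "e k s <= y" if "ncell (rho powr s) (E k) <= rho powr (- y)" for k s y
  proof (rule ccontr)
   assume "~ ?thesis"
   then have "rho powr (- y) < rho powr (- e k s)" using rho rho1 by (intro powr_less_mono') auto
   then show False using that unfolding ncell_e by simp
  qed
  have e_ge: "y <= e k s" if "rho powr (- y) <= ncell (rho powr s) (E k)" for k s y
  proof (rule ccontr)
   assume "~ ?thesis"
   then have "rho powr (- e k s) < rho powr (- y)" using rho rho1 by (intro powr_less_mono') auto
   then show False using that unfolding ncell_e by simp
  qed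
  have e0: "0 <= e k s" for k s using n1[of "rho powr s" k] by (intro e_ge) simp
  have e_Suc: "e k s <= e (Suc k) s" for k s
   using ncell_mono[OF E(1) E_sub, of "rho powr s" k] by (intro e_ge) (simp flip: ncell_e)
  have e_mono: "e 0 s <= e k s" for k s by (induction k) (auto intro: order_trans e_Suc)
  define s0 where "s0 = 2 * eta / ppi"
  have s0: "0 < s0" "s0 <= eps * x0" using eta pi by (auto simp: s0_def field_simps)
  have "eps * x0 <= 1 * 1" using ep x0 t1 by (intro mult_mono) auto
  then have s01: "s0 <= 1" using s0 by simp
  have e0_low: "ppi * s / 2 <= e 0 s" if "s0 <= s" "s <= 1" for s
  proof -
   have "rho powr 1 <= rho powr s" "rho powr s <= rho powr 0" using that s0 by (intro pm; linarith)+
   then have "(rho powr s) powr (- ppi) <= L * ncell (rho powr s) R" using fr rho by simp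
   then have "rho powr (- (ppi * s)) <= L * ncell (rho powr s) R" by (simp add: powr_powr mult.commute)
   also have "... <= rho powr (- eta) * ncell (rho powr s) (E 0)" using L by (intro mult_mono) (auto simp: E_def)
   finally have "rho powr eta * rho powr (- (ppi * s)) <= rho powr eta * (rho powr (- eta) * ncell (rho powr s) (E 0))"
    by (intro mult_left_mono) auto
   also have "... = ncell (rho powr s) (E 0)" using rho by (simp add: powr_minus)
   finally have "rho powr (- (ppi * s - eta)) <= ncell (rho powr s) (E 0)" by (simp add: algebra_simps flip: powr_add)
   then have "ppi * s - eta <= e 0 s" by (rule e_ge)
   moreover have "eta <= ppi * s / 2" using that(1) pi by (simp add: s0_def field_simps)
   ultimately show ?thesis by simp
  qed
  \<comment> \<open>An exponent above \<open>1\<close> keeps the minimising scale away from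
    \<open>0\<close>: the initial counts grow at least linearly in \<open>s\<close>, and comparison
    with \<open>s powr (1 + b)\<close> forces \<open>ppi / 4 <= x powr b\<close>, that is
    \<open>x0 <= x\<close>. With exponent \<open>1\<close> this argument would give no lower bound
    for \<open>x\<close>.\<close>
  define p where "p = 1 + b"
  have p1: "1 <= p" "p <= 2" using bb by (auto simp: p_def)
  define A where "A = (%k. INF s\<in>{s0..1}. e k s / s powr p)"
  have bdd: "bdd_below ((%s. e k s / s powr p) ` {s0..1})" for k
   by (rule bdd_belowI[of _ 0]) (auto intro!: divide_nonneg_nonneg e0)
  have A_le: "A k <= e k s / s powr p" if "s0 <= s" "s <= 1" for k s
   unfolding A_def using that by (intro cINF_lower bdd) auto
  have A_ge: "c <= A k" if "!!s. s0 <= s ==> s <= 1 ==> c <= e k s / s powr p" for c k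
   unfolding A_def using that s01 by (intro cINF_greatest) auto
  have A_pi: "ppi / 2 <= A k" for k
  proof (rule A_ge)
   fix s assume s: "s0 <= s" "s <= 1"
   have "s powr p <= s powr 1" using s s0 p1 by (intro powr_mono') auto
   then have "ppi / 2 * s powr p <= ppi / 2 * s" using pi s s0 by simp
   also have "... <= e k s" using e0_low[OF s] e_mono[of s k] by simp
   finally show "ppi / 2 <= e k s / s powr p" using s s0 by (simp add: pos_le_divide_eq)
  qed
  have A_tau: "A k <= tau" if "k <= N" for k
  proof -
   have "ncell (rho powr 1) (E k) <= rho powr (- tau)" using small[of "4 * k"] that rho by (simp add: E_def m_def)
   then have "e k 1 <= tau" by (rule e_le)
   then show ?thesis using A_le[of 1 k] s01 by simp
  qed
  have "EX k<N. A (Suc k) <= A k + eps / 2"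
  proof (rule slow_growth)
   show "0 <= A 0" using A_pi[of 0] pi by simp
   show "A N <= tau" by (rule A_tau) simp
   show "tau < N * (eps / 2)" using N tau by simp
  qed
  then obtain k where k: "k < N" "A (Suc k) <= A k + eps / 2" by auto
  have "A (Suc k) < A (Suc k) + eps / 2" using ep by simp
  then obtain x where x: "s0 <= x" "x <= 1" "e (Suc k) x / x powr p < A (Suc k) + eps / 2"
   using cINF_less_iff[OF _ bdd, of "Suc k" "A (Suc k) + eps / 2"] s01 unfolding A_def by auto
  have xpos: "0 < x" using x s0 by simp
  have "e (Suc k) x / x powr p < A k + eps" using x(3) k(2) by simp
  then have ex: "e (Suc k) x <= (A k + eps) * x powr p" using xpos by (simp add: pos_divide_less_eq)
  have AK: "ppi / 2 <= A k" "A k <= tau" using A_pi A_tau k by auto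
  have xp: "x powr p = x * x powr b" using xpos by (simp add: p_def powr_add)
  have "ppi * x / 2 <= e (Suc k) x" using e0_low[OF x(1,2)] e_mono[of x "Suc k"] by simp
  also have "... <= 2 * x powr p" using AK tau ep t1 by (intro order_trans[OF ex] mult_right_mono) auto
  finally have "x * (ppi / 4) <= x * x powr b" unfolding xp by (simp add: mult.commute)
  then have xb: "ppi / 4 <= x powr b" using xpos by simp
  have "(ppi / 4) powr (1 / b) <= (x powr b) powr (1 / b)" using xb pi bb by (intro powr_mono2) auto
  then have x0x: "x0 <= x" using bb xpos by (simp add: x0_def powr_powr)
  define alpha where "alpha = A k * x powr b"
  have xb1: "x powr b <= 1" using xpos x bb by (intro powr_le1) auto
  have "ppi / 2 * (ppi / 4) <= alpha" unfolding alpha_def using AK xb pi by (intro mult_mono) auto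
  then have al0: "alpha0 <= alpha" by (simp add: alpha0_def power2_eq_square)
  have "alpha <= tau * 1" unfolding alpha_def using AK xb1 tau by (intro mult_mono) auto
  then have al1: "alpha <= tau" by simp
  define r where "r = rho powr x"
  have rpw: "r powr y = rho powr (x * y)" for y by (simp add: r_def powr_powr)
  define T where "T = (2 * L) ^ (2 ^ m)"
  have xeps: "x0 * eps <= x * eps" using x0x ep by simp
  have eta_big: "2 <= rho powr (- eta)" and big: "1000 <= rho powr (- (x0 * eps))"
  proof -
   have "rho <= 2 powr (- 1 / eta)" "rho <= 1000 powr (- 1 / (x0 * eps))" using rho by (auto simp: rho0_def)
   then have "(2 powr (- 1 / eta)) powr (- eta) <= rho powr (- eta)"
    "(1000 powr (- 1 / (x0 * eps))) powr (- (x0 * eps)) <= rho powr (- (x0 * eps))"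
    using eta x0 ep rho by (auto intro!: powr_mono2')
   then show "2 <= rho powr (- eta)" "1000 <= rho powr (- (x0 * eps))"
    using eta x0 ep by (auto simp: powr_powr)
  qed
  have "2 * L <= rho powr (- eta) * rho powr (- eta)" using eta_big L by (intro mult_mono) auto
  then have L2: "2 * L <= rho powr (- 2 * eta)" by (simp flip: powr_add)
  have "T <= (rho powr (- 2 * eta)) ^ (2 ^ m)" unfolding T_def using L2 L by (intro power_mono) auto
  also have "... = rho powr (- 2 * eta * 2 ^ m)" using rho by (simp add: powr_powr flip: powr_realpow)
  also have "... <= rho powr (- (x * eps))"
  proof (rule pm)
   have "2 * eta * 2 ^ m <= x0 * eps" using eta(2) by (simp add: field_simps)
   then show "- (x * eps) <= - 2 * eta * 2 ^ m" using xeps by simp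
  qed
  finally have T: "T <= r powr (- eps)" unfolding rpw by simp
  have ET: "abs y <= T" if "y \<in> E k" for y
  proof -
   have "abs y <= (2 * L) ^ (2 ^ (4 * k)) / 2" using E(5)[OF that] .
   also have "... <= (2 * L) ^ (2 ^ (4 * k))" using L by simp
   also have "... <= T" unfolding T_def using L k by (intro power_increasing) (auto simp: m_def)
   finally show ?thesis .
  qed
  have t_sq: "theta1^2 <= theta1 powr p" "theta2^2 <= theta2 powr p"
  proof -
   have "theta1^2 = theta1 powr 2" "theta2^2 = theta2 powr 2" using t1 t2 by auto
   moreover have "theta1 powr 2 <= theta1 powr p" "theta2 powr 2 <= theta2 powr p" using t1 t2 p1 by (intro powr_mono'; linarith)+
   ultimately show "theta1^2 <= theta1 powr p" "theta2^2 <= theta2 powr p" by auto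
  qed
  have "ring_gap (E k) r alpha b eps theta1 theta2 T"
  proof
   show "finite (E k)" "0 \<in> E k" "1 \<in> E k" using E by auto
   show "abs y <= T" if "y \<in> E k" for y by (rule ET[OF that])
   show "1 <= T" unfolding T_def using L by (intro one_le_power) simp
   show "T <= r powr - eps" by (rule T)
   show "0 < r" using rho by (simp add: r_def)
   show "r < 1" using xpos rho rho1 powr_less_mono'[of rho 0 x] by (simp add: r_def)
   have "rho powr (- (x0 * eps)) <= r powr (- eps)" unfolding rpw using xeps by (intro pm) simp
   then show "1000 <= r powr - eps" using big by simp
   show "0 < alpha" using al0 a0 by simp
   show "alpha < 1" using al1 tau by simp
   show "0 < b" "b <= 1" using bb by auto
   show "0 < eps" "eps <= 1 / 4" using ep t1 by auto
   show "0 < theta1" "theta1 <= 1 / 4" "0 < theta2" "theta2 <= 1 / 2" using t1 t2 by auto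
   show "r powr (eps - alpha * theta powr (1 + b)) <= ncell (r powr theta) (E k)" if th: "0 <= theta" "theta <= 1" for theta
   proof (cases "s0 <= x * theta")
    case True
    have "x * theta <= 1" using th x by (simp add: mult_le_one)
    then have "A k <= e k (x * theta) / (x * theta) powr p" using True by (intro A_le)
    moreover have "0 < x * theta" using True s0 by simp
    then have "0 < (x * theta) powr p" by auto
    ultimately have "A k * (x * theta) powr p <= e k (x * theta)" by (simp only: pos_le_divide_eq)
    moreover have "A k * (x * theta) powr p = x * (alpha * theta powr p)"
     by (simp add: powr_mult xp alpha_def)
    ultimately have "x * (eps - alpha * theta powr p) >= - e k (x * theta)"
     using mult_pos_pos[OF xpos ep(1)] by (simp add: algebra_simps)
    then have "rho powr (x * (eps - alpha * theta powr p)) <= rho powr (- e k (x * theta))" by (rule pm)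
    then show ?thesis unfolding rpw ncell_e p_def by simp
   next
    case False
    have "x0 * theta <= x * theta" using x0x th by (intro mult_right_mono)
    then have "x0 * theta <= x0 * eps" using False s0 by (simp add: mult.commute)
    then have "theta <= eps" using x0 by simp
    moreover have "theta powr p <= theta" using powr_mono'[of 1 p theta] th p1 by simp
    moreover have "alpha * theta powr p <= 1 * theta powr p" using al1 tau by (intro mult_right_mono) auto
    ultimately have "0 <= eps - alpha * theta powr p" by simp
    then have "0 <= x * (eps - alpha * theta powr p)" using xpos by simp
    then have "rho powr (x * (eps - alpha * theta powr p)) <= rho powr 0" by (rule pm)
    then have "r powr (eps - alpha * theta powr p) <= 1" unfolding rpw using rho by simp
    then show ?thesis using n1[of "r powr theta" k] unfolding p_def by simp
   qed
   show "ncell r (difprod (difprod (difprod (difprod (E k))))) <= r powr (- alpha - eps)"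
   proof -
    have "x * (- alpha - eps) <= - e (Suc k) x"
    proof -
     have "e (Suc k) x <= x * alpha + x * eps * x powr b" using ex by (simp add: xp alpha_def algebra_simps)
     also have "x * eps * x powr b <= x * eps * 1" using xb1 xpos ep by simp
     finally show ?thesis by (simp add: algebra_simps)
    qed
    then have "rho powr (- e (Suc k) x) <= rho powr (x * (- alpha - eps))" by (rule pm)
    then show ?thesis using ncell_e[of x "Suc k"] unfolding rpw E_Suc r_def[symmetric] by simp
   qed
   have e1: "eps <= alpha * theta1^2 / 100" unfolding eps_def using al0 by (intro divide_right_mono mult_right_mono) auto
   have "0 < alpha * theta1^2" using al0 a0 t1 by simp
   moreover have "alpha * theta1^2 <= alpha * theta1 powr p" using t_sq al0 a0 by simp
   moreover have "4 * b * alpha = alpha * theta1^2 / 2" by (simp add: b_def)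
   ultimately show "4 * b * alpha + 30 * eps < alpha * theta1 powr (1 + b)" using e1 unfolding p_def by linarith
   have "theta1^2 <= theta2^2" using t12 t1 by simp
   then have "alpha * theta1^2 <= alpha * theta2^2" using al0 a0 by simp
   moreover have "alpha * theta2^2 <= alpha * theta2 powr p" using t_sq al0 a0 by simp
   moreover have "8 * alpha * theta1 = alpha * theta2^2 / 4" by (simp add: theta1_def)
   ultimately show "8 * alpha * theta1 + 30 * eps < alpha * theta2 powr (1 + b)"
    using e1 \<open>0 < alpha * theta1^2\<close> unfolding p_def by linarith
   show "theta2 + 2 * theta1 + alpha + 10 * eps < 1"
   proof -
    have "tau = 1 - 4 * theta2" by (simp add: theta2_def field_simps)
    then show ?thesis using t12 ep al1 by simp
   qed
  qed
  then show False by (rule ring_gap.contradiction)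
 qed
 show ?thesis using main eta(1) r0 by blast
qed

subsection \<open>Dilates near few translates\<close>

text \<open>An approximate form of \<open>t\<close> being a multiplier of \<open>J\<close>. The
  translates are real because \<open>t * j\<close> is; the tolerance \<open>1\<close> is the spacing
  of the integers and is restored by \<open>cover_round\<close> after every operation.\<close>

definition covers :: "int set => real => real => bool" where
 "covers J t M \<longleftrightarrow> (EX F::real set. finite F & real (card F) <= M &
   (ALL j:J. EX f:F. EX a:J. EX b:J. abs (t * of_int j - (f + of_int a - of_int b)) <= 1))"

text \<open>Allows signed sums of eight elements of \<open>J\<close> to be folded back into
  \<open>J - J\<close> at the price of a factor \<open>M\<close>.\<close>

definition four_cover :: "int set => real => bool" where
 "four_cover J M \<longleftrightarrow> (EX G. finite G & real (card G) <= M &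
   (ALL s:diffset (nsum 4 J) (nsum 4 J). EX g:G. EX a:J. EX b:J. s = g + a - b))"

lemma covers_mono: "covers J t M ==> M <= M' ==> covers J t M'"
 unfolding covers_def by auto

lemma diff4: "a \<in> J ==> b \<in> J ==> c \<in> J ==> d \<in> J ==> a' \<in> J ==> b' \<in> J ==> c' \<in> J ==> d' \<in> J ==>
  (a + b + c + d) - (a' + b' + c' + d') \<in> diffset (nsum 4 J) (nsum 4 J)" for a :: int
proof -
 have n4: "a + b + c + d \<in> nsum 4 J" if "a \<in> J" "b \<in> J" "c \<in> J" "d \<in> J" for a b c d :: int
 proof -
  have "a + (b + (c + (d + 0))) \<in> nsum 4 J"
   using that by (simp only: numeral_eq_Suc pred_numeral_simps nsum.simps BitM.simps) (intro sumsetI; simp)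
  then show ?thesis by (simp add: add.assoc)
 qed
 show "a \<in> J ==> b \<in> J ==> c \<in> J ==> d \<in> J ==> a' \<in> J ==> b' \<in> J ==> c' \<in> J ==> d' \<in> J ==> ?thesis"
  by (intro diffsetI n4)
qed

text \<open>\<open>four_cover\<close> replaces elements of \<open>4 J - 4 J\<close> by translates of
  \<open>J - J\<close>. An error up to \<open>H\<close> is split into an integer, which joins the
  list of translates, and a remainder below \<open>1\<close>.\<close>

lemma cover_round:
 fixes F :: "'i set" and c :: "'i => real"
 assumes F: "finite F" "real (card F) <= M" and G: "four_cover J M'" and M: "0 <= M'" "0 <= H"
  and near: "!!j. j \<in> J ==> EX f:F. EX s:diffset (nsum 4 J) (nsum 4 J). abs (t * of_int j - (c f + of_int s)) <= H"
 shows "covers J t (M * M' * (2 * H + 2))"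
proof -
 obtain G where G: "finite G" "real (card G) <= M'" "!!s. s \<in> diffset (nsum 4 J) (nsum 4 J) ==> EX g:G. EX a:J. EX b:J. s = g + a - b"
  using G unfolding four_cover_def by blast
 let ?K = "{\<lfloor>- H\<rfloor>..\<lfloor>H\<rfloor>}"
 let ?h = "%(f, g, k). c f + of_int g + of_int k"
 let ?F = "?h ` (F \<times> G \<times> ?K)"
 have "\<lfloor>- H\<rfloor> <= \<lfloor>H\<rfloor>" using M by linarith
 then have "real (card ?K) = of_int (\<lfloor>H\<rfloor> - \<lfloor>- H\<rfloor> + 1)" by simp
 then have cK: "real (card ?K) <= 2 * H + 2" by linarith
 have "card ?F <= card (F \<times> G \<times> ?K)" using F G by (intro card_image_le) auto
 then have "real (card ?F) <= real (card F) * (real (card G) * real (card ?K))"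
  by (simp add: card_cartesian_product flip: of_nat_mult)
 also have "... <= M * (M' * (2 * H + 2))"
  using F(2) G(2) cK by (intro mult_mono mult_nonneg_nonneg) (auto intro: order_trans[OF of_nat_0_le_iff])
 finally have card: "card ?F <= M * M' * (2 * H + 2)" by simp
 show ?thesis unfolding covers_def
 proof (intro exI[of _ ?F] conjI ballI card)
  show "finite ?F" using F G by auto
  fix j assume "j \<in> J"
  then obtain f s where fs: "f \<in> F" "s \<in> diffset (nsum 4 J) (nsum 4 J)" "abs (t * of_int j - (c f + of_int s)) <= H"
   using near by blast
  obtain g a b where g: "g \<in> G" "a \<in> J" "b \<in> J" "s = g + a - b" using G(3)[OF fs(2)] by auto
  define k where "k = \<lfloor>t * of_int j - (c f + of_int s)\<rfloor>"
  have "k \<in> ?K" unfolding k_def using fs(3) by (auto intro!: floor_mono)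
  then have "?h (f, g, k) \<in> ?F" using fs g by blast
  moreover have "abs (t * of_int j - (?h (f, g, k) + of_int a - of_int b)) <= 1"
  proof -
   have "t * of_int j - (?h (f, g, k) + of_int a - of_int b) = (t * of_int j - (c f + of_int s)) - of_int k"
    using g(4) by simp
   then show ?thesis unfolding k_def by linarith
  qed
  ultimately show "EX f:?F. EX a:J. EX b:J. abs (t * real_of_int j - (f + real_of_int a - real_of_int b)) <= 1"
   using g by blast
 qed
qed

text \<open>Substituting the cover of \<open>y * J\<close> into that of \<open>x * J\<close>, and
  that of \<open>w * J\<close> into that of \<open>z * J\<close>, expresses
  \<open>(x * y - z * w) * j\<close> by eight elements of \<open>J\<close>, four of each sign. Six
  lists of translates and \<open>four_cover\<close> cost \<open>M ^ 7\<close>; rounding the error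
  \<open>2 * M + 4\<close> costs at most \<open>M ^ 3\<close>.\<close>

lemma covers_difprod:
 assumes G: "four_cover J M" and M: "10 <= M"
  and c: "covers J x M" "covers J y M" "covers J z M" "covers J w M" and b: "abs x <= M" "abs z <= M"
 shows "covers J (x * y - z * w) (M ^ 10)"
proof -
 obtain X where X: "finite X" "real (card X) <= M" "ALL j:J. EX f:X. EX a:J. EX b:J. abs (x * of_int j - (f + of_int a - of_int b)) <= 1"
  using c(1) unfolding covers_def by auto
 obtain Y where Y: "finite Y" "real (card Y) <= M" "ALL j:J. EX f:Y. EX a:J. EX b:J. abs (y * of_int j - (f + of_int a - of_int b)) <= 1"
  using c(2) unfolding covers_def by auto
 obtain Z where Z: "finite Z" "real (card Z) <= M" "ALL j:J. EX f:Z. EX a:J. EX b:J. abs (z * of_int j - (f + of_int a - of_int b)) <= 1"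
  using c(3) unfolding covers_def by auto
 obtain W where W: "finite W" "real (card W) <= M" "ALL j:J. EX f:W. EX a:J. EX b:J. abs (w * of_int j - (f + of_int a - of_int b)) <= 1"
  using c(4) unfolding covers_def by auto
 let ?F = "Y \<times> X \<times> X \<times> W \<times> Z \<times> Z"
 let ?c = "%(f2, f1, f1', f4, f3, f3'). (x * f2 + f1 - f1') - (z * f4 + f3 - f3')"
 have "covers J (x * y - z * w) ((M * (M * (M * (M * (M * M))))) * M * (2 * (2 * M + 4) + 2))"
 proof (rule cover_round[where F = ?F and c = ?c])
  show "finite ?F" using X Y Z W by auto
  show "real (card ?F) <= M * (M * (M * (M * (M * M))))"
   unfolding card_cartesian_product of_nat_mult using X Y Z W M by (intro mult_mono mult_nonneg_nonneg) auto
  fix j assume j: "j \<in> J"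
  obtain f2 a b where y: "f2 \<in> Y" "a \<in> J" "b \<in> J" "abs (y * j - (f2 + a - b)) <= 1" using bspec[OF Y(3) j] by auto
  obtain f1 a1 b1 where x1: "f1 \<in> X" "a1 \<in> J" "b1 \<in> J" "abs (x * a - (f1 + a1 - b1)) <= 1" using bspec[OF X(3) y(2)] by auto
  obtain f1' a2 b2 where x2: "f1' \<in> X" "a2 \<in> J" "b2 \<in> J" "abs (x * b - (f1' + a2 - b2)) <= 1" using bspec[OF X(3) y(3)] by auto
  obtain f4 u v where w: "f4 \<in> W" "u \<in> J" "v \<in> J" "abs (w * j - (f4 + u - v)) <= 1" using bspec[OF W(3) j] by auto
  obtain f3 u1 v1 where z1: "f3 \<in> Z" "u1 \<in> J" "v1 \<in> J" "abs (z * u - (f3 + u1 - v1)) <= 1" using bspec[OF Z(3) w(2)] by auto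
  obtain f3' u2 v2 where z2: "f3' \<in> Z" "u2 \<in> J" "v2 \<in> J" "abs (z * v - (f3' + u2 - v2)) <= 1" using bspec[OF Z(3) w(3)] by auto
  let ?s = "(a1 + b2 + v1 + u2) - (b1 + a2 + u1 + v2)"
  have s: "?s \<in> diffset (nsum 4 J) (nsum 4 J)" using x1 x2 z1 z2 by (intro diff4)
  have "abs (x * (y * j - (f2 + a - b))) <= M * 1" "abs (z * (w * j - (f4 + u - v))) <= M * 1"
   unfolding abs_mult by (rule mult_mono, rule b, rule y(4) w(4), use M in simp, rule abs_ge_zero)+
  moreover have "(x * y - z * w) * j - (?c (f2, f1, f1', f4, f3, f3') + ?s)
   = x * (y * j - (f2 + a - b)) + (x * a - (f1 + a1 - b1)) - (x * b - (f1' + a2 - b2))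
    - (z * (w * j - (f4 + u - v)) + (z * u - (f3 + u1 - v1)) - (z * v - (f3' + u2 - v2)))"
   by (simp add: algebra_simps)
  moreover have "abs (p + q - r - (p' + q' - r')) <= 2 * M + 4"
   if "abs p <= M * 1" "abs p' <= M * 1" "abs q <= 1" "abs r <= 1" "abs q' <= 1" "abs r' <= 1" for p q r p' q' r' :: real
   using that unfolding abs_le_iff by simp
  ultimately have near: "abs ((x * y - z * w) * j - (?c (f2, f1, f1', f4, f3, f3') + ?s)) <= 2 * M + 4"
   using x1(4) x2(4) z1(4) z2(4) by (simp only:)
  have mem: "(f2, f1, f1', f4, f3, f3') \<in> ?F" using y x1 x2 w z1 z2 by simp
  show "EX f:?F. EX s:diffset (nsum 4 J) (nsum 4 J). abs ((x * y - z * w) * j - (?c f + s)) <= 2 * M + 4"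
   by (rule bexI[OF _ mem], rule bexI[OF _ s], rule near)
 qed (use G M in auto)
 moreover have "(M * (M * (M * (M * (M * M))))) * M * (2 * (2 * M + 4) + 2) <= M ^ 10"
 proof -
  have "10 * M <= M * M" using M by simp
  moreover have "2 * (2 * M + 4) + 2 = 4 * M + 10" by simp
  ultimately have "2 * (2 * M + 4) + 2 <= M * M" using M by linarith
  also have "... <= M * M * M" using M by simp
  finally have "M ^ 7 * (2 * (2 * M + 4) + 2) <= M ^ 7 * (M * M * M)" using M by simp
  then show ?thesis by (simp add: power_numeral_reduce)
 qed
 ultimately show ?thesis by (rule covers_mono)
qed

lemma covers_0: "finite J ==> J ~= {} ==> 1 <= M ==> covers J 0 M"
 unfolding covers_def
proof (intro exI[of _ "{0}"] conjI ballI)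
 fix j assume "j \<in> J"
 then show "EX f:{0}. EX a:J. EX b:J. abs (0 * real_of_int j - (f + real_of_int a - real_of_int b)) <= 1"
  by force
qed auto

lemma covers_1: "finite J ==> J ~= {} ==> 1 <= M ==> covers J 1 M"
proof -
 assume J: "finite J" "J ~= {}" "1 <= M"
 then obtain a where "a \<in> J" by auto
 show ?thesis unfolding covers_def
 proof (intro exI[of _ "{of_int a}"] conjI ballI)
  fix j assume "j \<in> J"
  then show "EX f:{of_int a}. EX c:J. EX b:J. abs (1 * real_of_int j - (f + real_of_int c - real_of_int b)) <= 1"
   using \<open>a \<in> J\<close> by force
 qed (use J in auto)
qed

lemma covers_pow:
 assumes J: "finite J" "J ~= {}" "four_cover J M" and M: "10 <= M"
  and R: "!!t. t \<in> R ==> covers J t M & abs t <= M"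
 shows "t \<in> (difprod ^^ k) R ==> covers J t (M ^ (10 ^ k)) & abs t <= M ^ (10 ^ k)"
proof (induction k arbitrary: t)
 case (Suc k)
 let ?M = "M ^ (10 ^ k)"
 have M1: "M ^ 1 <= ?M" using M by (intro power_increasing) auto
 have G: "four_cover J ?M" using J(3) M1 unfolding four_cover_def by force
 have "t \<in> difprod ((difprod ^^ k) R)" using Suc.prems by simp
 then obtain x y z w where t: "t = x * y - z * w" "x \<in> (difprod ^^ k) R" "y \<in> (difprod ^^ k) R"
  "z \<in> (difprod ^^ k) R" "w \<in> (difprod ^^ k) R" using difprodE by metis
 have e: "M ^ (10 ^ Suc k) = ?M ^ 10" by (simp add: power_mult mult.commute[of 10])
 have "covers J t (?M ^ 10)" unfolding t(1)
  using Suc.IH t M M1 by (intro covers_difprod G) auto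
 moreover have "abs t <= ?M ^ 10"
 proof -
  have M0: "10 <= ?M" using M M1 by simp
  have "abs (x * y) <= ?M * ?M" "abs (z * w) <= ?M * ?M"
   unfolding abs_mult using Suc.IH t M0 by (auto intro!: mult_mono)
  then have "abs t <= 2 * (?M * ?M)" unfolding t(1) by simp
  also have "... <= ?M * (?M * ?M)" using M0 by simp
  also have "... = ?M ^ 3" by (simp add: power3_eq_cube)
  also have "... <= ?M ^ 10" using M0 by simp
  finally show ?thesis .
 qed
 ultimately show ?case unfolding e by simp
qed (use R in simp)

text \<open>A covered \<open>t\<close> makes \<open>J + t * J\<close> occupy few unit cells, because
  it lies near few translates of \<open>J + J - J\<close>. By \<open>conc\<close> most pairs of
  elements of \<open>J\<close> are at least \<open>H\<close> apart, and two points whose second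
  coordinates are that far apart share a cell only for \<open>t\<close> in an interval of length
  \<open>2 / H\<close>; \<open>energy_count\<close> concludes.\<close>

lemma covers_separated_card:
 fixes D :: "real set" and J :: "int set" and M rho H :: real
 assumes J: "finite J" "J ~= {}" and M: "1 <= M" and rho: "0 < rho" and H: "0 < H"
  and dbl: "card (sumset J (diffset J J)) <= M * card J"
  and D: "finite D" "separated rho D" "!!t. t \<in> D ==> covers J t M"
  and conc: "!!x::real. 10 * M^2 * card {j \<in> J. abs (x - of_int j) < H} <= card J"
 shows "card D <= 10 * M^2 * card J * (2 / (H * rho) + 2)"
proof -
 define n where "n = real (card J)"
 have n0: "n > 0" using J by (simp add: n_def card_gt_0_iff)
 let ?S = "real_of_int ` J"
 have cS: "card ?S = card J" by (intro card_image) (auto simp: inj_on_def)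
 let ?f = "%t. %(x, y). \<lfloor>x + t * y\<rfloor>"
 let ?M = "5 * M^2 * n" and ?K = "n / (10 * M^2)" and ?B = "2 / (H * rho) + 2"
 have "real (card D) * ((real (card ?S))^2 - ?M * ?K) <= ?M * (real (card ?S))^2 * ?B"
 proof (rule energy_count[where f = ?f and h = H])
  show "card (?f t ` (?S \<times> ?S)) <= ?M" if t: "t \<in> D" for t
  proof -
   obtain F where F: "finite F" "real (card F) <= M" "ALL j:J. EX f:F. EX a:J. EX b:J. abs (t * of_int j - (f + of_int a - of_int b)) <= 1"
    using D(3)[OF t] unfolding covers_def by auto
   let ?T = "(%(f, s, k). \<lfloor>f\<rfloor> + s + k) ` (F \<times> sumset J (diffset J J) \<times> {-1..2::int})"
   have "?f t ` (?S \<times> ?S) <= ?T"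
   proof
    fix z assume "z \<in> ?f t ` (?S \<times> ?S)"
    then obtain i j where ij: "i \<in> J" "j \<in> J" "z = \<lfloor>of_int i + t * of_int j\<rfloor>" by auto
    obtain f a b where f: "f \<in> F" "a \<in> J" "b \<in> J" "abs (t * of_int j - (f + of_int a - of_int b)) <= 1" using bspec[OF F(3) ij(2)] by auto
    define s where "s = i + (a - b)"
    have s: "s \<in> sumset J (diffset J J)" unfolding s_def using ij f by (intro sumsetI diffsetI)
    have "of_int i + t * of_int j = f + of_int s + (t * j - (f + a - b))" by (simp add: s_def)
    then have "z - (\<lfloor>f\<rfloor> + s) \<in> {-1..2}" using f(4) unfolding ij(3) by (simp; linarith)
    then show "z \<in> ?T" using f(1) s by force
   qed
   then have "card (?f t ` (?S \<times> ?S)) <= card ?T" using F J by (intro card_mono) auto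
   also have "... <= card (F \<times> sumset J (diffset J J) \<times> {-1..2::int})" using F J by (intro card_image_le) auto
   finally have "card (?f t ` (?S \<times> ?S)) <= card F * (card (sumset J (diffset J J)) * 4)"
    by (simp add: card_cartesian_product)
   from of_nat_mono[OF this, where 'a = real]
   have "real (card (?f t ` (?S \<times> ?S))) <= real (card F) * (real (card (sumset J (diffset J J))) * 4)" by simp
   also have "... <= M * ((M * n) * 4)" using F(2) dbl by (intro mult_mono mult_nonneg_nonneg) (auto simp: n_def)
   also have "... <= ?M"
   proof -
    have "0 <= M * (M * n)" using M n0 by simp
    then show ?thesis by (simp add: power2_eq_square)
   qed
   finally show ?thesis .
  qed
  show "card {y' \<in> ?S. abs (y - y') < H} <= ?K" for y
  proof -
   have "{y' \<in> ?S. abs (y - y') < H} = real_of_int ` {j \<in> J. abs (y - of_int j) < H}" by auto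
   then have "card {y' \<in> ?S. abs (y - y') < H} <= card {j \<in> J. abs (y - of_int j) < H}"
    by (simp only:) (intro card_image_le, use J in simp)
   moreover have "real (card {j \<in> J. abs (y - of_int j) < H}) <= ?K"
    using conc[of y] M by (simp add: n_def pos_le_divide_eq mult.commute)
   ultimately show ?thesis by simp
  qed
  show "card {t \<in> D. ?f t (x, y) = ?f t (x', y')} <= ?B" if far: "H <= abs (y - y')" for x y x' y'
  proof -
   let ?D = "{t \<in> D. ?f t (x, y) = ?f t (x', y')}" and ?c = "- (x - x') / (y - y')"
   have y0: "abs (y - y') > 0" using far H by simp
   have "real (card ((%t. \<lfloor>t / rho\<rfloor>) ` ?D)) <= ((?c + 1 / H) - (?c - 1 / H)) / rho + 2"
   proof (rule card_floor_interval)
    fix t assume "t \<in> ?D"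
    then have "\<lfloor>(x + t * y) / 1\<rfloor> = \<lfloor>(x' + t * y') / 1\<rfloor>" by simp
    from same_cell[OF zero_less_one this] have "abs ((x + t * y) - (x' + t * y')) < 1" .
    moreover have "(x + t * y) - (x' + t * y') = (t - ?c) * (y - y')" using y0 by (simp add: field_simps)
    ultimately have "abs (t - ?c) * abs (y - y') < 1" by simp
    then have "abs (t - ?c) <= 1 / abs (y - y')" using y0 by (simp add: pos_le_divide_eq)
    also have "... <= 1 / H" using far H by (intro divide_left_mono) auto
    finally show "?c - 1 / H <= t & t <= ?c + 1 / H" by auto
   qed (use rho H in auto)
   also have "... = ?B" by simp
   finally have "real (ncell rho ?D) <= ?B" by (simp add: ncell_def)
   moreover have "ncell rho ?D = card ?D" using D(2) by (intro card_separated rho) (auto intro: separated_subset)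
   ultimately show ?thesis by simp
  qed
  fix t x x' y assume xy: "x \<in> ?S" "x' \<in> ?S" "?f t (x, y) = ?f t (x', y)"
  obtain i i' where "x = of_int i" "x' = of_int i'" using xy by auto
  moreover have "\<lfloor>(x + t * y) / 1\<rfloor> = \<lfloor>(x' + t * y) / 1\<rfloor>" using xy(3) by simp
  from same_cell[OF zero_less_one this] have "abs (x - x') < 1" by simp
  ultimately show "x = x'" by simp
 qed (use rho H J D M n0 in auto)
 then have "real (card D) * (n^2 - ?M * ?K) <= ?M * n^2 * ?B" unfolding cS n_def .
 moreover have MK: "?M * ?K = n^2 / 2" using M by (simp add: power2_eq_square)
 have "real (card D) * (n^2 - ?M * ?K) = n^2 * (real (card D) / 2)" unfolding MK by simp
 moreover have "?M * n^2 * ?B = n^2 * (?M * ?B)" by simp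
 ultimately have "n^2 * (real (card D) / 2) <= n^2 * (?M * ?B)" by linarith
 moreover have "0 < n^2" using n0 by simp
 ultimately have "real (card D) / 2 <= ?M * ?B" by simp
 then show ?thesis unfolding n_def by simp
qed

text \<open>Padding with a fixed element of \<open>J\<close> embeds both sets, the first up to a
  shift, into \<open>5 J - 4 J\<close>, whose size \<open>sumset_cover\<close> bounds.\<close>

lemma card_shifted_sums:
 fixes J :: "'a::ab_group_add set"
 assumes "finite J" "J ~= {}"
 shows "card (sumset J J) <= card (diffset (nsum 5 J) (nsum 4 J))"
  "card (sumset J (diffset J J)) <= card (diffset (nsum 5 J) (nsum 4 J))"
proof -
 obtain j where j: "j \<in> J" using assms by auto
 let ?D = "diffset (nsum 5 J) (nsum 4 J)"
 have n5: "a + (b + (c + (d + (e + 0)))) \<in> nsum 5 J" if "a \<in> J" "b \<in> J" "c \<in> J" "d \<in> J" "e \<in> J" for a b c d e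
  using that by (simp only: numeral_eq_Suc pred_numeral_simps nsum.simps BitM.simps) (intro sumsetI; simp)
 have n4: "a + (b + (c + (d + 0))) \<in> nsum 4 J" if "a \<in> J" "b \<in> J" "c \<in> J" "d \<in> J" for a b c d
  using that by (simp only: numeral_eq_Suc pred_numeral_simps nsum.simps BitM.simps) (intro sumsetI; simp)
 have sub: "(%x. x - j) ` sumset J J <= ?D"
 proof clarify
  fix x assume "x \<in> sumset J J"
  then obtain a b where x: "x = a + b" "a \<in> J" "b \<in> J" by (rule sumsetE)
  have "(a + (b + (j + (j + (j + 0))))) - (j + (j + (j + (j + 0)))) \<in> ?D"
   using x j by (intro diffsetI n5 n4)
  then show "x - j \<in> ?D" unfolding x(1) by simp
 qed
 have "card (sumset J J) = card ((%x. x - j) ` sumset J J)" by (simp add: card_image)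
 also have "... <= card ?D" using sub assms by (intro card_mono) auto
 finally show "card (sumset J J) <= card ?D" .
 have "sumset J (diffset J J) <= ?D"
 proof
  fix x assume "x \<in> sumset J (diffset J J)"
  then obtain a b c where x: "x = a + (b - c)" "a \<in> J" "b \<in> J" "c \<in> J" by (auto elim!: sumsetE diffsetE)
  have "(a + (b + (j + (j + (j + 0))))) - (c + (j + (j + (j + 0)))) \<in> ?D"
   using x j by (intro diffsetI n5 n4)
  then show "x \<in> ?D" unfolding x(1) by (simp add: algebra_simps)
 qed
 then show "card (sumset J (diffset J J)) <= card ?D" using assms by (intro card_mono) auto
qed

lemma card_floor_image:
 fixes g h :: "'w => real"
 assumes fin: "finite S" and near: "!!w. w \<in> S ==> abs (g w - c * h w) <= e"
 shows "real (card ((%w. \<lfloor>g w\<rfloor>) ` S)) <= (abs c + 2 * e + 2) * card ((%w. \<lfloor>h w\<rfloor>) ` S)"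
proof (cases "S = {}")
 case False
 then have e0: "0 <= e" using near order_trans[OF abs_ge_zero] by auto
 let ?H = "(%w. \<lfloor>h w\<rfloor>) ` S" and ?S = "%z. {w \<in> S. \<lfloor>h w\<rfloor> = z}"
 have b: "real (card ((%w. \<lfloor>g w\<rfloor>) ` ?S z)) <= abs c + 2 * e + 2" for z
 proof -
  let ?a = "c * (of_int z + 1 / 2)"
  have "real (card ((%x. \<lfloor>x / 1\<rfloor>) ` (g ` ?S z))) <= ((?a + abs c / 2 + e) - (?a - abs c / 2 - e)) / 1 + 2"
  proof (rule card_floor_interval)
   fix x assume "x \<in> g ` ?S z"
   then obtain w where w: "w \<in> S" "\<lfloor>h w\<rfloor> = z" "x = g w" by auto
   have "abs (h w - (of_int z + 1 / 2)) <= 1 / 2" using w(2) by linarith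
   then have "abs c * abs (h w - (of_int z + 1 / 2)) <= abs c * (1 / 2)" by (intro mult_left_mono) auto
   then have "abs (c * h w - ?a) <= abs c / 2" by (simp flip: abs_mult right_diff_distrib)
   then show "?a - abs c / 2 - e <= x & x <= ?a + abs c / 2 + e" using near[OF w(1)] w(3) by linarith
  qed (use e0 in auto)
  then show ?thesis by (simp add: image_image)
 qed
 have "(%w. \<lfloor>g w\<rfloor>) ` S = (\<Union>z\<in>?H. (%w. \<lfloor>g w\<rfloor>) ` ?S z)" by auto
 then have "card ((%w. \<lfloor>g w\<rfloor>) ` S) <= (\<Sum>z\<in>?H. card ((%w. \<lfloor>g w\<rfloor>) ` ?S z))"
  using fin by (simp only:) (intro card_UN_le, simp)
 then have "real (card ((%w. \<lfloor>g w\<rfloor>) ` S)) <= (\<Sum>z\<in>?H. real (card ((%w. \<lfloor>g w\<rfloor>) ` ?S z)))"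
  by (simp flip: of_nat_sum)
 also have "... <= (\<Sum>z\<in>?H. abs c + 2 * e + 2)" by (intro sum_mono b)
 finally show ?thesis by (simp add: mult.commute)
qed simp

text \<open>Along a path \<open>a\<close>, \<open>b1\<close>, \<open>a1\<close>, \<open>b\<close>
  the value of \<open>u + t * v\<close> at \<open>(a, b)\<close> is the alternating sum of its
  values on the three edges, so its floor is given by three cells of \<open>G\<close> up to an error
  in \<open>{-1..1}\<close>. Conversely the value and the three cells fix \<open>a1\<close>, since
  an integer shift moves the floor by itself, and leave at most \<open>m\<close> choices for
  \<open>b1\<close>.\<close>

lemma path_cells:
 fixes A B A' B' :: "int set" and N m Z t :: real
 assumes fin: "finite A" "finite B" "G <= A \<times> B" "A' <= A" "B' <= B"
  and m: "!!x. card {v \<in> B. \<lfloor>x + t * of_int v\<rfloor> = 0} <= m"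
  and Z: "card ((%(u, v). \<lfloor>of_int u + t * of_int v\<rfloor>) ` G) <= Z"
  and N: "!!a b. a \<in> A' ==> b \<in> B' ==> N <= card {(a1, b1). (a, b1) \<in> G & (a1, b1) \<in> G & (a1, b) \<in> G}"
 shows "card ((%(u, v). \<lfloor>of_int u + t * of_int v\<rfloor>) ` (A' \<times> B')) * N <= 3 * Z ^ 3 * m"
proof -
 let ?f = "%u v. \<lfloor>of_int u + t * of_int v\<rfloor>"
 let ?F = "%(u, v). ?f u v"
 let ?I = "?F ` (A' \<times> B')" and ?Z = "?F ` G"
 have finG: "finite G" using fin by (meson finite_SigmaI finite_subset)
 have fZ: "finite ?Z" using finG by simp
 have finI: "finite ?I" using fin by (meson finite_SigmaI finite_imageI finite_subset)
 have "ALL n:?I. EX a b. a \<in> A' & b \<in> B' & n = ?f a b" by auto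
 then obtain alpha beta where ab: "!!n. n \<in> ?I ==> alpha n \<in> A' & beta n \<in> B' & n = ?f (alpha n) (beta n)" by metis
 let ?P = "%n. {(a1, b1). (alpha n, b1) \<in> G & (a1, b1) \<in> G & (a1, beta n) \<in> G}"
 have fP: "finite (?P n)" for n by (rule finite_subset[OF _ finG]) auto
 let ?S = "SIGMA n:?I. ?P n"
 have fS: "finite ?S" using finI fP by auto
 have "card ?I * N = (\<Sum>n\<in>?I. N)" by simp
 also have "... <= (\<Sum>n\<in>?I. real (card (?P n)))" using N ab by (intro sum_mono) blast
 also have "... = card ?S" using finI fP by simp
 finally have 1: "card ?I * N <= card ?S" .
 define h where "h = (%(n, a1, b1). (n - (?f (alpha n) b1 - ?f a1 b1 + ?f a1 (beta n)), ?f (alpha n) b1, ?f a1 b1, ?f a1 (beta n)))"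
 have h: "h (n, a1, b1) = (n - (?f (alpha n) b1 - ?f a1 b1 + ?f a1 (beta n)), ?f (alpha n) b1, ?f a1 b1, ?f a1 (beta n))" for n a1 b1
  by (simp add: h_def)
 have Zi: "?f u v \<in> ?Z" if "(u, v) \<in> G" for u v using that by auto
 have "h ` ?S <= {-1..1} \<times> ?Z \<times> ?Z \<times> ?Z"
 proof
  fix q assume "q \<in> h ` ?S"
  then obtain p where p: "p \<in> ?S" "q = h p" by auto
  obtain n a1 b1 where pe: "p = (n, a1, b1)" by (metis prod.collapse)
  have n: "n \<in> ?I" and G: "(alpha n, b1) \<in> G" "(a1, b1) \<in> G" "(a1, beta n) \<in> G" using p(1) unfolding pe by auto
  have nn: "n = ?f (alpha n) (beta n)" using ab[OF n] by simp
  have "of_int (alpha n) + t * of_int (beta n) = (of_int (alpha n) + t * of_int b1) - (of_int a1 + t * of_int b1) + (of_int a1 + t * of_int (beta n))"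
   by simp
  then have "n - (?f (alpha n) b1 - ?f a1 b1 + ?f a1 (beta n)) \<in> {-1..1}"
   using nn by simp
  then show "q \<in> {-1..1} \<times> ?Z \<times> ?Z \<times> ?Z" using Zi[OF G(1)] Zi[OF G(2)] Zi[OF G(3)] unfolding p(2) pe h by simp
 qed
 then have "card (h ` ?S) <= card ({-1..1::int} \<times> ?Z \<times> ?Z \<times> ?Z)" using fZ by (intro card_mono) auto
 also have "... = 3 * card ?Z ^ 3" by (simp add: card_cartesian_product power3_eq_cube)
 finally have "real (card (h ` ?S)) <= real (3 * card ?Z ^ 3)" by linarith
 also have "... = 3 * real (card ?Z) ^ 3" by simp
 also have "... <= 3 * Z ^ 3" using Z by simp
 finally have 2: "card (h ` ?S) <= 3 * Z ^ 3" .
 have m0: "0 <= m" using m[of 0] by simp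
 have "card ?S <= 3 * Z ^ 3 * m"
 proof (rule card_le_fibres[OF fS 2 m0])
  fix p assume "p \<in> ?S"
  then obtain n a1 b1 where p: "p = (n, a1, b1)" "n \<in> ?I" by blast
  let ?V = "{v \<in> B. \<lfloor>(of_int (alpha n) - of_int (?f (alpha n) b1)) + t * of_int v\<rfloor> = 0}"
  have "{p' \<in> ?S. h p' = h p} <= (%v. (n, a1, v)) ` ?V"
  proof
   fix p' assume p': "p' \<in> {p' \<in> ?S. h p' = h p}"
   obtain n' a' b' where pe: "p' = (n', a', b')" by (metis prod.collapse)
   have G: "(alpha n', b') \<in> G" and e: "h (n', a', b') = h p" using p' unfolding pe by auto
   have e: "n' - (?f (alpha n') b' - ?f a' b' + ?f a' (beta n')) = n - (?f (alpha n) b1 - ?f a1 b1 + ?f a1 (beta n))"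
    "?f (alpha n') b' = ?f (alpha n) b1" "?f a' b' = ?f a1 b1" "?f a' (beta n') = ?f a1 (beta n)"
    using e unfolding p(1) h by auto
   have nn: "n' = n" using e by simp
   have "a' = a1" using e(4) unfolding nn by simp
   moreover have "b' \<in> ?V" using e(2) G fin unfolding nn by auto
   ultimately show "p' \<in> (%v. (n, a1, v)) ` ?V" unfolding pe using nn by simp
  qed
  then have "card {p' \<in> ?S. h p' = h p} <= card ((%v. (n, a1, v)) ` ?V)" using fin by (intro card_mono) auto
  also have "... <= card ?V" using fin by (intro card_image_le) auto
  finally show "real (card {p' \<in> ?S. h p' = h p}) <= m" using m[of "of_int (alpha n) - of_int (?f (alpha n) b1)"] by simp
 qed
 then show ?thesis using 1 by simp
qed

subsection \<open>A discretised projection theorem\<close>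

text \<open>Lines \<open>u \<mapsto> l w + kappa w * u\<close> and points at resolution \<open>rho\<close>; \<open>I\<close> need not be the full incidence relation.\<close>

definition incidence_data ::
 "'w set => real set => ('w => real => bool) => ('w => real) => ('w => real) => real => real => real => real => bool" where
 "incidence_data Lam P I kappa l ppi tau rho L \<longleftrightarrow> finite Lam & finite P & P ~= {} & P <= {0..1} &
  rho powr (- 2 * tau) <= L * real (card Lam) &
  (ALL w:Lam. real (card P) <= L * real (card {p \<in> P. I w p})) &
  (ALL x r. rho <= r --> card (P Int {x - r..x + r}) <= L * r powr ppi * card P) &
  (ALL p:P. card ((%w. \<lfloor>(l w + kappa w * p) / rho\<rfloor>) ` {w \<in> Lam. I w p}) <= L * rho powr (- tau)) &
  (ALL p:P. ALL y k r. rho <= r -->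
    card {w \<in> Lam. I w p & abs (l w + kappa w * p - y) <= rho & abs (kappa w - k) <= r} <= L * (r / rho) powr tau)"

text \<open>\<open>B\<close> is the common currency for losses. By the equation for
  \<open>B powr ppi\<close>, a ball of radius \<open>1 / B\<close> holds at most a proportion
  \<open>1 / (12 * L)\<close> of \<open>P\<close>, so three such balls may be discarded; all later
  losses are powers of \<open>B\<close>.\<close>

locale incidence =
 fixes Lam :: "'w set" and P :: "real set" and I :: "'w => real => bool" and kappa l :: "'w => real"
  and ppi tau rho L B :: real
 assumes data: "incidence_data Lam P I kappa l ppi tau rho L"
  and L: "1 <= L" and par: "0 < ppi" "ppi <= 1" "0 < tau" "tau < 1" "0 < rho" "rho <= 1"
  and B: "1 <= B" "B powr ppi = 12 * L^2" "B <= 1 / rho"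
begin

lemmas data' = data[unfolded incidence_data_def]

lemma fin: "finite Lam" "finite P" "P ~= {}" "P <= {0..1}"
 and lines: "rho powr (- 2 * tau) <= L * card Lam"
 using data' by auto

lemma rich: "w \<in> Lam ==> card P <= L * card {p \<in> P. I w p}"
 using data' by simp

lemma frostman: "rho <= r ==> card (P Int {x - r..x + r}) <= L * r powr ppi * card P"
 using data' by simp

lemma fibres: "p \<in> P ==> card ((%w. \<lfloor>(l w + kappa w * p) / rho\<rfloor>) ` {w \<in> Lam. I w p}) <= L * rho powr (- tau)"
 using data' by simp

lemma slopes: "p \<in> P ==> rho <= r ==>
  card {w \<in> Lam. I w p & abs (l w + kappa w * p - y) <= rho & abs (kappa w - k) <= r} <= L * (r / rho) powr tau"
 using data' by simp

lemma B_ge: "12 * L^2 <= B" "12 <= B" "12 * L <= B" "144 * L ^ 4 <= B^2"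
proof -
 have "B powr ppi <= B powr 1" using B par by (intro powr_mono) auto
 then show 1: "12 * L^2 <= B" using B by simp
 have "L * 1 <= L * L" using L by simp
 then have LL: "L <= L^2" by (simp add: power2_eq_square)
 show "12 * L <= B" using 1 LL by simp
 then show "12 <= B" using L by simp
 have "(12 * L^2)^2 <= B^2" using 1 by (intro power_mono) auto
 then show "144 * L ^ 4 <= B^2" by simp
qed

lemma B_pow: "i <= j ==> B ^ i <= B ^ j"
 using B by (intro power_increasing) auto

text \<open>Double counting: the points near \<open>Z\<close> and the points on few lines of
  \<open>S\<close> together account for at most half of the incidences guaranteed by
  \<open>rich\<close>.\<close>

lemma many_points:
 assumes S: "S <= Lam" "S ~= {}" and Z: "finite Z" "card Z <= 3"
 shows "card P <= 2 * L * card {p \<in> P. (ALL z:Z. 1 / B < abs (p - z)) & card S <= 4 * L * card {w \<in> S. I w p}}"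
proof -
 define s where "s = real (card S)"
 have fS: "finite S" using S fin finite_subset by auto
 have s0: "s > 0" using S fS by (simp add: s_def card_gt_0_iff)
 let ?c = "%p. real (card {w \<in> S. I w p})"
 let ?near = "{p \<in> P. EX z:Z. abs (p - z) <= 1 / B}"
 let ?good = "{p \<in> P. (ALL z:Z. 1 / B < abs (p - z)) & s <= 4 * L * ?c p}"
 have "?near <= (\<Union>z\<in>Z. P Int {z - 1 / B..z + 1 / B})" by force
 then have "card ?near <= card (\<Union>z\<in>Z. P Int {z - 1 / B..z + 1 / B})"
  using fin by (intro card_mono) auto
 also have "... <= (\<Sum>z\<in>Z. card (P Int {z - 1 / B..z + 1 / B}))" using Z by (intro card_UN_le)
 finally have "real (card ?near) <= (\<Sum>z\<in>Z. real (card (P Int {z - 1 / B..z + 1 / B})))"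
  by (simp flip: of_nat_sum)
 also have "... <= (\<Sum>z\<in>Z. card P / (12 * L))"
 proof (intro sum_mono)
  fix z
  have "rho <= 1 / B" using B par by (simp add: field_simps)
  then have "card (P Int {z - 1 / B..z + 1 / B}) <= L * (1 / B) powr ppi * card P" by (rule frostman)
  also have "... = card P / (12 * L)" using B by (simp add: powr_divide power2_eq_square)
  finally show "real (card (P Int {z - 1 / B..z + 1 / B})) <= card P / (12 * L)" .
 qed
 also have "... = card Z * (card P / (12 * L))" by simp
 also have "... <= 3 * (card P / (12 * L))" using Z L by (intro mult_right_mono) auto
 also have "... = card P / (4 * L)" by simp
 finally have near: "real (card ?near) <= card P / (4 * L)" .
 have "s * (card P / L) = (\<Sum>w\<in>S. card P / L)" by (simp add: s_def)
 also have "... <= (\<Sum>w\<in>S. real (card {p \<in> P. I w p}))"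
  using rich S L by (intro sum_mono) (auto simp: pos_divide_le_eq mult.commute)
 also have "... = (\<Sum>p\<in>P. ?c p)"
  using double_count[OF fS fin(2), of I] by (simp flip: of_nat_sum)
 also have "... <= (\<Sum>p\<in>P. (if p \<in> ?near then s else 0) + (if p \<in> ?good then s else 0) + s / (4 * L))"
 proof (intro sum_mono)
  fix p assume p: "p \<in> P"
  have c: "?c p <= s" unfolding s_def using fS by (auto intro!: card_mono)
  have sL: "0 <= s / (4 * L)" using s0 L by simp
  have "?c p <= s / (4 * L)" if "~ s <= 4 * L * ?c p" using that L by (simp add: pos_le_divide_eq mult.commute)
  then have "p \<in> ?near | p \<in> ?good | ?c p <= s / (4 * L)" using p by force
  then consider "p \<in> ?near" | "p \<in> ?good" | "?c p <= s / (4 * L)" by argo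
  then show "?c p <= (if p \<in> ?near then s else 0) + (if p \<in> ?good then s else 0) + s / (4 * L)"
   using c sL by auto
 qed
 also have "... = s * card ?near + s * card ?good + card P * (s / (4 * L))"
  using fin by (simp add: sum.distrib sum.If_cases Int_def)
 finally have "s * (card P / L) <= s * (card ?near + card ?good + card P / (4 * L))"
  by (simp add: algebra_simps)
 then have "card P / L <= real (card ?near) + card ?good + card P / (4 * L)" using s0 by (simp only: mult_le_cancel_left_pos)
 moreover have "card P / L = card P / (4 * L) + card P / (4 * L) + card P / (2 * L)" by simp
 ultimately have "card P / (2 * L) <= card ?good" using near by linarith
 then show ?thesis using L by (simp add: s_def pos_divide_le_eq mult.commute)
qed

lemma pick_point:
 assumes S: "S <= Lam" "S ~= {}" and Z: "finite Z" "card Z <= 3"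
 obtains p where "p \<in> P" "!!z. z \<in> Z ==> 1 / B < abs (p - z)" "card S <= 4 * L * card {w \<in> S. I w p}" "{w \<in> S. I w p} ~= {}"
proof -
 let ?G = "{p \<in> P. (ALL z:Z. 1 / B < abs (p - z)) & card S <= 4 * L * card {w \<in> S. I w p}}"
 have "card P > 0" using fin by auto
 then have "0 < 2 * L * real (card ?G)" using many_points[OF assms] by simp
 then have "?G ~= {}" by force
 then obtain p where p: "p \<in> ?G" by auto
 have "finite S" using S fin finite_subset by auto
 then have "card S > 0" using S by auto
 moreover have "real (card S) <= 4 * L * card {w \<in> S. I w p}" using p by simp
 ultimately have "0 < 4 * L * real (card {w \<in> S. I w p})" by simp
 then have "{w \<in> S. I w p} ~= {}" by force
 then show thesis using that[of p] p by simp
qed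

text \<open>The heights at the first two points will be coordinates on the space of lines, and the
  third point supplies a combination of them that takes few values. Each choice thins the lines by a
  factor \<open>4 * L\<close>.\<close>

lemma three_points:
 obtains p0 p1 p2 where "p0 \<in> P" "p1 \<in> P" "p2 \<in> P" "1 / B < abs (p0 - p1)" "1 / B < abs (p0 - p2)" "1 / B < abs (p1 - p2)"
  "card Lam <= 64 * L ^ 3 * card {w \<in> Lam. I w p0 & I w p1 & I w p2}" "{w \<in> Lam. I w p0 & I w p1 & I w p2} ~= {}"
proof -
 have "0 < rho powr (- 2 * tau)" using par by simp
 then have "0 < L * card Lam" using lines by linarith
 then have ne: "Lam ~= {}" by auto
 obtain p0 where p0: "p0 \<in> P" "card Lam <= 4 * L * card {w \<in> Lam. I w p0}" "{w \<in> Lam. I w p0} ~= {}"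
  by (rule pick_point[OF subset_refl ne, of "{}"]) (simp_all add: that)
 obtain p1 where p1: "p1 \<in> P" "1 / B < abs (p1 - p0)" "card {w \<in> Lam. I w p0} <= 4 * L * card {w \<in> {w \<in> Lam. I w p0}. I w p1}"
   "{w \<in> {w \<in> Lam. I w p0}. I w p1} ~= {}"
 proof -
  have "{w \<in> Lam. I w p0} <= Lam" "finite {p0}" "card {p0} <= 3" by auto
  from this show thesis
   by (rule pick_point[OF _ p0(3)]) (rule that, assumption, blast, assumption, assumption)
 qed
 let ?S = "{w \<in> {w \<in> Lam. I w p0}. I w p1}"
 have "?S <= Lam" "finite {p0, p1}" "card {p0, p1} <= 3" by (auto simp: card_insert_if)
 then obtain p2 where p2: "p2 \<in> P" "!!z. z \<in> {p0, p1} ==> 1 / B < abs (p2 - z)" "card ?S <= 4 * L * card {w \<in> ?S. I w p2}" "{w \<in> ?S. I w p2} ~= {}"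
  by (rule pick_point[OF _ p1(4)]) (rule that, assumption, blast, assumption, assumption)
 let ?T = "{w \<in> Lam. I w p0 & I w p1 & I w p2}"
 have T: "{w \<in> ?S. I w p2} = ?T" by auto
 have "card Lam <= 4 * L * (4 * L * (4 * L * card ?T))"
  using p0(2) p1(3) p2(3) L unfolding T
  by (intro order_trans[OF p0(2)] mult_left_mono order_trans[OF p1(3)]) auto
 then have "card Lam <= 64 * L ^ 3 * card ?T" by (simp add: power3_eq_cube)
 then show thesis using that[of p0 p1 p2] p0 p1 p2 by (simp add: abs_minus_commute)
qed

end

section \<open>Coordinates for lines from three base points\<close>

locale incidence_base = incidence Lam P I kappa l ppi tau rho L B
 for Lam :: "'w set" and P I kappa l and ppi tau rho L B :: real +
 fixes p0 p1 p2 :: real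
 assumes p: "p0 \<in> P" "p1 \<in> P" "p2 \<in> P" "1 / B < abs (p0 - p1)" "1 / B < abs (p0 - p2)" "1 / B < abs (p1 - p2)"
  and card_base: "card Lam <= 64 * L ^ 3 * card {w \<in> Lam. I w p0 & I w p1 & I w p2}"
  and base_ne: "{w \<in> Lam. I w p0 & I w p1 & I w p2} ~= {}"
begin

definition Lam2 where "Lam2 = {w \<in> Lam. I w p0 & I w p1 & I w p2}"
text \<open>The normalisation that makes \<open>t p2 = 1\<close>, so that the third base point
  corresponds to the plain sum of the coordinates.\<close>

definition theta where "theta = (p2 - p0) / (p1 - p2)"
definition x where "x w = (l w + kappa w * p0) / rho"
definition y where "y w = theta * (l w + kappa w * p1) / rho"
text \<open>A projective parameter on \<open>P\<close>: by \<open>combine\<close> the height at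
  \<open>p\<close> is a multiple of \<open>x w + t p * y w\<close>. Lines become points of the plane
  and points of \<open>P\<close> become projections.\<close>

definition t where "t p = (p - p0) / ((p1 - p) * theta)"
definition X where "X w = \<lfloor>x w\<rfloor>"
definition Y where "Y w = \<lfloor>y w\<rfloor>"
abbreviation Q where "Q == rho powr (- tau)"

lemma fin2: "finite Lam2" "Lam2 <= Lam" "Lam2 ~= {}" using fin base_ne by (auto simp: Lam2_def)

lemma Q_sq: "Q * Q = rho powr (- 2 * tau)" by (simp flip: powr_add)

lemma Q_pos: "Q > 0" using par by simp

lemma dist_le: "q \<in> P ==> q' \<in> P ==> abs (q - q') <= 1"
proof -
 assume "q \<in> P" "q' \<in> P"
 then have "q \<in> {0..1}" "q' \<in> {0..1}" using fin(4) by auto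
 then show "abs (q - q') <= 1" by auto
qed

lemma invB: "0 < 1 / B" "B > 0" using B by auto

lemma ratio_bounds:
 assumes "1 / B < abs a" "abs a <= 1" "1 / B < abs b" "abs b <= 1"
 shows "1 / B <= abs (a / b)" "abs (a / b) <= B"
proof -
 have b: "abs b > 0" using assms(3) invB by auto
 have "1 / B / 1 <= abs a / abs b" using assms b by (intro frac_le) auto
 then show "1 / B <= abs (a / b)" by simp
 have "abs a / abs b <= 1 / (1 / B)" using assms invB by (intro frac_le) auto
 then show "abs (a / b) <= B" by simp
qed

lemma theta: "1 / B <= abs (theta)" "abs (theta) <= B" "theta ~= 0"
proof -
 show "1 / B <= abs (theta)" "abs (theta) <= B"
  unfolding theta_def using p dist_le[OF p(3,1)] dist_le[OF p(2,3)] by (intro ratio_bounds; simp add: abs_minus_commute)+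
 then show "theta ~= 0" using invB by auto
qed

lemma t_bounds:
 assumes "q \<in> P" "1 / B < abs (q - p0)" "1 / B < abs (q - p1)"
 shows "1 / B^2 <= abs (t q)" "abs (t q) <= B^2"
proof -
 have r: "1 / B <= abs ((q - p0) / (p1 - q))" "abs ((q - p0) / (p1 - q)) <= B"
  using assms p dist_le[OF assms(1) p(1)] dist_le[OF p(2) assms(1)] by (intro ratio_bounds; simp add: abs_minus_commute)+
 have te: "abs (t q) = abs ((q - p0) / (p1 - q)) / abs (theta)" by (simp add: t_def abs_mult)
 have "1 / B / B <= abs (t q)" unfolding te using r theta invB by (intro frac_le) auto
 then show "1 / B^2 <= abs (t q)" by (simp add: power2_eq_square)
 have "abs (t q) <= B / (1 / B)" unfolding te using r theta invB by (intro frac_le) auto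
 then show "abs (t q) <= B^2" by (simp add: power2_eq_square)
qed

lemma t_p2: "t p2 = 1"
proof -
 have "p1 ~= p2" "p2 ~= p0" using p invB by auto
 then show ?thesis by (simp add: t_def theta_def)
qed

lemma combine:
 assumes "q ~= p1"
 shows "x w + t q * y w = (p1 - p0) / (p1 - q) * ((l w + kappa w * q) / rho)"
proof -
 have q: "p1 - q ~= 0" using assms by simp
 have "t q * y w = (q - p0) * (l w + kappa w * p1) / ((p1 - q) * rho)"
  using theta(3) by (simp add: t_def y_def)
 moreover have "x w = (p1 - q) * (l w + kappa w * p0) / ((p1 - q) * rho)"
  unfolding x_def using q by simp
 ultimately have "x w + t q * y w = ((p1 - q) * (l w + kappa w * p0) + (q - p0) * (l w + kappa w * p1)) / ((p1 - q) * rho)"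
  by (simp only: add_divide_distrib)
 also have "(p1 - q) * (l w + kappa w * p0) + (q - p0) * (l w + kappa w * p1) = (p1 - p0) * (l w + kappa w * q)"
  by (simp add: algebra_simps)
 finally show ?thesis by simp
qed

text \<open>By \<open>combine\<close> the rounded combination is a bounded multiple of the height at
  \<open>q\<close> up to an error \<open>1 + B^2\<close>, and \<open>fibres\<close> says that few
  heights occur at \<open>q\<close>.\<close>

lemma cells:
 assumes q: "q \<in> P" "1 / B < abs (q - p0)" "1 / B < abs (q - p1)" and S: "S <= Lam2" "!!w. w \<in> S ==> I w q"
 shows "card ((%w. \<lfloor>of_int (X w) + t q * of_int (Y w)\<rfloor>) ` S) <= B ^ 4 * Q"
proof -
 let ?c = "(p1 - p0) / (p1 - q)"
 have qp: "q ~= p1" using q invB by auto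
 have c: "abs ?c <= B"
  using q p dist_le[OF p(1,2)] dist_le[OF p(2) q(1)] by (intro ratio_bounds(2)) (auto simp: abs_minus_commute)
 note tb = t_bounds(2)[OF q]
 have fS: "finite S" by (rule finite_subset[OF S(1) fin2(1)])
 have "real (card ((%w. \<lfloor>of_int (X w) + t q * of_int (Y w)\<rfloor>) ` S))
   <= (abs ?c + 2 * (1 + B^2) + 2) * card ((%w. \<lfloor>(l w + kappa w * q) / rho\<rfloor>) ` S)"
 proof (rule card_floor_image[OF fS])
  fix w
  have "abs (of_int (Y w) - y w) <= 1" unfolding Y_def by linarith
  then have "abs (t q) * abs (of_int (Y w) - y w) <= B^2 * 1" using tb by (intro mult_mono) auto
  then have "abs (t q * (of_int (Y w) - y w)) <= B^2" by (simp add: abs_mult)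
  moreover have "abs (of_int (X w) - x w) <= 1" unfolding X_def by linarith
  moreover have "of_int (X w) + t q * of_int (Y w) - ?c * ((l w + kappa w * q) / rho)
    = (of_int (X w) - x w) + t q * (of_int (Y w) - y w)"
   unfolding combine[OF qp, symmetric] by (simp add: algebra_simps)
  ultimately show "abs (of_int (X w) + t q * of_int (Y w) - ?c * ((l w + kappa w * q) / rho)) <= 1 + B^2" by linarith
 qed
 also have "... <= (4 * B^2) * (B * Q)"
 proof (rule mult_mono)
  have "B <= B^2" "12 <= B" using B_pow[of 1 2] B_ge by auto
  moreover have "2 * (1 + B^2) = 2 + 2 * B^2" by simp
  ultimately show "abs ?c + 2 * (1 + B^2) + 2 <= 4 * B^2" using c by simp
  have "card ((%w. \<lfloor>(l w + kappa w * q) / rho\<rfloor>) ` S) <= card ((%w. \<lfloor>(l w + kappa w * q) / rho\<rfloor>) ` {w \<in> Lam. I w q})"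
   using S fin fin2 by (intro card_mono) auto
  then have "card ((%w. \<lfloor>(l w + kappa w * q) / rho\<rfloor>) ` S) <= L * Q" using fibres[OF q(1)] by simp
  also have "... <= B * Q" using B_ge by (intro mult_right_mono) auto
  finally show "real (card ((%w. \<lfloor>(l w + kappa w * q) / rho\<rfloor>) ` S)) <= B * Q" .
 qed auto
 also have "... = 4 * (B ^ 3 * Q)" by (simp add: power2_eq_square power3_eq_cube)
 also have "... <= B * (B ^ 3 * Q)" using B_ge by (intro mult_right_mono) auto
 finally show ?thesis by (simp add: power_numeral_reduce)
qed

lemma card_X: "card (X ` Lam2) <= B * Q"
proof -
 have "X ` Lam2 <= (%w. \<lfloor>(l w + kappa w * p0) / rho\<rfloor>) ` {w \<in> Lam. I w p0}" by (auto simp: X_def x_def Lam2_def)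
 then have "card (X ` Lam2) <= card ((%w. \<lfloor>(l w + kappa w * p0) / rho\<rfloor>) ` {w \<in> Lam. I w p0})"
  using fin by (intro card_mono) auto
 then have "card (X ` Lam2) <= L * Q" using fibres[OF p(1)] by simp
 also have "... <= B * Q" using B_ge by (intro mult_right_mono) auto
 finally show ?thesis .
qed

lemma card_Y: "card (Y ` Lam2) <= B^2 * Q"
proof -
 have "real (card ((%w. \<lfloor>y w\<rfloor>) ` Lam2)) <= (abs (theta) + 2 * 0 + 2) * card ((%w. \<lfloor>(l w + kappa w * p1) / rho\<rfloor>) ` Lam2)"
  by (rule card_floor_image) (use fin2 in \<open>auto simp: y_def\<close>)
 also have "... <= (2 * B) * (L * Q)"
 proof (rule mult_mono)
  show "abs (theta) + 2 * 0 + 2 <= 2 * B" using theta B_ge by simp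
  have "card ((%w. \<lfloor>(l w + kappa w * p1) / rho\<rfloor>) ` Lam2) <= card ((%w. \<lfloor>(l w + kappa w * p1) / rho\<rfloor>) ` {w \<in> Lam. I w p1})"
   using fin by (intro card_mono) (auto simp: Lam2_def)
  then show "card ((%w. \<lfloor>(l w + kappa w * p1) / rho\<rfloor>) ` Lam2) <= L * Q" using fibres[OF p(2)] by simp
 qed (use B in auto)
 also have "... = (2 * L) * (B * Q)" by simp
 also have "... <= B * (B * Q)" using B_ge by (intro mult_right_mono) auto
 finally show ?thesis by (simp add: Y_def power2_eq_square)
qed

text \<open>A prescribed \<open>X\<close> fixes the height at \<open>p0\<close> up to
  \<open>rho\<close>, and confining \<open>Y\<close> to an interval of length about \<open>H\<close>
  then confines the slope to a range of order \<open>B^2 * H * rho\<close>. This is the situation of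
  \<open>slopes\<close>.\<close>

lemma fibre_bound:
 assumes S: "S <= Lam2" and u: "!!w. w \<in> S ==> X w = u" and v: "!!w. w \<in> S ==> abs (v - of_int (Y w)) < H" and H: "1 <= H"
 shows "card S <= B ^ 3 * H powr tau"
proof (cases "S = {}")
 case False
 then obtain w0 where w0: "w0 \<in> S" by auto
 let ?r = "4 * B^2 * H * rho"
 let ?T = "{w \<in> Lam. I w p0 & abs (l w + kappa w * p0 - (l w0 + kappa w0 * p0)) <= rho & abs (kappa w - kappa w0) <= ?r}"
 have "S <= ?T"
 proof
  fix w assume w: "w \<in> S"
  have "\<lfloor>(l w + kappa w * p0) / rho\<rfloor> = \<lfloor>(l w0 + kappa w0 * p0) / rho\<rfloor>"
   using u[OF w] u[OF w0] by (simp add: X_def x_def)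
  from same_cell[OF par(5) this] have dx: "abs (l w + kappa w * p0 - (l w0 + kappa w0 * p0)) < rho" .
  have "abs (y w - y w0) <= 2 * H + 1" using v[OF w] v[OF w0] unfolding Y_def by linarith
  also have "... <= 3 * H" using H by simp
  finally have "abs (y w - y w0) <= 3 * H" .
  moreover have "y w - y w0 = theta * ((l w + kappa w * p1) - (l w0 + kappa w0 * p1)) / rho"
   by (simp add: y_def algebra_simps diff_divide_distrib)
  ultimately have "abs (theta) * abs ((l w + kappa w * p1) - (l w0 + kappa w0 * p1)) <= 3 * H * rho"
   using par by (simp add: pos_divide_le_eq)
  moreover have "1 / B * abs ((l w + kappa w * p1) - (l w0 + kappa w0 * p1)) <= abs (theta) * abs ((l w + kappa w * p1) - (l w0 + kappa w0 * p1))"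
   using theta by (intro mult_right_mono) auto
  ultimately have "abs ((l w + kappa w * p1) - (l w0 + kappa w0 * p1)) / B <= 3 * H * rho" by simp
  then have dy: "abs ((l w + kappa w * p1) - (l w0 + kappa w0 * p1)) <= 3 * H * rho * B" using invB by (simp add: pos_divide_le_eq)
  have "(kappa w - kappa w0) * (p1 - p0) = ((l w + kappa w * p1) - (l w0 + kappa w0 * p1)) - (l w + kappa w * p0 - (l w0 + kappa w0 * p0))"
   by (simp add: algebra_simps)
  then have "abs ((kappa w - kappa w0) * (p1 - p0)) <= 3 * H * rho * B + rho" using dx dy by linarith
  moreover have "rho * 1 <= rho * (H * B)" using mult_mono[OF H B(1)] par H by simp
  ultimately have "abs (kappa w - kappa w0) * abs (p1 - p0) <= 4 * (H * rho * B)" by (simp add: mult_ac)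
  moreover have "abs (kappa w - kappa w0) * (1 / B) <= abs (kappa w - kappa w0) * abs (p1 - p0)"
   using p by (intro mult_left_mono) (auto simp: abs_minus_commute)
  ultimately have "abs (kappa w - kappa w0) / B <= 4 * (H * rho * B)" by simp
  then have "abs (kappa w - kappa w0) <= ?r" using invB by (simp add: pos_divide_le_eq power2_eq_square mult_ac)
  then show "w \<in> ?T" using dx w S by (auto simp: Lam2_def)
 qed
 then have "card S <= card ?T" using fin by (intro card_mono) auto
 moreover have "rho <= ?r"
 proof -
  have "1 * 1 <= B^2 * H" using B H by (intro mult_mono) auto
  then have "1 * rho <= 4 * B^2 * H * rho" using par by simp
  then show ?thesis by simp
 qed
 ultimately have "card S <= L * (?r / rho) powr tau"
  using slopes[OF p(1), of ?r "l w0 + kappa w0 * p0" "kappa w0"] by simp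
 also have "?r / rho = (4 * B^2) * H" using par by simp
 also have "((4 * B^2) * H) powr tau = (4 * B^2) powr tau * H powr tau" by (simp add: powr_mult)
 also have "L * ((4 * B^2) powr tau * H powr tau) <= L * ((4 * B^2) * H powr tau)"
 proof (intro mult_left_mono mult_right_mono)
  have "1 * 1 <= B^2 * 4" using B by (intro mult_mono) auto
  then have "(4 * B^2) powr tau <= (4 * B^2) powr 1" using par by (intro powr_mono) auto
  then show "(4 * B^2) powr tau <= 4 * B^2" by simp
 qed (use L in auto)
 also have "... = (4 * L) * B^2 * H powr tau" by simp
 also have "... <= B * B^2 * H powr tau" using B_ge by (intro mult_right_mono) auto
 finally show ?thesis by (simp add: power_numeral_reduce)
qed (use B in simp)

lemma card_XY:
 assumes S: "S <= Lam2"
 shows "card S <= B ^ 3 * card ((%w. (X w, Y w)) ` S)"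
proof -
 have fS: "finite S" by (rule finite_subset[OF S fin2(1)])
 have "card S <= card ((%w. (X w, Y w)) ` S) * B ^ 3"
 proof (rule card_le_fibres[OF fS order_refl])
  fix w assume "w \<in> S"
  have "card {w' \<in> S. (X w', Y w') = (X w, Y w)} <= B ^ 3 * 1 powr tau"
   by (rule fibre_bound[where u = "X w" and v = "of_int (Y w)"]) (use S in auto)
  then show "real (card {w' \<in> S. (X w', Y w') = (X w, Y w)}) <= B ^ 3" by simp
 qed (use B in auto)
 then show ?thesis by (simp add: mult.commute)
qed

end

section \<open>First use of the graph theorem: a small sumset\<close>

context incidence_base begin

lemma chain: "a <= B ^ i * b ==> b <= B ^ j * c ==> a <= B ^ (i + j) * (c::real)"
proof -
 assume 1: "a <= B ^ i * b" and 2: "b <= B ^ j * c"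
 have "B ^ i * b <= B ^ i * (B ^ j * c)" using 2 B by simp
 with 1 show ?thesis by (simp add: power_add)
qed

lemma cancel_right: "a * c <= b * c ==> 0 < c ==> a <= (b::real)"
 by simp

lemma const_pow: "12 <= B ^ 1" "32 <= B^2" "2 ^ 14 <= B ^ 4"
proof -
 show "12 <= B ^ 1" using B_ge by simp
 have "(12::real)^2 <= B^2" "(12::real) ^ 4 <= B ^ 4" using B_ge by (intro power_mono; simp)+
 then show "32 <= B^2" "2 ^ 14 <= B ^ 4" by auto
qed

lemma bsg_consts:
 "8 * B ^ k <= B ^ (k + 1)" "32 * (B ^ k)^2 <= B ^ (2 * k + 2)" "4 * B ^ k <= B ^ (k + 1)"
 "2 ^ 14 * (B ^ k) ^ 5 <= B ^ (5 * k + 4)"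
proof -
 have "c * B ^ i <= B ^ j * B ^ i" if "c <= B ^ j" for c i j using that B by simp
 note c = this
 have "32 * (B ^ k)^2 = 32 * B ^ (2 * k)" by (simp flip: power_mult add: mult.commute)
 also have "... <= B^2 * B ^ (2 * k)" by (rule c[OF const_pow(2)])
 also have "... = B ^ (2 * k + 2)" by (simp only: power_add mult.commute)
 finally show "32 * (B ^ k)^2 <= B ^ (2 * k + 2)" .
 from c[of 8 1 k] c[of 4 1 k] c[of "2 ^ 14" 4 "5 * k"]
 show "8 * B ^ k <= B ^ (k + 1)" "4 * B ^ k <= B ^ (k + 1)" "2 ^ 14 * (B ^ k) ^ 5 <= B ^ (5 * k + 4)"
  using const_pow by (simp_all add: power_add power_mult[symmetric] mult.commute)
qed

lemma cube_pow: "B ^ i * (B ^ 4 * Q) ^ 3 * B ^ j = B ^ (i + 12 + j) * (Q * (Q * Q))"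
 by (simp add: power_add power_mult_distrib power3_eq_cube mult_ac flip: power_mult)

definition G where "G = (%w. (X w, Y w)) ` Lam2"

text \<open>The pairs \<open>(X w, Y w)\<close> form a dense graph between two sets of about
  \<open>Q\<close> integers, since there are about \<open>Q * Q\<close> lines. On its edges
  \<open>X + Y\<close> takes few values because \<open>t p2 = 1\<close>; paths of length three
  extend this to the full sumset of \<open>U\<close> and \<open>V\<close>.\<close>

lemma bsg_sets:
 obtains U V where "U <= X ` Lam2" "V <= Y ` Lam2" "Q <= B ^ 16 * card U" "Q <= B ^ 24 * card V"
  "Q * Q <= B ^ 23 * card {w \<in> Lam2. X w \<in> U & Y w \<in> V}" "card (sumset U V) <= B ^ 62 * Q"
  "!!v. v \<in> V ==> card U <= B ^ 9 * card {u \<in> U. (u, v) \<in> G}"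
proof -
 let ?U = "X ` Lam2" and ?V = "Y ` Lam2"
 have finUV: "finite ?U" "finite ?V" "?U ~= {}" "?V ~= {}" using fin2 by auto
 have GUV: "G <= ?U \<times> ?V" by (auto simp: G_def)
 define u v g where "u = real (card ?U)" and "v = real (card ?V)" and "g = real (card G)"
 have uv: "0 < u" "0 < v" using finUV by (auto simp: u_def v_def)
 have gu: "g <= u * v"
  using card_mono[OF _ GUV] finUV by (simp add: u_def v_def g_def card_cartesian_product flip: of_nat_mult)
 have uQ: "u <= B * Q" and vQ: "v <= B^2 * Q" unfolding u_def v_def by (rule card_X, rule card_Y)
 have Q2: "Q * Q <= B ^ 5 * g"
 proof -
  have "Q * Q <= L * card Lam" unfolding Q_sq by (rule lines)
  also have "... <= L * (64 * L ^ 3 * card Lam2)" using card_base L unfolding Lam2_def by simp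
  also have "... = (64 * L ^ 4) * card Lam2" by (simp add: power_numeral_reduce)
  also have "... <= B^2 * card Lam2"
  proof (intro mult_right_mono)
   have "0 <= L ^ 4" by simp
   then show "64 * L ^ 4 <= B^2" using B_ge(4) by linarith
  qed simp
  finally have "Q * Q <= B ^ 2 * card Lam2" .
  from chain[OF this card_XY[OF subset_refl]] show ?thesis by (simp add: g_def G_def)
 qed
 have "u * v <= (B * Q) * (B^2 * Q)" using uQ vQ uv by (intro mult_mono) auto
 then have "u * v <= B ^ 3 * (Q * Q)" by (simp add: power_numeral_reduce mult_ac)
 from chain[OF this Q2] have dense: "u * v <= B ^ 8 * g" by simp
 have Q2uv: "Q * Q <= B ^ 5 * (u * v)" using Q2 gu B by (meson mult_left_mono order_trans zero_le_power zero_le_one)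
 have "Q * Q <= (B ^ 7 * u) * Q"
 proof -
  have "B ^ 5 * (u * v) <= B ^ 5 * (u * (B^2 * Q))" using vQ uv B by simp
  then show ?thesis using Q2uv by (simp add: mult_ac)
 qed
 from cancel_right[OF this Q_pos] have Qu: "Q <= B ^ 7 * u" .
 have "Q * Q <= (B ^ 6 * v) * Q"
 proof -
  have "B ^ 5 * (u * v) <= B ^ 5 * ((B * Q) * v)" using uQ uv B by simp
  then show ?thesis using Q2uv by (simp add: power_numeral_reduce mult_ac)
 qed
 from cancel_right[OF this Q_pos] have Qv: "Q <= B ^ 6 * v" .
 have K: "1 <= B ^ 8" "real (card ?U * card ?V) <= B ^ 8 * card G"
  using B dense by (auto simp: u_def v_def g_def)
 obtain U V where UV: "U <= ?U" "V <= ?V" "card ?U <= 8 * B ^ 8 * card U"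
  "card ?U * card ?V <= 32 * (B ^ 8)^2 * card (G Int U \<times> V)"
  "ALL b:V. card U <= 4 * B ^ 8 * card {a \<in> U. (a, b) \<in> G}"
  "ALL a:U. ALL b:V. card ?U * card ?V
    <= 2 ^ 14 * (B ^ 8) ^ 5 * card {(a1, b1). (a, b1) \<in> G & (a1, b1) \<in> G & (a1, b) \<in> G}"
  by (rule bsg_graph[OF finUV(1,2) GUV K(1) finUV(3,4) K(2)]) (rule that)
 define u' v' where "u' = real (card U)" and "v' = real (card V)"
 have finUV': "finite U" "finite V" by (rule finite_subset[OF UV(1) finUV(1)], rule finite_subset[OF UV(2) finUV(2)])
 have u'u: "u' <= u" unfolding u_def u'_def using UV(1) finUV by (auto intro: card_mono)
 have up: "c * real n <= B ^ k * real n" if "c <= B ^ k" for c k n using that by (intro mult_right_mono) auto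
 have "u <= B ^ 9 * u'" using UV(3) up[OF bsg_consts(1)[of 8], of "card U"] by (simp add: u_def u'_def)
 from chain[OF Qu this] have Qu': "Q <= B ^ 16 * u'" by simp
 have g': "u * v <= B ^ 18 * card (G Int U \<times> V)"
  using UV(4) up[OF bsg_consts(2)[of 8], of "card (G Int U \<times> V)"] by (simp add: u_def v_def)
 have "card (G Int U \<times> V) <= card (U \<times> V)" using finUV' by (intro card_mono) auto
 then have "real (card (G Int U \<times> V)) <= u' * v'" by (simp add: u'_def v'_def card_cartesian_product flip: of_nat_mult)
 also have "... <= u * v'" using u'u by (intro mult_right_mono) (auto simp: v'_def)
 finally have "B ^ 18 * real (card (G Int U \<times> V)) <= B ^ 18 * (u * v')" by (intro mult_left_mono) auto
 with g' have "v * u <= (B ^ 18 * v') * u" by (simp add: mult_ac)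
 from cancel_right[OF this uv(1)] have "v <= B ^ 18 * v'" .
 from chain[OF Qv this] have Qv': "Q <= B ^ 24 * v'" by simp
 have "G Int U \<times> V <= (%w. (X w, Y w)) ` {w \<in> Lam2. X w \<in> U & Y w \<in> V}" by (auto simp: G_def)
 then have "card (G Int U \<times> V) <= card {w \<in> Lam2. X w \<in> U & Y w \<in> V}"
  using fin2 by (intro surj_card_le) auto
 then have "B ^ 18 * real (card (G Int U \<times> V)) <= B ^ 18 * real (card {w \<in> Lam2. X w \<in> U & Y w \<in> V})"
  by (intro mult_left_mono) auto
 with g' have "u * v <= B ^ 18 * card {w \<in> Lam2. X w \<in> U & Y w \<in> V}" by simp
 from chain[OF Q2uv this] have QLam: "Q * Q <= B ^ 23 * card {w \<in> Lam2. X w \<in> U & Y w \<in> V}" by simp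
 have sums: "card (sumset U V) <= B ^ 62 * Q"
 proof -
  have "card ((%(u, v). \<lfloor>of_int u + (1::real) * of_int v\<rfloor>) ` (U \<times> V)) * (u * v / B ^ 44) <= 3 * (B ^ 4 * Q) ^ 3 * 1"
  proof (rule path_cells[OF finUV(1,2) GUV UV(1,2)])
   show "card {v \<in> ?V. \<lfloor>x + 1 * of_int v\<rfloor> = 0} <= (1::real)" for x :: real
   proof -
    have "{v \<in> ?V. \<lfloor>x + 1 * of_int v\<rfloor> = 0} <= {- \<lfloor>x\<rfloor>}" by auto
    then have "card {v \<in> ?V. \<lfloor>x + 1 * of_int v\<rfloor> = 0} <= card {- \<lfloor>x\<rfloor>}" by (intro card_mono) auto
    then show ?thesis by simp
   qed
   have "(%(u, v). \<lfloor>of_int u + (1::real) * of_int v\<rfloor>) ` G = (%w. \<lfloor>of_int (X w) + t p2 * of_int (Y w)\<rfloor>) ` Lam2"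
    unfolding G_def image_image t_p2 by simp
   moreover have "card ((%w. \<lfloor>of_int (X w) + t p2 * of_int (Y w)\<rfloor>) ` Lam2) <= B ^ 4 * Q"
    using p by (intro cells) (auto simp: abs_minus_commute Lam2_def)
   ultimately show "card ((%(u, v). \<lfloor>real_of_int u + 1 * real_of_int v\<rfloor>) ` G) <= B ^ 4 * Q" by simp
   fix a b assume ab: "a \<in> U" "b \<in> V"
   have "u * v <= B ^ 44 * card {(a1, b1). (a, b1) \<in> G & (a1, b1) \<in> G & (a1, b) \<in> G}"
    using bspec[OF bspec[OF UV(6) ab(1)] ab(2)] up[OF bsg_consts(4)[of 8], of "card {(a1, b1). (a, b1) \<in> G & (a1, b1) \<in> G & (a1, b) \<in> G}"]
    by (simp add: u_def v_def)
   then show "u * v / B ^ 44 <= card {(a1, b1). (a, b1) \<in> G & (a1, b1) \<in> G & (a1, b) \<in> G}"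
    using B by (simp add: pos_divide_le_eq mult.commute)
  qed
  moreover have "(%(u, v). \<lfloor>of_int u + (1::real) * of_int v\<rfloor>) ` (U \<times> V) = sumset U V"
   unfolding sumset_def by simp
  ultimately have "card (sumset U V) * (u * v / B ^ 44) <= 3 * (B ^ 4 * Q) ^ 3" by simp
  also have "... <= B ^ 1 * (B ^ 4 * Q) ^ 3" using const_pow(1) by (intro mult_right_mono) auto
  finally have "card (sumset U V) * (u * v) <= B ^ 1 * (B ^ 4 * Q) ^ 3 * B ^ 44"
   using B by (simp add: pos_divide_le_eq)
  also have "... = B ^ 57 * (Q * (Q * Q))" unfolding cube_pow by simp
  finally have "B ^ 5 * (card (sumset U V) * (u * v)) <= B ^ 5 * (B ^ 57 * (Q * (Q * Q)))"
   using B by (intro mult_left_mono) auto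
  moreover have "card (sumset U V) * (Q * Q) <= card (sumset U V) * (B ^ 5 * (u * v))"
   using Q2uv by (intro mult_left_mono) auto
  ultimately have "card (sumset U V) * (Q * Q) <= B ^ 5 * (B ^ 57 * (Q * (Q * Q)))" by (simp add: mult_ac)
  also have "... = (B ^ 5 * B ^ 57) * Q * (Q * Q)" by simp
  also have "B ^ 5 * B ^ 57 = B ^ 62" by simp
  finally have c: "card (sumset U V) * (Q * Q) <= B ^ 62 * Q * (Q * Q)" .
  have "0 < Q * Q" using Q_pos by simp
  from cancel_right[OF c this] show ?thesis .
 qed
 have deg: "card U <= B ^ 9 * card {u \<in> U. (u, v) \<in> G}" if "v \<in> V" for v
  using bspec[OF UV(5) that] up[OF bsg_consts(3)[of 8], of "card {u \<in> U. (u, v) \<in> G}"] by simp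
 show thesis
 proof (rule that)
  show "Q <= B ^ 16 * card U" by (rule Qu'[unfolded u'_def])
  show "Q <= B ^ 24 * card V" by (rule Qv'[unfolded v'_def])
 qed (rule UV(1), rule UV(2), rule QLam, rule sums, rule deg)
qed

end

section \<open>Second use of the graph theorem: covers of dilates\<close>

context incidence_base begin

definition doubling_bound where
 "doubling_bound V D \<longleftrightarrow> card (diffset (nsum 5 V) (nsum 4 V)) <= D * real (card V)"

text \<open>The graph theorem for the lines through \<open>q\<close> gives \<open>U'\<close>,
  \<open>V'\<close> on which \<open>u + t q * v\<close> has few cells, so each \<open>a\<close> in
  \<open>V'\<close> has \<open>t q * (a - a0)\<close> near a difference of elements of
  \<open>U'\<close> for some \<open>a0\<close> in a small set. As \<open>U\<close> lies in few
  translates of \<open>V - V\<close>, and \<open>V\<close> in few translates of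
  \<open>V' - V'\<close>, the dilate of \<open>V\<close> is near few translates of
  \<open>4 V - 4 V\<close>.\<close>

lemma covers_good:
 assumes U: "U <= X ` Lam2" and V: "V <= Y ` Lam2" and Qu: "Q <= B ^ 16 * card U" and Qv: "Q <= B ^ 24 * card V"
  and QLam: "Q * Q <= B ^ 23 * card {w \<in> Lam2. X w \<in> U & Y w \<in> V}" and sums: "card (sumset U V) <= B ^ 62 * Q"
  and D: "doubling_bound V (B ^ 727)" and four: "four_cover V (B ^ 727)"
  and q: "q \<in> P" "1 / B < abs (q - p0)" "1 / B < abs (q - p1)"
  and qr: "card {w \<in> Lam2. X w \<in> U & Y w \<in> V} <= 4 * L * card {w \<in> {w \<in> Lam2. X w \<in> U & Y w \<in> V}. I w q}"
 shows "covers V (t q) (B ^ 3000)"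
proof -
 let ?S = "{w \<in> {w \<in> Lam2. X w \<in> U & Y w \<in> V}. I w q}"
 let ?G = "(%w. (X w, Y w)) ` ?S"
 have finUV: "finite U" "finite V" using U V fin2 by (meson finite_imageI finite_subset)+
 define u v g where "u = real (card U)" and "v = real (card V)" and "g = real (card ?G)"
 have "0 < B ^ 16 * u" "0 < B ^ 24 * v" using Qu Qv Q_pos unfolding u_def v_def by linarith+
 then have uv: "0 < u" "0 < v" by (auto simp: zero_less_mult_iff)
 then have ne: "U ~= {}" "V ~= {}" by (auto simp: u_def v_def)
 have uQ: "u <= B * Q"
 proof -
  have "card U <= card (X ` Lam2)" using U fin2 by (intro card_mono) auto
  then show ?thesis using card_X unfolding u_def by simp
 qed
 have vQ: "v <= B^2 * Q"
 proof -
  have "card V <= card (Y ` Lam2)" using V fin2 by (intro card_mono) auto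
  then show ?thesis using card_Y unfolding v_def by simp
 qed
 have up: "c * real n <= B ^ k * real n" if "c <= B ^ k" for c k n using that by (intro mult_right_mono) auto
 have GUV: "?G <= U \<times> V" by auto
 have Q2: "Q * Q <= B ^ 27 * g"
 proof -
  have "4 * L <= B ^ 1" using B_ge by simp
  from up[OF this] qr have "real (card {w \<in> Lam2. X w \<in> U & Y w \<in> V}) <= B ^ 1 * card ?S" by (meson order_trans)
  from chain[OF QLam this] have "Q * Q <= B ^ (23 + 1) * card ?S" .
  from chain[OF this card_XY] show ?thesis by (auto simp: g_def)
 qed
 have "u * v <= (B * Q) * (B^2 * Q)" using uQ vQ uv by (intro mult_mono) auto
 then have "u * v <= B ^ 3 * (Q * Q)" by (simp add: power_numeral_reduce mult_ac)
 from chain[OF this Q2] have dense: "u * v <= B ^ 30 * g" by simp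
 have Q2uv: "Q * Q <= B ^ 40 * (u * v)"
 proof -
  have "Q * Q <= (B ^ 16 * u) * (B ^ 24 * v)" using Qu Qv Q_pos uv B unfolding u_def v_def by (intro mult_mono) auto
  also have "... = (B ^ 16 * B ^ 24) * (u * v)" by simp
  also have "B ^ 16 * B ^ 24 = B ^ 40" by simp
  finally show ?thesis .
 qed
 have K: "1 <= B ^ 30" "real (card U * card V) <= B ^ 30 * card ?G"
  using B dense by (auto simp: u_def v_def g_def)
 obtain U' V' where UV: "U' <= U" "V' <= V" "card U <= 8 * B ^ 30 * card U'"
  "card U * card V <= 32 * (B ^ 30)^2 * card (?G Int U' \<times> V')"
  "ALL b:V'. card U' <= 4 * B ^ 30 * card {a \<in> U'. (a, b) \<in> ?G}"
  "ALL a:U'. ALL b:V'. card U * card V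
    <= 2 ^ 14 * (B ^ 30) ^ 5 * card {(a1, b1). (a, b1) \<in> ?G & (a1, b1) \<in> ?G & (a1, b) \<in> ?G}"
  by (rule bsg_graph[OF finUV GUV K(1) ne K(2)]) (rule that)
 define u' v' where "u' = real (card U')" and "v' = real (card V')"
 have finUV': "finite U'" "finite V'" by (rule finite_subset[OF UV(1) finUV(1)], rule finite_subset[OF UV(2) finUV(2)])
 have u'u: "u' <= u" unfolding u_def u'_def using UV(1) finUV by (auto intro: card_mono)
 have uu': "u <= B ^ 31 * u'" using UV(3) up[OF bsg_consts(1)[of 30], of "card U'"] by (simp add: u_def u'_def)
 have g': "u * v <= B ^ 62 * card (?G Int U' \<times> V')"
  using UV(4) up[OF bsg_consts(2)[of 30], of "card (?G Int U' \<times> V')"] by (simp add: u_def v_def)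
 have "card (?G Int U' \<times> V') <= card (U' \<times> V')" using finUV' by (intro card_mono) auto
 then have "real (card (?G Int U' \<times> V')) <= u' * v'" by (simp add: u'_def v'_def card_cartesian_product flip: of_nat_mult)
 also have "... <= u * v'" using u'u by (intro mult_right_mono) (auto simp: v'_def)
 finally have "B ^ 62 * real (card (?G Int U' \<times> V')) <= B ^ 62 * (u * v')" by (intro mult_left_mono) auto
 with g' have "v * u <= (B ^ 62 * v') * u" by (simp add: mult_ac)
 from cancel_right[OF this uv(1)] have vv': "v <= B ^ 62 * v'" .
 have u'0: "0 < u'" "0 < v'"
 proof -
  have "0 < B ^ 31 * u'" "0 < B ^ 62 * v'" using uu' vv' uv by auto
  then show "0 < u'" "0 < v'" using B by (auto simp: zero_less_mult_iff)
 qed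
 let ?f = "%u v. \<lfloor>of_int u + t q * of_int v\<rfloor>"
 let ?Z = "(%(u, v). ?f u v) ` (U' \<times> V')"
 note tb = t_bounds[OF q]
 have cells_t: "card ?Z <= B ^ 210 * Q"
 proof -
  have "card ?Z * (u * v / B ^ 154) <= 3 * (B ^ 4 * Q) ^ 3 * B ^ 3"
  proof (rule path_cells[OF finUV GUV UV(1,2)])
   show "card {v \<in> V. \<lfloor>x + t q * of_int v\<rfloor> = 0} <= B ^ 3" for x :: real
   proof -
    let ?W = "{v \<in> V. \<lfloor>x + t q * of_int v\<rfloor> = 0}" and ?c = "(1 / 2 - x) / t q"
    have t0: "abs (t q) > 0"
    proof -
     have "0 < 1 / B^2" using B by simp
     then show ?thesis using tb(1) by auto
    qed
    have "real (card ((%x. \<lfloor>x / 1\<rfloor>) ` (real_of_int ` ?W))) <= ((?c + B^2 / 2) - (?c - B^2 / 2)) / 1 + 2"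
    proof (rule card_floor_interval)
     fix z assume "z \<in> real_of_int ` ?W"
     then obtain v where v: "z = of_int v" "\<lfloor>x + t q * of_int v\<rfloor> = 0" by auto
     have "abs (x + t q * of_int v - 1 / 2) <= 1 / 2" using v(2) by linarith
     moreover have "x + t q * of_int v - 1 / 2 = t q * (of_int v - ?c)" using t0 by (simp add: field_simps)
     ultimately have "abs (t q) * abs (of_int v - ?c) <= 1 / 2" by linarith
     moreover have "1 / B^2 * abs (of_int v - ?c) <= abs (t q) * abs (of_int v - ?c)" using tb(1) by (intro mult_right_mono) auto
     ultimately have "1 / B^2 * abs (of_int v - ?c) <= 1 / 2" by linarith
     then have "abs (of_int v - ?c) / B^2 <= 1 / 2" by simp
     then have "abs (of_int v - ?c) <= B^2 / 2" using B by simp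
     then show "?c - B^2 / 2 <= z & z <= ?c + B^2 / 2" unfolding v(1) by linarith
    qed auto
    moreover have "(%x. \<lfloor>x / 1\<rfloor>) ` (real_of_int ` ?W) = ?W" by force
    ultimately have "real (card ?W) <= B^2 + 2" by simp
    also have "... <= 2 * B^2" using const_pow by simp
    also have "... <= B * B^2" using B_ge by simp
    finally show ?thesis by (simp add: power_numeral_reduce)
   qed
   have "(%(u, v). ?f u v) ` ?G = (%w. ?f (X w) (Y w)) ` ?S" unfolding image_image by simp
   moreover have "card ((%w. ?f (X w) (Y w)) ` ?S) <= B ^ 4 * Q" by (rule cells[OF q]) auto
   ultimately show "card ((%(u, v). ?f u v) ` ?G) <= B ^ 4 * Q" by simp
   fix a b assume ab: "a \<in> U'" "b \<in> V'"
   let ?T = "{(a1, b1). (a, b1) \<in> ?G & (a1, b1) \<in> ?G & (a1, b) \<in> ?G}"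
   have "u * v <= B ^ 154 * card ?T"
    using bspec[OF bspec[OF UV(6) ab(1)] ab(2)] up[OF bsg_consts(4)[of 30], of "card ?T"]
    by (simp only: u_def v_def of_nat_mult) simp
   then show "u * v / B ^ 154 <= card ?T" using B by (simp add: pos_divide_le_eq mult.commute)
  qed
  then have "card ?Z * (u * v) <= 3 * (B ^ 4 * Q) ^ 3 * B ^ 3 * B ^ 154" using B by (simp add: pos_divide_le_eq)
  also have "... = 3 * ((B ^ 4 * Q) ^ 3 * B ^ 157)" by simp
  also have "... <= B ^ 1 * ((B ^ 4 * Q) ^ 3 * B ^ 157)" using const_pow(1) by (intro mult_right_mono) auto
  also have "... = B ^ 170 * (Q * (Q * Q))" using cube_pow[of 1 157] by simp
  finally have "B ^ 40 * (card ?Z * (u * v)) <= B ^ 40 * (B ^ 170 * (Q * (Q * Q)))"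
   by (intro mult_left_mono) auto
  moreover have "card ?Z * (Q * Q) <= card ?Z * (B ^ 40 * (u * v))"
   using Q2uv by (intro mult_left_mono) auto
  moreover have "real (card ?Z) * (B ^ 40 * (u * v)) = B ^ 40 * (card ?Z * (u * v))" by simp
  ultimately have "card ?Z * (Q * Q) <= B ^ 40 * (B ^ 170 * (Q * (Q * Q)))" by linarith
  also have "... = (B ^ 40 * B ^ 170) * Q * (Q * Q)" by simp
  also have "B ^ 40 * B ^ 170 = B ^ 210" by simp
  finally have c: "card ?Z * (Q * Q) <= B ^ 210 * Q * (Q * Q)" .
  have "0 < Q * Q" using Q_pos by simp
  from cancel_right[OF c this] show ?thesis .
 qed
 have V'0: "V' ~= {}" "U' ~= {}" using u'0 by (auto simp: u'_def v'_def)
 obtain F1 where F1: "F1 <= V" "card F1 * card V' <= card (sumset V V')"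
  "ALL s:V. EX g:F1. EX a:V'. EX b:V'. s = g + a - b"
  by (rule ruzsa_covering[OF finUV(2) finUV'(2) V'0(1)]) (rule that)
 have cF1: "real (card F1) <= B ^ 789"
 proof -
  have "card (sumset V V') <= card (sumset V V)"
   using UV(2) finUV by (intro card_mono) (auto elim!: sumsetE intro: sumsetI)
  then have "card F1 * card V' <= card (diffset (nsum 5 V) (nsum 4 V))"
   using F1(2) card_shifted_sums(1)[OF finUV(2) ne(2)] by simp
  then have "real (card F1 * card V') <= card (diffset (nsum 5 V) (nsum 4 V))" by linarith
  then have "real (card F1) * v' <= B ^ 727 * v" using D unfolding doubling_bound_def v_def v'_def by simp
  from chain[OF this vv'] have "real (card F1) * v' <= B ^ 789 * v'" by simp
  then show ?thesis using u'0 by simp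
 qed
 obtain F3 where F3: "F3 <= U" "card F3 * card V <= card (sumset U V)"
  "ALL s:U. EX g:F3. EX a:V. EX b:V. s = g + a - b"
  by (rule ruzsa_covering[OF finUV(1) finUV(2) ne(2)]) (rule that)
 have cF3: "real (card F3) <= B ^ 86"
 proof -
  have "real (card F3 * card V) <= card (sumset U V)" using F3(2) by linarith
  then have "real (card F3) * v <= B ^ 62 * Q" using sums unfolding v_def by simp
  from chain[OF this Qv] have "real (card F3) * v <= B ^ 86 * v" by (simp add: v_def)
  then show ?thesis using uv by simp
 qed
 \<comment> \<open>If two of these families share a cell, \<open>t q\<close> times the difference of
   their parameters is within \<open>1\<close> of a difference of elements of \<open>U'\<close>. A
   disjoint subfamily is small because there are few cells altogether.\<close>
 let ?C = "%v. (%u. ?f u v) ` U'"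
 have cC: "card (?C v) = card U'" for v by (intro card_image inj_onI) simp
 obtain F2 where F2: "F2 <= V'" "card F2 * card U' <= card ?Z"
  "ALL v:V'. card U' > 0 --> (EX v0:F2. ?C v Int ?C v0 ~= {})"
 proof (rule disjoint_subfamily[of V' ?Z ?C "card U'"])
  show "finite ?Z" using finUV' by simp
  show "?C y <= ?Z" if "y \<in> V'" for y using that by auto
 qed (use finUV' cC in \<open>simp_all add: that\<close>)
 have cU'0: "card U' > 0" using u'0 by (simp add: u'_def)
 have cF2: "real (card F2) <= B ^ 257"
 proof -
  have "real (card F2 * card U') <= card ?Z" using F2(2) by linarith
  then have "real (card F2) * u' <= B ^ 210 * Q" using cells_t unfolding u'_def by simp
  from chain[OF this Qu] have "real (card F2) * u' <= B ^ 226 * u" by (simp add: u_def)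
  from chain[OF this uu'] have "real (card F2) * u' <= B ^ 257 * u'" by simp
  then show ?thesis using u'0 by simp
 qed
 have finF: "finite F1" "finite F2" "finite F3"
  using finite_subset[OF F1(1)] finite_subset[OF F2(1)] finite_subset[OF F3(1)] finUV finUV' by auto
 let ?F = "F1 \<times> F2 \<times> F2 \<times> F3 \<times> F3 \<times> F3 \<times> F3"
 let ?c = "%(f, a, b, g1, g2, g3, g4). t q * of_int f + t q * of_int a - t q * of_int b + of_int (g1 - g2 - g3 + g4)"
 have step: "EX a0:F2. EX g1:F3. EX g2:F3. EX c1:V. EX d1:V. EX c2:V. EX d2:V.
   abs (t q * of_int a - (t q * of_int a0 + of_int (g1 - g2) + of_int (c1 + d2 - d1 - c2))) <= 1" if a: "a \<in> V'" for a
 proof -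
  obtain a0 where a0: "a0 \<in> F2" "?C a Int ?C a0 ~= {}" using F2(3) a cU'0 by blast
  then obtain s2 s1 where s: "s1 \<in> U'" "s2 \<in> U'" "?f s2 a = ?f s1 a0" by auto
  obtain g1 c1 d1 where g1: "g1 \<in> F3" "c1 \<in> V" "d1 \<in> V" "s1 = g1 + c1 - d1" using bspec[OF F3(3), of s1] s UV(1) by auto
  obtain g2 c2 d2 where g2: "g2 \<in> F3" "c2 \<in> V" "d2 \<in> V" "s2 = g2 + c2 - d2" using bspec[OF F3(3), of s2] s UV(1) by auto
  have "abs (t q * of_int a - (t q * of_int a0 + of_int (s1 - s2))) <= 1" using s(3) by linarith
  also have "of_int (s1 - s2) = real_of_int (g1 - g2) + of_int (c1 + d2 - d1 - c2)" unfolding g1 g2 by simp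
  finally show ?thesis using a0(1) g1(1-3) g2(1-3) by (auto simp: add.assoc intro!: bexI)
 qed
 have "covers V (t q) ((B ^ 789 * (B ^ 257 * (B ^ 257 * (B ^ 86 * (B ^ 86 * (B ^ 86 * B ^ 86)))))) * B ^ 727 * (2 * 2 + 2))"
 proof (rule cover_round[where F = ?F and c = ?c, OF _ _ four])
  show "finite ?F" using finF by auto
  show "real (card ?F) <= B ^ 789 * (B ^ 257 * (B ^ 257 * (B ^ 86 * (B ^ 86 * (B ^ 86 * B ^ 86)))))"
   unfolding card_cartesian_product of_nat_mult using B by (intro mult_mono cF1 cF2 cF3 mult_nonneg_nonneg) auto
  fix j assume "j \<in> V"
  then obtain f a b where f: "f \<in> F1" "a \<in> V'" "b \<in> V'" "j = f + a - b" using F1(3) by auto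
  obtain a0 g1 g2 c1 d1 c2 d2 where A: "a0 \<in> F2" "g1 \<in> F3" "g2 \<in> F3" "c1 \<in> V" "d1 \<in> V" "c2 \<in> V" "d2 \<in> V"
   "abs (t q * of_int a - (t q * of_int a0 + of_int (g1 - g2) + of_int (c1 + d2 - d1 - c2))) <= 1"
   using step[OF f(2)] by blast
  obtain b0 h1 h2 e1 f1 e2 f2 where C: "b0 \<in> F2" "h1 \<in> F3" "h2 \<in> F3" "e1 \<in> V" "f1 \<in> V" "e2 \<in> V" "f2 \<in> V"
   "abs (t q * of_int b - (t q * of_int b0 + of_int (h1 - h2) + of_int (e1 + f2 - f1 - e2))) <= 1"
   using step[OF f(3)] by blast
  let ?s = "(c1 + d2 + f1 + e2) - (d1 + c2 + e1 + f2)"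
  have mem: "(f, a0, b0, g1, g2, h1, h2) \<in> ?F" using f A C by simp
  have s: "?s \<in> diffset (nsum 4 V) (nsum 4 V)" using A C by (intro diff4)
  have "t q * of_int j - (?c (f, a0, b0, g1, g2, h1, h2) + of_int ?s)
   = (t q * of_int a - (t q * of_int a0 + of_int (g1 - g2) + of_int (c1 + d2 - d1 - c2)))
    - (t q * of_int b - (t q * of_int b0 + of_int (h1 - h2) + of_int (e1 + f2 - f1 - e2)))"
   unfolding f(4) by (simp add: algebra_simps)
  moreover have "abs (x - y) <= 2" if "abs x <= 1" "abs y <= 1" for x y :: real using that by simp
  ultimately have near: "abs (t q * of_int j - (?c (f, a0, b0, g1, g2, h1, h2) + of_int ?s)) <= 2"
   using A(8) C(8) by (simp only:)
  show "EX f:?F. EX s:diffset (nsum 4 V) (nsum 4 V). abs (t q * of_int j - (?c f + of_int s)) <= 2"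
   by (rule bexI[OF _ mem], rule bexI[OF _ s], rule near)
 qed (use B in auto)
 \<comment> \<open>The exponents add up to \<open>789 + 2 * 257 + 4 * 86 + 727 = 2374\<close>;
   \<open>3000\<close> is a round number above it.\<close>
 moreover have "(B ^ 789 * (B ^ 257 * (B ^ 257 * (B ^ 86 * (B ^ 86 * (B ^ 86 * B ^ 86)))))) * B ^ 727 * (2 * 2 + 2) <= B ^ 3000"
 proof -
  have "(B ^ 789 * (B ^ 257 * (B ^ 257 * (B ^ 86 * (B ^ 86 * (B ^ 86 * B ^ 86)))))) * B ^ 727 * (2 * 2 + 2) = 6 * B ^ 2374"
   by simp
  also have "... <= B ^ 1 * B ^ 2374" using const_pow(1) by simp
  also have "... = B ^ 2375" by (simp only: power_add[symmetric]) simp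
  also have "... <= B ^ 3000" by (rule B_pow) simp
  finally show ?thesis .
 qed
 ultimately show ?thesis by (rule covers_mono)
qed

end

section \<open>Ring growth against spread of the integer set\<close>

context incidence_base begin

text \<open>\<open>J\<close> is the \<open>V\<close> of \<open>bsg_sets\<close>, and
  \<open>R\<close> consists of the parameters of the points rich in the selected lines, together
  with \<open>0\<close> and \<open>1\<close>. \<open>R\<close> inherits the spread of
  \<open>P\<close> because on these points the inverse of \<open>t\<close> has Lipschitz constant at
  most \<open>B^2\<close>. \<open>J\<close> does not concentrate: each element has many neighbours
  in \<open>U\<close>, and \<open>fibre_bound\<close> limits the neighbours of one \<open>u\<close>
  in an interval.\<close>

lemma ring_data:
 obtains J R where "finite J" "J ~= {}" "four_cover J (B ^ 3000)" "card (sumset J (diffset J J)) <= B ^ 3000 * card J"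
  "card J <= B^2 * Q" "Q <= B ^ 24 * card J" "ALL H x. 1 <= H --> card {j \<in> J. abs (x - of_int j) < H} <= B ^ 12 * H powr tau"
  "finite R" "0 \<in> R" "1 \<in> R" "ALL s:R. covers J s (B ^ 3000) & abs s <= B ^ 3000"
  "ALL r. rho <= r --> r <= 1 --> r powr (- ppi) <= B ^ 3000 * ncell r R"
proof -
 obtain U V where U: "U <= X ` Lam2" and V: "V <= Y ` Lam2" and Qu: "Q <= B ^ 16 * card U" and Qv: "Q <= B ^ 24 * card V"
  and QLam: "Q * Q <= B ^ 23 * card {w \<in> Lam2. X w \<in> U & Y w \<in> V}" and sums: "card (sumset U V) <= B ^ 62 * Q"
  and deg: "!!v. v \<in> V ==> card U <= B ^ 9 * card {u \<in> U. (u, v) \<in> G}"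
  by (rule bsg_sets) (rule that)
 have finUV: "finite U" "finite V" using U V fin2 by (meson finite_imageI finite_subset)+
 have "0 < B ^ 16 * card U" "0 < B ^ 24 * card V" using Qu Qv Q_pos by linarith+
 then have ne: "U ~= {}" "V ~= {}" by auto
 have uv: "0 < real (card U)" "0 < real (card V)" using finUV ne by auto
 have vQ: "card V <= B^2 * Q"
 proof -
  have "card V <= card (Y ` Lam2)" using V fin2 by (intro card_mono) auto
  then show ?thesis using card_Y by simp
 qed
 have "card U <= card (X ` Lam2)" using U fin2 by (intro card_mono) auto
 then have "card U <= B ^ 1 * Q" using card_X by simp
 from chain[OF this Qv] have uv1: "card U <= B ^ 25 * card V" by simp
 have "card (sumset U V) <= B ^ 78 * card U" using chain[OF sums Qu] by simp
 then obtain F where F: "card (diffset (nsum 5 V) (nsum 4 V)) <= (B ^ 78) ^ 9 * card U"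
  "finite F" "card F * card V <= (B ^ 78) ^ 9 * card U"
  "ALL s:diffset (nsum 4 V) (nsum 4 V). EX g:F. EX a:V. EX b:V. s = g + a - b"
  by (rule sumset_cover[OF finUV(1) ne(1) finUV(2) ne(2)]) (rule that)
 have p702: "(B ^ 78) ^ 9 = B ^ 702" by simp
 have dbl: "card (diffset (nsum 5 V) (nsum 4 V)) <= B ^ 727 * card V"
  using chain[OF F(1)[unfolded p702] uv1] by simp
 have "card F * card V <= B ^ 727 * card V" using chain[OF F(3)[unfolded p702] uv1] by simp
 then have cF: "card F <= B ^ 727" using uv by simp
 have four: "four_cover V (B ^ 727)" unfolding four_cover_def using F(2,4) cF by auto
 let ?S = "{w \<in> Lam2. X w \<in> U & Y w \<in> V}"
 let ?P = "{q \<in> P. (ALL z:{p0, p1}. 1 / B < abs (q - z)) & card ?S <= 4 * L * card {w \<in> ?S. I w q}}"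
 have "0 < Q * Q" using Q_pos by simp
 then have "0 < B ^ 23 * card ?S" using QLam by simp
 then have S: "?S ~= {}" "?S <= Lam" using fin2 by (auto simp: zero_less_mult_iff card_gt_0_iff)
 have P: "card P <= 2 * L * card ?P" by (rule many_points[OF S(2,1)]) (auto simp: card_insert_if)
 have finP: "finite ?P" using fin by simp
 define R where "R = insert 0 (insert 1 (t ` ?P))"
 have b0: "1 <= B ^ 3000" using B by simp
 have cov: "covers V s (B ^ 3000) & abs s <= B ^ 3000" if "s \<in> R" for s
 proof -
  consider "s = 0" | "s = 1" | q where "q \<in> ?P" "s = t q" using \<open>s \<in> R\<close> by (auto simp: R_def)
  then show ?thesis
  proof cases
   case 1
   then show ?thesis using covers_0[OF finUV(2) ne(2) b0] by simp
  next
   case 2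
   then show ?thesis using covers_1[OF finUV(2) ne(2) b0] b0 by simp
  next
   case 3
   have q: "q \<in> P" "1 / B < abs (q - p0)" "1 / B < abs (q - p1)" "card ?S <= 4 * L * card {w \<in> ?S. I w q}"
    using 3(1) by auto
   have "covers V (t q) (B ^ 3000)"
    by (rule covers_good[OF U V Qu Qv QLam sums _ four q]) (use dbl in \<open>simp add: doubling_bound_def\<close>)
   moreover have "abs (t q) <= B ^ 3000" using t_bounds(2)[OF q(1-3)] B_pow[of 2 3000] by simp
   ultimately show ?thesis using 3 by simp
  qed
 qed
 have frost: "r powr (- ppi) <= B ^ 3000 * ncell r R" if r: "rho <= r" "r <= 1" for r
 proof -
  have r0: "r > 0" using r par by simp
  let ?K = "L * (B^2 * r) powr ppi * card P"
  have "real (card ?P) <= ncell r R * ?K"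
  proof (rule card_le_fibres[OF finP, of "%q. \<lfloor>t q / r\<rfloor>"])
   have "(%q. \<lfloor>t q / r\<rfloor>) ` ?P <= (%x. \<lfloor>x / r\<rfloor>) ` R" by (auto simp: R_def)
   moreover have "finite R" using finP by (simp add: R_def)
   ultimately show "card ((%q. \<lfloor>t q / r\<rfloor>) ` ?P) <= real (ncell r R)"
    unfolding ncell_def of_nat_le_iff by (intro card_mono) auto
   fix q assume q: "q \<in> ?P"
   have "{q' \<in> ?P. \<lfloor>t q' / r\<rfloor> = \<lfloor>t q / r\<rfloor>} <= P Int {q - B^2 * r..q + B^2 * r}"
   proof
    fix q' assume q': "q' \<in> {q' \<in> ?P. \<lfloor>t q' / r\<rfloor> = \<lfloor>t q / r\<rfloor>}"
    then have "abs (t q' - t q) < r" using same_cell[OF r0, of "t q'" "t q"] by simp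
    have PP: "q \<in> P" "q' \<in> P" "p1 ~= q" "p1 ~= q'" using q q' invB by auto
    have d: "abs (p1 - q) <= 1" "abs (p1 - q') <= 1" using dist_le PP p by auto
    have "t q' - t q = (q' - q) * (p1 - p0) / ((p1 - q') * (p1 - q) * theta)"
     using PP(3,4) by (simp add: t_def divide_simps) (simp add: algebra_simps)
    then have "abs (t q' - t q) * (abs (p1 - q') * abs (p1 - q) * abs (theta)) = abs (q' - q) * abs (p1 - p0)"
     using PP(3,4) theta(3) by (simp add: abs_mult)
    moreover have "abs (t q' - t q) * (abs (p1 - q') * abs (p1 - q) * abs (theta)) <= r * (1 * 1 * B)"
     using \<open>abs (t q' - t q) < r\<close> d theta by (intro mult_mono) auto
    moreover have "abs (q' - q) * (1 / B) <= abs (q' - q) * abs (p1 - p0)"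
     using p(4) by (intro mult_left_mono) (auto simp: abs_minus_commute)
    ultimately have "abs (q' - q) * (1 / B) <= r * B" by simp
    then have "abs (q' - q) <= B^2 * r" using invB by (simp add: pos_divide_le_eq power2_eq_square mult_ac)
    then show "q' \<in> P Int {q - B^2 * r..q + B^2 * r}" using PP by auto
   qed
   then have "card {q' \<in> ?P. \<lfloor>t q' / r\<rfloor> = \<lfloor>t q / r\<rfloor>} <= card (P Int {q - B^2 * r..q + B^2 * r})"
    using fin by (intro card_mono) auto
   moreover have "rho <= B^2 * r"
    using mult_mono[of 1 "B^2" rho r] B r par by simp
   ultimately show "real (card {q' \<in> ?P. \<lfloor>t q' / r\<rfloor> = \<lfloor>t q / r\<rfloor>}) <= ?K"
    using frostman[of "B^2 * r" q] by linarith
  qed (use L in auto)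
  then have "2 * L * real (card ?P) <= 2 * L * (ncell r R * ?K)" using L by simp
  with P have "real (card P) * 1 <= card P * (2 * L * L * (B^2 * r) powr ppi * ncell r R)" by (simp add: mult_ac)
  moreover have "0 < real (card P)" using fin by auto
  ultimately have "1 <= 2 * L * L * (B^2 * r) powr ppi * ncell r R" by simp
  also have "(B^2 * r) powr ppi = (B^2) powr ppi * r powr ppi" by (simp add: powr_mult)
  finally have "r powr (-ppi) * 1 <= r powr (-ppi) * (2 * L * L * ((B^2) powr ppi * r powr ppi) * ncell r R)"
   by (intro mult_left_mono) auto
  also have "... = (r powr (-ppi) * r powr ppi) * (2 * L * L * (B^2) powr ppi * ncell r R)" by simp
  also have "r powr (-ppi) * r powr ppi = 1" using r0 by (simp flip: powr_add)
  finally have "r powr (-ppi) <= (2 * L * L * (B^2) powr ppi) * ncell r R" by simp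
  also have "... <= B ^ 3000 * ncell r R"
  proof (intro mult_right_mono)
   have "(B^2) powr ppi <= (B^2) powr 1" using B par by (intro powr_mono) auto
   then have "2 * L * L * (B^2) powr ppi <= B ^ 1 * B ^ 2"
    using B_ge(1) B by (intro mult_mono) (auto simp: power2_eq_square)
   also have "... = B ^ 3" by (simp add: power2_eq_square power3_eq_cube)
   also have "... <= B ^ 3000" by (rule B_pow) simp
   finally show "2 * L * L * (B^2) powr ppi <= B ^ 3000" .
  qed simp
  finally show ?thesis .
 qed
 have conc: "card {v \<in> V. abs (x - of_int v) < H} <= B ^ 12 * H powr tau" if H: "1 <= H" for H x :: real
 proof -
  let ?V = "{v \<in> V. abs (x - of_int v) < H}"
  have fV: "finite ?V" using finUV by simp
  have "card ?V * real (card U) = (\<Sum>v\<in>?V. real (card U))" by simp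
  also have "... <= (\<Sum>v\<in>?V. B ^ 9 * real (card {u \<in> U. (u, v) \<in> G}))" using deg by (intro sum_mono) auto
  also have "... = B ^ 9 * (\<Sum>u\<in>U. real (card {v \<in> ?V. (u, v) \<in> G}))"
   unfolding sum_distrib_left[symmetric]
   using double_count[OF fV finUV(1), of "%v u. (u, v) \<in> G"] by (simp flip: of_nat_sum)
  also have "... <= B ^ 9 * (\<Sum>u\<in>U. B ^ 3 * H powr tau)"
  proof (intro mult_left_mono sum_mono)
   fix u assume "u \<in> U"
   let ?T = "{w \<in> Lam2. X w = u & abs (x - of_int (Y w)) < H}"
   have "{v \<in> ?V. (u, v) \<in> G} <= Y ` ?T" by (auto simp: G_def)
   then have "card {v \<in> ?V. (u, v) \<in> G} <= card ?T" using fin2 by (intro surj_card_le) auto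
   also have "real (card ?T) <= B ^ 3 * H powr tau" by (rule fibre_bound[of _ u x]) (use H in auto)
   finally show "real (card {v \<in> ?V. (u, v) \<in> G}) <= B ^ 3 * H powr tau" by simp
  qed (use B in auto)
  also have "... = (B ^ 9 * B ^ 3 * H powr tau) * card U" by simp
  also have "B ^ 9 * B ^ 3 = B ^ 12" by simp
  finally show ?thesis by (rule cancel_right) (rule uv)
 qed
 have p727: "c <= B ^ 727 ==> c <= B ^ 3000" for c using B_pow[of 727 3000] by simp
 show thesis
 proof (rule that[of V R])
  show "four_cover V (B ^ 3000)" using four p727 unfolding four_cover_def by auto
  have "B ^ 727 * real (card V) <= B ^ 3000 * real (card V)" by (intro mult_right_mono p727) auto
  moreover have "card (sumset V (diffset V V)) <= B ^ 727 * real (card V)"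
   using dbl card_shifted_sums(2)[OF finUV(2) ne(2)] by simp
  ultimately show "card (sumset V (diffset V V)) <= B ^ 3000 * card V" by simp
  show "finite R" "0 \<in> R" "1 \<in> R" using finP by (auto simp: R_def)
 qed (use finUV ne vQ Qv conc cov frost in auto)
qed

text \<open>Growth yields more than \<open>rho powr (- tau')\<close> cells of multipliers. All of
  them cover \<open>J\<close> with \<open>M = B ^ e\<close>, as each round of \<open>difprod\<close>
  raises the constant to the tenth power; but \<open>covers_separated_card\<close> leaves room for
  only about \<open>rho powr (- tau)\<close>.\<close>

lemma ring_contradiction:
 fixes m :: nat and a tau' :: real
 assumes growth: "!!R. finite R ==> 0 \<in> R ==> 1 \<in> R ==> ALL e:R. abs e <= B ^ 3000 ==>
   ALL r. rho <= r --> r <= 1 --> r powr (-ppi) <= B ^ 3000 * ncell r R ==> EX k<=m. rho powr (-tau') < ncell rho ((difprod ^^ k) R)"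
  and Ba: "B <= rho powr (- a)" "0 < a" and e: "e = 3000 * 10 ^ m"
  and a: "a * (38 + 2 * real e) <= tau" "tau + a * (4 + 2 * real e + (38 + 2 * real e) / tau) <= tau'"
 shows False
proof -
 obtain J R where J: "finite J" "J ~= {}" "four_cover J (B ^ 3000)" "card (sumset J (diffset J J)) <= B ^ 3000 * card J"
  "card J <= B^2 * Q" "Q <= B ^ 24 * card J" "ALL H x. 1 <= H --> card {j \<in> J. abs (x - of_int j) < H} <= B ^ 12 * H powr tau"
  and R: "finite R" "0 \<in> R" "1 \<in> R" "ALL s:R. covers J s (B ^ 3000) & abs s <= B ^ 3000"
  "ALL r. rho <= r --> r <= 1 --> r powr (- ppi) <= B ^ 3000 * ncell r R"
  by (rule ring_data) (rule that)
 obtain k where k: "k <= m" "rho powr (-tau') < ncell rho ((difprod ^^ k) R)"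
  using growth[OF R(1-3) _ R(5)] R(4) by auto
 let ?E = "(difprod ^^ k) R"
 have finE: "finite ?E" using difprod_pow[OF R(1-3), of "B ^ 3000" k] R(4) B by simp
 obtain D where D: "D <= ?E" "separated rho D" "ncell rho ?E <= 2 * card D"
  using separated_subset_exists[OF par(5) finE] by auto
 define M where "M = B ^ e"
 have M1: "1 <= M" using B by (simp add: M_def)
 have m10: "(10::nat) ^ 0 <= 10 ^ m" "(10::nat) ^ k <= 10 ^ m" using k by auto
 have M3: "B ^ 3000 <= M" unfolding M_def e by (intro B_pow) simp
 have b10: "10 <= B ^ 3000" using B_ge B_pow[of 1 3000] by simp
 have cov: "covers J s M" if "s \<in> D" for s
 proof -
  have "covers J s ((B ^ 3000) ^ (10 ^ k))"
   using covers_pow[OF J(1,2,3) b10, of R s k] R(4) D(1) that by auto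
  moreover have "(B ^ 3000) ^ (10 ^ k) <= M"
   unfolding M_def e power_mult[symmetric] using m10(2) by (intro B_pow) simp
  ultimately show ?thesis by (rule covers_mono)
 qed
 define E where "E = B ^ 38 * M^2"
 have Ee: "E = B ^ (38 + 2 * e)" by (simp add: E_def M_def power_add mult.commute flip: power_mult)
 have E0: "E > 0" using B by (simp add: Ee)
 have Bpw: "B ^ n <= rho powr (- (a * n))" for n
 proof -
  have "B ^ n <= (rho powr (- a)) ^ n" using Ba B by (intro power_mono) auto
  also have "... = rho powr (- (a * n))" using par by (simp add: powr_powr mult.commute flip: powr_realpow)
  finally show ?thesis .
 qed
 have EQ: "E <= Q"
 proof -
  have "E <= rho powr (- (a * real (38 + 2 * e)))" unfolding Ee by (rule Bpw)
  also have "... <= Q" using a(1) par by (intro powr_mono') auto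
  finally show ?thesis .
 qed
 \<comment> \<open>Chosen as large as the spread of \<open>J\<close> permits, from
   \<open>H powr tau = Q / E\<close>. Since \<open>Q = rho powr (- tau)\<close>, it is
   \<open>1 / rho\<close> up to the loss \<open>E powr (1 / tau)\<close>.\<close>
 define H where "H = (Q / E) powr (1 / tau)"
 have H1: "1 <= H" unfolding H_def using EQ E0 par by (intro ge_one_powr_ge_zero) auto
 have Ht: "H powr tau = Q / E" unfolding H_def using par E0 by (simp add: powr_powr)
 have Hr: "1 / (H * rho) = E powr (1 / tau)"
 proof -
  have "H = Q powr (1 / tau) / E powr (1 / tau)" unfolding H_def by (simp add: powr_divide)
  also have "Q powr (1 / tau) = rho powr (- tau * (1 / tau))" by (rule powr_powr)
  also have "- tau * (1 / tau) = - 1" using par by simp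
  also have "rho powr (- 1) = 1 / rho" using par by simp
  finally show ?thesis using par by simp
 qed
 have "card D <= 10 * M^2 * card J * (2 / (H * rho) + 2)"
 proof (rule covers_separated_card[OF J(1,2) M1 par(5)])
  show "0 < H" using H1 by simp
  have "B ^ 3000 * real (card J) <= M * real (card J)" using M3 by (intro mult_right_mono) auto
  then show "card (sumset J (diffset J J)) <= M * card J" using J(4) by simp
  show "finite D" using D finE finite_subset by auto
  show "10 * M^2 * card {j \<in> J. abs (x - of_int j) < H} <= card J" for x
  proof -
   have "10 * M^2 * card {j \<in> J. abs (x - of_int j) < H} <= (B * M^2) * (B ^ 12 * (Q / E))"
    using J(7) H1 B_ge unfolding Ht[symmetric] by (intro mult_mono) auto
   also have "... <= (B * M^2) * (B ^ 12 * ((B ^ 24 * card J) / E))"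
    using J(6) B E0 by (intro mult_left_mono divide_right_mono) auto
   also have "... = (B ^ 1 * B ^ 12 * B ^ 24) * M^2 * card J / E" by simp
   also have "B ^ 1 * B ^ 12 * B ^ 24 = B ^ 37" by (simp only: power_add[symmetric]) simp
   also have "B ^ 37 * M^2 * card J / E <= E * card J / E"
   proof (intro divide_right_mono mult_right_mono)
    show "B ^ 37 * M^2 <= E" unfolding E_def by (intro mult_right_mono B_pow) auto
   qed (use E0 in auto)
   also have "... = card J" using E0 by simp
   finally show ?thesis .
  qed
 qed (use D cov in auto)
 also have "2 / (H * rho) + 2 = 2 * E powr (1 / tau) + 2" using Hr by simp
 also have "... <= 4 * E powr (1 / tau)"
 proof -
  have "1 <= E" unfolding Ee using B by simp
  then have "1 <= E powr (1 / tau)" using par by (intro ge_one_powr_ge_zero) auto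
  then show ?thesis by simp
 qed
 finally have "card D <= 10 * M^2 * card J * (4 * E powr (1 / tau))" by (simp add: mult_left_mono)
 also have "... <= 10 * M^2 * (B^2 * Q) * (4 * E powr (1 / tau))" using J(5) by (intro mult_right_mono mult_left_mono) auto
 finally have "2 * real (card D) <= 80 * (M^2 * B^2 * Q * E powr (1 / tau))" by linarith
 also have "... <= B^2 * (M^2 * B^2 * Q * E powr (1 / tau))"
 proof (intro mult_right_mono)
  have "(12::real)^2 <= B^2" using B_ge by (intro power_mono) auto
  then show "80 <= B^2" by simp
 qed (use Q_pos B in auto)
 also have "... = B ^ (4 + 2 * e) * Q * E powr (1 / tau)"
  by (simp add: M_def power_add power_mult power_numeral_reduce power_mult_distrib)
 also have "... <= rho powr (- (a * (4 + 2 * e))) * Q * rho powr (- (a * (38 + 2 * e) / tau))"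
 proof (intro mult_mono)
  show "B ^ (4 + 2 * e) <= rho powr (- (a * (4 + 2 * e)))" using Bpw[of "4 + 2 * e"] by simp
  have "E powr (1 / tau) <= (rho powr (- (a * real (38 + 2 * e)))) powr (1 / tau)"
   using Bpw[of "38 + 2 * e"] E0 par unfolding Ee by (intro powr_mono2) auto
  then show "E powr (1 / tau) <= rho powr (- (a * (38 + 2 * e) / tau))" by (simp add: powr_powr)
 qed (use Q_pos B in auto)
 also have "... = rho powr (- (tau + a * (4 + 2 * real e + (38 + 2 * real e) / tau)))"
  by (simp add: algebra_simps flip: powr_add)
 also have "... <= rho powr (- tau')" using a(2) par by (intro powr_mono') auto
 finally have "2 * real (card D) <= rho powr (- tau')" .
 then show False using k(2) D(3) by simp
qed

end

text \<open>The projection theorem in contrapositive form: about \<open>rho powr (- 2 * tau)\<close>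
  lines cannot show only \<open>rho powr (- tau)\<close> heights at every point of a set of positive
  dimension \<open>ppi\<close>.\<close>

theorem no_incidence_data:
 fixes ppi tau :: real
 assumes pi: "0 < ppi" "ppi <= 1" and tau: "0 < tau" "tau < 1"
 shows "EX eta rho0. 0 < eta & 0 < rho0 & rho0 < 1 & (ALL rho L (Lam :: 'w set) P I kappa l. 0 < rho --> rho < rho0 --> 1 <= L --> L <= rho powr (-eta) -->
   ~ incidence_data Lam P I kappa l ppi tau rho L)"
proof -
 define tau' where "tau' = (1 + tau) / 2"
 have tau': "0 < tau'" "tau' < 1" using tau by (auto simp: tau'_def)
 obtain m etag rhog where g: "0 < etag" "0 < rhog" "rhog < 1" and growth: "ALL rho L R. 0 < rho --> rho < rhog --> 1 <= L --> L <= rho powr (-etag) -->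
   finite R --> 0 \<in> R --> 1 \<in> R --> (ALL e:R. abs e <= L) -->
   (ALL r. rho <= r --> r <= 1 --> r powr (-ppi) <= L * ncell r R) -->
   (EX k<=m. rho powr (-tau') < ncell rho ((difprod ^^ k) R))"
  using ring_growth[OF pi tau'] by auto
 define e where "e = (3000 * 10 ^ m :: nat)"
 define c1 c2 where "c1 = 38 + 2 * real e" and "c2 = 4 + 2 * real e + c1 / tau"
 have c: "0 < c1" "0 < c2" using tau by (auto simp: c1_def c2_def add_pos_nonneg)
 \<comment> \<open>\<open>B\<close> will be at most \<open>rho powr (- a)\<close>. The exponent must
   be small against the tolerance \<open>etag\<close> of \<open>ring_growth\<close>, used with
   \<open>L = B ^ 3000\<close>, and against the gap between \<open>tau\<close> and
   \<open>tau'\<close>.\<close>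
 define a where "a = min 1 (min (etag / 3000) (min (tau / c1) ((1 - tau) / 2 / c2)))"
 have "0 < a" using g c tau by (auto simp: a_def)
 moreover have "a <= 1" "a <= etag / 3000" "a <= tau / c1" "a <= (1 - tau) / 2 / c2"
  unfolding a_def min_le_iff_disj by auto
 ultimately have a: "0 < a" "a <= 1" "a <= etag / 3000" "a <= tau / c1" "a <= (1 - tau) / 2 / c2" by auto
 have a1: "a * c1 <= tau" using a(4) c by (simp add: pos_le_divide_eq)
 have "a * c2 <= (1 - tau) / 2" using a(5) c by (simp only: pos_le_divide_eq)
 then have a2: "tau + a * c2 <= tau'" unfolding tau'_def by simp
 define eta where "eta = a * ppi / 4"
 define rho0 where "rho0 = min rhog (12 powr (- 2 / (a * ppi)))"
 have ap: "0 < a * ppi" using a pi by simp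
 show ?thesis
 proof (rule exI[of _ eta], rule exI[of _ rho0], intro conjI allI impI)
  show "0 < eta" "0 < rho0" "rho0 < 1" using ap g by (auto simp: eta_def rho0_def)
  fix rho L :: real and Lam :: "'w set" and P I kappa l
  assume rho: "0 < rho" "rho < rho0" and L: "1 <= L" "L <= rho powr (-eta)"
  have rho1: "rho < rhog" "rho <= 1" "rho <= 12 powr (- 2 / (a * ppi))" using rho g by (auto simp: rho0_def)
  define B where "B = (12 * L^2) powr (1 / ppi)"
  have L12: "1 <= 12 * L^2" using one_le_power[OF L(1), of 2] by simp
  have B1: "1 <= B" unfolding B_def using L12 pi by (intro ge_one_powr_ge_zero) auto
  have Bp: "B powr ppi = 12 * L^2" unfolding B_def using pi by (simp add: powr_powr)
  have "(12 powr (- 2 / (a * ppi))) powr (- (a * ppi / 2)) <= rho powr (- (a * ppi / 2))"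
   using rho rho1 ap by (intro powr_mono2') auto
  then have 12: "12 <= rho powr (- (a * ppi / 2))" using a pi by (simp add: powr_powr)
  have "L * L <= rho powr (-eta) * rho powr (-eta)" using L by (intro mult_mono) auto
  then have "L^2 <= rho powr (- (a * ppi / 2))" by (simp add: power2_eq_square eta_def mult.commute flip: powr_add)
  then have "12 * L^2 <= rho powr (- (a * ppi / 2)) * rho powr (- (a * ppi / 2))" using 12 by (intro mult_mono) auto
  then have "12 * L^2 <= rho powr (- (a * ppi))" by (simp add: mult.commute flip: powr_add)
  then have "B <= (rho powr (- (a * ppi))) powr (1 / ppi)" unfolding B_def using pi by (intro powr_mono2) auto
  then have Ba: "B <= rho powr (- a)" using pi by (simp add: powr_powr)
  have "rho powr (- a) <= rho powr (- 1)" using rho rho1 a by (intro powr_mono') auto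
  then have Br: "B <= 1 / rho" using Ba rho by simp
  show "~ incidence_data Lam P I kappa l ppi tau rho L"
  proof
   assume "incidence_data Lam P I kappa l ppi tau rho L"
   then interpret incidence Lam P I kappa l ppi tau rho L B
    by unfold_locales (use L pi tau rho rho1 B1 Bp Br in auto)
   obtain p0 p1 p2 where p: "p0 \<in> P" "p1 \<in> P" "p2 \<in> P" "1 / B < abs (p0 - p1)" "1 / B < abs (p0 - p2)" "1 / B < abs (p1 - p2)"
    "card Lam <= 64 * L ^ 3 * card {w \<in> Lam. I w p0 & I w p1 & I w p2}" "{w \<in> Lam. I w p0 & I w p1 & I w p2} ~= {}"
    by (rule three_points) (rule that)
   interpret incidence_base Lam P I kappa l ppi tau rho L B p0 p1 p2
    by unfold_locales (rule p)+
   have "B ^ 3000 <= (rho powr (- a)) ^ 3000" using Ba B1 by simp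
   also have "... = rho powr (- (a * 3000))" using rho by (simp add: powr_powr mult.commute flip: powr_realpow)
   also have "... <= rho powr (- etag)" using a(3) rho rho1 by (intro powr_mono') auto
   finally have B3: "B ^ 3000 <= rho powr (- etag)" .
   have B31: "1 <= B ^ 3000" using B1 by simp
   show False
    by (rule ring_contradiction[of m tau' a e])
     (use growth rho rho1 B31 B3 Ba a a1 a2 in \<open>auto simp: e_def c1_def c2_def\<close>)
  qed
 qed
qed

subsection \<open>Tubes spanned by pairs of points\<close>

definition slope :: "(real \<times> real) \<times> (real \<times> real) => real" where
 "slope w = (snd (snd w) - snd (fst w)) / (fst (snd w) - fst (fst w))"

definition icpt :: "(real \<times> real) \<times> (real \<times> real) => real" where
 "icpt w = snd (fst w) - slope w * fst (fst w)"

text \<open>Only the scales \<open>l powr (- j)\<close> with \<open>j <= J\<close> are used. The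
  lower bounds on \<open>l\<close> make absolute constants up to \<open>400\<close>, the factors
  polynomial in \<open>J\<close> that occur, and the number of mass profiles smaller than
  \<open>l\<close>, so losses become shifts of exponents. \<open>c1\<close> makes it unlikely that
  two random points are horizontally closer than \<open>l powr (- c1)\<close>.\<close>

locale cloud =
 fixes A :: "real set" and l :: real and J c1 :: nat and sgm tau :: real
 assumes A: "finite A" "A ~= {}" "A <= {0..1}"
  and l: "100 * (real J + 2)^2 <= l"
  and l_pow: "(5 * real J + 2) ^ (J + 2) <= l" and c1: "c1 <= J"
  and par: "0 < tau" "tau < 2 * sgm" "2 * sgm <= 1" "4 <= sgm * c1"
  and frost: "!!x j. j <= J ==> card (A Int {x - l powr (- real j)..x + l powr (- real j)}) <= l powr (1 - sgm * j) * card A"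
begin

abbreviation E :: "real => real" where "E y == l powr y"
definition X where "X = A \<times> A"
definition mu :: "(real \<times> real) set => real" where "mu S = real (card (X Int S)) / real (card X)"
definition nb :: "real \<times> real => real => (real \<times> real) set" where
 "nb q r = {q'. abs (fst q' - fst q) <= r & abs (snd q' - snd q) <= r}"
definition tube :: "(real \<times> real) \<times> (real \<times> real) => real => (real \<times> real) set" where
 "tube w r = {q. abs (snd q - slope w * fst q - icpt w) <= r}"

lemma l_ge: "400 <= l" "real J + 2 <= l" "100 * (real J + 2) <= l" "1 < l"
proof -
 have "2 * 2 <= (real J + 2)^2" "(real J + 2) * 1 <= (real J + 2)^2"
  unfolding power2_eq_square by (intro mult_mono; simp)+
 then have 1: "400 <= 100 * (real J + 2)^2" "100 * (real J + 2) <= 100 * (real J + 2)^2" by auto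
 show 2: "400 <= l" by (rule order_trans[OF 1(1) l])
 show 3: "100 * (real J + 2) <= l" by (rule order_trans[OF 1(2) l])
 show "real J + 2 <= l" using 3 by simp
 show "1 < l" using 2 by simp
qed

lemma l_ne [simp]: "l ~= 0" "0 < l" using l_ge(4) by auto
lemma E_add: "E x * E y = E (x + y)" by (simp add: powr_add)
lemma E_mono: "x <= y ==> E x <= E y" using l_ge by simp
lemma E_pos: "E x > 0" by simp
lemma E_1: "E 1 = l" using l_ge by simp
lemma E_ge_1: "0 <= x ==> 1 <= E x" using E_mono[of 0 x] by simp
lemma E_cong: "x = y ==> E x = E y" by simp
lemma E_le_imp: "E x <= E y ==> x <= y" using l_ge powr_less_mono[of y x l] by simp
lemma E_const: "c <= 400 ==> c * E y <= E (y + 1)"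
proof -
 assume "c <= 400"
 then have "c * E y <= E 1 * E y" using l_ge by simp
 then show ?thesis unfolding E_add by (simp add: add.commute)
qed
lemma E_J: "(real J + 2) * E y <= E (y + 1)"
proof -
 have "(real J + 2) * E y <= E 1 * E y" using l_ge by simp
 then show ?thesis unfolding E_add by (simp add: add.commute)
qed
lemma E_sum4: "a <= y ==> b <= y ==> c <= y ==> d <= y ==> E a + E b + E c + E d <= E (y + 1)"
 using E_mono[of a y] E_mono[of b y] E_mono[of c y] E_mono[of d y] E_const[of 4 y] by simp
lemma E_div: "E x / E y = E (x - y)" by (simp add: powr_diff)

lemma finX [simp]: "finite X" using A by (simp add: X_def)
lemma X_ne: "X ~= {}" "0 < real (card X)" using A by (auto simp: X_def)
lemma cardX: "real (card X) = (real (card A))^2" by (simp add: X_def card_cartesian_product power2_eq_square)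
lemma X_unit: "q \<in> X ==> 0 <= fst q & fst q <= 1 & 0 <= snd q & snd q <= 1" using A by (auto simp: X_def)

lemma mu_mono: "S Int X <= T ==> mu S <= mu T"
 unfolding mu_def by (intro divide_right_mono of_nat_mono card_mono) auto
lemma mu_le_1: "mu S <= 1" unfolding mu_def using X_ne by (simp add: card_mono)
lemma mu_nonneg: "0 <= mu S" by (simp add: mu_def)
lemma mu_Un: "mu (S Un T) <= mu S + mu T"
 unfolding mu_def Int_Un_distrib add_divide_distrib[symmetric] of_nat_add[symmetric] by (intro divide_right_mono of_nat_mono card_Un_le) simp
lemma mu_card: "real (card (X Int S)) = mu S * card X" by (simp add: mu_def)
lemma mu_X: "X <= S ==> mu S = 1" using X_ne by (simp add: mu_def Int_absorb2)

lemma mu_UN_disjoint: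
 assumes "finite S" "!!s t. s \<in> S ==> t \<in> S ==> s ~= t ==> X Int f s Int f t = {}"
 shows "mu (\<Union>s\<in>S. f s) = (\<Sum>s\<in>S. mu (f s))"
proof -
 have "card (X Int (\<Union>s\<in>S. f s)) = card (\<Union>s\<in>S. X Int f s)" by simp
 also have "... = (\<Sum>s\<in>S. card (X Int f s))" using assms by (intro card_UN_disjoint) auto
 finally show ?thesis by (simp add: mu_def sum_divide_distrib)
qed

text \<open>Double counting of points against sets; it gives the upper bounds on numbers of boxes
  and tubes below.\<close>

lemma packing:
 fixes m M :: real
 assumes S: "finite S" and ov: "!!x. x \<in> X ==> real (card {s \<in> S. x \<in> f s}) <= M"
  and m: "!!s. s \<in> S ==> m <= mu (f s)" and Z: "!!s. s \<in> S ==> X Int f s <= Z"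
 shows "card S * m <= M * mu Z"
proof -
 have "card S * (m * card X) = (\<Sum>s\<in>S. m * card X)" by simp
 also have "... <= (\<Sum>s\<in>S. real (card {x \<in> X Int Z. x \<in> f s}))"
 proof (intro sum_mono)
  fix s assume s: "s \<in> S"
  have "m * card X <= mu (f s) * card X" using m[OF s] by (intro mult_right_mono) auto
  also have "... = real (card {x \<in> X Int Z. x \<in> f s})"
   unfolding mu_card[symmetric] using Z[OF s] by (intro arg_cong[of _ _ "%S. real (card S)"]) auto
  finally show "m * card X <= real (card {x \<in> X Int Z. x \<in> f s})" .
 qed
 also have "... = (\<Sum>x\<in>X Int Z. real (card {s \<in> S. x \<in> f s}))"
  using double_count[OF S, of "X Int Z" "%s x. x \<in> f s"] by (simp flip: of_nat_sum)
 also have "... <= (\<Sum>x\<in>X Int Z. M)" using ov by (intro sum_mono) auto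
 also have "... = mu Z * card X * M" unfolding mu_card[symmetric] by simp
 finally have "(card S * m) * card X <= (M * mu Z) * card X" by (simp add: mult_ac)
 then show ?thesis using X_ne by simp
qed

lemma nb_ge_1: "q \<in> X ==> 1 <= r ==> mu (nb q r) = 1"
proof (rule mu_X)
 assume q: "q \<in> X" "1 <= r"
 show "X <= nb q r" using X_unit[OF q(1)] q(2) X_unit by (fastforce simp: nb_def)
qed

lemma mu_strip:
 assumes "j <= J"
 shows "mu {q. abs (fst q - x) <= E (- real j)} <= E (1 - sgm * j)"
proof -
 have "X Int {q. abs (fst q - x) <= E (- real j)} = (A Int {x - E (- real j)..x + E (- real j)}) \<times> A"
  by (auto simp: X_def)
 then have "real (card (X Int {q. abs (fst q - x) <= E (- real j)})) = card (A Int {x - E (- real j)..x + E (- real j)}) * real (card A)"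
  by (simp only: card_cartesian_product of_nat_mult)
 also have "... <= (E (1 - sgm * j) * card A) * card A" using frost[OF assms] by (intro mult_right_mono) auto
 finally show ?thesis using X_ne unfolding mu_def cardX by (simp add: pos_divide_le_eq power2_eq_square)
qed

lemma mu_nb:
 assumes "j <= J"
 shows "mu (nb q (E (- real j))) <= E (2 - 2 * sgm * j)"
proof -
 let ?r = "E (- real j)"
 have "X Int nb q ?r = (A Int {fst q - ?r..fst q + ?r}) \<times> (A Int {snd q - ?r..snd q + ?r})"
  by (auto simp: X_def nb_def)
 then have "real (card (X Int nb q ?r)) = real (card (A Int {fst q - ?r..fst q + ?r})) * card (A Int {snd q - ?r..snd q + ?r})"
  by (simp only: card_cartesian_product of_nat_mult)
 also have "... <= (E (1 - sgm * j) * card A) * (E (1 - sgm * j) * card A)" using frost[OF assms] by (intro mult_mono) auto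
 also have "... = (E (1 - sgm * j) * E (1 - sgm * j)) * (real (card A))^2" by (simp add: power2_eq_square)
 also have "E (1 - sgm * j) * E (1 - sgm * j) = E (2 - 2 * sgm * j)" unfolding E_add by (simp add: algebra_simps)
 finally show ?thesis using X_ne unfolding mu_def cardX by (simp add: pos_divide_le_eq)
qed

text \<open>A point where the mass drops by more than \<open>l\<^sup>-\<^sup>5\<close> from one scale to the next lies in a light
  cell of side \<open>E (- (j + 1))\<close>, and at most about \<open>l\<^sup>2\<close> such cells meet the larger neighbourhood.\<close>

lemma jump_points:
 assumes j: "j < J"
 shows "mu {q \<in> X. mu (nb q (E (- real (Suc j)))) < E (- 5) * mu (nb q (E (- real j)))} <= E (- 2)"
proof -
 let ?r = "E (- real j)" and ?s = "E (- real (Suc j))"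
 have rs: "?r = l * ?s" using l_ge by (simp add: powr_diff powr_minus field_simps)
 define B where "B = {q \<in> X. mu (nb q ?s) < E (- 5) * mu (nb q ?r)}"
 have fB: "finite B" by (simp add: B_def)
 let ?c = "%q. (\<lfloor>fst q / ?s\<rfloor>, \<lfloor>snd q / ?s\<rfloor>)"
 define rep where "rep = inv_into B ?c"
 let ?Z = "?c ` B"
 have rep: "rep z \<in> B" "?c (rep z) = z" if "z \<in> ?Z" for z
  using that unfolding rep_def by (rule inv_into_into, rule f_inv_into_f)
 have "mu B <= mu (\<Union>z\<in>?Z. {q \<in> B. ?c q = z})" by (intro mu_mono) auto
 also have "... = (\<Sum>z\<in>?Z. mu {q \<in> B. ?c q = z})" using fB by (intro mu_UN_disjoint) auto
 also have "... <= (\<Sum>z\<in>?Z. E (- 5) * mu (nb (rep z) ?r))"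
 proof (intro sum_mono)
  fix z assume z: "z \<in> ?Z"
  have "{q \<in> B. ?c q = z} Int X <= nb (rep z) ?s"
  proof
   fix q assume q: "q \<in> {q \<in> B. ?c q = z} Int X"
   then have "?c q = ?c (rep z)" using rep(2)[OF z] by simp
   then have "abs (fst q - fst (rep z)) < ?s" "abs (snd q - snd (rep z)) < ?s"
    using same_cell[OF E_pos] by auto
   then show "q \<in> nb (rep z) ?s" by (simp add: nb_def)
  qed
  then have "mu {q \<in> B. ?c q = z} <= mu (nb (rep z) ?s)" by (rule mu_mono)
  also have "... <= E (- 5) * mu (nb (rep z) ?r)" using rep(1)[OF z] by (simp add: B_def)
  finally show "mu {q \<in> B. ?c q = z} <= E (- 5) * mu (nb (rep z) ?r)" .
 qed
 also have "... = E (- 5) * (\<Sum>z\<in>?Z. mu (nb (rep z) ?r))" by (simp only: sum_distrib_left)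
 also have "(\<Sum>z\<in>?Z. mu (nb (rep z) ?r)) <= E 3"
 proof -
  have "(\<Sum>z\<in>?Z. mu (nb (rep z) ?r)) * card X = (\<Sum>z\<in>?Z. real (card {q \<in> X. q \<in> nb (rep z) ?r}))"
   unfolding sum_distrib_right mu_card[symmetric] by (simp add: Int_def)
  also have "... = (\<Sum>q\<in>X. real (card {z \<in> ?Z. q \<in> nb (rep z) ?r}))"
   using double_count[of ?Z X "%z q. q \<in> nb (rep z) ?r"] fB by (simp flip: of_nat_sum)
  also have "... <= (\<Sum>q\<in>X. E 3)"
  proof (intro sum_mono)
   fix q
   let ?T = "{z \<in> ?Z. q \<in> nb (rep z) ?r}"
   let ?I = "%a. (%x. \<lfloor>x / ?s\<rfloor>) ` {x. a - ?r <= x & x <= a + ?r}"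
   have I: "finite (?I a) & real (card (?I a)) <= 2 * l + 2" for a
   proof
    have "?I a <= {\<lfloor>(a - ?r) / ?s\<rfloor>..\<lfloor>(a + ?r) / ?s\<rfloor>}"
     by (auto intro!: floor_mono divide_right_mono)
    then show "finite (?I a)" by (rule finite_subset) simp
    have "real (card (?I a)) <= ((a + ?r) - (a - ?r)) / ?s + 2"
     by (rule card_floor_interval) (simp_all add: E_pos less_imp_le[OF E_pos])
    also have "((a + ?r) - (a - ?r)) / ?s = 2 * l" proof -
     have "l ~= 0" by simp
     then show ?thesis unfolding rs by simp
    qed
    finally show "real (card (?I a)) <= 2 * l + 2" .
   qed
   have "?T <= ?I (fst q) \<times> ?I (snd q)"
   proof
    fix z assume z: "z \<in> ?T"
    then obtain p where p: "q \<in> nb p ?r" "z = ?c p" using rep(2)[of z] by fastforce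
    have "fst p \<in> {x. fst q - ?r <= x & x <= fst q + ?r}" "snd p \<in> {x. snd q - ?r <= x & x <= snd q + ?r}"
     using p(1) by (auto simp: nb_def)
    then show "z \<in> ?I (fst q) \<times> ?I (snd q)" unfolding p(2) by simp
   qed
   then have "card ?T <= card (?I (fst q) \<times> ?I (snd q))" using I by (intro card_mono) auto
   then have "real (card ?T) <= real (card (?I (fst q))) * real (card (?I (snd q)))"
    by (simp add: card_cartesian_product flip: of_nat_mult)
   also have "... <= (2 * l + 2) * (2 * l + 2)" using I by (intro mult_mono) (auto intro: order_trans[OF of_nat_0_le_iff])
   also have "... <= (3 * l) * (3 * l)" using l_ge by (intro mult_mono) auto
   also have "... <= l * (l * l)" using l_ge by simp
   also have "... = E 3" using l_ge by (simp add: power3_eq_cube)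
   finally show "real (card ?T) <= E 3" .
  qed
  finally have "(\<Sum>z\<in>?Z. mu (nb (rep z) ?r)) * card X <= E 3 * card X" by (simp add: mult.commute)
  then show ?thesis using X_ne by simp
 qed
 also have "E (- 5) * E 3 = E (- 2)" unfolding E_add by simp
 finally show ?thesis using E_pos[of "-5"] unfolding B_def by simp
qed

lemma slope_swap: "slope (p, q) = slope (q, p)"
proof -
 have "(snd q - snd p) / (fst q - fst p) = (- (snd q - snd p)) / (- (fst q - fst p))" by (simp only: minus_divide_divide)
 then show ?thesis by (simp add: slope_def)
qed

lemma icpt_swap: "fst p ~= fst q ==> icpt (p, q) = icpt (q, p)"
proof -
 assume "fst p ~= fst q"
 then have "slope (q, p) * (fst p - fst q) = snd p - snd q" by (simp add: slope_def)
 then show ?thesis unfolding icpt_def slope_swap[of p q] by (simp add: algebra_simps)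
qed

lemma tube_swap: "fst p ~= fst q ==> tube (p, q) r = tube (q, p) r"
 by (simp add: tube_def slope_swap[of p q] icpt_swap)

lemma slope_bound:
 assumes "p \<in> X" "q \<in> X" "E (- real c) <= abs (fst p - fst q)"
 shows "abs (slope (p, q)) <= E (real c)"
proof -
 have "abs (slope (p, q)) = abs (snd q - snd p) / abs (fst q - fst p)" by (simp add: slope_def)
 also have "... <= 1 / E (- real c)"
  using X_unit[OF assms(1)] X_unit[OF assms(2)] assms(3) by (intro frac_le) (auto simp: abs_le_iff abs_minus_commute)
 also have "... = E (real c)" by (simp add: powr_minus_divide)
 finally show ?thesis .
qed

lemma line_through: "fst p ~= fst q ==> snd q - slope (p, q) * fst q - icpt (p, q) = 0"
 "snd q' - slope (p, q) * fst q' - icpt (p, q) = (snd q' - snd p) - slope (p, q) * (fst q' - fst p)"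
proof -
 show 2: "snd q' - slope (p, q) * fst q' - icpt (p, q) = (snd q' - snd p) - slope (p, q) * (fst q' - fst p)" for q'
  by (simp add: icpt_def algebra_simps)
 show "fst p ~= fst q ==> snd q - slope (p, q) * fst q - icpt (p, q) = 0"
  unfolding 2 by (simp add: slope_def)
qed

end

section \<open>Pinned tubes, exceptional pairs and mass profiles\<close>

context cloud begin

text \<open>In \<open>kauf\<close> the first point of the pair is fixed: averaging the mass of the tube in an annulus over the
second point loses only a constant power of \<open>l\<close>, since thin tubes through the first point are almost disjoint there.\<close>

definition ann where "ann q h = nb q (E (- real h)) - nb q (E (- real (Suc h)))"
definition sepx where "sepx w \<longleftrightarrow> E (- real c1) <= abs (fst (fst w) - fst (snd w))"
definition thin where "thin w \<longleftrightarrow> (ALL j<=J. mu (tube w (E (- real j))) <= E (1 - tau * j))"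
definition tight where "tight w \<longleftrightarrow> E (- 1 - tau * J) <= mu (tube w (E (- real J)))"
definition kauf where
 "kauf w \<longleftrightarrow> (ALL h j. h + 2 <= j --> j <= J -->
   mu (tube w (E (- real j)) Int ann (fst w) h) <= E (7 + real c1 - tau * (real j - real h)) * mu (nb (fst w) (E (- real h))))"
definition tame where
 "tame q \<longleftrightarrow> (ALL j<J. E (- 5) * mu (nb q (E (- real j))) <= mu (nb q (E (- real (Suc j)))))"
definition prof where "prof q j = nat \<lfloor>- log l (mu (nb q (E (- real j))))\<rfloor>"

lemma mu_nb_pos: "q \<in> X ==> 0 <= r ==> 0 < mu (nb q r)"
proof -
 assume "q \<in> X" "0 <= r"
 then have "q \<in> X Int nb q r" by (simp add: nb_def)
 then have "card (X Int nb q r) > 0" by (metis card_gt_0_iff empty_iff finX finite_Int)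
 then show ?thesis using X_ne by (simp add: mu_def)
qed

text \<open>Both lines pass through \<open>q\<close> and within \<open>E (- j)\<close> of
  \<open>x\<close>. Since slopes are at most \<open>E c1\<close>, leaving the inner box means that
  \<open>x\<close> is horizontally at least \<open>E (- h - 2 - c1)\<close> from \<open>q\<close>.
  So the slopes nearly agree, and \<open>p\<close>, on one line, is close to the other.\<close>

lemma pinned_sector:
 assumes q: "q \<in> X" "p \<in> X" "p' \<in> X" "sepx (q, p)" "sepx (q, p')" and hj: "h + 2 <= j"
  and x: "x \<in> X" "x \<in> ann q h" "x \<in> tube (q, p) (E (- real j))" "x \<in> tube (q, p') (E (- real j))"
 shows "p \<in> tube (q, p') (E (- (real j - real h - 3 - real c1)))"
proof -
 have sl: "abs (slope (q, p)) <= E (real c1)" "abs (slope (q, p')) <= E (real c1)"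
  using slope_bound[OF q(1,2)] slope_bound[OF q(1,3)] q(4,5) by (simp_all add: sepx_def)
 define dx dy where "dx = fst x - fst q" and "dy = snd x - snd q"
 have t: "abs (dy - slope (q, p) * dx) <= E (- real j)" "abs (dy - slope (q, p') * dx) <= E (- real j)"
  using x(3,4) unfolding tube_def line_through(2) by (simp_all add: dx_def dy_def)
 have dxl: "E (- real h - 2 - real c1) <= abs dx"
 proof (rule ccontr)
  assume "~ ?thesis"
  then have d: "abs dx <= E (- real h - 2 - real c1)" by simp
  have "abs (slope (q, p) * dx) <= E (real c1) * E (- real h - 2 - real c1)"
   unfolding abs_mult using sl d by (intro mult_mono) auto
  also have "... = E (- real h - 2)" unfolding E_add by simp
  finally have "abs (slope (q, p) * dx) <= E (- real h - 2)" .
  moreover have "E (- real j) <= E (- real h - 2)" using hj by (intro E_mono) linarith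
  ultimately have "abs dy <= 2 * E (- real h - 2)" using t(1) by simp
  also have "... <= E (- real h - 2 + 1)" by (rule E_const) simp
  also have "- real h - 2 + 1 = - real (Suc h)" by simp
  finally have "abs dy <= E (- real (Suc h))" .
  moreover have "E (- real h - 2 - real c1) <= E (- real (Suc h))" by (intro E_mono) simp
  ultimately have "x \<in> nb q (E (- real (Suc h)))" using d by (simp add: nb_def dx_def dy_def)
  then show False using x(2) by (simp add: ann_def)
 qed
 have "abs ((slope (q, p) - slope (q, p')) * dx) <= 2 * E (- real j)" using t by (simp add: algebra_simps)
 then have "abs (slope (q, p) - slope (q, p')) * abs dx <= 2 * E (- real j)" by simp
 moreover have "abs (slope (q, p) - slope (q, p')) * E (- real h - 2 - real c1) <= abs (slope (q, p) - slope (q, p')) * abs dx"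
  using dxl by (intro mult_left_mono) auto
 ultimately have "abs (slope (q, p) - slope (q, p')) * E (- real h - 2 - real c1) <= 2 * E (- real j)" by simp
 then have "abs (slope (q, p) - slope (q, p')) <= 2 * E (- real j) / E (- real h - 2 - real c1)" by (simp add: pos_le_divide_eq)
 also have "... = 2 * E (- real j + real h + 2 + real c1)" unfolding times_divide_eq_right[symmetric] E_div by (simp add: algebra_simps)
 also have "... <= E (- real j + real h + 2 + real c1 + 1)" by (rule E_const) simp
 also have "- real j + real h + 2 + real c1 + 1 = - (real j - real h - 3 - real c1)" by simp
 finally have ds: "abs (slope (q, p) - slope (q, p')) <= E (- (real j - real h - 3 - real c1))" .
 have ne: "fst q ~= fst p" using q(4) by (auto simp: sepx_def)
 have "snd p - snd q = slope (q, p) * (fst p - fst q)" using ne by (simp add: slope_def)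
 then have "(snd p - snd q) - slope (q, p') * (fst p - fst q) = (slope (q, p) - slope (q, p')) * (fst p - fst q)"
  by (simp add: algebra_simps)
 moreover have "abs (fst p - fst q) <= 1" using X_unit[OF q(1)] X_unit[OF q(2)] by auto
 ultimately have "abs ((snd p - snd q) - slope (q, p') * (fst p - fst q)) <= E (- (real j - real h - 3 - real c1)) * 1"
  using ds by (simp only: abs_mult) (intro mult_mono, auto)
 then show ?thesis unfolding tube_def line_through(2) by simp
qed

text \<open>For \<open>x\<close> in the annulus, the \<open>p\<close> whose tube through
  \<open>q\<close> contains \<open>x\<close> all lie in one wider tube, which is thin. Summing over
  \<open>x\<close> bounds the average over \<open>p\<close> of the tube mass in the annulus, and
  Markov's inequality bounds the exceptional \<open>p\<close>. If \<open>j\<close> is too close to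
  \<open>h\<close> the trivial bound suffices.\<close>

lemma kaufman_bad:
 assumes q: "q \<in> X" and hj: "h + 2 <= j" "j <= J"
 shows "card {p \<in> X. sepx (q, p) & thin (q, p) &
  ~ mu (tube (q, p) (E (- real j)) Int ann q h) <= E (7 + real c1 - tau * (real j - real h)) * mu (nb q (E (- real h)))} <= E (- 3) * card X"
proof -
 let ?t = "%p. tube (q, p) (E (- real j))" and ?e = "tau * (real j - real h)" and ?m = "mu (nb q (E (- real h)))"
 define S where "S = {p \<in> X. sepx (q, p) & thin (q, p) & ~ mu (?t p Int ann q h) <= E (7 + real c1 - ?e) * ?m}"
 have fS: "finite S" by (simp add: S_def)
 have m: "?m > 0" using q by (intro mu_nb_pos) (auto intro: less_imp_le)
 let ?Y = "X Int ann q h"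
 have "card S * (E (7 + real c1 - ?e) * ?m * card X) = (\<Sum>p\<in>S. E (7 + real c1 - ?e) * ?m * card X)" by simp
 also have "... <= (\<Sum>p\<in>S. real (card {x \<in> ?Y. x \<in> ?t p}))"
 proof (intro sum_mono)
  fix p assume "p \<in> S"
  then have "E (7 + real c1 - ?e) * ?m * card X <= mu (?t p Int ann q h) * card X"
   by (intro mult_right_mono) (auto simp: S_def)
  also have "... = real (card {x \<in> ?Y. x \<in> ?t p})" unfolding mu_card[symmetric] by (rule arg_cong[of _ _ "%S. real (card S)"]) auto
  finally show "E (7 + real c1 - ?e) * ?m * card X <= real (card {x \<in> ?Y. x \<in> ?t p})" .
 qed
 also have "... = (\<Sum>x\<in>?Y. real (card {p \<in> S. x \<in> ?t p}))"
  using double_count[OF fS, of ?Y "%p x. x \<in> ?t p"] by (simp flip: of_nat_sum)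
 also have "... <= (\<Sum>x\<in>?Y. E (4 + real c1 - ?e) * card X)"
 proof (intro sum_mono)
  fix x assume x: "x \<in> ?Y"
  show "real (card {p \<in> S. x \<in> ?t p}) <= E (4 + real c1 - ?e) * card X"
  proof (cases "h + 3 + c1 <= j & {p \<in> S. x \<in> ?t p} ~= {}")
   case True
   then obtain p' where p': "p' \<in> S" "x \<in> ?t p'" by auto
   define k where "k = j - (h + 3 + c1)"
   have k: "real k = real j - real h - 3 - real c1" "k <= J" using True hj by (auto simp: k_def)
   have "{p \<in> S. x \<in> ?t p} <= X Int tube (q, p') (E (- real k))"
   proof
    fix p assume p: "p \<in> {p \<in> S. x \<in> ?t p}"
    have "p \<in> tube (q, p') (E (- (real j - real h - 3 - real c1)))"
     using p p' x by (intro pinned_sector[OF q _ _ _ _ hj(1)]) (auto simp: S_def)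
    then show "p \<in> X Int tube (q, p') (E (- real k))" using p unfolding k by (simp add: S_def)
   qed
   then have "real (card {p \<in> S. x \<in> ?t p}) <= card (X Int tube (q, p') (E (- real k)))"
    by (intro of_nat_mono card_mono) auto
   also have "... = mu (tube (q, p') (E (- real k))) * card X" by (rule mu_card)
   also have "... <= E (1 - tau * k) * card X" using p' k by (intro mult_right_mono) (auto simp: S_def thin_def)
   also have "... <= E (4 + real c1 - ?e) * card X"
   proof (intro mult_right_mono E_mono)
    have "tau * (3 + real c1) <= 1 * (3 + real c1)" using par by simp
    then show "1 - tau * k <= 4 + real c1 - ?e" unfolding k(1) by (simp add: algebra_simps)
   qed simp
   finally show ?thesis .
  next
   case F: False
   show ?thesis
   proof (cases "{p \<in> S. x \<in> ?t p} = {}")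
    case True
    show ?thesis unfolding True by simp
   next
    case False
    then have "j < h + 3 + c1" using F by auto
    then have "?e <= 1 * (3 + real c1)" using par hj by (intro mult_mono) auto
    then have "1 <= E (4 + real c1 - ?e)" by (intro E_ge_1) simp
    then have "1 * real (card X) <= E (4 + real c1 - ?e) * card X" by (intro mult_right_mono) auto
    moreover have "card {p \<in> S. x \<in> ?t p} <= card X" by (intro card_mono) (auto simp: S_def)
    ultimately show ?thesis by simp
   qed
  qed
 qed
 also have "... = real (card ?Y) * (E (4 + real c1 - ?e) * card X)" by simp
 also have "... <= (?m * card X) * (E (4 + real c1 - ?e) * card X)"
 proof (intro mult_right_mono)
  have "mu (ann q h) <= ?m" by (intro mu_mono) (auto simp: ann_def)
  then show "real (card ?Y) <= ?m * card X" unfolding mu_card by (intro mult_right_mono) auto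
 qed (use E_pos in \<open>auto intro: less_imp_le\<close>)
 also have "E (4 + real c1 - ?e) = E (7 + real c1 - ?e) * E (- 3)" unfolding E_add by (simp add: algebra_simps)
 finally have "(?m * card X * E (7 + real c1 - ?e)) * card S <= (?m * card X * E (7 + real c1 - ?e)) * (E (- 3) * card X)"
  by (simp add: mult_ac)
 moreover have "0 < ?m * card X * E (7 + real c1 - ?e)" using m X_ne by simp
 ultimately show ?thesis unfolding S_def by (simp only: mult_le_cancel_left_pos)
qed

lemma card_pairs_le:
 fixes c :: real
 assumes "!!q. q \<in> X ==> real (card {p \<in> X. R q p}) <= c * card X"
 shows "real (card {w \<in> X \<times> X. R (fst w) (snd w)}) <= c * (real (card X))^2"
proof -
 have "{w \<in> X \<times> X. R (fst w) (snd w)} = {(q, p). q \<in> X & p \<in> X & R q p}" by auto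
 then have "real (card {w \<in> X \<times> X. R (fst w) (snd w)}) = (\<Sum>q\<in>X. real (card {p \<in> X. R q p}))"
  using card_rel_bound[OF finX finX, of R] by simp
 also have "... <= (\<Sum>q\<in>X. c * card X)" using assms by (intro sum_mono)
 finally show ?thesis by (simp add: power2_eq_square mult_ac)
qed

lemma card_pairs_swap: "card {w \<in> X \<times> X. R (snd w) (fst w)} = card {w \<in> X \<times> X. R (fst w) (snd w)}"
proof -
 have "{w \<in> X \<times> X. R (snd w) (fst w)} = prod.swap ` {w \<in> X \<times> X. R (fst w) (snd w)}" by auto
 then show ?thesis by (simp add: card_image)
qed

lemma card_not_sepx: "real (card {w \<in> X \<times> X. ~ sepx w}) <= E (- 3) * (real (card X))^2"
proof -
 have "real (card {w \<in> X \<times> X. ~ sepx (fst w, snd w)}) <= E (- 3) * (real (card X))^2"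
 proof (rule card_pairs_le)
  fix q assume "q \<in> X"
  have "real (card {p \<in> X. ~ sepx (q, p)}) <= card (X Int {p. abs (fst p - fst q) <= E (- real c1)})"
   by (intro of_nat_mono card_mono) (auto simp: sepx_def abs_minus_commute)
  also have "... = mu {p. abs (fst p - fst q) <= E (- real c1)} * card X" by (rule mu_card)
  also have "... <= E (1 - sgm * c1) * card X" using c1 by (intro mult_right_mono mu_strip) auto
  also have "... <= E (- 3) * card X" using par(4) by (intro mult_right_mono E_mono) auto
  finally show "real (card {p \<in> X. ~ sepx (q, p)}) <= E (- 3) * card X" .
 qed
 then show ?thesis by simp
qed

lemma card_not_kauf:
 "real (card {w \<in> X \<times> X. sepx w & thin w & ~ kauf w}) <= (real J + 2)^2 * E (- 3) * (real (card X))^2"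
proof -
 let ?R = "%hj q p. sepx (q, p) & thin (q, p) & ~ mu (tube (q, p) (E (- real (snd hj))) Int ann q (fst hj))
   <= E (7 + real c1 - tau * (real (snd hj) - real (fst hj))) * mu (nb q (E (- real (fst hj))))"
 let ?I = "{hj \<in> {..J} \<times> {..J}. fst hj + 2 <= snd hj}"
 have "{w \<in> X \<times> X. sepx w & thin w & ~ kauf w} <= (\<Union>hj\<in>?I. {w \<in> X \<times> X. ?R hj (fst w) (snd w)})"
 proof
  fix w assume w: "w \<in> {w \<in> X \<times> X. sepx w & thin w & ~ kauf w}"
  then obtain h j where hj: "h + 2 <= j" "j <= J"
   "~ mu (tube w (E (- real j)) Int ann (fst w) h) <= E (7 + real c1 - tau * (real j - real h)) * mu (nb (fst w) (E (- real h)))"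
   unfolding kauf_def by auto
  have "w \<in> {w \<in> X \<times> X. ?R (h, j) (fst w) (snd w)}" using w hj(3) by simp
  moreover have "(h, j) \<in> ?I" using hj by simp
  ultimately show "w \<in> (\<Union>hj\<in>?I. {w \<in> X \<times> X. ?R hj (fst w) (snd w)})" by auto
 qed
 then have "card {w \<in> X \<times> X. sepx w & thin w & ~ kauf w} <= card (\<Union>hj\<in>?I. {w \<in> X \<times> X. ?R hj (fst w) (snd w)})"
  by (intro card_mono finite_UN_I) auto
 also have "... <= (\<Sum>hj\<in>?I. card {w \<in> X \<times> X. ?R hj (fst w) (snd w)})" by (intro card_UN_le) simp
 finally have "real (card {w \<in> X \<times> X. sepx w & thin w & ~ kauf w}) <= (\<Sum>hj\<in>?I. real (card {w \<in> X \<times> X. ?R hj (fst w) (snd w)}))"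
  by (simp flip: of_nat_sum)
 also have "... <= (\<Sum>hj\<in>?I. E (- 3) * (real (card X))^2)"
 proof (intro sum_mono)
  fix hj assume hj: "hj \<in> ?I"
  show "real (card {w \<in> X \<times> X. ?R hj (fst w) (snd w)}) <= E (- 3) * (real (card X))^2"
   by (rule card_pairs_le, rule kaufman_bad) (use hj in auto)
 qed
 also have "... = card ?I * (E (- 3) * (real (card X))^2)" by simp
 also have "... <= (real J + 2)^2 * (E (- 3) * (real (card X))^2)"
 proof (intro mult_right_mono)
  have "card ?I <= card ({..J} \<times> {..J})" by (intro card_mono) auto
  then have "card ?I <= Suc J * Suc J" by simp
  from of_nat_mono[OF this, where 'a = real] have "real (card ?I) <= (real J + 1) * (real J + 1)"
   by (simp only: of_nat_mult of_nat_Suc add.commute)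
  also have "... <= (real J + 2) * (real J + 2)" by (intro mult_mono) auto
  finally show "real (card ?I) <= (real J + 2)^2" by (simp add: power2_eq_square)
 qed simp
 finally show ?thesis by simp
qed

lemma card_not_tame: "real (card {w \<in> X \<times> X. ~ tame (fst w)}) <= real J * E (- 2) * (real (card X))^2"
proof -
 let ?B = "%j. {q \<in> X. mu (nb q (E (- real (Suc j)))) < E (- 5) * mu (nb q (E (- real j)))}"
 have "{w \<in> X \<times> X. ~ tame (fst w)} <= (\<Union>j\<in>{..<J}. ?B j) \<times> X" by (auto simp: tame_def)
 then have "card {w \<in> X \<times> X. ~ tame (fst w)} <= card ((\<Union>j\<in>{..<J}. ?B j) \<times> X)" by (intro card_mono) auto
 also have "... = card (\<Union>j\<in>{..<J}. ?B j) * card X" by simp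
 also have "... <= (\<Sum>j\<in>{..<J}. card (?B j)) * card X" by (intro mult_le_mono1 card_UN_le) simp
 finally have "real (card {w \<in> X \<times> X. ~ tame (fst w)}) <= (\<Sum>j\<in>{..<J}. real (card (?B j))) * card X"
  by (simp flip: of_nat_sum of_nat_mult)
 also have "... <= (\<Sum>j\<in>{..<J}. E (- 2) * card X) * card X"
 proof (intro mult_right_mono sum_mono)
  fix j assume j: "j \<in> {..<J}"
  have "real (card (?B j)) = mu (?B j) * card X" unfolding mu_card[symmetric] by (rule arg_cong[of _ _ "%S. real (card S)"]) auto
  also have "... <= E (- 2) * card X" using jump_points[of j] j by (intro mult_right_mono) auto
  finally show "real (card (?B j)) <= E (- 2) * card X" .
 qed simp
 finally show ?thesis by (simp add: power2_eq_square)
qed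

text \<open>At most a factor \<open>l ^ 5\<close> of mass is lost per scale, so profiles are
  functions into \<open>{..5 * J}\<close>; their finite number makes the pigeonhole in
  \<open>typical_exists\<close> affordable.\<close>

lemma tame_prof: "q \<in> X ==> tame q ==> j <= J ==> prof q j <= 5 * J"
proof -
 assume q: "q \<in> X" "tame q" "j <= J"
 have "E (- 5 * real j) <= mu (nb q (E (- real j)))" using q(3)
 proof (induction j)
  case 0
  then show ?case using nb_ge_1[OF q(1), of 1] by simp
 next
  case (Suc j)
  have "E (- 5 * real (Suc j)) = E (- 5) * E (- 5 * real j)" unfolding E_add by simp
  also have "... <= E (- 5) * mu (nb q (E (- real j)))" using Suc by simp
  also have "... <= mu (nb q (E (- real (Suc j))))" using q(2) Suc.prems by (auto simp: tame_def)
  finally show ?case .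
 qed
 moreover from this have "0 < mu (nb q (E (- real j)))" by (rule less_le_trans[OF E_pos])
 ultimately have "log l (E (- 5 * real j)) <= log l (mu (nb q (E (- real j))))"
  using l_ge by (subst log_le_cancel_iff) auto
 then have "- log l (mu (nb q (E (- real j)))) <= 5 * real j" using l_ge by simp
 also have "... <= real (5 * J)" using q(3) by simp
 finally show ?thesis unfolding prof_def by linarith
qed

text \<open>The exceptional sets are small against \<open>alpha\<close>: non-thin pairs by
  hypothesis, the others as small multiples of \<open>E (- 1)\<close>, which is at most
  \<open>alpha\<close>. Pigeonholing the rest by the profile of the first point costs less than a
  factor \<open>l\<close>, by \<open>lP\<close>.\<close>

lemma typical_exists:
 assumes al: "E (- 1) <= alpha" and tight: "alpha * (real (card X))^2 <= card {w \<in> X \<times> X. tight w}"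
  and thin: "card {w \<in> X \<times> X. ~ thin w} <= alpha / 10 * (real (card X))^2"
 obtains W F where "W <= X \<times> X" "E (- 2) * (real (card X))^2 <= card W"
  "ALL w:W. sepx w & tight w & thin w & kauf w & kauf (prod.swap w) & tame (fst w) & (ALL j<=J. prof (fst w) j = F j)"
proof -
 let ?N = "(real (card X))^2"
 have N0: "?N > 0" using X_ne by simp
 let ?k = "%w. sepx w & thin w & ~ kauf w"
 define V where "V = {w \<in> X \<times> X. sepx w & tight w & thin w & kauf w & kauf (prod.swap w) & tame (fst w)}"
 have fV: "finite V" by (simp add: V_def)
 have sym: "sepx (prod.swap w) \<longleftrightarrow> sepx w" for w by (simp add: sepx_def abs_minus_commute)
 have thsym: "thin (prod.swap w) \<longleftrightarrow> thin w" if "sepx w" for w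
 proof -
  have ne: "fst (fst w) ~= fst (snd w)" using that by (auto simp: sepx_def)
  have "prod.swap w = (snd w, fst w)" by (simp add: prod.swap_def)
  then show ?thesis unfolding thin_def using tube_swap[OF ne] by simp
 qed
 let ?A1 = "{w \<in> X \<times> X. ~ sepx w}" and ?A2 = "{w \<in> X \<times> X. ~ thin w}" and ?A3 = "{w \<in> X \<times> X. ?k w}"
 let ?A4 = "{w \<in> X \<times> X. ?k (snd w, fst w)}" and ?A5 = "{w \<in> X \<times> X. ~ tame (fst w)}"
 have sw: "prod.swap w = (snd w, fst w)" for w :: "(real \<times> real) \<times> (real \<times> real)" by (simp add: prod.swap_def)
 have "{w \<in> X \<times> X. tight w} <= V Un ?A1 Un ?A2 Un ?A3 Un ?A4 Un ?A5"
 proof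
  fix w assume w: "w \<in> {w \<in> X \<times> X. tight w}"
  show "w \<in> V Un ?A1 Un ?A2 Un ?A3 Un ?A4 Un ?A5"
   using w sym[of w] thsym[of w] unfolding V_def sw by simp
 qed
 then have "card {w \<in> X \<times> X. tight w} <= card (V Un ?A1 Un ?A2 Un ?A3 Un ?A4 Un ?A5)"
  using fV by (intro card_mono) auto
 also have "... <= card V + card ?A1 + card ?A2 + card ?A3 + card ?A4 + card ?A5"
  by (meson add_le_mono card_Un_le order_refl order_trans)
 finally have "real (card {w \<in> X \<times> X. tight w}) <= real (card V) + card ?A1 + card ?A2 + card ?A3 + card ?A4 + card ?A5"
  by simp
 moreover have "card ?A4 = card ?A3"
  using card_pairs_swap[of "%q p. ?k (q, p)"] by simp
 moreover have j1: "(real J + 2)^2 * E (- 3) <= E (- 1) / 100"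
 proof -
  have "(real J + 2)^2 * E (- 3) <= (l / 100) * E (- 3)" using l by simp
  also have "... = E 1 * E (- 3) / 100" using E_1 by simp
  also have "E 1 * E (- 3) = E (- 2)" unfolding E_add by simp
  also have "E (- 2) / 100 <= E (- 1) / 100" by (intro divide_right_mono E_mono) auto
  finally show ?thesis .
 qed
 moreover have "E (- 3) <= E (- 1) / 100"
 proof -
  have "100 * E (- 3) <= E (- 3 + 1)" by (rule E_const) simp
  also have "... <= E (- 1)" by (rule E_mono) simp
  finally show ?thesis by simp
 qed
 moreover have "real J * E (- 2) <= E (- 1) / 100"
 proof -
  have "real J * E (- 2) <= (l / 100) * E (- 2)" using l_ge(3) by simp
  also have "... = E 1 * E (- 2) / 100" using E_1 by simp
  also have "E 1 * E (- 2) = E (- 1)" unfolding E_add by simp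
  finally show ?thesis .
 qed
 ultimately have "real (card {w \<in> X \<times> X. tight w}) <= real (card V) + alpha / 10 * ?N + 4 * (E (- 1) / 100 * ?N)"
  using card_not_sepx card_not_kauf card_not_tame thin
   mult_right_mono[of "(real J + 2)^2 * E (- 3)" "E (- 1) / 100" ?N] mult_right_mono[of "E (- 3)" "E (- 1) / 100" ?N]
   mult_right_mono[of "real J * E (- 2)" "E (- 1) / 100" ?N] by simp
 moreover have "E (- 1) / 100 * ?N <= alpha / 100 * ?N" using al by (intro mult_right_mono) auto
 ultimately have "alpha * ?N - alpha / 10 * ?N - 4 * (alpha / 100 * ?N) <= card V" using tight by simp
 moreover have "E (- 1) / 2 * ?N <= alpha / 2 * ?N" by (intro mult_right_mono divide_right_mono al) auto
 moreover have "0 <= alpha" using al E_pos[of "- 1"] by linarith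
 then have "0 <= alpha * ?N" by simp
 ultimately have V: "E (- 1) / 2 * ?N <= card V" by simp
 let ?f = "%w. restrict (prof (fst w)) {..J}"
 let ?P = "{..J} \<rightarrow>\<^sub>E {..5 * J}"
 have "?f ` V <= ?P"
 proof (rule image_subsetI)
  fix w assume "w \<in> V"
  then show "?f w \<in> ?P" unfolding restrict_PiE_iff using tame_prof[of "fst w"] by (auto simp: V_def)
 qed
 moreover have fP: "finite ?P" by (intro finite_PiE) auto
 ultimately have "card (?f ` V) <= card ?P" by (intro card_mono)
 also have "card ?P = (5 * J + 1) ^ (J + 1)" by (simp add: card_PiE)
 finally have "real (card (?f ` V)) <= real ((5 * J + 1) ^ (J + 1))" by linarith
 also have "real ((5 * J + 1) ^ (J + 1)) = (5 * real J + 1) ^ (J + 1)"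
  by (simp only: of_nat_power of_nat_add of_nat_mult of_nat_1 of_nat_numeral)
 finally have cP: "real (card (?f ` V)) <= (5 * real J + 1) ^ (J + 1)" .
 have lP: "2 * (5 * real J + 1) ^ (J + 1) <= l"
 proof -
  have "2 * (5 * real J + 1) ^ (J + 1) <= (5 * real J + 2) * (5 * real J + 2) ^ (J + 1)"
   by (intro mult_mono power_mono) auto
  then show ?thesis using l_pow by simp
 qed
 have "EX w0:V. E (- 2) * ?N <= card {w \<in> V. ?f w = ?f w0}"
 proof (rule ccontr)
  assume no: "~ ?thesis"
  have "0 < E (- 1) / 2 * ?N" using N0 by simp
  then have "0 < real (card V)" using V by simp
  then have "V ~= {}" by auto
  define K where "K = Max ((%w0. real (card {w \<in> V. ?f w = ?f w0})) ` V)"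
  have KM: "K < E (- 2) * ?N" unfolding K_def using fV \<open>V ~= {}\<close> no by auto
  have K0: "0 <= K" unfolding K_def using fV \<open>V ~= {}\<close> by (subst Max_ge_iff) auto
  have "real (card V) <= (5 * real J + 1) ^ (J + 1) * K"
   by (rule card_le_fibres[OF fV cP K0]) (auto simp: K_def fV)
  also have "... < (5 * real J + 1) ^ (J + 1) * (E (- 2) * ?N)" using KM by simp
  also have "... <= (l / 2) * (E (- 2) * ?N)" using lP by (intro mult_right_mono) auto
  also have "... = (E 1 * E (- 2)) / 2 * ?N" using E_1 by simp
  also have "E 1 * E (- 2) = E (- 1)" unfolding E_add by simp
  finally show False using V by simp
 qed
 then obtain w0 where w0: "w0 \<in> V" "E (- 2) * ?N <= card {w \<in> V. ?f w = ?f w0}" by auto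
 show thesis
 proof (rule that[of "{w \<in> V. ?f w = ?f w0}" "prof (fst w0)"])
  show "{w \<in> V. ?f w = ?f w0} <= X \<times> X" by (auto simp: V_def)
  have "prof (fst w) j = prof (fst w0) j" if "?f w = ?f w0" "j <= J" for w j
   using fun_cong[OF that(1), of j] that(2) by simp
  then show "ALL w:{w \<in> V. ?f w = ?f w0}. sepx w & tight w & thin w & kauf w & kauf (prod.swap w) & tame (fst w)
    & (ALL j<=J. prof (fst w) j = prof (fst w0) j)" by (auto simp: V_def)
 qed (rule w0(2))
qed

end

section \<open>Pairs with a common mass profile\<close>

locale typical = cloud A l J c1 sgm tau for A :: "real set" and l :: real and J c1 :: nat and sgm tau :: real +
 fixes W :: "((real \<times> real) \<times> (real \<times> real)) set" and F :: "nat => nat"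
 assumes W: "W <= X \<times> X" and card_W: "E (- 2) * (real (card X))^2 <= card W"
  and W_typ: "!!w. w \<in> W ==> sepx w & tight w & thin w & kauf w & kauf (prod.swap w) & tame (fst w) & (ALL j<=J. prof (fst w) j = F j)"
begin

text \<open>\<open>recd s\<close> makes \<open>G s\<close> the smallest value of \<open>G\<close> from scale \<open>s\<close> on, so that \<open>Ob_tube_nb\<close> can be used with
\<open>V = G s\<close> up to a constant.\<close>

definition theta where "theta = 2 * sgm - tau"
text \<open>Heuristically \<open>l powr (G j)\<close> is the number of boxes of side
  \<open>E (- j)\<close> along a tube of that width: the tube has mass about
  \<open>E (- tau * j)\<close> and a box at a typical point \<open>E (- F j)\<close>.\<close>

definition G where "G j = real (F j) - tau * real j"
definition recd where "recd s \<longleftrightarrow> s <= J & (ALL h. s <= h --> h <= J --> G s <= G h)"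
definition hgt where "hgt w u = slope w * u + icpt w"
definition idx where "idx j w = (\<lfloor>slope w / E (- real j)\<rfloor>, \<lfloor>icpt w / E (- real j)\<rfloor>)"
text \<open>First points of all pairs whose line falls into the same finest cell as that of
  \<open>w\<close>. Unlike arbitrary points of the tube they are typical, so the masses of their
  boxes are known at every scale.\<close>

definition Ob where "Ob w = fst ` {w' \<in> W. idx J w' = idx J w}"
definition col where "col j q = \<lfloor>fst q / E (- real j)\<rfloor>" for q :: "real \<times> real"

lemma theta: "0 < theta" "theta <= 1" using par by (auto simp: theta_def)
lemma tau_le: "tau <= 1" using par by simp
lemma finW [simp]: "finite W" using W by (rule finite_subset) simp

lemma W_ne: "W ~= {}"
proof
 assume "W = {}"
 then have "E (- 2) * (real (card X))^2 <= 0" using card_W by simp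
 moreover have "0 < E (- 2) * (real (card X))^2" using X_ne by simp
 ultimately show False by simp
qed

lemma WX: "w \<in> W ==> fst w \<in> X" "w \<in> W ==> snd w \<in> X" using W by auto
lemma mem_tube: "q \<in> tube w r \<longleftrightarrow> abs (snd q - hgt w (fst q)) <= r" by (simp add: tube_def hgt_def algebra_simps)
lemma tube_mono: "r <= r' ==> tube w r <= tube w r'" by (auto simp: tube_def)
lemma nb_mono: "r <= r' ==> nb q r <= nb q r'" by (auto simp: nb_def)

lemma W_slope: "w \<in> W ==> abs (slope w) <= E (real c1)"
 using slope_bound[of "fst w" "snd w"] W_typ[of w] WX[of w] by (simp add: sepx_def)

lemma W_line: "w \<in> W ==> snd (fst w) = hgt w (fst (fst w))" "w \<in> W ==> snd (snd w) = hgt w (fst (snd w))"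
proof -
 show "snd (fst w) = hgt w (fst (fst w))" by (simp add: hgt_def icpt_def)
 assume "w \<in> W"
 then have "fst (fst w) ~= fst (snd w)" using W_typ[of w] by (auto simp: sepx_def)
 then show "snd (snd w) = hgt w (fst (snd w))" using line_through(1)[of "fst w" "snd w"] by (simp add: hgt_def)
qed

lemma thin_real: "w \<in> W ==> y <= real J ==> mu (tube w (E (- y))) <= E (2 - tau * y)"
proof -
 assume w: "w \<in> W" "y <= real J"
 show ?thesis
 proof (cases "0 <= y")
  case True
  define j where "j = nat \<lfloor>y\<rfloor>"
  have j: "real j <= y" "y - 1 <= real j" "j <= J" using True w(2) unfolding j_def by linarith+
  have "mu (tube w (E (- y))) <= mu (tube w (E (- real j)))" using j by (intro mu_mono) (auto intro!: le_infI1 tube_mono E_mono)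
  also have "... <= E (1 - tau * j)" using W_typ[OF w(1)] j by (simp add: thin_def)
  also have "... <= E (2 - tau * y)"
  proof (intro E_mono)
   have "tau * (y - 1) <= tau * j" using par j by simp
   then show "1 - tau * j <= 2 - tau * y" using tau_le by (simp add: algebra_simps)
  qed
  finally show ?thesis .
 next
  case False
  then have "tau * y <= 0" using par by (simp add: mult_le_0_iff)
  then have "1 <= E (2 - tau * y)" by (intro E_ge_1) simp
  then show ?thesis using mu_le_1[of "tube w (E (- y))"] by simp
 qed
qed

lemma mu_typ:
 assumes w: "w \<in> W" and j: "j <= J"
 shows "mu (nb (fst w) (E (- real j))) <= E (- real (F j))" "E (- real (F j) - 1) <= mu (nb (fst w) (E (- real j)))"
proof -
 let ?m = "mu (nb (fst w) (E (- real j)))"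
 have m: "?m > 0" using WX[OF w] by (intro mu_nb_pos) (auto intro: less_imp_le)
 have "log l ?m <= 0" using m mu_le_1[of "nb (fst w) (E (- real j))"] l_ge by simp
 then have "real (F j) <= - log l ?m" "- log l ?m <= real (F j) + 1"
 proof -
  have "nat \<lfloor>- log l ?m\<rfloor> = F j" using W_typ[OF w] j unfolding prof_def by simp
  then show "real (F j) <= - log l ?m" "- log l ?m <= real (F j) + 1" using \<open>log l ?m <= 0\<close> by linarith+
 qed
 then have *: "log l ?m <= - real (F j)" "- real (F j) - 1 <= log l ?m" by auto
 have "?m = E (log l ?m)" using m l_ge by simp
 then show "?m <= E (- real (F j))" "E (- real (F j) - 1) <= ?m" using E_mono[OF *(1)] E_mono[OF *(2)] by auto
qed

lemma F_0: "F 0 = 0"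
proof -
 obtain w where w: "w \<in> W" using W_ne by auto
 have "mu (nb (fst w) (E (- real 0))) = 1" using WX[OF w] by (intro nb_ge_1) auto
 then have "1 <= E (- real (F 0))" using mu_typ(1)[OF w, of 0] by simp
 then have "E 0 <= E (- real (F 0))" by simp
 from E_le_imp[OF this] show ?thesis by simp
qed

lemma F_Suc: "j < J ==> real (F (Suc j)) <= real (F j) + 6"
proof -
 assume j: "j < J"
 obtain w where w: "w \<in> W" using W_ne by auto
 have "E (- 5) * E (- real (F j) - 1) <= E (- 5) * mu (nb (fst w) (E (- real j)))"
  using mu_typ(2)[OF w, of j] j by simp
 also have "... <= mu (nb (fst w) (E (- real (Suc j))))" using W_typ[OF w] j unfolding tame_def by simp
 also have "... <= E (- real (F (Suc j)))" using j by (intro mu_typ(1)[OF w]) simp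
 finally have "E (- 5 + (- real (F j) - 1)) <= E (- real (F (Suc j)))" unfolding E_add .
 from E_le_imp[OF this] show ?thesis by simp
qed

lemma F_steps: "h <= j ==> j <= J ==> real (F j) <= real (F h) + 6 * (real j - real h)"
proof (induction rule: dec_induct)
 case (step n)
 then show ?case using F_Suc[of n] by simp
qed simp

lemma G_steps: "h <= j ==> j <= J ==> G j <= G h + 6 * (real j - real h)"
proof -
 assume h: "h <= j" "j <= J"
 then have "tau * real h <= tau * real j" using par by simp
 then show ?thesis using F_steps[OF h] by (simp add: G_def)
qed

text \<open>Boxes of the product set have mass at most \<open>E (2 - 2 * sgm * j)\<close>, so
  \<open>F j\<close> is at least \<open>2 * sgm * j - 3\<close>. The gap between
  \<open>2 * sgm\<close> and \<open>tau\<close> becomes the dimension of the points along a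
  tube.\<close>

lemma G_ge: "j <= J ==> theta * j - 3 <= G j"
proof -
 assume j: "j <= J"
 obtain w where w: "w \<in> W" using W_ne by auto
 have "E (- real (F j) - 1) <= E (2 - 2 * sgm * j)" using mu_typ(2)[OF w j] mu_nb[OF j, of "fst w"] by simp
 from E_le_imp[OF this] show ?thesis by (simp add: G_def theta_def algebra_simps)
qed

lemma G_linear: "h <= J ==> z <= real h ==> theta * z - 3 <= G h"
 using G_ge[of h] theta mult_left_mono[of z "real h" theta] by linarith

lemma G_record: "recd s ==> h <= J ==> real s - e <= h ==> 0 <= e ==> G s - 6 * e <= G h"
proof (cases "s <= h")
 case False
 moreover assume "recd s" "real s - e <= h"
 ultimately show ?thesis using G_steps[of h s] by (simp add: recd_def)
qed (auto simp: recd_def)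

text \<open>Sum over annuli around the first point. At scale \<open>h\<close> the bound of
  \<open>kauf\<close> and the box bound multiply to about \<open>E (- tau * j - g h)\<close>: the
  terms \<open>tau * h\<close> cancel, and only a lower bound \<open>V\<close> for \<open>g\<close>
  on the relevant scales matters. \<open>g\<close> is general because the second point of a pair has
  no known profile; there a linear \<open>g\<close> is used.\<close>

lemma kauf_nb:
 assumes w: "fst w \<in> X" "kauf w" and yz: "y <= real J" "z <= y"
  and g: "g 0 <= 0" "!!h. h <= J ==> mu (nb (fst w) (E (- real h))) <= E (- g h - tau * real h)"
  and V: "!!h. h <= J ==> z - 3 <= real h ==> V <= g h"
 shows "mu (tube w (E (- y)) Int nb (fst w) (E (- z))) <= E (9 + real c1 - tau * y - V)"
proof (cases "1 <= y")
 case False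
 have "V <= 0" using V[of 0] yz False g(1) by simp
 moreover have "tau * y <= 1"
 proof (cases "0 <= y")
  case True
  then have "tau * y <= 1 * 1" using False tau_le by (intro mult_mono) auto
  then show ?thesis by simp
 next
  case False
  then have "tau * y <= 0" using par by (simp add: mult_le_0_iff)
  then show ?thesis by simp
 qed
 ultimately have "1 <= E (9 + real c1 - tau * y - V)" by (intro E_ge_1) simp
 then show ?thesis using mu_le_1[of "tube w (E (- y)) Int nb (fst w) (E (- z))"] by simp
next
 case True
 define j where "j = nat \<lfloor>y\<rfloor>"
 have j: "real j <= y" "y - 1 <= real j" "j <= J" "1 <= j" using True yz unfolding j_def by linarith+
 define i where "i = nat \<lfloor>z\<rfloor>"
 have i: "z - 1 <= real i" by (simp add: i_def) linarith
 let ?o = "fst w" and ?T = "tube w (E (- real j))" and ?e = "7 + real c1 - tau * j - V"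
 have cover: "X Int (tube w (E (- y)) Int nb ?o (E (- z))) <= (\<Union>h\<in>{h. i <= h & h + 2 <= j}. ?T Int ann ?o h) Un nb ?o (E (- real (j - 1)))"
 proof
  fix q assume q: "q \<in> X Int (tube w (E (- y)) Int nb ?o (E (- z)))"
  have "E (- y) <= E (- real j)" using j by (intro E_mono) simp
  then have qT: "q \<in> ?T" using q by (simp add: mem_tube)
  have qi: "q \<in> nb ?o (E (- real i))"
  proof (cases "0 <= z")
   case True
   then have "E (- z) <= E (- real i)" by (intro E_mono) (simp add: i_def)
   then show ?thesis using q by (simp add: nb_def)
  next
   case False
   then have "E (- real i) = 1" by (simp add: i_def)
   then show ?thesis using q X_unit[of q] X_unit[OF w(1)] by (auto simp: nb_def)
  qed
  show "q \<in> (\<Union>h\<in>{h. i <= h & h + 2 <= j}. ?T Int ann ?o h) Un nb ?o (E (- real (j - 1)))"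
  proof (rule ccontr)
   assume no: "~ ?thesis"
   have "q \<in> nb ?o (E (- real h))" if "i <= h" "h <= max i (j - 1)" for h using that
   proof (induction rule: dec_induct)
    case base
    show ?case by (rule qi)
   next
    case (step n)
    then show ?case using no qT by (auto simp: ann_def)
   qed
   from this[of "max i (j - 1)"] have "q \<in> nb ?o (E (- real (max i (j - 1))))" by simp
   moreover have "E (- real (max i (j - 1))) <= E (- real (j - 1))" by (intro E_mono) simp
   ultimately have "q \<in> nb ?o (E (- real (j - 1)))" using nb_mono by blast
   then show False using no by simp
  qed
 qed
 let ?H = "{h. i <= h & h + 2 <= j}"
 have fH: "finite ?H" by (rule finite_subset[of _ "{..j}"]) auto
 have UN: "mu (\<Union>h\<in>H. f h) <= (\<Sum>h\<in>H. mu (f h))" if "finite H" for H :: "nat set" and f using that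
 proof (induction H)
  case empty
  show ?case by (simp add: mu_def)
 next
  case (insert h H)
  then show ?case using mu_Un[of "f h" "\<Union>h\<in>H. f h"] by simp
 qed
 have tj: "tau * y <= tau * j + 1"
 proof -
  have "tau * (y - 1) <= tau * j" using par j by simp
  then show ?thesis using tau_le by (simp add: algebra_simps)
 qed
 have "mu (tube w (E (- y)) Int nb ?o (E (- z))) <= mu ((\<Union>h\<in>?H. ?T Int ann ?o h) Un nb ?o (E (- real (j - 1))))"
  using cover by (intro mu_mono) blast
 also have "... <= (\<Sum>h\<in>?H. mu (?T Int ann ?o h)) + mu (nb ?o (E (- real (j - 1))))"
  using mu_Un[of "\<Union>h\<in>?H. ?T Int ann ?o h" "nb ?o (E (- real (j - 1)))"] UN[OF fH, of "%h. ?T Int ann ?o h"] by simp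
 also have "... <= (\<Sum>h\<in>?H. E ?e) + E ?e"
 proof (intro add_mono sum_mono)
  fix h assume h: "h \<in> ?H"
  have "mu (?T Int ann ?o h) <= E (7 + real c1 - tau * (real j - real h)) * mu (nb ?o (E (- real h)))"
   using w(2) h j unfolding kauf_def by simp
  also have "... <= E (7 + real c1 - tau * (real j - real h)) * E (- g h - tau * real h)"
   using h j by (intro mult_left_mono g(2)) auto
  also have "... <= E ?e" unfolding E_add
  proof (intro E_mono)
   have "V <= g h" using h i j by (intro V) auto
   then show "7 + real c1 - tau * (real j - real h) + (- g h - tau * real h) <= ?e" by (simp add: algebra_simps)
  qed
  finally show "mu (?T Int ann ?o h) <= E ?e" .
 next
  have "mu (nb ?o (E (- real (j - 1)))) <= E (- g (j - 1) - tau * real (j - 1))" using j by (intro g(2)) simp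
  also have "... <= E ?e"
  proof (intro E_mono)
   have "V <= g (j - 1)" using j yz by (intro V) auto
   moreover have "tau * real (j - 1) = tau * j - tau" using j by (simp add: algebra_simps)
   ultimately show "- g (j - 1) - tau * real (j - 1) <= ?e" using tau_le by simp
  qed
  finally show "mu (nb ?o (E (- real (j - 1)))) <= E ?e" .
 qed
 also have "... = (real (card ?H) + 1) * E ?e" by (simp add: algebra_simps)
 also have "... <= (real J + 2) * E ?e"
 proof (intro mult_right_mono)
  have "card ?H <= card {..J}" using j by (intro card_mono) auto
  then show "real (card ?H) + 1 <= real J + 2" by simp
 qed simp
 also have "... <= E (?e + 1)" by (rule E_J)
 also have "... <= E (9 + real c1 - tau * y - V)" using tj by (intro E_mono) linarith
 finally show ?thesis .
qed

lemma tube_nb: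
 assumes w: "w \<in> W" and yz: "y <= real J" "z <= y" and V: "!!h. h <= J ==> z - 3 <= real h ==> V <= G h"
 shows "mu (tube w (E (- y)) Int nb (fst w) (E (- z))) <= E (9 + real c1 - tau * y - V)"
proof (rule kauf_nb[of w y z G])
 show "mu (nb (fst w) (E (- real h))) <= E (- G h - tau * real h)" if "h <= J" for h
  using mu_typ(1)[OF w that] by (simp add: G_def)
qed (use W_typ[OF w] WX[OF w] yz V in \<open>auto simp: G_def F_0\<close>)

lemma tube_nb_snd:
 assumes w: "w \<in> W" and yz: "y <= real J" "z <= y"
 shows "mu (tube w (E (- y)) Int nb (snd w) (E (- z))) <= E (14 + real c1 - tau * y - theta * z)"
proof -
 have ne: "fst (snd w) ~= fst (fst w)" using W_typ[OF w] by (auto simp: sepx_def)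
 have "tube (snd w, fst w) (E (- y)) = tube w (E (- y))" using tube_swap[OF ne] by simp
 moreover have "mu (tube (snd w, fst w) (E (- y)) Int nb (fst (snd w, fst w)) (E (- z))) <= E (9 + real c1 - tau * y - (theta * (z - 3) - 2))"
 proof (rule kauf_nb[of "(snd w, fst w)" y z "%h. theta * real h - 2"])
  show "kauf (snd w, fst w)" using W_typ[OF w] by (simp add: prod.swap_def)
  show "mu (nb (fst (snd w, fst w)) (E (- real h))) <= E (- (theta * real h - 2) - tau * real h)" if "h <= J" for h
   using mu_nb[OF that, of "snd w"] by (simp add: theta_def algebra_simps)
  show "theta * (z - 3) - 2 <= theta * real h - 2" if "z - 3 <= real h" for h
   using mult_left_mono[OF that, of theta] theta by simp
 qed (use WX[OF w] yz in auto)
 moreover have "E (9 + real c1 - tau * y - (theta * (z - 3) - 2)) <= E (14 + real c1 - tau * y - theta * z)"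
  using theta by (intro E_mono) (simp add: algebra_simps)
 ultimately show ?thesis by simp
qed

lemma same_idx:
 assumes "idx j w = idx j w'"
 shows "abs (slope w - slope w') <= E (- real j)" "0 <= u ==> u <= 1 ==> abs (hgt w u - hgt w' u) <= 2 * E (- real j)"
proof -
 have *: "abs (slope w - slope w') < E (- real j)" "abs (icpt w - icpt w') < E (- real j)"
  using assms same_cell[OF E_pos] unfolding idx_def by auto
 show "abs (slope w - slope w') <= E (- real j)" using * by simp
 assume u: "0 <= u" "u <= 1"
 have "abs ((slope w - slope w') * u) <= E (- real j) * 1" unfolding abs_mult using * u by (intro mult_mono) auto
 moreover have "hgt w u - hgt w' u = (slope w - slope w') * u + (icpt w - icpt w')" by (simp add: hgt_def algebra_simps)
 ultimately show "abs (hgt w u - hgt w' u) <= 2 * E (- real j)" using * by simp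
qed

lemma tube_idx:
 assumes "idx j w = idx j w'" "y <= j"
 shows "X Int tube w (E (- y)) <= tube w' (E (1 - y))"
proof
 fix q assume q: "q \<in> X Int tube w (E (- y))"
 have "abs (hgt w (fst q) - hgt w' (fst q)) <= 2 * E (- real j)" using q X_unit[of q] by (intro same_idx(2)[OF assms(1)]) auto
 moreover have "E (- real j) <= E (- y)" using assms(2) by (intro E_mono) simp
 moreover have "3 * E (- y) <= E (- y + 1)" by (rule E_const) simp
 ultimately show "q \<in> tube w' (E (1 - y))" using q by (simp add: mem_tube add.commute) linarith
qed

lemma ObE:
 assumes "q \<in> Ob w"
 obtains w' where "w' \<in> W" "idx J w' = idx J w" "q = fst w'"
 using assms by (auto simp: Ob_def)

lemma Ob_X: "Ob w <= X" using WX by (auto simp: Ob_def)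
lemma Ob_W: "Ob w <= fst ` W" by (auto simp: Ob_def)
lemma fin_Ob [simp]: "finite (Ob w)" by (simp add: Ob_def)
lemma fst_Ob: "w \<in> W ==> fst w \<in> Ob w" by (auto simp: Ob_def)

lemma Ob_tube: "q \<in> Ob w ==> j <= J ==> q \<in> tube w (E (1 - real j))"
proof -
 assume q: "q \<in> Ob w" "j <= J"
 from q(1) obtain w' where w': "w' \<in> W" "idx J w' = idx J w" "q = fst w'" by (rule ObE)
 have "q \<in> X Int tube w' (E (- real j))" using W_line(1)[OF w'(1)] WX(1)[OF w'(1)] w'(3) by (simp add: mem_tube)
 then show ?thesis using tube_idx[OF w'(2), of "real j"] q by auto
qed

lemma Ob_tube_nb:
 assumes q: "q \<in> Ob w" and yz: "y <= real J" "z <= y" and V: "!!h. h <= J ==> z - 4 <= real h ==> V <= G h"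
 shows "mu (tube w (E (- y)) Int nb q (E (- z))) <= E (10 + real c1 - tau * y - V)"
proof -
 from q obtain w' where w': "w' \<in> W" "idx J w' = idx J w" "q = fst w'" by (rule ObE)
 have "mu (tube w (E (- y)) Int nb q (E (- z))) <= mu (tube w' (E (- (y - 1))) Int nb (fst w') (E (- (z - 1))))"
  using tube_idx[OF w'(2)[symmetric] yz(1)] nb_mono[OF E_mono[of "- z" "- (z - 1)"], of q] unfolding w'(3)
  by (intro mu_mono) (auto simp: algebra_simps)
 also have "... <= E (9 + real c1 - tau * (y - 1) - V)" using yz V by (intro tube_nb[OF w'(1)]) auto
 also have "... <= E (10 + real c1 - tau * y - V)" using tau_le by (intro E_mono) (simp add: algebra_simps)
 finally show ?thesis .
qed

lemma tube_step:
 assumes w: "w \<in> W" and q: "q \<in> tube w (E (a - y))" "q' \<in> nb q (E (- y))" and a: "0 <= a"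
 shows "q' \<in> tube w (E (a + c1 + 1 - y))"
proof -
 have "abs (slope w * (fst q' - fst q)) <= E (real c1) * E (- y)"
  unfolding abs_mult using W_slope[OF w] q(2) by (intro mult_mono) (auto simp: nb_def)
 then have 1: "abs (slope w * (fst q' - fst q)) <= E (real c1 - y)" unfolding E_add by simp
 have 2: "hgt w (fst q') = hgt w (fst q) + slope w * (fst q' - fst q)" by (simp add: hgt_def algebra_simps)
 have 3: "E (a - y) + E (real c1 - y) + E (- y) + E (- y) <= E ((a + c1 - y) + 1)" using a by (intro E_sum4) auto
 have 4: "(a + c1 - y) + 1 = a + c1 + 1 - y" by simp
 have "abs (snd q - hgt w (fst q)) <= E (a - y)" "abs (snd q' - snd q) <= E (- y)" using q by (auto simp: mem_tube nb_def)
 then show ?thesis using 1 3 E_pos[of "- y"] unfolding mem_tube 2 4 by linarith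
qed

lemma near_tube:
 assumes w: "w \<in> W" and q: "q \<in> tube w (E (a - y))" "q' \<in> tube w (E (a - y))" and d: "abs (fst q' - fst q) <= E (a - y)" and a: "0 <= a"
 shows "q' \<in> nb q (E (a + c1 + 1 - y))"
proof -
 have "abs (slope w * (fst q' - fst q)) <= E (real c1) * E (a - y)"
  unfolding abs_mult using W_slope[OF w] d by (intro mult_mono) auto
 then have 1: "abs (slope w * (fst q' - fst q)) <= E (a + c1 - y)" unfolding E_add by (simp add: algebra_simps)
 have 2: "hgt w (fst q') = hgt w (fst q) + slope w * (fst q' - fst q)" by (simp add: hgt_def algebra_simps)
 have 3: "E (a - y) + E (a - y) + E (a + c1 - y) + E (a + c1 - y) <= E ((a + c1 - y) + 1)" by (intro E_sum4) auto
 have 4: "(a + c1 - y) + 1 = a + c1 + 1 - y" by simp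
 have "abs (snd q - hgt w (fst q)) <= E (a - y)" "abs (snd q' - hgt w (fst q')) <= E (a - y)" using q by (auto simp: mem_tube)
 then have "abs (snd q' - snd q) <= E (a + c1 + 1 - y)" using 1 3 E_pos[of "a + c1 - y"] unfolding 2 4 by linarith
 moreover have "abs (fst q' - fst q) <= E (a + c1 + 1 - y)" using d E_mono[of "a - y" "a + c1 + 1 - y"] by simp
 ultimately show ?thesis by (simp add: nb_def)
qed

text \<open>As the centres have distinct columns, a point lies in at most four of the boxes; each
  box has mass at least \<open>E (- F j - 1)\<close> because its centre is typical.\<close>

lemma box_packing:
 assumes j: "j <= J" and Q: "Q <= fst ` W" "inj_on (col j) Q" and Z: "!!q. q \<in> Q ==> X Int nb q (E (- real j)) <= Z"
 shows "card Q <= E (real (F j) + 2) * mu Z"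
proof -
 have fQ: "finite Q" using Q(1) by (rule finite_subset) simp
 have "card Q * E (- real (F j) - 1) <= 4 * mu Z"
 proof (rule packing[OF fQ _ _ Z])
  fix x
  have "card {q \<in> Q. x \<in> nb q (E (- real j))} = card (col j ` {q \<in> Q. x \<in> nb q (E (- real j))})"
   using Q(2) by (intro card_image[symmetric]) (auto simp: inj_on_def)
  also have "col j ` {q \<in> Q. x \<in> nb q (E (- real j))} = (%u. \<lfloor>u / E (- real j)\<rfloor>) ` (fst ` {q \<in> Q. x \<in> nb q (E (- real j))})"
   unfolding image_image col_def ..
  also have "real (card ...) <= ((fst x + E (- real j)) - (fst x - E (- real j))) / E (- real j) + 2"
   by (intro card_floor_interval) (auto simp: nb_def abs_le_iff)
  also have "... = 4" by simp
  finally show "real (card {q \<in> Q. x \<in> nb q (E (- real j))}) <= 4" .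
 next
  fix q assume "q \<in> Q"
  then show "E (- real (F j) - 1) <= mu (nb q (E (- real j)))" using Q(1) mu_typ(2)[OF _ j] by auto
 qed
 then have "E (real (F j) + 1) * (card Q * E (- real (F j) - 1)) <= E (real (F j) + 1) * (4 * mu Z)" by simp
 moreover have "E (real (F j) + 1) * (card Q * E (- real (F j) - 1)) = card Q * (E (real (F j) + 1) * E (- real (F j) - 1))" by simp
 moreover have "E (real (F j) + 1) * E (- real (F j) - 1) = 1" unfolding E_add by simp
 ultimately have "card Q <= (4 * E (real (F j) + 1)) * mu Z" by simp
 also have "... <= E (real (F j) + 1 + 1) * mu Z" by (intro mult_right_mono E_const mu_nonneg) simp
 finally show ?thesis by (simp add: add.commute)
qed

text \<open>The boxes around \<open>Q\<close> lie in a slightly wider tube near the observed point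
  \<open>q0\<close>, whose mass \<open>Ob_tube_nb\<close> bounds. Dividing by the mass of one box
  gives non-concentration along the tube.\<close>

lemma card_cols:
 assumes j: "j <= J" and Q: "Q <= fst ` W" "inj_on (col j) Q" and w: "w \<in> W" and q0: "q0 \<in> Ob w" and a: "0 <= a"
  and near: "Q <= tube w (E (a - real j))" "Q <= nb q0 (E (- z))" and z: "z <= j"
  and V: "!!h. h <= J ==> z - a - real c1 - 5 <= real h ==> V <= G h"
 shows "card Q <= E (G j - V + 13 + 2 * real c1 + a)"
proof -
 define e where "e = a + real c1 + 1"
 have e: "1 <= e" using a by (simp add: e_def)
 have "card Q <= E (real (F j) + 2) * mu (tube w (E (- (real j - e))) Int nb q0 (E (- (z - e))))"
 proof (rule box_packing[OF j Q])
  fix q assume q: "q \<in> Q"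
  show "X Int nb q (E (- real j)) <= tube w (E (- (real j - e))) Int nb q0 (E (- (z - e)))"
  proof
   fix x assume x: "x \<in> X Int nb q (E (- real j))"
   have 1: "x \<in> tube w (E (a + c1 + 1 - real j))" using near(1) q x by (intro tube_step[OF w _ _ a]) auto
   have "E (- real j) <= E (- z)" using z by (intro E_mono) simp
   moreover have "2 * E (- z) <= E (- z + 1)" by (rule E_const) simp
   moreover have "E (- z + 1) <= E (- (z - e))" using e by (intro E_mono) simp
   ultimately have 2: "x \<in> nb q0 (E (- (z - e)))" using near(2) q x by (fastforce simp: nb_def abs_le_iff)
   have 3: "a + c1 + 1 - real j = - (real j - e)" by (simp add: e_def)
   show "x \<in> tube w (E (- (real j - e))) Int nb q0 (E (- (z - e)))" using 1 2 unfolding 3 by simp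
  qed
 qed
 also have "... <= E (real (F j) + 2) * E (10 + real c1 - tau * (real j - e) - V)"
 proof (intro mult_left_mono Ob_tube_nb[OF q0])
  show "V <= G h" if "h <= J" "z - e - 4 <= real h" for h using that by (intro V) (auto simp: e_def)
 qed (use j z e in auto)
 also have "... <= E (G j - V + 13 + 2 * real c1 + a)" unfolding E_add
 proof (intro E_mono)
  have "tau * e <= 1 * e" using tau_le e by simp
  then show "real (F j) + 2 + (10 + real c1 - tau * (real j - e) - V) <= G j - V + 13 + 2 * real c1 + a"
   by (simp add: G_def e_def algebra_simps)
 qed
 finally show ?thesis .
qed

lemma card_cols_tube:
 assumes j: "j <= J" and Q: "Q <= fst ` W" "inj_on (col j) Q" and w: "w \<in> W" and a: "0 <= a" and near: "Q <= tube w (E (a - real j))"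
 shows "card Q <= E (G j + 16 + 2 * real c1 + a)"
proof -
 have "Q <= nb (fst w) (E (- 0))"
 proof
  fix q assume "q \<in> Q"
  then have "q \<in> X" using Q(1) WX by auto
  then show "q \<in> nb (fst w) (E (- 0))" using X_unit[of q] X_unit[OF WX(1)[OF w]] by (auto simp: nb_def)
 qed
 then have "card Q <= E (G j - (- 3) + 13 + 2 * real c1 + a)"
  using G_linear[of _ 0] by (intro card_cols[OF j Q w fst_Ob[OF w] a near, of 0]) auto
 then show ?thesis by (simp add: algebra_simps)
qed

end

section \<open>Far parts of tubes, and tubes through two points\<close>

context typical begin

lemma far_dist:
 assumes w: "w \<in> W" and j: "b + 2 * c1 + 3 <= j" and q: "q0 \<in> tube w (E (real c1 + 2 - real j))" "q \<in> tube w (E (real c1 + 2 - real j))"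
  and far: "q \<notin> nb q0 (E (- real b))"
 shows "E (- real b - real c1 - 1) <= abs (fst q - fst q0)"
proof (rule ccontr)
 assume no: "~ ?thesis"
 have "E (real c1 + 2 - real j) <= E (0 - (real b + c1 + 1))" using j by (intro E_mono) linarith
 then have "q0 \<in> tube w (E (0 - (real b + c1 + 1)))" "q \<in> tube w (E (0 - (real b + c1 + 1)))"
  using q tube_mono by blast+
 then have "q \<in> nb q0 (E (0 + real c1 + 1 - (real b + c1 + 1)))"
 proof (rule near_tube[OF w])
  have "E (0 - (real b + c1 + 1)) = E (- real b - real c1 - 1)" by simp
  then show "abs (fst q - fst q0) <= E (0 - (real b + c1 + 1))" using no by simp
 qed simp
 then show False using far by simp
qed

text \<open>Near an observed point a tube carries little mass because \<open>G\<close> grows at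
  least linearly. For large \<open>b\<close> this is less than half of the mass of a fat tube, so
  the part outside the box of side \<open>E (- b)\<close> keeps the rest.\<close>

lemma Ob_far:
 fixes k :: real
 assumes w: "w \<in> W" and q: "q \<in> Ob w" and j: "b + 2 * c1 + 3 <= j" "j <= J" and b: "20 + 2 * real c1 + k <= theta * b"
  and fat: "E (- tau * j - k) <= mu (tube w (E (real c1 + 2 - real j)))"
 shows "E (- tau * j - k - 1) <= mu (tube w (E (real c1 + 2 - real j)) - nb q (E (- real b)))"
proof -
 let ?T = "tube w (E (real c1 + 2 - real j))" and ?y = "real j - c1 - 2"
 have y: "E (real c1 + 2 - real j) = E (- ?y)" by (rule E_cong) simp
 have "mu (tube w (E (- ?y)) Int nb q (E (- real b))) <= E (10 + real c1 - tau * ?y - (theta * (real b - 4) - 3))"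
  using j by (intro Ob_tube_nb[OF q] G_linear) auto
 also have "... <= E (- tau * j - k - 1)"
 proof (intro E_mono)
  have "tau * (real c1 + 2) <= 1 * (real c1 + 2)" using tau_le by simp
  then have "tau * c1 + tau * 2 <= c1 + 2" by (simp add: distrib_left)
  then show "10 + real c1 - tau * ?y - (theta * (real b - 4) - 3) <= - tau * j - k - 1"
   using b theta by (simp add: algebra_simps)
 qed
 finally have "mu (?T Int nb q (E (- real b))) <= E (- tau * j - k - 1)" unfolding y .
 moreover have "mu ?T <= mu ((?T - nb q (E (- real b))) Un (?T Int nb q (E (- real b))))" by (intro mu_mono) auto
 moreover have "2 * E (- tau * j - k - 1) <= E (- tau * j - k - 1 + 1)" by (rule E_const) simp
 ultimately show ?thesis using fat mu_Un[of "?T - nb q (E (- real b))" "?T Int nb q (E (- real b))"] by simp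
qed

text \<open>Two points at horizontal distance \<open>E (- d)\<close> determine slope and intercept
  of a tube through both up to \<open>E (a + d + 2 - j)\<close>.\<close>

lemma card_idx:
 assumes q: "!!w. w \<in> T ==> q \<in> tube w (E (a - real j)) & q' \<in> tube w (E (a - real j))"
  and far: "E (- d) <= abs (fst q - fst q')" and ad: "0 <= a" "0 <= d" and q1: "0 <= fst q" "fst q <= 1"
 shows "card (idx j ` T) <= E (2 * (a + d) + 6)"
proof (cases "T = {}")
 case False
 then obtain w0 where w0: "w0 \<in> T" by auto
 let ?r = "E (a + d + 2 - real j)"
 have "abs (slope w - slope w0) <= ?r & abs (icpt w - icpt w0) <= ?r" if w: "w \<in> T" for w
 proof -
  let ?s = "slope w - slope w0" and ?D = "%u. hgt w u - hgt w0 u"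
  have D: "?D u = ?s * u + (icpt w - icpt w0)" for u by (simp add: hgt_def algebra_simps)
  have Dq: "abs (?D (fst q)) <= 2 * E (a - real j)" "abs (?D (fst q')) <= 2 * E (a - real j)"
   using q[OF w] q[OF w0] unfolding mem_tube by linarith+
  have "?s * (fst q - fst q') = ?D (fst q) - ?D (fst q')" unfolding D by (simp add: algebra_simps)
  then have "abs ?s * abs (fst q - fst q') <= 4 * E (a - real j)" using Dq unfolding abs_mult[symmetric] by auto
  moreover have "abs ?s * E (- d) <= abs ?s * abs (fst q - fst q')" using far by (intro mult_left_mono) auto
  ultimately have "abs ?s <= 4 * E (a - real j) / E (- d)" by (simp add: pos_le_divide_eq)
  also have "... = 4 * E (a + d - real j)" unfolding times_divide_eq_right[symmetric] E_div by (simp add: algebra_simps)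
  also have "... <= E (a + d - real j + 1)" by (rule E_const) simp
  finally have s: "abs ?s <= E (a + d + 1 - real j)" by (simp add: algebra_simps)
  have "abs (?s * fst q) <= E (a + d + 1 - real j) * 1" unfolding abs_mult using s q1 by (intro mult_mono) auto
  moreover have "icpt w - icpt w0 = ?D (fst q) - ?s * fst q" unfolding D by simp
  moreover have "E (a - real j) <= E (a + d + 1 - real j)" "E (a + d + 1 - real j) <= ?r" using ad by (intro E_mono; simp)+
  moreover have "3 * E (a + d + 1 - real j) <= E (a + d + 1 - real j + 1)" by (rule E_const) simp
  ultimately have "abs (icpt w - icpt w0) <= ?r" using Dq(1) by (simp add: algebra_simps)
  then show ?thesis using s \<open>E (a + d + 1 - real j) <= ?r\<close> by simp
 qed
 note close = this
 have card1: "finite ((%x. \<lfloor>x / E (- real j)\<rfloor>) ` {x. c - ?r <= x & x <= c + ?r}) &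
   real (card ((%x. \<lfloor>x / E (- real j)\<rfloor>) ` {x. c - ?r <= x & x <= c + ?r})) <= E (a + d + 3)" for c
 proof
  have "(%x. \<lfloor>x / E (- real j)\<rfloor>) ` {x. c - ?r <= x & x <= c + ?r} <= {\<lfloor>(c - ?r) / E (- real j)\<rfloor>..\<lfloor>(c + ?r) / E (- real j)\<rfloor>}"
   by (auto intro!: floor_mono divide_right_mono)
  then show "finite ((%x. \<lfloor>x / E (- real j)\<rfloor>) ` {x. c - ?r <= x & x <= c + ?r})" by (rule finite_subset) simp
  have "real (card ((%x. \<lfloor>x / E (- real j)\<rfloor>) ` {x. c - ?r <= x & x <= c + ?r})) <= ((c + ?r) - (c - ?r)) / E (- real j) + 2"
   by (intro card_floor_interval E_pos) (auto intro: less_imp_le[OF E_pos] order_trans[of _ c])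
  also have "((c + ?r) - (c - ?r)) / E (- real j) = 2 * (?r / E (- real j))" by simp
  also have "?r / E (- real j) = E (a + d + 2)" unfolding E_div by simp
  also have "2 * E (a + d + 2) + 2 <= E (a + d + 3)"
   using E_ge_1[of "a + d + 2"] E_const[of 4 "a + d + 2"] ad by (simp add: algebra_simps)
  finally show "real (card ((%x. \<lfloor>x / E (- real j)\<rfloor>) ` {x. c - ?r <= x & x <= c + ?r})) <= E (a + d + 3)" .
 qed
 let ?I = "%c. (%x. \<lfloor>x / E (- real j)\<rfloor>) ` {x. c - ?r <= x & x <= c + ?r}"
 have "idx j ` T <= ?I (slope w0) \<times> ?I (icpt w0)"
 proof (rule image_subsetI)
  fix w assume "w \<in> T"
  then have "slope w \<in> {x. slope w0 - ?r <= x & x <= slope w0 + ?r}" "icpt w \<in> {x. icpt w0 - ?r <= x & x <= icpt w0 + ?r}"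
   using close[of w] by auto
  then show "idx j w \<in> ?I (slope w0) \<times> ?I (icpt w0)" unfolding idx_def by simp
 qed
 then have "card (idx j ` T) <= card (?I (slope w0) \<times> ?I (icpt w0))" using card1 by (intro card_mono) auto
 then have "real (card (idx j ` T)) <= real (card (?I (slope w0))) * real (card (?I (icpt w0)))"
  by (simp add: card_cartesian_product flip: of_nat_mult)
 also have "... <= E (a + d + 3) * E (a + d + 3)" using card1 by (intro mult_mono) auto
 also have "... = E (2 * (a + d) + 6)" unfolding E_add by (simp add: algebra_simps)
 finally show ?thesis .
qed simp

end

section \<open>Rich pairs, and numbers of tubes at two scales\<close>

locale typical_const = typical A l J c1 sgm tau W F
 for A :: "real set" and l :: real and J c1 :: nat and sgm tau :: real and W F +
 fixes b1 b :: nat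
 assumes b1: "24 + 2 * real c1 <= (2 * sgm - tau) * b1" "b1 + 2 * c1 + 3 <= J"
  and b: "90 + 13 * real c1 + 2 * real b1 <= (2 * sgm - tau) * b"
begin

definition c0 where "c0 = 18 + 4 * real c1 + 2 * real b1"
definition k1 where "k1 = c0 + 47 + 7 * real c1"
text \<open>The finest tube still has the expected mass, up to \<open>E (- c0)\<close>, when only
  its observed points are counted.\<close>

definition R where "R = {w \<in> W. E (- c0 - tau * real J) <= mu (Ob w)}"

lemma RW: "w \<in> R ==> w \<in> W" by (simp add: R_def)
lemma finR [simp]: "finite R" by (simp add: R_def)
text \<open>To each poor pair join a third point of its tube far from both ends; tightness provides
  many. The second and third points fix the tube up to a bounded power of \<open>l\<close>, and
  within one cell the pairs with a given second point number at most \<open>card (Ob w)\<close>,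
  which is small for a poor pair.\<close>

lemma card_poor: "real (card (W - R)) <= E (- 3) * (real (card X))^2"
proof -
 let ?P = "W - R" and ?T = "%w. tube w (E (real c1 + 2 - real J))" and ?d = "real b1 + real c1 + 1"
 let ?far = "%w. ?T w - nb (fst w) (E (- real b1)) - nb (snd w) (E (- real b1))"
 let ?N = "real (card X)"
 have bb: "24 + 2 * real c1 <= theta * b1" using b1(1) by (simp add: theta_def)
 have far: "E (- tau * J - 3) <= mu (?far w)" if w: "w \<in> W" for w
 proof -
  have "E (- tau * J - 1) = E (- 1 - tau * J)" by (rule E_cong) simp
  also have "... <= mu (tube w (E (- real J)))" using W_typ[OF w] by (simp add: tight_def)
  also have "... <= mu (?T w)" by (intro mu_mono le_infI1 tube_mono E_mono) simp
  finally have "E (- tau * J - 1) <= mu (?T w)" .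
  then have 1: "E (- tau * J - 1 - 1) <= mu (?T w - nb (fst w) (E (- real b1)))"
   using bb by (intro Ob_far[OF w fst_Ob[OF w] b1(2)]) auto
  have y: "E (real c1 + 2 - real J) = E (- (real J - c1 - 2))" by (rule E_cong) simp
  have 2: "mu (?T w Int nb (snd w) (E (- real b1))) <= E (14 + real c1 - tau * (real J - c1 - 2) - theta * b1)"
   unfolding y using b1(2) by (intro tube_nb_snd[OF w]) auto
  have 3: "E (14 + real c1 - tau * (real J - c1 - 2) - theta * b1) <= E (- tau * J - 3)"
  proof (intro E_mono)
   have "tau * (real c1 + 2) <= 1 * (real c1 + 2)" using tau_le by simp
   then have "tau * c1 + tau * 2 <= c1 + 2" by (simp add: distrib_left)
   then show "14 + real c1 - tau * (real J - c1 - 2) - theta * b1 <= - tau * J - 3" using bb by (simp add: algebra_simps)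
  qed
  have 4: "mu (?T w - nb (fst w) (E (- real b1))) <= mu (?far w Un (?T w Int nb (snd w) (E (- real b1))))" by (intro mu_mono) auto
  have "2 * E (- tau * J - 3) <= E (- tau * J - 3 + 1)" by (rule E_const) simp
  also have "... = E (- tau * J - 1 - 1)" by simp
  finally show ?thesis using 1 2 3 4 mu_Un[of "?far w" "?T w Int nb (snd w) (E (- real b1))"] by simp
 qed
 have fP: "finite ?P" by simp
 let ?E = "E (2 * (real c1 + 2 + ?d) + 6)" and ?f = "E (- c0 - tau * real J)"
 have fib: "real (card {w \<in> ?P. snd w = fst z & snd z \<in> ?far w}) <= ?E * (?f * ?N)" if z: "z \<in> X \<times> X" for z
 proof (rule card_le_fibres[where f = "idx J"])
  let ?S = "{w \<in> ?P. snd w = fst z & snd z \<in> ?far w}"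
  show "finite ?S" by simp
  show "real (card (idx J ` ?S)) <= ?E"
  proof (cases "?S = {}")
   case False
   then obtain w where w: "w \<in> W" "snd w = fst z" "snd z \<in> ?far w" by auto
   have "E (- real b1 - real c1 - 1) <= abs (fst (snd z) - fst (fst z))"
   proof (rule far_dist[OF w(1) b1(2)])
    show "fst z \<in> tube w (E (real c1 + 2 - real J))" using W_line(2)[OF w(1)] w(2) by (simp add: mem_tube)
   qed (use w in auto)
   moreover have "- ?d = - real b1 - real c1 - 1" by simp
   ultimately have "E (- ?d) <= abs (fst (fst z) - fst (snd z))" by simp
   then show ?thesis
   proof (rule card_idx[rotated])
    fix w assume w: "w \<in> ?S"
    then show "fst z \<in> tube w (E (real c1 + 2 - real J)) & snd z \<in> tube w (E (real c1 + 2 - real J))"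
     using W_line(2)[of w] by (auto simp: mem_tube)
   qed (use z X_unit[of "fst z"] in auto)
  next
   case True
   show ?thesis unfolding True by simp
  qed
  show "0 <= ?f * ?N" by simp
  fix w assume w: "w \<in> ?S"
  have "card {w' \<in> ?S. idx J w' = idx J w} <= card (Ob w)"
  proof (rule card_inj_on_le)
   show "inj_on fst {w' \<in> ?S. idx J w' = idx J w}" by (auto simp: inj_on_def)
   show "fst ` {w' \<in> ?S. idx J w' = idx J w} <= Ob w" by (auto simp: Ob_def)
  qed simp
  moreover have "real (card (Ob w)) = mu (Ob w) * ?N" unfolding mu_card[symmetric] using Ob_X[of w] by (simp add: Int_absorb1)
  moreover have "mu (Ob w) * ?N <= ?f * ?N" using w by (intro mult_right_mono) (auto simp: R_def)
  ultimately show "real (card {w' \<in> ?S. idx J w' = idx J w}) <= ?f * ?N" by simp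
 qed
 have "card ?P * (E (- tau * J - 3) * ?N) = (\<Sum>w\<in>?P. E (- tau * J - 3) * ?N)" by simp
 also have "... <= (\<Sum>w\<in>?P. real (card {z \<in> X \<times> X. snd w = fst z & snd z \<in> ?far w}))"
 proof (intro sum_mono)
  fix w assume w: "w \<in> ?P"
  have "E (- tau * J - 3) * ?N <= mu (?far w) * ?N" using far w by (intro mult_right_mono) auto
  also have "... = card (X Int ?far w)" by (simp only: mu_card)
  also have "... <= card {z \<in> X \<times> X. snd w = fst z & snd z \<in> ?far w}"
  proof (intro of_nat_mono card_inj_on_le)
   show "inj_on (%q. (snd w, q)) (X Int ?far w)" by (simp add: inj_on_def)
   show "(%q. (snd w, q)) ` (X Int ?far w) <= {z \<in> X \<times> X. snd w = fst z & snd z \<in> ?far w}"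
    using w WX(2)[of w] by auto
  qed simp
  finally show "E (- tau * J - 3) * ?N <= real (card {z \<in> X \<times> X. snd w = fst z & snd z \<in> ?far w})" .
 qed
 also have "... = (\<Sum>z\<in>X \<times> X. real (card {w \<in> ?P. snd w = fst z & snd z \<in> ?far w}))"
  using double_count[OF fP, of "X \<times> X" "%w z. snd w = fst z & snd z \<in> ?far w"] by (simp flip: of_nat_sum)
 also have "... <= (\<Sum>z\<in>X \<times> X. ?E * (?f * ?N))" using fib by (intro sum_mono)
 also have "... = (?E * ?f) * ?N * ?N^2" by (simp add: power2_eq_square)
 also have "?E * ?f = E (- 3) * E (- tau * J - 3)" unfolding E_add by (rule E_cong) (simp add: c0_def algebra_simps)
 finally have "(E (- tau * J - 3) * ?N) * card ?P <= (E (- tau * J - 3) * ?N) * (E (- 3) * ?N^2)" by (simp only: mult_ac)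
 moreover have "0 < E (- tau * J - 3) * ?N" using X_ne E_pos by simp
 ultimately show ?thesis by (simp only: mult_le_cancel_left_pos)
qed

lemma card_R: "E (- 3) * (real (card X))^2 <= card R"
proof -
 have "card W = card R + card (W - R)" using card_Un_disjoint[of R "W - R"] RW by (auto simp: Un_absorb1 subset_iff)
 moreover have "2 * E (- 3) <= E (- 3 + 1)" by (rule E_const) simp
 then have "2 * E (- 3) * (real (card X))^2 <= E (- 3 + 1) * (real (card X))^2" by (intro mult_right_mono) auto
 ultimately show ?thesis using card_W card_poor by simp
qed

lemma Ob_near: "w \<in> W ==> q \<in> Ob w ==> q' \<in> Ob w ==> s <= J ==> col s q' = col s q ==> q' \<in> nb q (E (1 + real c1 + 1 - real s))"
proof (rule near_tube[of w])
 assume "col s q' = col s q"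
 then have "abs (fst q' - fst q) < E (- real s)" unfolding col_def by (rule same_cell[OF E_pos])
 then show "abs (fst q' - fst q) <= E (1 - real s)" using E_mono[of "- real s" "1 - real s"] by simp
qed (auto intro: Ob_tube)

text \<open>One column holds at most about \<open>E (- tau * J - G s)\<close> of the observed mass:
  this is \<open>Ob_tube_nb\<close>, where the record property keeps \<open>G\<close> from falling
  much below \<open>G s\<close> on the scales involved. A rich pair therefore needs many
  columns.\<close>

lemma card_obs_cols:
 assumes w: "w \<in> R" and s: "recd s"
 shows "E (G s - k1) <= card (col s ` Ob w)"
proof -
 let ?N = "real (card X)" and ?e = "47 + 7 * c1 - tau * J - G s" and ?y = "real J - 1" and ?z = "real s - real c1 - 2"
 have sJ: "s <= J" using s by (simp add: recd_def)
 have "real (card (Ob w)) <= real (card (col s ` Ob w)) * (E ?e * ?N)"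
 proof (rule card_le_fibres)
  fix q assume q: "q \<in> Ob w"
  have "{q' \<in> Ob w. col s q' = col s q} <= X Int (tube w (E (- ?y)) Int nb q (E (- ?z)))"
  proof
   fix q' assume q': "q' \<in> {q' \<in> Ob w. col s q' = col s q}"
   have "q' \<in> nb q (E (1 + real c1 + 1 - real s))" using q q' RW[OF w] sJ by (intro Ob_near[of w]) auto
   moreover have "1 + real c1 + 1 - real s = - ?z" "1 - real J = - ?y" by auto
   moreover have "q' \<in> tube w (E (1 - real J))" using q' by (intro Ob_tube) auto
   moreover have "q' \<in> X" using q' Ob_X by blast
   ultimately show "q' \<in> X Int (tube w (E (- ?y)) Int nb q (E (- ?z)))" by (simp only: Int_iff)
  qed
  then have "real (card {q' \<in> Ob w. col s q' = col s q}) <= card (X Int (tube w (E (- ?y)) Int nb q (E (- ?z))))"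
   by (intro of_nat_mono card_mono) auto
  also have "... = mu (tube w (E (- ?y)) Int nb q (E (- ?z))) * ?N" by (rule mu_card)
  also have "... <= E (10 + real c1 - tau * ?y - (G s - 6 * (real c1 + 6))) * ?N"
  proof (intro mult_right_mono Ob_tube_nb[OF q])
   show "G s - 6 * (real c1 + 6) <= G h" if "h <= J" "?z - 4 <= real h" for h using that by (intro G_record[OF s]) auto
  qed (use sJ in auto)
  also have "... <= E ?e * ?N" using tau_le by (intro mult_right_mono E_mono) (auto simp: algebra_simps)
  finally show "real (card {q' \<in> Ob w. col s q' = col s q}) <= E ?e * ?N" .
 qed auto
 moreover have "E (- c0 - tau * real J) * ?N <= mu (Ob w) * ?N" using w by (intro mult_right_mono) (auto simp: R_def)
 moreover have "mu (Ob w) * ?N = card (Ob w)" unfolding mu_card[symmetric] using Ob_X[of w] by (simp add: Int_absorb1)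
 ultimately have "E (- c0 - tau * real J) * ?N <= (real (card (col s ` Ob w)) * E ?e) * ?N" by simp
 then have "E (- c0 - tau * real J) <= real (card (col s ` Ob w)) * E ?e" using X_ne by simp
 then have "E (- c0 - tau * real J) / E ?e <= card (col s ` Ob w)" by (simp add: pos_divide_le_eq)
 moreover have "E (- c0 - tau * real J) / E ?e = E (G s - k1)" unfolding E_div by (rule E_cong) (simp add: k1_def)
 ultimately show ?thesis by simp
qed

definition boxes where "boxes w s = (\<Union>q\<in>Ob w. nb q (E (- real s)))"

lemma boxes_tube: "w \<in> W ==> s <= J ==> boxes w s <= tube w (E (real c1 + 2 - real s))"
proof -
 assume w: "w \<in> W" "s <= J"
 have "x \<in> tube w (E (1 + real c1 + 1 - real s))" if "q \<in> Ob w" "x \<in> nb q (E (- real s))" for q x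
  using that w by (intro tube_step[OF w(1) Ob_tube]) auto
 moreover have "E (1 + real c1 + 1 - real s) = E (real c1 + 2 - real s)" by (rule E_cong) simp
 ultimately show ?thesis by (auto simp: boxes_def)
qed

text \<open>Tightness was assumed at the finest scale only; counting boxes over distinct columns
  shows that tubes of rich pairs are heavy at every record scale.\<close>

lemma mu_boxes:
 assumes w: "w \<in> R" and s: "recd s"
 shows "E (- tau * s - (k1 + 2)) <= mu (boxes w s)"
proof -
 obtain Q where Q: "Q <= Ob w" "inj_on (col s) Q" "col s ` Ob w = col s ` Q"
  using subset_image_inj[of "col s ` Ob w" "col s" "Ob w"] by auto
 have "E (G s - k1) <= card Q" using card_obs_cols[OF w s] Q by (simp add: card_image)
 also have "card Q <= E (real (F s) + 2) * mu (boxes w s)"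
 proof (rule box_packing)
  show "s <= J" using s by (simp add: recd_def)
  show "Q <= fst ` W" using Q(1) Ob_W by blast
 qed (use Q in \<open>auto simp: boxes_def\<close>)
 finally have "E (G s - k1) / E (real (F s) + 2) <= mu (boxes w s)" by (simp add: pos_divide_le_eq mult.commute)
 moreover have "E (G s - k1) / E (real (F s) + 2) = E (- tau * s - (k1 + 2))" unfolding E_div by (rule E_cong) (simp add: G_def)
 ultimately show ?thesis by simp
qed

lemma R_far:
 assumes w: "w \<in> R" and q: "q \<in> Ob w" and s: "recd s" "b + 2 * c1 + 3 <= s"
 shows "E (- tau * s - k1 - 3) <= mu (tube w (E (real c1 + 2 - real s)) - nb q (E (- real b)))"
proof -
 have sJ: "s <= J" using s by (simp add: recd_def)
 have "E (- tau * s - (k1 + 2)) <= mu (tube w (E (real c1 + 2 - real s)))"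
  using mu_boxes[OF w s(1)] boxes_tube[OF RW[OF w] sJ] mu_mono[of "boxes w s" "tube w (E (real c1 + 2 - real s))"] by force
 moreover have "20 + 2 * real c1 + (k1 + 2) <= theta * b" using b by (simp add: theta_def k1_def c0_def)
 ultimately have "E (- tau * s - (k1 + 2) - 1) <= mu (tube w (E (real c1 + 2 - real s)) - nb q (E (- real b)))"
  using Ob_far[OF RW[OF w] q s(2) sJ] by blast
 moreover have "E (- tau * s - (k1 + 2) - 1) = E (- tau * s - k1 - 3)" by simp
 ultimately show ?thesis by simp
qed

definition k2 where "k2 = 2 * k1 + 4 * real c1 + 2 * real b + 19"

text \<open>Each coarse tube contains a proportion about \<open>E (- 2 * tau * s)\<close> of all
  pairs of points, with the two points horizontally far apart, and such a pair lies in a number of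
  coarse tubes bounded by a fixed power of \<open>l\<close>.\<close>

lemma card_coarse:
 assumes s: "recd s" "b + 2 * c1 + 3 <= s"
 shows "card (idx s ` R) <= E (2 * tau * s + k2)"
proof -
 let ?N = "real (card X)" and ?T = "%w. tube w (E (real c1 + 2 - real s))" and ?d = "real b + real c1 + 2"
 have sJ: "s <= J" using s by (simp add: recd_def)
 obtain T where T: "T <= R" "inj_on (idx s) T" "idx s ` R = idx s ` T"
  using subset_image_inj[of "idx s ` R" "idx s" R] by auto
 have fT: "finite T" using T(1) by (rule finite_subset) simp
 define D where "D w z \<longleftrightarrow> fst z \<in> boxes w s & snd z \<in> ?T w & E (- ?d) <= abs (fst (fst z) - fst (snd z))" for w z
 have "card T * (E (- tau * s - (k1 + 2)) * ?N * (E (- tau * s - k1 - 3) * ?N)) <= (\<Sum>w\<in>T. real (card {z \<in> X \<times> X. D w z}))"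
  unfolding sum_constant[symmetric]
 proof (intro sum_mono)
  fix w assume "w \<in> T"
  then have w: "w \<in> R" "w \<in> W" using T(1) RW by blast+
  have "E (- tau * s - (k1 + 2)) * ?N <= card (X Int boxes w s)" unfolding mu_card by (intro mult_right_mono mu_boxes[OF w(1) s(1)]) simp
  then have "E (- tau * s - (k1 + 2)) * ?N * (E (- tau * s - k1 - 3) * ?N) <= card (X Int boxes w s) * (E (- tau * s - k1 - 3) * ?N)"
   by (intro mult_right_mono) auto
  also have "... = (\<Sum>q\<in>X Int boxes w s. E (- tau * s - k1 - 3) * ?N)" by simp
  also have "... <= (\<Sum>q\<in>X Int boxes w s. real (card {q' \<in> X. D w (q, q')}))"
  proof (intro sum_mono)
   fix q assume q: "q \<in> X Int boxes w s"
   then obtain q0 where q0: "q0 \<in> Ob w" "q \<in> nb q0 (E (- real s))" by (auto simp: boxes_def)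
   have "E (- tau * s - k1 - 3) * ?N <= card (X Int (?T w - nb q0 (E (- real b))))"
    unfolding mu_card by (intro mult_right_mono R_far[OF w(1) q0(1) s]) simp
   also have "... <= card {q' \<in> X. D w (q, q')}"
   proof (intro of_nat_mono card_mono subsetI)
    fix q' assume q': "q' \<in> X Int (?T w - nb q0 (E (- real b)))"
    have "q0 \<in> ?T w" using Ob_tube[OF q0(1) sJ] tube_mono[OF E_mono[of "1 - real s" "real c1 + 2 - real s"], of w] by auto
    then have "E (- real b - real c1 - 1) <= abs (fst q' - fst q0)" using q' by (intro far_dist[OF w(2) s(2)]) auto
    moreover have "E (- real s) <= E (- ?d)" using s(2) by (intro E_mono) simp
    moreover have "2 * E (- ?d) <= E (- ?d + 1)" by (rule E_const) simp
    moreover have "E (- ?d + 1) = E (- real b - real c1 - 1)" by simp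
    moreover have "abs (fst q - fst q0) <= E (- real s)" using q0(2) by (simp add: nb_def)
    ultimately have "E (- ?d) <= abs (fst q - fst q')" by simp
    then show "q' \<in> {q' \<in> X. D w (q, q')}" using q q' by (simp add: D_def)
   qed simp
   finally show "E (- tau * s - k1 - 3) * ?N <= real (card {q' \<in> X. D w (q, q')})" .
  qed
  also have "... = real (card {(q, q'). q \<in> X Int boxes w s & q' \<in> X & D w (q, q')})"
   by (subst card_rel_bound) auto
  also have "{(q, q'). q \<in> X Int boxes w s & q' \<in> X & D w (q, q')} = {z \<in> X \<times> X. D w z}" by (auto simp: D_def)
  finally show "E (- tau * s - (k1 + 2)) * ?N * (E (- tau * s - k1 - 3) * ?N) <= real (card {z \<in> X \<times> X. D w z})" .
 qed
 also have "... = (\<Sum>z\<in>X \<times> X. real (card {w \<in> T. D w z}))"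
  using double_count[OF fT, of "X \<times> X" D] by (simp flip: of_nat_sum)
 also have "... <= (\<Sum>z\<in>X \<times> X. E (2 * (real c1 + 2 + ?d) + 6))"
 proof (intro sum_mono)
  fix z assume z: "z \<in> X \<times> X"
  show "real (card {w \<in> T. D w z}) <= E (2 * (real c1 + 2 + ?d) + 6)"
  proof (cases "{w \<in> T. D w z} = {}")
   case False
   then have far: "E (- ?d) <= abs (fst (fst z) - fst (snd z))" by (auto simp: D_def)
   have "card {w \<in> T. D w z} = card (idx s ` {w \<in> T. D w z})" using T(2) by (intro card_image[symmetric]) (auto simp: inj_on_def)
   also have "real ... <= E (2 * (real c1 + 2 + ?d) + 6)" using far
   proof (rule card_idx[rotated])
    fix w assume w: "w \<in> {w \<in> T. D w z}"
    then have "w \<in> W" using T(1) RW by blast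
    then show "fst z \<in> ?T w & snd z \<in> ?T w" using w boxes_tube[OF _ sJ, of w] by (auto simp: D_def)
   qed (use z X_unit[of "fst z"] in auto)
   finally show ?thesis .
  next
   case True
   show ?thesis unfolding True by simp
  qed
 qed
 also have "... = E (2 * (real c1 + 2 + ?d) + 6) * ?N^2" by (simp add: power2_eq_square)
 finally have "card T * (E (- tau * s - (k1 + 2)) * E (- tau * s - k1 - 3)) * ?N^2 <= E (2 * (real c1 + 2 + ?d) + 6) * ?N^2"
  by (simp only: power2_eq_square mult_ac)
 moreover have "0 < ?N^2" using X_ne by simp
 ultimately have "card T * (E (- tau * s - (k1 + 2)) * E (- tau * s - k1 - 3)) <= E (2 * (real c1 + 2 + ?d) + 6)"
  by simp
 then have "card T <= E (2 * (real c1 + 2 + ?d) + 6) / E (- tau * s - (k1 + 2) + (- tau * s - k1 - 3))"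
  unfolding E_add using E_pos by (simp only: pos_le_divide_eq)
 also have "... = E (2 * tau * s + k2)" unfolding E_div by (rule E_cong) (simp add: k2_def algebra_simps)
 finally show ?thesis unfolding T(3) using T(2) by (simp add: card_image)
qed

text \<open>Pairs with the same index lie in the square of one thin tube, a proportion at most
  \<open>E (6 - 2 * tau * x)\<close> of all pairs, so the rich pairs need many indices.\<close>

lemma card_fine:
 assumes x: "x <= J"
 shows "E (2 * tau * x - 9) <= card (idx x ` R)"
proof -
 let ?N = "real (card X)"
 have "real (card R) <= real (card (idx x ` R)) * (E (6 - 2 * tau * x) * ?N^2)"
 proof (rule card_le_fibres)
  fix w assume w: "w \<in> R"
  let ?t = "X Int tube w (E (- (real x - 1)))"
  have "{w' \<in> R. idx x w' = idx x w} <= ?t \<times> ?t"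
  proof
   fix w' assume w': "w' \<in> {w' \<in> R. idx x w' = idx x w}"
   then have W': "w' \<in> W" "idx x w' = idx x w" using RW by auto
   have "q \<in> ?t" if "q \<in> X" "snd q = hgt w' (fst q)" for q
   proof -
    have "q \<in> X Int tube w' (E (- real x))" using that by (simp add: mem_tube)
    moreover have "1 - real x = - (real x - 1)" by simp
    ultimately show ?thesis using tube_idx[OF W'(2), of "real x"] by auto
   qed
   from this[OF WX(1)[OF W'(1)] W_line(1)[OF W'(1)]] this[OF WX(2)[OF W'(1)] W_line(2)[OF W'(1)]]
   show "w' \<in> ?t \<times> ?t" by (simp only: mem_Times_iff)
  qed
  then have "card {w' \<in> R. idx x w' = idx x w} <= card (?t \<times> ?t)" by (intro card_mono) auto
  then have "real (card {w' \<in> R. idx x w' = idx x w}) <= real (card ?t) * real (card ?t)"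
   by (simp add: card_cartesian_product flip: of_nat_mult)
  also have "... <= (E (3 - tau * x) * ?N) * (E (3 - tau * x) * ?N)"
  proof -
   have "mu (tube w (E (- (real x - 1)))) <= E (2 - tau * (real x - 1))" using x by (intro thin_real[OF RW[OF w]]) simp
   also have "... <= E (3 - tau * x)" using tau_le by (intro E_mono) (simp add: algebra_simps)
   finally have "real (card ?t) <= E (3 - tau * x) * ?N" unfolding mu_card by (intro mult_right_mono) auto
   then show ?thesis by (intro mult_mono) auto
  qed
  also have "... = (E (3 - tau * x) * E (3 - tau * x)) * ?N^2" by (simp add: power2_eq_square)
  also have "E (3 - tau * x) * E (3 - tau * x) = E (6 - 2 * tau * x)" unfolding E_add by (rule E_cong) simp
  finally show "real (card {w' \<in> R. idx x w' = idx x w}) <= E (6 - 2 * tau * x) * ?N^2" .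
 qed auto
 then have "E (- 3) * ?N^2 <= (real (card (idx x ` R)) * E (6 - 2 * tau * x)) * ?N^2" using card_R by simp
 then have "E (- 3) <= real (card (idx x ` R)) * E (6 - 2 * tau * x)" using X_ne by simp
 then have "E (- 3) / E (6 - 2 * tau * x) <= card (idx x ` R)" by (simp add: pos_divide_le_eq)
 moreover have "E (- 3) / E (6 - 2 * tau * x) = E (2 * tau * x - 9)" unfolding E_div by simp
 ultimately show ?thesis by simp
qed

text \<open>Pigeonhole between \<open>card_coarse\<close> and \<open>card_fine\<close>. The surplus
  \<open>2 * tau * (x - s)\<close> in the exponent is, up to constants, the number of lines required
  at the rescaled resolution \<open>E (s - x)\<close>.\<close>

lemma popular_tube:
 assumes s: "recd s" "b + 2 * c1 + 3 <= s" and x: "x <= J"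
 obtains Lam where "Lam <= R" "inj_on (idx x) Lam" "!!w w'. w \<in> Lam ==> w' \<in> Lam ==> idx s w = idx s w'"
  "E (2 * tau * (real x - real s) - k2 - 10) <= card Lam"
proof -
 obtain T where T: "T <= R" "inj_on (idx x) T" "idx x ` R = idx x ` T"
  using subset_image_inj[of "idx x ` R" "idx x" R] by auto
 have fT: "finite T" using T(1) by (rule finite_subset) simp
 let ?K = "E (2 * tau * (real x - real s) - k2 - 10)"
 have "EX w:T. ?K < card {w' \<in> T. idx s w' = idx s w}"
 proof (rule ccontr)
  assume no: "~ ?thesis"
  have "card (idx s ` T) <= card (idx s ` R)" using T(1) by (intro card_mono) auto
  then have "real (card (idx s ` T)) <= E (2 * tau * s + k2)" using card_coarse[OF s] by simp
  then have "card T <= E (2 * tau * s + k2) * ?K" using no by (intro card_le_fibres[OF fT]) (auto simp: not_less)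
  also have "... = E (2 * tau * x - 10)" unfolding E_add by (rule E_cong) (simp add: algebra_simps)
  also have "... < E (2 * tau * x - 9)" using l_ge by simp
  also have "... <= card T" using card_fine[OF x] T by (simp add: card_image)
  finally show False by simp
 qed
 then obtain w where w: "w \<in> T" "?K < card {w' \<in> T. idx s w' = idx s w}" by auto
 show thesis
 proof (rule that[of "{w' \<in> T. idx s w' = idx s w}"])
  show "inj_on (idx x) {w' \<in> T. idx s w' = idx s w}" using T(2) by (auto simp: inj_on_def)
 qed (use T w in auto)
qed
end

section \<open>The rescaled incidence structure inside a coarse tube\<close>

locale scales = typical_const A l J c1 sgm tau W F b1 b
 for A :: "real set" and l :: real and J c1 :: nat and sgm tau :: real and W F b1 b +
 fixes s x :: nat and Lam :: "((real \<times> real) \<times> (real \<times> real)) set" and w0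
 assumes s: "recd s" "b + 2 * c1 + 4 <= s" and x: "recd x" "s < x" "x <= 2 * s"
  and Lam: "Lam <= R" "inj_on (idx x) Lam" "!!w w'. w \<in> Lam ==> w' \<in> Lam ==> idx s w = idx s w'"
  and card_Lam: "E (2 * tau * (real x - real s) - k2 - 10) <= card Lam" and w0: "w0 \<in> Lam"
begin

text \<open>The tubes in \<open>Lam\<close> are distinct at scale \<open>x\<close> but indistinguishable at scale \<open>s\<close>. Points of the rescaled
picture are the columns of width \<open>E (- s)\<close>, and a tube is incident to those in which it carries its due
share of columns of width \<open>E (- x)\<close>. As \<open>x \<le> 2 * s\<close>, all these tubes are parallel up to \<open>E (- x)\<close>
inside one column.\<close>

definition pos where "pos q = of_int (col s q) * E (- real s)"
definition Oc where "Oc w p = {q \<in> Ob w. pos q = p}"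
definition k3 where "k3 = 62 + 14 * real c1"
definition k4 where "k4 = k1 + 18 + 2 * real c1"
definition I where "I w p \<longleftrightarrow> E (G x - G s - k4) <= card (col x ` Oc w p)"
definition P where "P = {p. EX w:Lam. I w p}"

lemma sx: "s <= J" "x <= J" "b + 2 * c1 + 3 <= s" "b + 2 * c1 + 3 <= x" using s x by (auto simp: recd_def)
lemma LamR: "w \<in> Lam ==> w \<in> R" "w \<in> Lam ==> w \<in> W" using Lam(1) RW by blast+
lemma finLam [simp]: "finite Lam" using Lam(1) by (rule finite_subset) simp

lemma pos_fst: "pos q <= fst q" "fst q < pos q + E (- real s)"
proof -
 have "of_int (col s q) <= fst q / E (- real s)" "fst q / E (- real s) < of_int (col s q) + 1" by (simp_all add: col_def)
 then show "pos q <= fst q" "fst q < pos q + E (- real s)" using E_pos[of "- real s"] unfolding pos_def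
  by (simp_all add: pos_le_divide_eq pos_divide_less_eq distrib_right del: E_pos)
qed

lemma pos_unit: "q \<in> X ==> 0 <= pos q & pos q <= 1"
proof -
 assume q: "q \<in> X"
 have "0 <= col s q" using X_unit[OF q] by (simp add: col_def)
 then have "0 <= pos q" unfolding pos_def by simp
 then show ?thesis using pos_fst(1)[of q] X_unit[OF q] by simp
qed

lemma pos_eq: "pos q = pos q' \<longleftrightarrow> col s q = col s q'" by (simp add: pos_def)

lemma Oc_sub: "Oc w p <= Ob w" "finite (Oc w p)" by (auto simp: Oc_def)

lemma I_ne: "I w p ==> EX q. q \<in> Oc w p"
proof (rule ccontr)
 assume "I w p" and no: "\<nexists>q. q \<in> Oc w p"
 then have "Oc w p = {}" by auto
 then show False using \<open>I w p\<close> E_pos[of "G x - G s - k4"] unfolding I_def by simp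
qed

lemma P_unit: "P <= {0..1}" and finP: "finite P"
proof -
 have "P <= pos ` X"
 proof
  fix p assume "p \<in> P"
  then obtain w q where "q \<in> Oc w p" using I_ne unfolding P_def by blast
  then have "q \<in> X" "p = pos q" using Ob_X[of w] by (auto simp: Oc_def)
  then show "p \<in> pos ` X" by simp
 qed
 then show "P <= {0..1}" "finite P" using pos_unit by (auto intro: finite_subset)
qed

lemma Lam_tube: "w \<in> Lam ==> w' \<in> Lam ==> q \<in> Ob w ==> q \<in> tube w' (E (2 - real s))"
proof -
 assume w: "w \<in> Lam" "w' \<in> Lam" "q \<in> Ob w"
 have "q \<in> X" using w(3) Ob_X by blast
 moreover have "q \<in> tube w (E (1 - real s))" using w sx by (intro Ob_tube)
 moreover have "X Int tube w (E (- (real s - 1))) <= tube w' (E (1 - (real s - 1)))" by (rule tube_idx[OF Lam(3)[OF w(1,2)]]) simp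
 moreover have "1 - real s = - (real s - 1)" "2 - real s = 1 - (real s - 1)" by auto
 ultimately show ?thesis by (metis IntI subsetD)
qed

lemma representatives:
 assumes "S <= P"
 obtains Q where "inj_on (col s) Q" "card Q = card S" "!!q. q \<in> Q ==> pos q \<in> S & (EX w:Lam. q \<in> Ob w)"
proof -
 have "ALL p:S. EX q. pos q = p & (EX w:Lam. q \<in> Ob w)"
 proof
  fix p assume "p \<in> S"
  then obtain w where w: "w \<in> Lam" "I w p" using assms by (auto simp: P_def)
  from I_ne[OF w(2)] show "EX q. pos q = p & (EX w:Lam. q \<in> Ob w)" using w(1) by (auto simp: Oc_def)
 qed
 then obtain g where g: "ALL p:S. pos (g p) = p & (EX w:Lam. g p \<in> Ob w)" by metis
 show thesis
 proof (rule that[of "g ` S"])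
  show "inj_on (col s) (g ` S)" using g by (auto simp: inj_on_def pos_eq[symmetric])
  show "card (g ` S) = card S" using g by (intro card_image) (metis inj_onI)
 qed (use g in auto)
qed

lemma card_P: "card P <= E (G s + 18 + 2 * real c1)"
proof -
 obtain Q where Q: "inj_on (col s) Q" "card Q = card P" "!!q. q \<in> Q ==> pos q \<in> P & (EX w:Lam. q \<in> Ob w)"
  using representatives[of P] by auto
 have "card Q <= E (G s + 16 + 2 * real c1 + 2)"
 proof (rule card_cols_tube[OF sx(1) _ Q(1) LamR(2)[OF w0]])
  show "Q <= fst ` W" using Q(3) Ob_W by blast
  show "Q <= tube w0 (E (2 - real s))" using Q(3) Lam_tube w0 by blast
 qed simp
 moreover have "E (G s + 16 + 2 * real c1 + 2) = E (G s + 18 + 2 * real c1)" by (rule E_cong) simp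
 ultimately show ?thesis using Q(2) by simp
qed

lemma card_Oc:
 assumes w: "w \<in> W"
 shows "card (col x ` Oc w p) <= E (G x - G s + k3)"
proof (cases "Oc w p = {}")
 case False
 then obtain q0 where q0: "q0 \<in> Oc w p" by auto
 obtain Q where Q: "Q <= Oc w p" "inj_on (col x) Q" "col x ` Oc w p = col x ` Q"
  using subset_image_inj[of "col x ` Oc w p" "col x" "Oc w p"] by auto
 have "card Q <= E (G x - (G s - 6 * (2 * real c1 + 8)) + 13 + 2 * real c1 + 1)"
 proof (rule card_cols[OF sx(2) _ Q(2) w, of q0 1 "real s - c1 - 2"])
  show "Q <= fst ` W" using Q(1) Oc_sub(1) Ob_W by blast
  show "q0 \<in> Ob w" using q0 Oc_sub(1) by blast
  show "Q <= tube w (E (1 - real x))" using Q(1) Oc_sub(1) sx by (intro subsetI Ob_tube) blast+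
  have e: "1 + real c1 + 1 - real s = - (real s - c1 - 2)" by simp
  show "Q <= nb q0 (E (- (real s - c1 - 2)))"
  proof
   fix q assume "q \<in> Q"
   then have "q \<in> Oc w p" using Q(1) by auto
   then show "q \<in> nb q0 (E (- (real s - c1 - 2)))"
    unfolding e[symmetric] using q0 sx by (intro Ob_near[OF w]) (auto simp: Oc_def pos_eq[symmetric])
  qed
  show "G s - 6 * (2 * real c1 + 8) <= G h" if "h <= J" "real s - c1 - 2 - 1 - c1 - 5 <= real h" for h
   using that by (intro G_record[OF s(1)]) auto
 qed (use x in auto)
 also have "... = E (G x - G s + k3)" by (rule E_cong) (simp add: k3_def)
 finally show ?thesis unfolding Q(3) using Q(2) by (simp add: card_image)
qed simp

text \<open>A tube of a rich pair occupies at least \<open>E (G x - k1)\<close> fine columns, and a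
  single position holds at most \<open>E (G x - G s + k3)\<close> of them. By the choice of
  \<open>k4\<close>, positions without incidence contribute at most a proportion
  \<open>1 / l\<close> of that lower bound.\<close>

lemma card_rich:
 assumes w: "w \<in> Lam"
 shows "E (G s - k1 - k3 - 1) <= card {p \<in> P. I w p}"
proof -
 let ?S = "pos ` Ob w" and ?c = "%p. real (card (col x ` Oc w p))"
 have W: "w \<in> W" "w \<in> R" using LamR[OF w] by auto
 obtain Q where Q: "Q <= Ob w" "inj_on (col s) Q" "col s ` Ob w = col s ` Q"
  using subset_image_inj[of "col s ` Ob w" "col s" "Ob w"] by auto
 have "?S = (%k. of_int k * E (- real s)) ` (col s ` Ob w)" by (simp add: pos_def image_image)
 then have "card ?S <= card (col s ` Ob w)" by (metis card_image_le fin_Ob finite_imageI)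
 also have "... = card Q" using Q by (simp add: card_image)
 also have "real ... <= E (G s + 16 + 2 * real c1 + 1)"
 proof (rule card_cols_tube[OF sx(1) _ Q(2) W(1)])
  show "Q <= fst ` W" using Q(1) Ob_W by blast
  show "Q <= tube w (E (1 - real s))" using Q(1) sx by (intro subsetI Ob_tube) blast+
 qed simp
 finally have cS: "real (card ?S) <= E (G s + 16 + 2 * real c1 + 1)" by simp
 let ?rich = "{p \<in> ?S. I w p}"
 have fS: "finite ?S" by simp
 have "E (G x - k1) <= card (col x ` Ob w)" by (rule card_obs_cols[OF W(2) x(1)])
 also have "col x ` Ob w = (\<Union>p\<in>?S. col x ` Oc w p)" by (auto simp: Oc_def)
 also have "real (card ...) <= (\<Sum>p\<in>?S. ?c p)" unfolding of_nat_sum[symmetric] by (intro of_nat_mono card_UN_le fS)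
 also have "... = (\<Sum>p\<in>?rich. ?c p) + (\<Sum>p\<in>{p \<in> ?S. ~ I w p}. ?c p)" by (subst sum.union_disjoint[symmetric]) (auto intro!: sum.cong)
 also have "... <= (\<Sum>p\<in>?rich. E (G x - G s + k3)) + (\<Sum>p\<in>{p \<in> ?S. ~ I w p}. E (G x - G s - k4))"
  using card_Oc[OF W(1)] by (intro add_mono sum_mono) (auto simp: I_def)
 also have "(\<Sum>p\<in>{p \<in> ?S. ~ I w p}. E (G x - G s - k4)) <= real (card ?S) * E (G x - G s - k4)"
  by (intro sum_const_le) auto
 also have "... <= E (G s + 16 + 2 * real c1 + 1) * E (G x - G s - k4)" using cS by simp
 also have "... = E (G x - k1 - 1)" unfolding E_add by (rule E_cong) (simp add: k4_def)
 finally have "E (G x - k1) <= card ?rich * E (G x - G s + k3) + E (G x - k1 - 1)" by simp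
 moreover have "2 * E (G x - k1 - 1) <= E (G x - k1 - 1 + 1)" by (rule E_const) simp
 ultimately have "E (G x - k1 - 1) <= card ?rich * E (G x - G s + k3)" by simp
 then have "E (G x - k1 - 1) / E (G x - G s + k3) <= card ?rich" using E_pos by (simp only: pos_divide_le_eq)
 moreover have "E (G x - k1 - 1) / E (G x - G s + k3) = E (G s - k1 - k3 - 1)" unfolding E_div by (rule E_cong) simp
 moreover have "card ?rich <= card {p \<in> P. I w p}" using w finP by (intro card_mono) (auto simp: P_def)
 ultimately show ?thesis by simp
qed

text \<open>Representatives of these positions lie on one coarse tube within about
  \<open>E (- i)\<close> of each other. \<open>card_cols\<close> with the linear lower bound for
  \<open>G\<close> produces the exponent \<open>theta\<close>.\<close>

lemma card_P_interval:
 fixes i :: real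
 assumes S: "S <= P" "!!p. p \<in> S ==> abs (p - u) <= E (- i)" and i: "i <= s"
 shows "card S <= E (G s - theta * i + 28 + 4 * real c1)"
proof -
 obtain Q where Q: "inj_on (col s) Q" "card Q = card S" "!!q. q \<in> Q ==> pos q \<in> S & (EX w:Lam. q \<in> Ob w)"
  using representatives[OF S(1)] by auto
 show ?thesis
 proof (cases "Q = {}")
  case False
  then obtain q0 w where q0: "q0 \<in> Q" "w \<in> Lam" "q0 \<in> Ob w" using Q(3) by blast
  have Qt: "q \<in> tube w (E (2 - real s))" if "q \<in> Q" for q using Q(3)[OF that] Lam_tube q0(2) by blast
  have mono: "E (2 - real s) <= E (2 - i)" "E (- real s) <= E (- i)" using i by (intro E_mono; simp)+
  have near: "abs (fst q - fst q0) <= E (2 - i)" if "q \<in> Q" for q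
  proof -
   have "abs (pos q - u) <= E (- i)" "abs (pos q0 - u) <= E (- i)" using S(2) Q(3) that q0(1) by auto
   moreover have "abs (fst q - pos q) <= E (- i)" "abs (fst q0 - pos q0) <= E (- i)" using pos_fst[of q] pos_fst[of q0] mono by auto
   moreover have "4 * E (- i) <= E (- i + 1)" by (rule E_const) simp
   moreover have "E (- i + 1) <= E (2 - i)" by (intro E_mono) simp
   ultimately show ?thesis by linarith
  qed
  have "card Q <= E (G s - (theta * (i - 2 * real c1 - 10) - 3) + 13 + 2 * real c1 + 2)"
  proof (rule card_cols[OF sx(1) _ Q(1) LamR(2)[OF q0(2)] q0(3), of 2 "i - c1 - 3"])
   show "Q <= fst ` W" using Q(3) Ob_W by blast
   show "Q <= tube w (E (2 - real s))" using Qt by auto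
   have e: "2 + real c1 + 1 - i = - (i - c1 - 3)" by simp
   have "q \<in> nb q0 (E (2 + real c1 + 1 - i))" if "q \<in> Q" for q
    using Qt[OF that] Qt[OF q0(1)] tube_mono[OF mono(1), of w] near[OF that] by (intro near_tube[OF LamR(2)[OF q0(2)]]) auto
   then show "Q <= nb q0 (E (- (i - c1 - 3)))" unfolding e by auto
   show "theta * (i - 2 * real c1 - 10) - 3 <= G h" if "h <= J" "i - c1 - 3 - 2 - c1 - 5 <= real h" for h
    using that by (intro G_linear) auto
  qed (use i in auto)
  also have "... <= E (G s - theta * i + 28 + 4 * real c1)"
  proof (intro E_mono)
   have "theta * (2 * real c1 + 10) <= 1 * (2 * real c1 + 10)" using theta by simp
   then show "G s - (theta * (i - 2 * real c1 - 10) - 3) + 13 + 2 * real c1 + 2 <= G s - theta * i + 28 + 4 * real c1"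
    by (simp add: algebra_simps)
  qed
  finally show ?thesis using Q(2) by simp
 next
  case True
  then show ?thesis using Q(2) by simp
 qed
qed

text \<open>Near the position every tube carries boxes of total mass at least \<open>?m\<close>, and
  tubes with distinct height cells overlap boundedly there up to a power of \<open>l\<close>. The
  coarse box has mass about \<open>E (- F s)\<close>, and
  \<open>tau * x + G s - F s = tau * (x - s)\<close>.\<close>

lemma card_heights:
 assumes T: "T <= Lam" "!!w. w \<in> T ==> I w p" "inj_on (%w. \<lfloor>(hgt w p - hgt w0 p) / E (- real x)\<rfloor>) T"
 shows "card T <= E (tau * (real x - real s) + k4 + 29 + 7 * real c1)"
proof (cases "T = {}")
 case False
 let ?cell = "%w. \<lfloor>(hgt w p - hgt w0 p) / E (- real x)\<rfloor>"
 obtain w1 q1 where w1: "w1 \<in> T" "q1 \<in> Oc w1 p" using False T(2) I_ne by blast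
 define D where "D w = (\<Union>q\<in>Oc w p. nb q (E (- real x)))" for w
 let ?Z = "nb q1 (E (real c1 + 4 - real s))" and ?m = "E (- tau * x - G s - k4 - 2)"
 have fT: "finite T" using T(1) by (rule finite_subset) simp
 have "card T * ?m <= E (real c1 + 3) * mu ?Z"
 proof (rule packing[OF fT, where f = D])
  fix w assume w: "w \<in> T"
  then have W: "w \<in> Lam" "w \<in> W" using T(1) LamR by blast+
  obtain Q where Q: "Q <= Oc w p" "inj_on (col x) Q" "col x ` Oc w p = col x ` Q"
   using subset_image_inj[of "col x ` Oc w p" "col x" "Oc w p"] by auto
  have "E (G x - G s - k4) <= card Q" using T(2)[OF w] Q by (simp add: I_def card_image)
  also have "card Q <= E (real (F x) + 2) * mu (D w)"
  proof (rule box_packing[OF sx(2) _ Q(2)])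
   show "Q <= fst ` W" using Q(1) Oc_sub(1) Ob_W by blast
  qed (use Q(1) in \<open>auto simp: D_def\<close>)
  finally have "E (G x - G s - k4) / E (real (F x) + 2) <= mu (D w)" by (simp add: pos_divide_le_eq mult.commute)
  moreover have "E (G x - G s - k4) / E (real (F x) + 2) = ?m" unfolding E_div by (rule E_cong) (simp add: G_def)
  ultimately show "?m <= mu (D w)" by simp
  show "X Int D w <= ?Z"
  proof
   fix y assume "y \<in> X Int D w"
   then obtain q where q: "q \<in> Oc w p" "y \<in> nb q (E (- real x))" by (auto simp: D_def)
   have w1L: "w1 \<in> Lam" "w1 \<in> W" using w1 T(1) LamR by blast+
   have "col s q = col s q1" using q(1) w1(2) by (simp add: Oc_def pos_eq[symmetric])
   then have "abs (fst q - fst q1) < E (- real s)" unfolding col_def by (rule same_cell[OF E_pos])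
   moreover have "E (- real s) <= E (2 - real s)" by (intro E_mono) simp
   ultimately have "q \<in> nb q1 (E (2 + real c1 + 1 - real s))"
    using Lam_tube[OF W(1) w1L(1)] Lam_tube[OF w1L(1) w1L(1)] q(1) w1(2) by (intro near_tube[OF w1L(2)]) (auto simp: Oc_def)
   moreover have "E (- real x) <= E (2 + real c1 + 1 - real s)" using x by (intro E_mono) simp
   moreover have "2 * E (2 + real c1 + 1 - real s) <= E (2 + real c1 + 1 - real s + 1)" by (rule E_const) simp
   moreover have "E (2 + real c1 + 1 - real s + 1) = E (real c1 + 4 - real s)" by (rule E_cong) simp
   moreover have "abs (fst y - fst q) <= E (- real x)" "abs (snd y - snd q) <= E (- real x)" using q(2) by (simp_all add: nb_def)
   ultimately show "y \<in> ?Z" unfolding nb_def mem_Collect_eq by linarith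
  qed
 next
  fix y assume y: "y \<in> X"
  let ?T = "{w \<in> T. y \<in> D w}" and ?h = "snd y - slope w0 * (fst y - p) - hgt w0 p" and ?r = "E (real c1 + 2 - real x)"
  have close: "abs ((hgt w p - hgt w0 p) - ?h) <= ?r" if "w \<in> ?T" for w
  proof -
   from that obtain q where q: "q \<in> Oc w p" "y \<in> nb q (E (- real x))" by (auto simp: D_def)
   have W: "w \<in> Lam" "w \<in> W" using that T(1) LamR by blast+
   have qp: "abs (fst q - p) <= E (- real s)" using q(1) pos_fst[of q] by (simp add: Oc_def)
   have "abs ((slope w - slope w0) * (fst q - p)) <= E (- real s) * E (- real s)"
    unfolding abs_mult using same_idx(1)[OF Lam(3)[OF W(1) w0]] qp by (intro mult_mono) auto
   \<comment> \<open>Here \<open>x <= 2 * s\<close> is used: a slope difference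
     \<open>E (- s)\<close> acts over a distance \<open>E (- s)\<close>.\<close>
   also have "... <= E (- real x)" unfolding E_add using x by (intro E_mono) linarith
   finally have 1: "abs ((slope w - slope w0) * (fst q - p)) <= E (- real x)" .
   have "abs (slope w0 * (fst q - fst y)) <= E (real c1) * E (- real x)"
    unfolding abs_mult using W_slope[OF LamR(2)[OF w0]] q(2) by (intro mult_mono) (auto simp: nb_def)
   then have 2: "abs (slope w0 * (fst q - fst y)) <= E (real c1 - real x)" unfolding E_add by simp
   have "q \<in> tube w (E (1 - real x))" using q(1) sx by (intro Ob_tube) (auto simp: Oc_def)
   then have 3: "abs (snd q - hgt w (fst q)) <= E (1 - real x)" by (simp add: mem_tube)
   have 4: "abs (snd y - snd q) <= E (- real x)" using q(2) by (simp add: nb_def)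
   have "(hgt w p - hgt w0 p) - ?h = (hgt w (fst q) - snd q) + (snd q - snd y) - (slope w - slope w0) * (fst q - p) - slope w0 * (fst q - fst y)"
    by (simp add: hgt_def algebra_simps)
   moreover have "E (- real x) + E (- real x) + E (real c1 - real x) + E (1 - real x) <= E (real c1 + 1 - real x + 1)"
    by (intro E_sum4) auto
   moreover have "E (real c1 + 1 - real x + 1) = ?r" by (rule E_cong) simp
   ultimately show ?thesis using 1 2 3 4 by linarith
  qed
  have "card ?T = card (?cell ` ?T)" using T(3) by (intro card_image[symmetric]) (auto simp: inj_on_def)
  also have "?cell ` ?T = (%u. \<lfloor>u / E (- real x)\<rfloor>) ` ((%w. hgt w p - hgt w0 p) ` ?T)" by auto
  also have "real (card ...) <= ((?h + ?r) - (?h - ?r)) / E (- real x) + 2"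
  proof (rule card_floor_interval[OF _ E_pos])
   fix u assume "u \<in> (%w. hgt w p - hgt w0 p) ` ?T"
   then obtain w where "w \<in> ?T" "u = hgt w p - hgt w0 p" by auto
   then show "?h - ?r <= u & u <= ?h + ?r" using close[of w] unfolding abs_le_iff by simp
  qed (use E_pos[of "real c1 + 2 - real x"] in linarith)
  also have "((?h + ?r) - (?h - ?r)) / E (- real x) = 2 * (?r / E (- real x))" by simp
  also have "?r / E (- real x) = E (real c1 + 2)" unfolding E_div by simp
  also have "2 * E (real c1 + 2) + 2 <= E (real c1 + 2 + 1)" using E_ge_1[of "real c1 + 2"] E_const[of 4 "real c1 + 2"] by simp
  finally show "real (card ?T) <= E (real c1 + 3)" by (simp add: algebra_simps)
 qed
 also have "mu ?Z <= E (- real (F s) + 6 * (real c1 + 4))"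
 proof -
  obtain w' where w': "w' \<in> W" "q1 = fst w'" using w1(2) Oc_sub(1) Ob_W by blast
  define j where "j = s - (c1 + 4)"
  have j: "real j = real s - real c1 - 4" "j <= s" "j <= J" using s(2) sx by (auto simp: j_def)
  have "- real j = real c1 + 4 - real s" using j by simp
  then have "mu ?Z <= E (- real (F j))" using mu_typ(1)[OF w'(1) j(3)] w'(2) by simp
  also have "... <= E (- real (F s) + 6 * (real c1 + 4))" using F_steps[OF j(2) sx(1)] j(1) by (intro E_mono) simp
  finally show ?thesis .
 qed
 finally have "card T * ?m <= E (real c1 + 3) * E (- real (F s) + 6 * (real c1 + 4))" by simp
 then have "card T <= E (real c1 + 3 + (- real (F s) + 6 * (real c1 + 4))) / ?m" unfolding E_add using E_pos by (simp only: pos_le_divide_eq)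
 also have "... = E (tau * (real x - real s) + k4 + 29 + 7 * real c1)" unfolding E_div by (rule E_cong) (simp add: G_def algebra_simps)
 finally show ?thesis .
qed simp

text \<open>The lines nearly meet at one point, so their parts far from it overlap only up to a
  power of \<open>l\<close>. Each has mass about \<open>E (- tau * x)\<close>, and all lie in one
  tube of width about \<open>E (- s - i)\<close>, which is thin.\<close>

lemma card_directions:
 assumes T: "T <= Lam" "!!w. w \<in> T ==> I w p" and p: "0 <= p" "p <= 1"
  and h: "!!w w'. w \<in> T ==> w' \<in> T ==> abs (hgt w p - hgt w' p) <= 2 * E (- real x)"
  and sl: "!!w w'. w \<in> T ==> w' \<in> T ==> abs (slope w - slope w') <= 2 * E (- real s - i)" and i: "i <= real x - real s"
 shows "card T <= E (tau * (real x - real s - i) + k1 + 22 + 5 * real c1 + 2 * real b)"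
proof (cases "T = {}")
 case False
 then obtain w1 where w1: "w1 \<in> T" by auto
 have "ALL w:T. EX q. q \<in> Oc w p" using T(2) I_ne by simp
 then obtain g where g: "!!w. w \<in> T ==> g w \<in> Oc w p" by metis
 let ?t = "%w. tube w (E (real c1 + 2 - real x))" and ?d = "real b + real c1 + 2"
 let ?D = "%w. ?t w - nb (g w) (E (- real b))" and ?Z = "tube w1 (E (- (real s + i - real c1 - 3)))"
 have fT: "finite T" using T(1) by (rule finite_subset) simp
 have W: "w \<in> W" "w \<in> R" if "w \<in> T" for w using that T(1) LamR by blast+
 have "card T * E (- tau * x - k1 - 3) <= E (2 * (real c1 + 2 + ?d) + 6) * mu ?Z"
 proof (rule packing[OF fT, where f = ?D])
  fix y assume y: "y \<in> X"
  show "real (card {w \<in> T. y \<in> ?D w}) <= E (2 * (real c1 + 2 + ?d) + 6)"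
  proof (cases "{w \<in> T. y \<in> ?D w} = {}")
   case False
   then obtain w where w: "w \<in> T" "y \<in> ?D w" by auto
   have gw: "g w \<in> Ob w" "pos (g w) = p" using g[OF w(1)] by (auto simp: Oc_def)
   have "g w \<in> tube w (E (1 - real x))" using gw sx by (intro Ob_tube)
   moreover have "E (1 - real x) <= E (real c1 + 2 - real x)" by (intro E_mono) simp
   ultimately have "g w \<in> ?t w" using tube_mono by blast
   then have "E (- real b - real c1 - 1) <= abs (fst y - fst (g w))" using w by (intro far_dist[OF W(1)[OF w(1)] sx(4)]) auto
   moreover have "abs (fst (g w) - p) <= E (- real s)" using pos_fst[of "g w"] gw by simp
   moreover have "E (- real s) <= E (- ?d)" using s(2) by (intro E_mono) simp
   moreover have "2 * E (- ?d) <= E (- ?d + 1)" by (rule E_const) simp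
   moreover have "E (- ?d + 1) = E (- real b - real c1 - 1)" by simp
   ultimately have far: "E (- ?d) <= abs (fst (p, hgt w1 p) - fst y)" unfolding fst_conv by simp
   have "card {w \<in> T. y \<in> ?D w} = card (idx x ` {w \<in> T. y \<in> ?D w})"
    using inj_on_subset[OF Lam(2) T(1)] by (intro card_image[symmetric]) (auto simp: inj_on_def)
   also have "real ... <= E (2 * (real c1 + 2 + ?d) + 6)" using far
   proof (rule card_idx[rotated])
    fix w assume w: "w \<in> {w \<in> T. y \<in> ?D w}"
    have "2 * E (- real x) <= E (- real x + 1)" by (rule E_const) simp
    also have "... <= E (real c1 + 2 - real x)" by (intro E_mono) simp
    finally have "abs (hgt w1 p - hgt w p) <= E (real c1 + 2 - real x)" using h[OF w1, of w] w by simp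
    then show "(p, hgt w1 p) \<in> ?t w & y \<in> ?t w" using w by (simp add: mem_tube)
   qed (use p in auto)
   finally show ?thesis .
  next
   case True
   show ?thesis unfolding True by simp
  qed
 next
  fix w assume w: "w \<in> T"
  have "g w \<in> Ob w" using g[OF w] by (auto simp: Oc_def)
  then show "E (- tau * x - k1 - 3) <= mu (?D w)" by (rule R_far[OF W(2)[OF w] _ x(1) sx(4)])
  show "X Int ?D w <= ?Z"
  proof
   fix y assume y: "y \<in> X Int ?D w"
   have u: "0 <= fst y" "fst y <= 1" using y X_unit[of y] by auto
   have D: "hgt w (fst y) - hgt w1 (fst y) = (hgt w p - hgt w1 p) + (slope w - slope w1) * (fst y - p)" by (simp add: hgt_def algebra_simps)
   have "abs ((slope w - slope w1) * (fst y - p)) <= 2 * E (- real s - i) * 1"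
    unfolding abs_mult using sl[OF w w1] u p by (intro mult_mono) (auto simp: abs_le_iff)
   moreover have "E (- real x) <= E (real c1 + 2 - real s - i)" "E (- real s - i) <= E (real c1 + 2 - real s - i)"
    "E (real c1 + 2 - real x) <= E (real c1 + 2 - real s - i)" using i by (intro E_mono; simp)+
   moreover have "5 * E (real c1 + 2 - real s - i) <= E (real c1 + 2 - real s - i + 1)" by (rule E_const) simp
   moreover have "E (real c1 + 2 - real s - i + 1) = E (- (real s + i - real c1 - 3))" by (rule E_cong) simp
   moreover have "abs (snd y - hgt w (fst y)) <= E (real c1 + 2 - real x)" using y by (simp add: mem_tube)
   ultimately show "y \<in> ?Z" using h[OF w w1] D unfolding mem_tube by linarith
  qed
 qed
 also have "mu ?Z <= E (5 + real c1 - tau * (real s + i))"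
 proof -
  have "mu ?Z <= E (2 - tau * (real s + i - real c1 - 3))" using i sx by (intro thin_real[OF W(1)[OF w1]]) linarith
  also have "... <= E (5 + real c1 - tau * (real s + i))"
  proof (intro E_mono)
   have "tau * (real c1 + 3) <= 1 * (real c1 + 3)" using tau_le by simp
   then show "2 - tau * (real s + i - real c1 - 3) <= 5 + real c1 - tau * (real s + i)" by (simp add: algebra_simps)
  qed
  finally show ?thesis .
 qed
 finally have "card T * E (- tau * x - k1 - 3) <= E (2 * (real c1 + 2 + ?d) + 6) * E (5 + real c1 - tau * (real s + i))" by simp
 then have "card T <= E (2 * (real c1 + 2 + ?d) + 6 + (5 + real c1 - tau * (real s + i))) / E (- tau * x - k1 - 3)"
  unfolding E_add using E_pos by (simp only: pos_le_divide_eq)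
 also have "... = E (tau * (real x - real s - i) + k1 + 22 + 5 * real c1 + 2 * real b)"
  unfolding E_div by (rule E_cong) (simp add: algebra_simps)
 finally show ?thesis .
qed simp

end

subsection \<open>Raising the exponent\<close>

context scales begin

text \<open>Subtracting the line of \<open>w0\<close> and stretching heights by \<open>E s\<close>
  blows the coarse tube up to unit width. The positions have dimension \<open>2 * sgm - tau\<close>,
  positive because \<open>tau\<close> is below its threshold. The exponent of the last argument
  dominates all accumulated constants.\<close>

lemma scales_incidence_data:
 "incidence_data Lam P I (%w. (slope w - slope w0) * E (real s)) (%w. (icpt w - icpt w0) * E (real s))
  (2 * sgm - tau) tau (E (real s - real x)) (E (400 + 70 * real c1 + 8 * real b1 + 6 * real b))"
proof -
 let ?kappa = "%w. (slope w - slope w0) * E (real s)" and ?l = "%w. (icpt w - icpt w0) * E (real s)"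
 let ?k = "400 + 70 * real c1 + 8 * real b1 + 6 * real b" and ?rho = "E (real s - real x)"
 have k: "k1 = 65 + 11 * real c1 + 2 * real b1" by (simp add: k1_def c0_def)
 note ks = k k2_def k3_def k4_def
 have pw: "E y powr z = E (y * z)" for y z by (simp add: powr_powr)
 have height: "?l w + ?kappa w * p = (hgt w p - hgt w0 p) * E (real s)" for w p by (simp add: hgt_def algebra_simps)
 have scale: "E (real s) / ?rho = E (real x)" unfolding E_div by simp
 have ex: "EX i. r = E (- i) & i <= real x - real s" if "?rho <= r" for r
 proof -
  have r: "0 < r" using that E_pos[of "real s - real x"] by linarith
  then have e: "r = E (- (- log l r))" using l_ge by simp
  have "?rho <= E (- (- log l r))" using that e by simp
  from E_le_imp[OF this] show ?thesis using e by fastforce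
 qed
 have card_P_ge: "E (G s - k1 - k3 - 1) <= card P"
 proof -
  have "card {p \<in> P. I w0 p} <= card P" using finP by (intro card_mono) auto
  then show ?thesis using card_rich[OF w0] by simp
 qed
 have "0 < real (card P)" using card_P_ge E_pos[of "G s - k1 - k3 - 1"] by linarith
 then have P_ne: "P ~= {}" by auto
 have b1: "?rho powr (- 2 * tau) <= E ?k * real (card Lam)"
 proof -
  have "?rho powr (- 2 * tau) = E (2 * tau * (real x - real s))" unfolding pw by (rule E_cong) (simp add: algebra_simps)
  also have "... <= E (?k + (2 * tau * (real x - real s) - k2 - 10))" by (intro E_mono) (simp add: ks)
  also have "... <= E ?k * card Lam" unfolding E_add[symmetric] by (intro mult_left_mono card_Lam) simp
  finally show ?thesis .
 qed
 have b2: "real (card P) <= E ?k * real (card {p \<in> P. I w p})" if w: "w \<in> Lam" for w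
 proof -
  have "real (card P) <= E (G s + 18 + 2 * real c1)" by (rule card_P)
  also have "... <= E (?k + (G s - k1 - k3 - 1))" by (intro E_mono) (simp add: ks)
  also have "... <= E ?k * real (card {p \<in> P. I w p})" unfolding E_add[symmetric] by (intro mult_left_mono card_rich w) simp
  finally show ?thesis .
 qed
 have b3: "card (P Int {u - r..u + r}) <= E ?k * r powr (2 * sgm - tau) * card P" if r: "?rho <= r" for u r
 proof -
  from ex[OF r] obtain i where i: "r = E (- i)" "i <= real x - real s" by auto
  have "card (P Int {u - r..u + r}) <= E (G s - theta * i + 28 + 4 * real c1)"
   using i x by (intro card_P_interval[where u = u]) auto
  also have "... <= E (?k + (- i) * theta + (G s - k1 - k3 - 1))" by (intro E_mono) (simp add: ks)
  also have "... <= E ?k * E ((- i) * theta) * card P" unfolding E_add[symmetric] by (intro mult_left_mono card_P_ge) simp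
  also have "E ((- i) * theta) = r powr (2 * sgm - tau)" unfolding i(1) pw theta_def ..
  finally show ?thesis .
 qed
 have b4: "card ((%w. \<lfloor>(?l w + ?kappa w * p) / ?rho\<rfloor>) ` {w \<in> Lam. I w p}) <= E ?k * ?rho powr (- tau)" for p
 proof -
  let ?c = "%w. \<lfloor>(hgt w p - hgt w0 p) / E (- real x)\<rfloor>"
  have c: "(%w. \<lfloor>(?l w + ?kappa w * p) / ?rho\<rfloor>) = ?c"
   unfolding height times_divide_eq_right[symmetric] scale by (simp add: powr_minus divide_inverse)
  obtain T where T: "T <= {w \<in> Lam. I w p}" "inj_on ?c T" "?c ` {w \<in> Lam. I w p} = ?c ` T"
   using subset_image_inj[of "?c ` {w \<in> Lam. I w p}" ?c "{w \<in> Lam. I w p}"] by auto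
  have "card (?c ` {w \<in> Lam. I w p}) = card T" unfolding T(3) by (rule card_image[OF T(2)])
  also have "real ... <= E (tau * (real x - real s) + k4 + 29 + 7 * real c1)" using T by (intro card_heights) auto
  also have "... <= E (?k + (real s - real x) * (- tau))" by (intro E_mono) (simp add: ks algebra_simps)
  also have "... = E ?k * ?rho powr (- tau)" unfolding pw E_add ..
  finally show ?thesis unfolding c .
 qed
 have b5: "card {w \<in> Lam. I w p & abs (?l w + ?kappa w * p - y) <= ?rho & abs (?kappa w - k) <= r} <= E ?k * (r / ?rho) powr tau"
  if p: "p \<in> P" and r: "?rho <= r" for p y k r
 proof -
  from ex[OF r] obtain i where i: "r = E (- i)" "i <= real x - real s" by auto
  let ?T = "{w \<in> Lam. I w p & abs (?l w + ?kappa w * p - y) <= ?rho & abs (?kappa w - k) <= r}"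
  have cancel: "abs (a - a') <= 2 * E (z - real s)" if "abs ((a - c) * E (real s) - y) <= E z" "abs ((a' - c) * E (real s) - y) <= E z" for a a' c y z
  proof -
   have "abs ((a - a') * E (real s)) <= 2 * E z" using that unfolding left_diff_distrib by simp
   then have "abs (a - a') <= 2 * E z / E (real s)" by (simp add: pos_le_divide_eq)
   also have "... = 2 * E (z - real s)" unfolding times_divide_eq_right[symmetric] E_div ..
   finally show ?thesis .
  qed
  have "card ?T <= E (tau * (real x - real s - i) + k1 + 22 + 5 * real c1 + 2 * real b)"
  proof (rule card_directions[OF _ _ _ _ _ _ i(2)])
   fix w w' assume w: "w \<in> ?T" "w' \<in> ?T"
   have "abs (hgt w p - hgt w' p) <= 2 * E (real s - real x - real s)"
    using w unfolding height by (intro cancel[of _ "hgt w0 p" y]) auto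
   then show "abs (hgt w p - hgt w' p) <= 2 * E (- real x)" by simp
   have "abs (slope w - slope w') <= 2 * E (- i - real s)"
    using w unfolding i(1) by (intro cancel[of _ "slope w0" k]) auto
   moreover have "E (- i - real s) = E (- real s - i)" by (rule E_cong) simp
   ultimately show "abs (slope w - slope w') <= 2 * E (- real s - i)" by simp
  qed (use p P_unit in auto)
  also have "... <= E (?k + (- i - (real s - real x)) * tau)" by (intro E_mono) (simp add: ks algebra_simps)
  also have "... = E ?k * (r / ?rho) powr tau" unfolding i(1) E_div pw E_add ..
  finally show ?thesis .
 qed
 show ?thesis unfolding incidence_data_def using finP P_ne P_unit b1 b2 b3 b4 b5 by (intro conjI ballI allI impI) simp_all
qed

end

text \<open>The last scale \<open>r i\<close> with \<open>G\<close> at most \<open>i * h\<close> is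
  a record. As \<open>G\<close> rises by at most \<open>6\<close> per scale, consecutive
  \<open>r i\<close> differ by at least \<open>h / 6 - 1\<close>. If each were more than twice its
  predecessor, the last one would exceed \<open>J\<close>.\<close>

lemma records_exist:
 fixes theta :: real
 assumes theta: "0 < theta"
 obtains kappa J0 :: real where "0 < kappa" "!!(J :: nat) G. J0 <= real J ==> G 0 <= 0 ==> (!!j. j < J ==> G (Suc j) <= G j + 6) ==> theta * J - 3 <= G J ==>
  EX s x. s < x & x <= 2 * s & x <= J & kappa * J <= s & kappa * J <= real x - real s &
   (ALL h. s <= h --> h <= J --> G s <= G h) & (ALL h. x <= h --> h <= J --> G x <= G h)"
proof -
 \<comment> \<open>Some \<open>m\<close> satisfies \<open>24 * (m + 1) <= theta * 2 ^ m\<close>. It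
   fixes the number of levels, and \<open>kappa\<close> is of order
   \<open>theta / m\<close>.\<close>
 have "(%n. of_nat n * (1 / 2 :: real) ^ n) \<longlonglongrightarrow> 0" by (rule powser_times_n_limit_0) simp
 from LIMSEQ_D[OF this, of "theta / 48"] theta obtain m0 where m0: "ALL m>=m0. norm (of_nat m * (1 / 2 :: real) ^ m - 0) < theta / 48" by auto
 define m where "m = max m0 1"
 have m: "1 <= m" by (simp add: m_def)
 have "real m * (1 / 2) ^ m < theta / 48" using m0[rule_format, of m] by (simp add: m_def)
 then have "48 * real m <= theta * 2 ^ m" by (simp add: field_simps)
 then have mm: "24 * (real m + 1) <= theta * 2 ^ m" using m by simp
 define n where "n = real m + 1"
 have n: "2 <= n" using m by (simp add: n_def)
 define kappa where "kappa = theta / (24 * n)"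
 define J0 where "J0 = 24 * n / theta + 7 / theta"
 have kap: "0 < kappa" using theta n by (simp add: kappa_def)
 show thesis
 proof (rule that[OF kap])
  fix J :: nat and G :: "nat => real"
  assume J: "J0 <= real J" and G0: "G 0 <= 0" and inc: "!!j. j < J ==> G (Suc j) <= G j + 6" and GJ: "theta * J - 3 <= G J"
  have "24 * n / theta <= J" "7 / theta <= J" using J theta n by (auto simp: J0_def intro: order_trans[rotated])
  then have J1: "24 * n <= theta * J" "7 <= theta * J" using theta by (simp_all add: pos_divide_le_eq mult.commute)
  define h where "h = theta * J / (2 * n)"
  have h: "kappa * J <= h / 6 - 1" "0 < h" "1 <= kappa * J"
  proof -
   have "h / 6 = 2 * (kappa * J)" by (simp add: h_def kappa_def)
   moreover show "1 <= kappa * J" using J1(1) n by (simp add: kappa_def)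
   ultimately show "kappa * J <= h / 6 - 1" "0 < h" by auto
  qed
  have step: "G j' <= G j + 6 * (real j' - real j)" if "j <= j'" "j' <= J" for j j' using that
  proof (induction rule: dec_induct)
   case (step k)
   then show ?case using inc[of k] by simp
  qed simp
  define r where "r i = Max {j. j <= J & G j <= real i * h}" for i
  have r: "r i <= J & G (r i) <= real i * h" for i
  proof -
   have "0 <= real i * h" using h by simp
   then have "{j. j <= J & G j <= real i * h} ~= {}" using G0 by auto
   then have "r i \<in> {j. j <= J & G j <= real i * h}" unfolding r_def by (intro Max_in) auto
   then show ?thesis by simp
  qed
  have above: "j <= r i" if "j <= J" "G j <= real i * h" for i j using that unfolding r_def by simp
  have lt: "r i < J & real i * h < G (Suc (r i))" if "i <= Suc m" for i
  proof -
   have "real i * h <= n * h" using that h by (intro mult_right_mono) (auto simp: n_def)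
   also have "... = theta * J / 2" using n by (simp add: h_def)
   also have "... < G J" using GJ J1 by simp
   finally have "r i ~= J" using r[of i] by auto
   then have "r i < J" using r[of i] by simp
   then show ?thesis using above[of "Suc (r i)" i] by linarith
  qed
  have rec: "ALL k. r i <= k --> k <= J --> G (r i) <= G k" for i
  proof (intro allI impI)
   fix k assume k: "r i <= k" "k <= J"
   show "G (r i) <= G k" using above[of k i] r[of i] k by force
  qed
  have gap: "r i <= r (Suc i) & kappa * J <= real (r (Suc i)) - real (r i)" if "i <= m" for i
  proof -
   have s: "real (Suc i) * h = real i * h + h" by (simp add: algebra_simps)
   have le: "r i <= r (Suc i)" using r[of i] h s by (intro above) auto
   have "real (Suc i) * h < G (Suc (r (Suc i)))" "r (Suc i) < J" using lt[of "Suc i"] that by auto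
   moreover have "G (Suc (r (Suc i))) <= G (r i) + 6 * (real (Suc (r (Suc i))) - real (r i))" using le calculation by (intro step) auto
   ultimately show ?thesis using r[of i] h s by simp
  qed
  have "EX i:{1..m}. r (Suc i) <= 2 * r i"
  proof (rule ccontr)
   assume no: "~ ?thesis"
   have "2 ^ k * (kappa * J) <= real (r (Suc k))" if "k <= m" for k using that
   proof (induction k)
    case 0
    then show ?case using gap[of 0] by simp
   next
    case (Suc k)
    then have "2 * r (Suc k) <= r (Suc (Suc k))" using no by force
    then have "2 * real (r (Suc k)) <= real (r (Suc (Suc k)))" by simp
    then show ?case using Suc by simp
   qed
   from this[of m] have "2 ^ m * (kappa * J) <= real (r (Suc m))" by simp
   moreover have "real (r (Suc m)) < J" using lt[of "Suc m"] by simp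
   moreover have "1 * real J <= (2 ^ m * kappa) * J" using mm by (intro mult_right_mono) (auto simp: kappa_def n_def field_simps)
   ultimately show False by simp
  qed
  then obtain i where i: "1 <= i" "i <= m" "r (Suc i) <= 2 * r i" by auto
  have "i - 1 <= m" "Suc (i - 1) = i" using i by auto
  then have "kappa * J <= r i" using gap[of "i - 1"] by simp
  moreover have "r i < r (Suc i)" using gap[OF i(2)] h(3) by simp
  ultimately show "EX s x. s < x & x <= 2 * s & x <= J & kappa * J <= s & kappa * J <= real x - real s &
   (ALL h. s <= h --> h <= J --> G s <= G h) & (ALL h. x <= h --> h <= J --> G x <= G h)"
   using i gap[OF i(2)] r[of "Suc i"] rec by blast
 qed
qed

text \<open>The constants \<open>c1\<close>, \<open>b1\<close>, \<open>b\<close>, \<open>k\<close>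
  depend only on the exponents and \<open>J1\<close> is chosen after them. The rescaled resolution
  \<open>E (s - x)\<close> has \<open>x - s\<close> at least \<open>kappa * J\<close>, so for large
  \<open>J\<close> the fixed loss \<open>E k\<close> is within the tolerance of
  \<open>no_incidence_data\<close>.\<close>

lemma not_thin_and_tight:
 fixes sgm tau :: real
 assumes par: "0 < tau" "tau < 2 * sgm" "2 * sgm <= 1"
 obtains c1 J1 :: nat and l0 :: real where "4 <= sgm * c1"
  "!!J l A alpha. J1 <= J ==> l0 <= l ==> cloud A l J c1 sgm tau ==> l powr (- 1) <= alpha ==>
   alpha * (real (card (A \<times> A)))^2 <= card {w \<in> (A \<times> A) \<times> (A \<times> A). cloud.tight A l J tau w} ==>
   ~ card {w \<in> (A \<times> A) \<times> (A \<times> A). ~ cloud.thin A l J tau w} <= alpha / 10 * (real (card (A \<times> A)))^2"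
proof -
 have th: "0 < 2 * sgm - tau" "2 * sgm - tau <= 1" "tau < 1" "0 < sgm" using par by auto
 from no_incidence_data[OF th(1,2) par(1) th(3), where 'w = "(real \<times> real) \<times> (real \<times> real)"]
 obtain eta rho0 where eta: "0 < eta" "0 < rho0" "rho0 < 1" and none: "!!rho L (Lam :: ((real \<times> real) \<times> (real \<times> real)) set) P I kappa l.
  0 < rho ==> rho < rho0 ==> 1 <= L ==> L <= rho powr (-eta) ==> ~ incidence_data Lam P I kappa l (2 * sgm - tau) tau rho L" by auto
 obtain kappa J0 :: real where kap: "0 < kappa" and rec: "!!(J :: nat) G. J0 <= real J ==> G 0 <= 0 ==> (!!j. j < J ==> G (Suc j) <= G j + 6) ==>
   (2 * sgm - tau) * J - 3 <= G J ==>
   EX s x. s < x & x <= 2 * s & x <= J & kappa * J <= s & kappa * J <= real x - real s &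
   (ALL h. s <= h --> h <= J --> G s <= G h) & (ALL h. x <= h --> h <= J --> G x <= G h)"
  using records_exist[OF th(1)] by blast
 have ceil: "EX n :: nat. a <= c * n" if "0 < c" for a c :: real
  using real_arch_simple[of "a / c"] that by (auto simp: pos_divide_le_eq mult.commute)
 obtain c1 :: nat where c1: "4 <= sgm * c1" using ceil[OF th(4)] by auto
 obtain b1 :: nat where b1: "24 + 2 * real c1 <= (2 * sgm - tau) * b1" using ceil[OF th(1)] by auto
 obtain b :: nat where b: "90 + 13 * real c1 + 2 * real b1 <= (2 * sgm - tau) * b" using ceil[OF th(1)] by auto
 define k where "k = 400 + 70 * real c1 + 8 * real b1 + 6 * real b"
 have ke: "0 < kappa * eta" using kap eta by simp
 obtain j1 :: nat where j1: "real (b + 2 * c1 + 4) <= kappa * j1" using ceil[OF kap] by auto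
 obtain j2 :: nat where j2: "k <= (kappa * eta) * j2" using ceil[OF ke] by auto
 obtain j3 :: nat where j3: "J0 <= real j3" using real_arch_simple by auto
 define J1 where "J1 = j1 + j2 + j3 + b1 + 2 * c1 + 3"
 show thesis
 proof (rule that[OF c1, of J1 "1 / rho0 + 1"], rule notI)
  fix J and l :: real and A and alpha
  assume J: "J1 <= J" and l_big: "1 / rho0 + 1 <= l" and cl: "cloud A l J c1 sgm tau" and al: "l powr (- 1) <= alpha"
   and tight: "alpha * (real (card (A \<times> A)))^2 <= card {w \<in> (A \<times> A) \<times> (A \<times> A). cloud.tight A l J tau w}"
   and thin: "card {w \<in> (A \<times> A) \<times> (A \<times> A). ~ cloud.thin A l J tau w} <= alpha / 10 * (real (card (A \<times> A)))^2"
  interpret cloud A l J c1 sgm tau by (rule cl)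
  obtain W F where W: "W <= X \<times> X" "E (- 2) * (real (card X))^2 <= card W"
   "ALL w:W. sepx w & tight w & thin w & kauf w & kauf (prod.swap w) & tame (fst w) & (ALL j<=J. prof (fst w) j = F j)"
   using typical_exists[OF al] tight thin unfolding X_def by auto
  interpret typical_const A l J c1 sgm tau W F b1 b
  proof
   show "b1 + 2 * c1 + 3 <= J" using J by (simp add: J1_def)
  qed (use W b1 b in blast)+
  have mono: "kappa * j <= kappa * J" if "j <= J1" for j :: nat using that J kap by simp
  have "EX s x. s < x & x <= 2 * s & x <= J & kappa * J <= s & kappa * J <= real x - real s &
   (ALL h. s <= h --> h <= J --> G s <= G h) & (ALL h. x <= h --> h <= J --> G x <= G h)"
  proof (rule rec)
   show "J0 <= real J" using j3 J by (simp add: J1_def)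
   show "G 0 <= 0" by (simp add: G_def F_0)
   show "G (Suc j) <= G j + 6" if "j < J" for j using G_steps[of j "Suc j"] that by simp
   show "(2 * sgm - tau) * J - 3 <= G J" using G_ge[of J] by (simp add: theta_def)
  qed
  then obtain s x where rx: "s < x" "x <= 2 * s" "x <= J" "kappa * J <= s" "kappa * J <= real x - real s" "recd s" "recd x"
   unfolding recd_def by auto
  have kJ: "real (b + 2 * c1 + 4) <= kappa * J" using j1 mono[of j1] by (simp add: J1_def)
  then have bs: "b + 2 * c1 + 4 <= s" using rx(4) by simp
  have bs': "b + 2 * c1 + 3 <= s" using bs by simp
  obtain Lam where Lam: "Lam <= R" "inj_on (idx x) Lam" "!!w w'. w \<in> Lam ==> w' \<in> Lam ==> idx s w = idx s w'"
   "E (2 * tau * (real x - real s) - k2 - 10) <= card Lam"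
   using popular_tube[OF rx(6) bs' rx(3)] by auto
  have "0 < real (card Lam)" using Lam(4) E_pos[of "2 * tau * (real x - real s) - k2 - 10"] by linarith
  then have "Lam ~= {}" by auto
  then obtain w0 where w0: "w0 \<in> Lam" by auto
  interpret scales A l J c1 sgm tau W F b1 b s x Lam w0 by unfold_locales (use rx bs Lam w0 in blast)+
  let ?rho = "E (real s - real x)"
  have "?rho <= E (- 1)" using rx by (intro E_mono) linarith
  also have "E (- 1) = 1 / l" using l_ge by simp
  also have "... < rho0"
  proof -
   have "1 / rho0 < l" using l_big by simp
   then show ?thesis using eta by (simp add: field_simps)
  qed
  finally have rho: "?rho < rho0" .
  have "k <= eta * (real x - real s)"
  proof -
   have "k <= eta * (kappa * j2)" using j2 by (simp add: mult_ac)
   also have "j2 <= J1" by (simp add: J1_def)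
   then have "eta * (kappa * j2) <= eta * (kappa * J)" using mono[of j2] eta(1) by simp
   also have "... <= eta * (real x - real s)" using rx(5) eta by simp
   finally show ?thesis .
  qed
  then have L: "E k <= ?rho powr (- eta)" unfolding powr_powr by (intro E_mono) (simp add: algebra_simps)
  have "0 <= k" by (simp add: k_def)
  from none[OF E_pos rho E_ge_1[OF this] L] scales_incidence_data show False unfolding k_def by simp
 qed
qed

section \<open>Bootstrapping the exponent of thin tubes\<close>

definition frostman :: "real => real => real => real set => bool" where
 "frostman delta sgm K A \<longleftrightarrow> finite A & A ~= {} & A <= {0..1} &
   (ALL x r. delta <= r --> card (A Int {x - r..x + r}) <= K * r powr sgm * card A)"

definition thick_pairs :: "real set => real => real => ((real \<times> real) \<times> (real \<times> real)) set" where
 "thick_pairs A delta t = {w \<in> (A \<times> A) \<times> (A \<times> A).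
   t * real (card (A \<times> A)) <= card {q \<in> A \<times> A. abs (snd q - slope w * fst q - icpt w) <= delta}}"

text \<open>Allowing a loss \<open>delta powr (- e)\<close> in the hypothesis lets the property be
  applied at coarser scales to a set that is controlled in terms of a finer one.\<close>

definition thin_tubes :: "real => real => bool" where
 "thin_tubes sgm tau \<longleftrightarrow> (EX e>0. EX delta0>0. ALL delta A. 0 < delta --> delta < delta0 --> frostman delta sgm (delta powr (- e)) A -->
   card (thick_pairs A delta (delta powr tau)) <= delta powr e * (real (card (A \<times> A)))^2)"

lemma frostman_mono: "frostman delta sgm K A ==> K <= K' ==> delta <= delta' ==> frostman delta' sgm K' A"
 unfolding frostman_def by (meson mult_right_mono order_trans of_nat_0_le_iff powr_ge_zero)

lemma thick_pairs_mono: "t <= t' ==> card (thick_pairs A delta t') <= card (thick_pairs A delta t)" if "finite A"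
proof (rule card_mono)
 show "finite (thick_pairs A delta t)" using that by (simp add: thick_pairs_def)
 show "t <= t' ==> thick_pairs A delta t' <= thick_pairs A delta t"
  unfolding thick_pairs_def by (intro Collect_mono) (meson mult_right_mono order_trans of_nat_0_le_iff)
qed

lemma thin_tubes_mono:
 assumes "thin_tubes sgm tau" "tau' <= tau"
 shows "thin_tubes sgm tau'"
proof -
 obtain e d0 where e: "0 < e" "0 < d0" and S: "!!delta A. 0 < delta ==> delta < d0 ==> frostman delta sgm (delta powr (- e)) A ==>
   card (thick_pairs A delta (delta powr tau)) <= delta powr e * (real (card (A \<times> A)))^2"
  using assms(1) unfolding thin_tubes_def by auto
 show ?thesis unfolding thin_tubes_def
 proof (rule exI[of _ e], rule conjI[OF e(1)], rule exI[of _ "min d0 1"], rule conjI, goal_cases)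
  case 2
  show ?case
  proof (intro allI impI)
   fix delta A assume d: "0 < delta" "delta < min d0 1" and A: "frostman delta sgm (delta powr (- e)) A"
   have "delta powr tau <= delta powr tau'" using d assms(2) by (intro powr_mono') auto
   then have "card (thick_pairs A delta (delta powr tau')) <= card (thick_pairs A delta (delta powr tau))"
    using A by (intro thick_pairs_mono) (auto simp: frostman_def)
   then show "card (thick_pairs A delta (delta powr tau')) <= delta powr e * (real (card (A \<times> A)))^2" using S[OF d(1) _ A] d(2) by simp
  qed
 qed (use e in simp)
qed

text \<open>A tube meets each vertical fibre of the product in an interval of length
  \<open>2 * delta\<close>, so any exponent below \<open>sgm\<close> is immediate; the value
  \<open>sgm / 2\<close> leaves room for the loss \<open>sgm / 4\<close>.\<close>

lemma thin_tubes_small: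
 assumes "0 < sgm"
 shows "thin_tubes sgm (sgm / 2)"
 unfolding thin_tubes_def
proof (rule exI[of _ "sgm / 4"], rule conjI, goal_cases)
 case 2
 show ?case
 proof (rule exI[of _ 1], intro conjI allI impI)
  fix delta A assume d: "0 < delta" "delta < 1" and A: "frostman delta sgm (delta powr (- (sgm / 4))) A"
  have fA: "finite A" "A ~= {}" using A by (auto simp: frostman_def)
  then have cA: "0 < real (card A)" by auto
  have "thick_pairs A delta (delta powr (sgm / 2)) = {}"
  proof (rule ccontr)
   assume "~ ?thesis"
   then obtain w where w: "delta powr (sgm / 2) * real (card (A \<times> A)) <= card {q \<in> A \<times> A. abs (snd q - slope w * fst q - icpt w) <= delta}"
    by (auto simp: thick_pairs_def)
   have "{q \<in> A \<times> A. abs (snd q - slope w * fst q - icpt w) <= delta} = {(u, v). u \<in> A & v \<in> A & abs (v - slope w * u - icpt w) <= delta}" by auto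
   then have "real (card {q \<in> A \<times> A. abs (snd q - slope w * fst q - icpt w) <= delta}) =
     (\<Sum>u\<in>A. real (card {v \<in> A. abs (v - slope w * u - icpt w) <= delta}))"
    using card_rel_bound[OF fA(1) fA(1), of "%u v. abs (v - slope w * u - icpt w) <= delta"] by simp
   also have "... <= (\<Sum>u\<in>A. delta powr (- (sgm / 4)) * delta powr sgm * card A)"
   proof (intro sum_mono)
    fix u
    have "{v \<in> A. abs (v - slope w * u - icpt w) <= delta} = A Int {(slope w * u + icpt w) - delta..(slope w * u + icpt w) + delta}"
     by auto
    then show "real (card {v \<in> A. abs (v - slope w * u - icpt w) <= delta}) <= delta powr (- (sgm / 4)) * delta powr sgm * card A"
     using A by (simp add: frostman_def)
   qed
   also have "... = delta powr (3 * sgm / 4) * card (A \<times> A)" by (simp add: card_cartesian_product flip: powr_add)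
   also have "... < delta powr (sgm / 2) * card (A \<times> A)"
    using d assms cA by (intro mult_strict_right_mono powr_less_mono') (auto simp: card_cartesian_product)
   finally show False using w by simp
  qed
  then show "card (thick_pairs A delta (delta powr (sgm / 2))) <= delta powr (sgm / 4) * (real (card (A \<times> A)))^2" by simp
 qed simp
qed (use assms in simp)

text \<open>The condition \<open>eta * J <= 1\<close> makes the deficit \<open>eta\<close> in the
  exponent cost at most one factor \<open>l\<close> at each of the scales.\<close>

lemma card_not_thin:
 assumes cl: "cloud A l J c1 sgm tau" and eta: "0 <= eta" "eta * J <= 1"
  and S: "!!j. 1 <= j ==> j <= J ==> real (card (thick_pairs A (l powr - real j) ((l powr - real j) powr (tau - eta)))) <= c"
 shows "card {w \<in> (A \<times> A) \<times> (A \<times> A). ~ cloud.thin A l J tau w} <= real J * c"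
proof -
 interpret cloud A l J c1 sgm tau by (rule cl)
 let ?T = "%j. thick_pairs A (l powr - real j) ((l powr - real j) powr (tau - eta))"
 have "{w \<in> (A \<times> A) \<times> (A \<times> A). ~ thin w} <= (\<Union>j\<in>{1..J}. ?T j)"
 proof
  fix w assume w: "w \<in> {w \<in> (A \<times> A) \<times> (A \<times> A). ~ thin w}"
  then obtain j where j: "j <= J" "E (1 - tau * j) < mu (tube w (E (- real j)))" by (auto simp: thin_def)
  have "j ~= 0"
  proof
   assume "j = 0"
   then show False using j mu_le_1[of "tube w (E (- real j))"] l_ge by simp
  qed
  have "real j * eta <= 1" using mult_left_mono[of "real j" "real J" eta] j eta by (simp add: mult.commute)
  then have "(E (- real j)) powr (tau - eta) <= E (1 - tau * j)" unfolding powr_powr by (intro E_mono) (simp add: algebra_simps)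
  then have "(E (- real j)) powr (tau - eta) * card X <= mu (tube w (E (- real j))) * card X" using j by (intro mult_right_mono) auto
  also have "... = card (X Int tube w (E (- real j)))" by (simp add: mu_card)
  also have "X Int tube w (E (- real j)) = {q \<in> A \<times> A. abs (snd q - slope w * fst q - icpt w) <= E (- real j)}" by (auto simp: X_def tube_def)
  finally have "w \<in> ?T j" using w by (simp add: thick_pairs_def X_def)
  then show "w \<in> (\<Union>j\<in>{1..J}. ?T j)" using j \<open>j ~= 0\<close> by auto
 qed
 then have "card {w \<in> (A \<times> A) \<times> (A \<times> A). ~ thin w} <= card (\<Union>j\<in>{1..J}. ?T j)"
  using A by (intro card_mono) (auto simp: thick_pairs_def)
 also have "... <= (\<Sum>j\<in>{1..J}. card (?T j))" by (intro card_UN_le) simp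
 finally have "real (card {w \<in> (A \<times> A) \<times> (A \<times> A). ~ thin w}) <= (\<Sum>j\<in>{1..J}. real (card (?T j)))" by (simp flip: of_nat_sum)
 also have "... <= (\<Sum>j\<in>{1..J}. c)" using S by (intro sum_mono) auto
 finally show ?thesis by simp
qed

text \<open>Thinness for \<open>tau - eta\<close> at the scales \<open>l powr (- j)\<close> makes
  most pairs \<open>thin\<close>, so tight pairs are rare by \<open>not_thin_and_tight\<close>. A
  tube that is too heavy for \<open>tau + eta\<close> is tight, as \<open>eta * J <= 1\<close>.
  Since \<open>eta\<close> depends on \<open>tau\<close> through \<open>J\<close>, iterating need
  not reach the threshold.\<close>

lemma thin_tubes_step:
 fixes sgm tau :: real
 assumes par: "0 < tau" "tau < 2 * sgm" "2 * sgm <= 1"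
 obtains eta where "0 < eta" "eta < tau" "thin_tubes sgm (tau - eta) ==> thin_tubes sgm (tau + eta)"
proof -
 obtain c1 J1 :: nat and l0 :: real where c1: "4 <= sgm * c1" and no:
  "!!J l A alpha. J1 <= J ==> l0 <= l ==> cloud A l J c1 sgm tau ==> l powr (- 1) <= alpha ==>
   alpha * (real (card (A \<times> A)))^2 <= card {w \<in> (A \<times> A) \<times> (A \<times> A). cloud.tight A l J tau w} ==>
   ~ card {w \<in> (A \<times> A) \<times> (A \<times> A). ~ cloud.thin A l J tau w} <= alpha / 10 * (real (card (A \<times> A)))^2"
  by (rule not_thin_and_tight[OF par]) blast
 define J where "J = Suc (J1 + c1)"
 have J: "J1 <= J" "c1 <= J" "1 <= real J" by (auto simp: J_def)
 define eta where "eta = min (1 / real J) (tau / 2)"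
 have eta: "0 < eta" "eta < tau" using J par by (auto simp: eta_def)
 have "eta * J <= (1 / real J) * J" unfolding eta_def by (intro mult_right_mono) auto
 then have etaJ: "eta * J <= 1" using J by simp
 show thesis
 proof (rule that[OF eta])
  assume "thin_tubes sgm (tau - eta)"
  then obtain e d0 where e: "0 < e" "0 < d0" and S: "!!delta A. 0 < delta ==> delta < d0 ==> frostman delta sgm (delta powr (- e)) A ==>
    card (thick_pairs A delta (delta powr (tau - eta))) <= delta powr e * (real (card (A \<times> A)))^2"
   unfolding thin_tubes_def by auto
  \<comment> \<open>As \<open>delta = l powr (- J)\<close>, a loss \<open>delta powr (- e')\<close>
    with \<open>e' * J <= e / 2\<close> is within the loss allowed at every scale
    \<open>l powr (- j)\<close>, even for \<open>j = 1\<close>.\<close>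
  define e' where "e' = min e 1 / (2 * J)"
  have e': "0 < e'" "e' * J <= e / 2" "e' * J <= 1 / 2" using e J by (auto simp: e'_def)
  define l1 where "l1 = max (max l0 (100 * (real J + 2)^2)) (max ((5 * real J + 2) ^ (J + 2)) (max (1 / d0 + 1) ((10 * J) powr (2 / e))))"
  have l1: "1 < l1"
  proof -
   have "1 / d0 + 1 <= l1" by (simp add: l1_def)
   moreover have "0 < 1 / d0" using e by simp
   ultimately show ?thesis by linarith
  qed
  define d1 where "d1 = l1 powr (- real J)"
  show "thin_tubes sgm (tau + eta)" unfolding thin_tubes_def
  proof (rule exI[of _ e'], rule conjI[OF e'(1)], rule exI[of _ d1], intro conjI allI impI)
   show "0 < d1" using l1 by (simp add: d1_def)
   fix delta A assume d: "0 < delta" "delta < d1" and fr: "frostman delta sgm (delta powr (- e')) A"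
   define l where "l = delta powr (- 1 / J)"
   have l: "l1 <= l"
   proof -
    have "d1 powr (- 1 / J) <= delta powr (- 1 / J)" using d by (intro powr_mono2') auto
    moreover have "d1 powr (- 1 / J) = l1" using J l1 by (simp add: d1_def powr_powr)
    ultimately show ?thesis by (simp add: l_def)
   qed
   have ll: "1 < l" "l0 <= l" "100 * (real J + 2)^2 <= l" "(5 * real J + 2) ^ (J + 2) <= l" "1 / d0 + 1 <= l" "(10 * J) powr (2 / e) <= l"
    using l l1 by (auto simp: l1_def)
   have dl: "delta powr a = l powr (- real J * a)" for a using J by (simp add: l_def powr_powr)
   have dl1: "delta = l powr (- real J)" using dl[of 1] d by simp
   have fA: "finite A" "A ~= {}" "A <= {0..1}" using fr by (auto simp: frostman_def)
   let ?N2 = "(real (card (A \<times> A)))^2"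
   have cl: "cloud A l J c1 sgm tau"
   proof
    fix x and j :: nat assume j: "j <= J"
    have "delta <= l powr (- real j)" unfolding dl1 using j ll by simp
    then have "card (A Int {x - l powr (- real j)..x + l powr (- real j)}) <= delta powr (- e') * (l powr (- real j)) powr sgm * card A"
     using fr by (simp add: frostman_def)
    also have "... = l powr (real J * e' - sgm * j) * card A" unfolding dl powr_powr powr_add[symmetric] by (simp add: algebra_simps)
    also have "... <= l powr (1 - sgm * j) * card A"
     using e'(3) ll(1) by (intro mult_right_mono powr_mono) (auto simp: mult.commute)
    finally show "card (A Int {x - l powr (- real j)..x + l powr (- real j)}) <= l powr (1 - sgm * j) * card A" .
   qed (use fA ll J par c1 in auto)
   interpret cloud A l J c1 sgm tau by (rule cl)
   have "real (card {w \<in> (A \<times> A) \<times> (A \<times> A). ~ thin w}) <= real J * (l powr (- e) * ?N2)"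
   proof (rule card_not_thin[OF cl less_imp_le[OF eta(1)] etaJ])
    fix j assume j: "1 <= j" "j <= J"
    have "l powr - real j <= l powr (- 1)" using j ll by (intro powr_mono) auto
    also have "... = 1 / l" using ll by simp
    also have "... < d0"
    proof -
     have "1 / d0 < l" using ll by simp
     then show ?thesis using e by (simp add: field_simps)
    qed
    finally have "l powr - real j < d0" .
    moreover have "frostman (l powr - real j) sgm ((l powr - real j) powr (- e)) A"
    proof (rule frostman_mono[OF fr])
     have "1 * e <= real j * e" using j e by simp
     then have "real J * e' <= real j * e" using e'(2) e mult.commute[of e' "real J"] by linarith
     then show "delta powr (- e') <= (l powr - real j) powr (- e)" unfolding dl powr_powr using ll by simp
     show "delta <= l powr - real j" unfolding dl1 using j ll by simp
    qed
    ultimately have "card (thick_pairs A (l powr - real j) ((l powr - real j) powr (tau - eta))) <= (l powr - real j) powr e * ?N2"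
     by (intro S) auto
    also have "... <= l powr (- e) * ?N2"
     unfolding powr_powr using j ll e by (intro mult_right_mono powr_mono) (auto simp: mult_le_cancel_right1)
    finally show "real (card (thick_pairs A (l powr - real j) ((l powr - real j) powr (tau - eta)))) <= l powr (- e) * ?N2" .
   qed
   also have "... <= delta powr e' / 10 * ?N2"
   proof -
    have "10 * J = ((10 * J) powr (2 / e)) powr (e / 2)" using e by (simp add: powr_powr)
    also have "... <= l powr (e / 2)" using ll e by (intro powr_mono2) auto
    finally have "(10 * J) * l powr (- e) <= l powr (e / 2) * l powr (- e)" by simp
    also have "... = l powr (- (e / 2))" unfolding powr_add[symmetric] by simp
    also have "... <= delta powr e'" unfolding dl using ll e' by (intro powr_mono) (auto simp: mult.commute)
    finally have "(10 * J) * l powr (- e) * ?N2 <= delta powr e' * ?N2" by (intro mult_right_mono) auto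
    then show ?thesis by simp
   qed
   finally have thin: "real (card {w \<in> (A \<times> A) \<times> (A \<times> A). ~ thin w}) <= delta powr e' / 10 * ?N2" .
   have "l powr (- 1) <= delta powr e'" unfolding dl using ll e' by (intro powr_mono) (auto simp: mult.commute)
   from no[OF J(1) ll(2) cl this] thin have "~ delta powr e' * ?N2 <= card {w \<in> (A \<times> A) \<times> (A \<times> A). tight w}" by auto
   moreover have "card (thick_pairs A delta (delta powr (tau + eta))) <= card {w \<in> (A \<times> A) \<times> (A \<times> A). tight w}"
   proof (intro card_mono subsetI)
    fix w assume w: "w \<in> thick_pairs A delta (delta powr (tau + eta))"
    have "E (- 1 - tau * J) <= delta powr (tau + eta)" unfolding dl using etaJ by (intro E_mono) (simp add: algebra_simps)
    then have "E (- 1 - tau * J) * card X <= delta powr (tau + eta) * card X" by (intro mult_right_mono) auto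
    also have "... <= card {q \<in> A \<times> A. abs (snd q - slope w * fst q - icpt w) <= delta}" using w by (simp add: thick_pairs_def X_def)
    also have "{q \<in> A \<times> A. abs (snd q - slope w * fst q - icpt w) <= delta} = X Int tube w (E (- real J))" unfolding dl1 by (auto simp: X_def tube_def)
    finally have "tight w" using X_ne unfolding mu_card tight_def by simp
    then show "w \<in> {w \<in> (A \<times> A) \<times> (A \<times> A). tight w}" using w by (simp add: thick_pairs_def)
   qed (use fA in auto)
   ultimately show "card (thick_pairs A delta (delta powr (tau + eta))) <= delta powr e' * ?N2" by simp
  qed
 qed
qed

text \<open>At the supremum of admissible exponents, assumed below the threshold, the step lemma
  passes from just below it to above it.\<close>

theorem thin_tubes_all:
 fixes sgm tau :: real
 assumes "0 < sgm" "2 * sgm <= 1" "tau < 2 * sgm"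
 shows "thin_tubes sgm tau"
proof (rule ccontr)
 assume no: "~ thin_tubes sgm tau"
 let ?S = "{t. thin_tubes sgm t}"
 have bdd: "t <= tau" if "t \<in> ?S" for t using thin_tubes_mono[of sgm t tau] that no by force
 then have "bdd_above ?S" unfolding bdd_above_def by auto
 have half: "sgm / 2 \<in> ?S" using thin_tubes_small[OF assms(1)] by simp
 define t where "t = Sup ?S"
 have le: "s <= t" if "s \<in> ?S" for s unfolding t_def using that \<open>bdd_above ?S\<close> by (rule cSup_upper)
 have t: "0 < t" "t < 2 * sgm"
 proof -
  show "0 < t" using le[OF half] assms by simp
  have "t <= tau" unfolding t_def using half bdd by (intro cSup_least) auto
  then show "t < 2 * sgm" using assms by simp
 qed
 obtain eta where eta: "0 < eta" "eta < t" "thin_tubes sgm (t - eta) ==> thin_tubes sgm (t + eta)"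
  by (rule thin_tubes_step[OF t assms(2)]) blast
 have "EX s:?S. t - eta < s"
 proof (rule ccontr)
  assume "~ ?thesis"
  then have "t <= t - eta" unfolding t_def[symmetric] using half by (subst (1) t_def) (intro cSup_least, auto simp: not_less)
  then show False using eta by simp
 qed
 then have "thin_tubes sgm (t - eta)" using thin_tubes_mono by auto
 then have "t + eta <= t" using eta(3) le[of "t + eta"] by simp
 then show False using eta by simp
qed

subsection \<open>Directions and dilations\<close>

text \<open>One frame for all four inequalities: a tuple of two points \<open>(a, b)\<close>,
  \<open>(x, y)\<close> is multiplied by a factor from \<open>D x\<close>. Products use
  \<open>D x = A\<close>; quotients use \<open>D x = {1 / x}\<close>, which turns the third entry
  into \<open>1\<close>. \<open>s = 1\<close> gives differences and \<open>s = - 1\<close>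
  sums.\<close>

locale dilation =
 fixes A :: "real set" and D :: "real => real set" and s delta kappa h M :: real and k :: nat
 assumes A: "finite A" "A <= {1..2}" "separated delta A" and s: "abs s = 1"
  and par: "0 < delta" "0 < kappa" "kappa <= 1" "16 * delta <= kappa" "0 < h" "1 <= M"
  and D: "!!x. x \<in> A ==> finite (D x) & card (D x) = k & D x <= {1 / 2..2}" "separated (delta / 4) (\<Union>x\<in>A. D x)"
begin

definition dx :: "(real \<times> real) \<times> (real \<times> real) => real" where "dx w = fst (snd w) - s * fst (fst w)"
definition dy :: "(real \<times> real) \<times> (real \<times> real) => real" where "dy w = snd (snd w) - s * snd (fst w)"
abbreviation fl :: "real => int" where "fl u == \<lfloor>u / delta\<rfloor>"
definition Q where "Q = (A \<times> A) \<times> (A \<times> A)"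
definition Z where "Z = (SIGMA w:Q. D (fst (snd w)))"
definition cell where "cell z = ((fl (fst (fst (fst z)) * snd z), fl (snd (fst (fst z)) * snd z)), (fl (fst (snd (fst z)) * snd z), fl (snd (snd (fst z)) * snd z)))"
text \<open>The bound on the tube says that few \<open>(x, y)\<close> share this direction as seen
  from \<open>(s * a, s * b)\<close>; the lower bound on \<open>dx\<close> keeps the direction
  stable under errors of order \<open>delta\<close>.\<close>

definition good where "good w \<longleftrightarrow> kappa <= abs (dx w) &
 card {q \<in> A \<times> A. abs ((snd q - s * snd (fst w)) - dy w / dx w * (fst q - s * fst (fst w))) <= 4 * delta} < h * (real (card A))^2"
definition fibre where "fibre z = {z' \<in> Z. cell z' = cell z}"
definition vec where "vec z = (fl (dx (fst z)), fl (dy (fst z)))" for z :: "((real \<times> real) \<times> (real \<times> real)) \<times> real"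

lemma fin [simp]: "finite Q" "finite Z" "finite (fibre z)"
proof -
 show "finite Q" using A by (simp add: Q_def)
 then show "finite Z" unfolding Z_def using D(1) by (intro finite_SigmaI) (auto simp: Q_def)
 then show "finite (fibre z)" by (simp add: fibre_def)
qed

lemma unit: "w \<in> Q ==> fst (fst w) \<in> {1..2} & snd (fst w) \<in> {1..2} & fst (snd w) \<in> {1..2} & snd (snd w) \<in> {1..2}"
 using A(2) unfolding Q_def by auto

lemma dxy_le: "w \<in> Q ==> abs (dx w) <= 4 & abs (dy w) <= 4"
proof -
 assume w: "w \<in> Q"
 have "abs (s * u) <= 2" if "u \<in> {1..2}" for u using that s by (simp add: abs_mult)
 from this[of "fst (fst w)"] this[of "snd (fst w)"] unit[OF w] show ?thesis unfolding dx_def dy_def atLeastAtMost_iff by auto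
qed

lemma ZD: "z \<in> Z ==> fst z \<in> Q & 1 / 2 <= snd z & snd z <= 2 & snd z \<in> (\<Union>x\<in>A. D x)"
proof -
 assume "z \<in> Z"
 then have "fst z \<in> Q" "fst (snd (fst z)) \<in> A" "snd z \<in> D (fst (snd (fst z)))" by (auto simp: Z_def Q_def)
 then show ?thesis using D(1) by force
qed

lemma flD: "fl u = fl v ==> abs (u - v) < delta" using same_cell[OF par(1)] .

lemma cellD:
 assumes "z' \<in> fibre z"
 shows "abs (fst (fst (fst z')) * snd z' - fst (fst (fst z)) * snd z) < delta" "abs (snd (fst (fst z')) * snd z' - snd (fst (fst z)) * snd z) < delta"
  "abs (fst (snd (fst z')) * snd z' - fst (snd (fst z)) * snd z) < delta" "abs (snd (snd (fst z')) * snd z' - snd (snd (fst z)) * snd z) < delta"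
  "abs (dx (fst z') * snd z' - dx (fst z) * snd z) <= 2 * delta" "abs (dy (fst z') * snd z' - dy (fst z) * snd z) <= 2 * delta"
proof -
 have "cell z' = cell z" using assms by (simp add: fibre_def)
 then show 1: "abs (fst (fst (fst z')) * snd z' - fst (fst (fst z)) * snd z) < delta" "abs (snd (fst (fst z')) * snd z' - snd (fst (fst z)) * snd z) < delta"
  "abs (fst (snd (fst z')) * snd z' - fst (snd (fst z)) * snd z) < delta" "abs (snd (snd (fst z')) * snd z' - snd (snd (fst z)) * snd z) < delta"
  by (auto simp: cell_def intro!: flD)
 have "abs ((u' - s * v') * t' - (u - s * v) * t) <= 2 * delta" if "abs (u' * t' - u * t) < delta" "abs (v' * t' - v * t) < delta" for u v t u' v' t'
 proof -
  have "abs (s * (v' * t' - v * t)) < delta" using that(2) s by (simp add: abs_mult)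
  moreover have "(u' - s * v') * t' - (u - s * v) * t = (u' * t' - u * t) - s * (v' * t' - v * t)" by (simp add: algebra_simps)
  ultimately show ?thesis using that(1) by simp
 qed
 from this[OF 1(3,1)] this[OF 1(4,2)] show "abs (dx (fst z') * snd z' - dx (fst z) * snd z) <= 2 * delta"
  "abs (dy (fst z') * snd z' - dy (fst z) * snd z) <= 2 * delta" by (simp_all add: dx_def dy_def)
qed

lemma dx_fibre:
 assumes z: "z \<in> Z" "good (fst z)" "z' \<in> fibre z"
 shows "kappa / 8 <= abs (dx (fst z'))"
proof -
 have t: "1 / 2 <= snd z" "snd z' <= 2" "0 <= snd z'" using ZD[of z] ZD[of z'] z by (auto simp: fibre_def)
 have "kappa * (1 / 2) <= abs (dx (fst z)) * abs (snd z)" using z(2) t by (intro mult_mono) (auto simp: good_def)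
 then have "kappa / 2 - 2 * delta <= abs (dx (fst z') * snd z')" using cellD(5)[OF z(3)] unfolding abs_mult[symmetric] by simp
 also have "... <= abs (dx (fst z')) * 2" unfolding abs_mult using t by (intro mult_left_mono) auto
 finally show ?thesis using par by simp
qed

lemma card_near:
 assumes "separated (delta / 4) S" "finite S"
 shows "card {u \<in> S. abs (u - v) <= 130 * delta / kappa} <= 1042 / kappa"
proof -
 let ?S = "{u \<in> S. abs (u - v) <= 130 * delta / kappa}"
 have d: "0 < delta / 4" using par by simp
 have "card ?S = card ((%u. \<lfloor>u / (delta / 4)\<rfloor>) ` ?S)"
  using card_separated[OF d separated_subset[OF assms(1), of ?S]] by (simp add: ncell_def)
 also have "real ... <= ((v + 130 * delta / kappa) - (v - 130 * delta / kappa)) / (delta / 4) + 2"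
  using par by (intro card_floor_interval) (auto simp: abs_le_iff)
 also have "... = 1040 / kappa + 2" using par by simp
 also have "... <= 1042 / kappa" using par by (simp add: field_simps)
 finally show ?thesis .
qed

text \<open>In one cell the scaled tuple is fixed up to \<open>delta\<close>. Knowing also the
  unscaled \<open>dx\<close> up to \<open>delta\<close> fixes the factor up to a multiple of
  \<open>delta / kappa\<close>, and then all four entries; separation leaves boundedly many choices
  for each of the five quantities.\<close>

lemma card_vec_fibre:
 assumes z: "z \<in> Z" "good (fst z)"
 shows "card (fibre z) <= card (vec ` fibre z) * (1042 / kappa) ^ 5"
proof (rule card_le_fibres)
 fix z1 assume z1: "z1 \<in> fibre z"
 let ?r = "130 * delta / kappa"
 let ?A = "%v. {u \<in> A. abs (u - v) <= ?r}" and ?U = "{u \<in> (\<Union>x\<in>A. D x). abs (u - snd z1) <= ?r}"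
 have "{z' \<in> fibre z. vec z' = vec z1} <=
   ((?A (fst (fst (fst z1))) \<times> ?A (snd (fst (fst z1)))) \<times> (?A (fst (snd (fst z1))) \<times> ?A (snd (snd (fst z1))))) \<times> ?U" (is "_ <= ?B")
 proof
  fix z2 assume z2: "z2 \<in> {z' \<in> fibre z. vec z' = vec z1}"
  then have f: "z2 \<in> fibre z1" "z1 \<in> Z" "z2 \<in> Z" "z2 \<in> fibre z" using z1 by (auto simp: fibre_def)
  let ?t = "snd z1" and ?t' = "snd z2"
  have t: "1 / 2 <= ?t" "?t <= 2" "1 / 2 <= ?t'" "?t' <= 2" using ZD f by auto
  have u: "abs (dx (fst z1) - dx (fst z2)) < delta" using z2 by (intro flD) (auto simp: vec_def)
  have "abs ((dx (fst z1) - dx (fst z2)) * ?t') <= delta * 2" unfolding abs_mult using u t by (intro mult_mono) auto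
  moreover have "dx (fst z1) * (?t - ?t') = (dx (fst z1) * ?t - dx (fst z2) * ?t') - (dx (fst z1) - dx (fst z2)) * ?t'" by (simp add: algebra_simps)
  ultimately have "abs (dx (fst z1) * (?t - ?t')) <= 4 * delta" using cellD(5)[OF f(1)] by simp
  moreover have "kappa / 8 * abs (?t - ?t') <= abs (dx (fst z1)) * abs (?t - ?t')" by (intro mult_right_mono dx_fibre[OF z z1]) simp
  ultimately have "kappa / 8 * abs (?t - ?t') <= 4 * delta" by simp
  then have tt: "abs (?t - ?t') <= 32 * delta / kappa" using par by (simp add: field_simps)
  have dk: "delta <= delta / kappa" using par by (simp add: field_simps)
  have near: "abs (u' - u) <= ?r" if "abs (u' * ?t' - u * ?t) < delta" "u \<in> {1..2}" for u u' :: real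
  proof -
   have "abs (u * (?t - ?t')) <= 2 * (32 * delta / kappa)" unfolding abs_mult using that(2) tt by (intro mult_mono) auto
   moreover have "(u' - u) * ?t' = (u' * ?t' - u * ?t) + u * (?t - ?t')" by (simp add: algebra_simps)
   ultimately have "abs ((u' - u) * ?t') <= delta + 64 * (delta / kappa)" using that(1) by simp
   moreover have "abs (u' - u) * (1 / 2) <= abs (u' - u) * ?t'" using t by (intro mult_left_mono) auto
   ultimately have "abs (u' - u) <= 130 * (delta / kappa)" using dk t by simp
   then show ?thesis by simp
  qed
  have "abs (?t' - ?t) <= ?r" using tt by simp
  moreover note near[OF cellD(1)[OF f(1)]] near[OF cellD(2)[OF f(1)]] near[OF cellD(3)[OF f(1)]] near[OF cellD(4)[OF f(1)]]
  moreover have "fst z1 \<in> Q" "fst z2 \<in> Q" "?t' \<in> (\<Union>x\<in>A. D x)" using ZD f by auto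
  ultimately show "z2 \<in> ?B" using unit[of "fst z1"] by (simp only: mem_Times_iff mem_Collect_eq Q_def)
 qed
 moreover have fU: "finite (\<Union>x\<in>A. D x)" using A D by auto
 ultimately have "card {z' \<in> fibre z. vec z' = vec z1} <= card ?B" using A by (intro card_mono finite_cartesian_product) auto
 then have "real (card {z' \<in> fibre z. vec z' = vec z1}) <= ((real (card (?A (fst (fst (fst z1))))) * real (card (?A (snd (fst (fst z1)))))) *
   (real (card (?A (fst (snd (fst z1))))) * real (card (?A (snd (snd (fst z1))))))) * real (card ?U)"
  by (simp add: card_cartesian_product flip: of_nat_mult)
 also have "... <= ((1042 / kappa * (1042 / kappa)) * (1042 / kappa * (1042 / kappa))) * (1042 / kappa)"
 proof -
  have "separated (delta / 4) A" using A(3) par by (force simp: separated_def)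
  then show ?thesis using card_near[of A] card_near[OF D(2) fU] A par by (intro mult_mono) auto
 qed
 also have "... = (1042 / kappa) ^ 5" by (simp add: power_numeral_reduce)
 finally show "real (card {z' \<in> fibre z. vec z' = vec z1}) <= (1042 / kappa) ^ 5" .
qed (use par in auto)

text \<open>Scaling does not change a direction, so members of a fibre have the direction of its
  base tuple up to a multiple of \<open>delta\<close>. Hence one pair of cells serves nearly one
  direction only.\<close>

lemma slope_vec:
 assumes z: "z \<in> Z" "good (fst z)" "z' \<in> fibre z" and y: "y \<in> Z" "good (fst y)" "y' \<in> fibre y" and eq: "vec z' = vec y'"
 shows "abs (dy (fst z) / dx (fst z) - dy (fst y) / dx (fst y)) <= 360 * delta / kappa^2"
proof -
 let ?q = "%z. dy (fst z) / dx (fst z)"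
 have q: "abs (?q z) <= 4 / kappa" "abs (dy (fst z') - ?q z * dx (fst z')) <= 20 * (delta / kappa)" if z: "z \<in> Z" "good (fst z)" "z' \<in> fibre z" for z z'
 proof -
  have d: "kappa <= abs (dx (fst z))" using z by (simp add: good_def)
  have "abs (dy (fst z)) <= 4" using dxy_le ZD[OF z(1)] by simp
  then show 1: "abs (?q z) <= 4 / kappa" unfolding abs_divide using d par by (intro frac_le) auto
  have t: "1 / 2 <= snd z'" using ZD[of z'] z by (simp add: fibre_def)
  have e: "?q z * dx (fst z) = dy (fst z)" using d par by auto
  have "(dy (fst z') - ?q z * dx (fst z')) * snd z' = (dy (fst z') * snd z' - dy (fst z) * snd z) - ?q z * (dx (fst z') * snd z' - dx (fst z) * snd z)"
   using arg_cong[OF e, of "%u. u * snd z"] unfolding left_diff_distrib right_diff_distrib by auto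
  moreover have "abs (?q z * (dx (fst z') * snd z' - dx (fst z) * snd z)) <= 4 / kappa * (2 * delta)"
   unfolding abs_mult[of "?q z"] using 1 cellD(5)[OF z(3)] par by (intro mult_mono) auto
  ultimately have "abs ((dy (fst z') - ?q z * dx (fst z')) * snd z') <= 2 * delta + 4 / kappa * (2 * delta)" using cellD(6)[OF z(3)] by linarith
  moreover have "abs (dy (fst z') - ?q z * dx (fst z')) * (1 / 2) <= abs (dy (fst z') - ?q z * dx (fst z')) * snd z'" using t by (intro mult_left_mono) auto
  moreover have "delta <= delta / kappa" using par by (simp add: field_simps)
  ultimately show "abs (dy (fst z') - ?q z * dx (fst z')) <= 20 * (delta / kappa)" using t by (simp add: abs_mult)
 qed
 define q1 q2 where "q1 = ?q z" and "q2 = ?q y"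
 have v: "abs (dx (fst z') - dx (fst y')) < delta" "abs (dy (fst z') - dy (fst y')) < delta" using eq by (auto simp: vec_def intro!: flD)
 have "abs (q2 * (dx (fst y') - dx (fst z'))) <= 4 / kappa * delta"
  unfolding abs_mult using q(1)[OF y] v par by (intro mult_mono) (auto simp: abs_minus_commute q2_def)
 moreover have "delta <= delta / kappa" using par by (simp add: field_simps)
 moreover have "(q1 - q2) * dx (fst z') = (dy (fst z') - dy (fst y')) - (dy (fst z') - q1 * dx (fst z')) + (dy (fst y') - q2 * dx (fst y'))
   + q2 * (dx (fst y') - dx (fst z'))" by (simp add: algebra_simps)
 moreover have "4 / kappa * delta = 4 * (delta / kappa)" by simp
 ultimately have "abs ((q1 - q2) * dx (fst z')) <= 45 * (delta / kappa)" using q(2)[OF z] q(2)[OF y] v(2) unfolding q1_def[symmetric] q2_def[symmetric] by linarith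
 moreover have "abs (q1 - q2) * (kappa / 8) <= abs (q1 - q2) * abs (dx (fst z'))" using dx_fibre[OF z] by (intro mult_left_mono) auto
 ultimately have "abs (q1 - q2) * (kappa / 8) <= 45 * (delta / kappa)" by simp
 then show ?thesis using par unfolding q1_def[symmetric] q2_def[symmetric] by (simp add: field_simps power2_eq_square)
qed

text \<open>By averaging, some \<open>o'\<close> sees at least about \<open>1 / h\<close> separate
  directions coming from tuples in populous cells. Each is realised by about \<open>n0\<close> pairs
  of cells of the sum or difference set, and each pair serves boundedly many directions; so
  \<open>n0 / h\<close> is at most a constant times the squared count.\<close>

lemma dilation_bound:
 assumes M: "card (cell ` Z) <= M" and bad: "card {w \<in> Q. ~ good w} <= real (card Q) / 4" and ne: "A ~= {}" "1 <= k"
 shows "k * real (card A) ^ 4 <= 8 * (1042 / kappa) ^ 5 * (722 / kappa^2) * h * M * (real (ncell delta {x - s * a |x a. x \<in> A & a \<in> A}))^2"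
proof -
 let ?N = "ncell delta {x - s * a |x a. x \<in> A & a \<in> A}" and ?n = "real (card A)"
 have n: "0 < ?n" using A ne by auto
 have cQ: "real (card Q) = ?n ^ 4" by (simp add: Q_def card_cartesian_product power4_eq_xxxx)
 have slice: "card {z \<in> Z. R (fst z)} = card {w \<in> Q. R w} * k" for R
 proof -
  have "{z \<in> Z. R (fst z)} = (SIGMA w:{w \<in> Q. R w}. D (fst (snd w)))" by (auto simp: Z_def)
  also have "card ... = (\<Sum>w\<in>{w \<in> Q. R w}. card (D (fst (snd w))))" using A D by (subst card_SigmaI) (auto simp: Q_def)
  also have "... = (\<Sum>w\<in>{w \<in> Q. R w}. k)" using D by (intro sum.cong) (auto simp: Q_def)
  finally show ?thesis by simp
 qed
 have cZ: "real (card Z) = k * ?n ^ 4" using slice[of "%_. True"] cQ by simp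
 \<comment> \<open>A quarter of the average population if there are \<open>M\<close> cells, so that
   sparse cells hold at most a quarter of \<open>Z\<close>.\<close>
 define n0 where "n0 = k * ?n ^ 4 / (4 * M)"
 have n0: "0 <= n0" "M * n0 = k * ?n ^ 4 / 4" using par by (simp_all add: n0_def)
 define Y where "Y = {z \<in> Z. good (fst z) & n0 < card (fibre z)}"
 have "real (card Z) <= card Y + card {z \<in> Z. ~ good (fst z)} + card {z \<in> Z. card (fibre z) <= n0}"
 proof -
  have "Z <= Y Un {z \<in> Z. ~ good (fst z)} Un {z \<in> Z. card (fibre z) <= n0}" by (auto simp: Y_def)
  then have "card Z <= card (Y Un {z \<in> Z. ~ good (fst z)} Un {z \<in> Z. card (fibre z) <= n0})" by (intro card_mono) (auto simp: Y_def)
  also have "... <= card Y + card {z \<in> Z. ~ good (fst z)} + card {z \<in> Z. card (fibre z) <= n0}"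
   by (meson add_le_mono card_Un_le order_refl order_trans)
  finally show ?thesis by simp
 qed
 moreover have "real (card {z \<in> Z. ~ good (fst z)}) <= k * ?n ^ 4 / 4"
  using slice[of "%w. ~ good w"] mult_right_mono[OF bad, of "real k"] cQ by (simp add: mult.commute)
 moreover have "real (card {z \<in> Z. card (fibre z) <= n0}) <= M * n0"
 proof (rule card_le_fibres[where f = cell])
  have "card (cell ` {z \<in> Z. card (fibre z) <= n0}) <= card (cell ` Z)" by (intro card_mono) auto
  then show "real (card (cell ` {z \<in> Z. card (fibre z) <= n0})) <= M" using M by simp
  fix z assume z: "z \<in> {z \<in> Z. card (fibre z) <= n0}"
  have "card {z' \<in> {z \<in> Z. card (fibre z) <= n0}. cell z' = cell z} <= card (fibre z)" by (intro card_mono) (auto simp: fibre_def)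
  then show "real (card {z' \<in> {z \<in> Z. card (fibre z) <= n0}. cell z' = cell z}) <= n0" using z by simp
 qed (use n0 in auto)
 ultimately have Y: "k * ?n ^ 4 / 2 <= card Y" using cZ n0(2) by simp
 have fY: "finite Y" by (simp add: Y_def)
 have "EX o':A \<times> A. k * ?n^2 / 2 <= card {z \<in> Y. fst (fst z) = o'}"
 proof (rule ccontr)
  assume no: "~ ?thesis"
  have "real (card Y) = (\<Sum>o'\<in>A \<times> A. real (card {z \<in> Y. fst (fst z) = o'}))"
  proof -
   have "fst (fst z) \<in> A \<times> A" if "z \<in> Y" for z using that by (auto simp: Y_def Z_def Q_def)
   then have "Y = (\<Union>o'\<in>A \<times> A. {z \<in> Y. fst (fst z) = o'})" by auto
   then have "card Y = card (\<Union>o'\<in>A \<times> A. {z \<in> Y. fst (fst z) = o'})" by simp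
   also have "... = (\<Sum>o'\<in>A \<times> A. card {z \<in> Y. fst (fst z) = o'})" using A fY by (intro card_UN_disjoint) auto
   finally show ?thesis by simp
  qed
  also have "... < (\<Sum>o'\<in>A \<times> A. k * ?n^2 / 2)" using no A ne by (intro sum_strict_mono) (auto simp: not_le)
  also have "... = k * ?n ^ 4 / 2" by (simp add: card_cartesian_product power2_eq_square power4_eq_xxxx)
  finally show False using Y by simp
 qed
 then obtain o' where o': "k * ?n^2 / 2 <= card {z \<in> Y. fst (fst z) = o'}" by auto
 let ?q = "%w. dy w / dx w"
 define H where "H = fst ` {z \<in> Y. fst (fst z) = o'}"
 have fH: "finite H" using fY by (simp add: H_def)
 have HQ: "w \<in> Q & good w & fst w = o'" if "w \<in> H" for w using that by (auto simp: H_def Y_def Z_def)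
 have "real (card {z \<in> Y. fst (fst z) = o'}) <= card H * real k"
 proof (rule card_le_fibres[where f = fst])
  fix z assume z: "z \<in> {z \<in> Y. fst (fst z) = o'}"
  have "card {z' \<in> {z \<in> Y. fst (fst z) = o'}. fst z' = fst z} <= card (D (fst (snd (fst z))))"
  proof (rule card_inj_on_le[where f = snd])
   show "finite (D (fst (snd (fst z))))" using z D by (auto simp: Y_def Z_def Q_def)
  qed (auto simp: inj_on_def prod_eq_iff Y_def Z_def)
  then show "real (card {z' \<in> {z \<in> Y. fst (fst z) = o'}. fst z' = fst z}) <= k" using z D by (auto simp: Y_def Z_def Q_def)
 qed (use fY in \<open>auto simp: H_def\<close>)
 then have "k * ?n^2 / 2 <= card H * real k" using o' by simp
 then have H: "?n^2 / 2 <= card H" using ne by simp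
 have "real (card H) <= card ((%w. fl (?q w)) ` H) * (h * ?n^2)"
 proof (rule card_le_fibres[OF fH])
  fix w assume w: "w \<in> H"
  have "card {w' \<in> H. fl (?q w') = fl (?q w)} <=
    card {q \<in> A \<times> A. abs ((snd q - s * snd (fst w)) - ?q w * (fst q - s * fst (fst w))) <= 4 * delta}"
  proof (rule card_inj_on_le[where f = snd])
   show "inj_on snd {w' \<in> H. fl (?q w') = fl (?q w)}" using HQ by (auto simp: inj_on_def prod_eq_iff)
   show "snd ` {w' \<in> H. fl (?q w') = fl (?q w)} <= {q \<in> A \<times> A. abs ((snd q - s * snd (fst w)) - ?q w * (fst q - s * fst (fst w))) <= 4 * delta}"
   proof (rule image_subsetI)
    fix w' assume w': "w' \<in> {w' \<in> H. fl (?q w') = fl (?q w)}"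
    have o: "fst w' = fst w" "snd w' \<in> A \<times> A" "w' \<in> Q" using HQ[of w'] HQ[OF w] w' by (auto simp: Q_def)
    have "kappa <= abs (dx w')" using HQ[of w'] w' by (simp add: good_def)
    then have "dy w' = ?q w' * dx w'" using par by auto
    then have e: "dy w' - ?q w * dx w' = (?q w' - ?q w) * dx w'" unfolding left_diff_distrib by simp
    have "abs (dx w') <= 4" using dxy_le[OF o(3)] by simp
    moreover have "abs (?q w' - ?q w) < delta" using w' by (intro flD) simp
    ultimately have "abs ((?q w' - ?q w) * dx w') <= delta * 4" unfolding abs_mult by (intro mult_mono) auto
    then have "abs (dy w' - ?q w * dx w') <= 4 * delta" unfolding e by simp
    moreover have "dx w' = fst (snd w') - s * fst (fst w)" "dy w' = snd (snd w') - s * snd (fst w)" by (simp_all add: dx_def dy_def o(1))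
    ultimately show "snd w' \<in> {q \<in> A \<times> A. abs ((snd q - s * snd (fst w)) - ?q w * (fst q - s * fst (fst w))) <= 4 * delta}" using o(2) by simp
   qed
  qed (use A in simp)
  then show "real (card {w' \<in> H. fl (?q w') = fl (?q w)}) <= h * ?n^2" using HQ[OF w] unfolding good_def by auto
 qed (use par in auto)
 then have "?n^2 * (1 / 2) <= ?n^2 * (card ((%w. fl (?q w)) ` H) * h)" using H by (simp add: mult_ac)
 then have slopes: "1 / 2 <= card ((%w. fl (?q w)) ` H) * h" using n by simp
 obtain H0 where H0: "H0 <= H" "inj_on (%w. fl (?q w)) H0" "(%w. fl (?q w)) ` H = (%w. fl (?q w)) ` H0"
  using subset_image_inj[of "(%w. fl (?q w)) ` H" "%w. fl (?q w)" H] by auto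
 have fH0: "finite H0" by (rule finite_subset[OF H0(1) fH])
 have cH0: "1 / 2 <= card H0 * h" using slopes H0 by (simp add: card_image)
 have "ALL w:H0. EX z. z \<in> Y & fst z = w" using H0(1) unfolding H_def by blast
 then obtain g where g: "!!w. w \<in> H0 ==> g w \<in> Y & fst (g w) = w" by metis
 let ?V = "(%u. fl u) ` {x - s * a |x a. x \<in> A & a \<in> A} \<times> (%u. fl u) ` {x - s * a |x a. x \<in> A & a \<in> A}"
 have "{x - s * a |x a. x \<in> A & a \<in> A} = (%(x, a). x - s * a) ` (A \<times> A)" by auto
 then have fV: "finite ?V" using A by simp
 have cV: "real (card ?V) = (real ?N)^2" by (simp add: card_cartesian_product ncell_def power2_eq_square)
 have "card H0 * (n0 / (1042 / kappa) ^ 5) = (\<Sum>w\<in>H0. n0 / (1042 / kappa) ^ 5)" by simp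
 also have "... <= (\<Sum>w\<in>H0. real (card {v \<in> ?V. v \<in> vec ` fibre (g w)}))"
 proof (intro sum_mono)
  fix w assume w: "w \<in> H0"
  have gY: "g w \<in> Z" "good (fst (g w))" "n0 < card (fibre (g w))" using g[OF w] by (auto simp: Y_def)
  have "vec ` fibre (g w) <= ?V"
  proof (rule image_subsetI)
   fix z assume "z \<in> fibre (g w)"
   then have "fst z \<in> Q" using ZD by (simp add: fibre_def)
   then show "vec z \<in> ?V" unfolding vec_def Q_def by (intro SigmaI imageI) (auto simp: mem_Times_iff dx_def dy_def)
  qed
  then have "{v \<in> ?V. v \<in> vec ` fibre (g w)} = vec ` fibre (g w)" by auto
  moreover have "n0 <= card (vec ` fibre (g w)) * (1042 / kappa) ^ 5" using card_vec_fibre[OF gY(1,2)] gY(3) by simp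
  ultimately show "n0 / (1042 / kappa) ^ 5 <= real (card {v \<in> ?V. v \<in> vec ` fibre (g w)})" using par by (simp add: pos_divide_le_eq)
 qed
 also have "... = (\<Sum>v\<in>?V. real (card {w \<in> H0. v \<in> vec ` fibre (g w)}))"
  using double_count[OF fH0 fV, of "%w v. v \<in> vec ` fibre (g w)"] by (simp flip: of_nat_sum)
 also have "... <= (\<Sum>v\<in>?V. 722 / kappa^2)"
 proof (intro sum_mono)
  fix v
  let ?S = "{w \<in> H0. v \<in> vec ` fibre (g w)}" and ?r = "360 * delta / kappa^2"
  show "real (card ?S) <= 722 / kappa^2"
  proof (cases "?S = {}")
   case False
   then obtain w1 z1 where w1: "w1 \<in> H0" "z1 \<in> fibre (g w1)" "v = vec z1" by auto
   have "card ?S = card ((%w. fl (?q w)) ` ?S)" using H0(2) by (intro card_image[symmetric]) (auto simp: inj_on_def)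
   also have "(%w. fl (?q w)) ` ?S = (%u. \<lfloor>u / delta\<rfloor>) ` (?q ` ?S)" by blast
   also have "real (card ...) <= ((?q w1 + ?r) - (?q w1 - ?r)) / delta + 2"
   proof (rule card_floor_interval[OF _ par(1)])
    fix u assume "u \<in> ?q ` ?S"
    then obtain w z where w: "w \<in> H0" "z \<in> fibre (g w)" "v = vec z" "u = ?q w" by auto
    have "abs (dy (fst (g w)) / dx (fst (g w)) - dy (fst (g w1)) / dx (fst (g w1))) <= ?r"
     using g[OF w(1)] g[OF w1(1)] w w1 by (intro slope_vec[of _ z _ z1]) (auto simp: Y_def)
    moreover have "fst (g w) = w" "fst (g w1) = w1" using g w(1) w1(1) by auto
    ultimately have "abs (?q w - ?q w1) <= ?r" by simp
    then show "?q w1 - ?r <= u & u <= ?q w1 + ?r" unfolding w(4) abs_le_iff by simp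
   next
    have "0 <= ?r" using par by simp
    then show "?q w1 - ?r <= ?q w1 + ?r" by simp
   qed
   also have "... = 720 / kappa^2 + 2" using par by simp
   also have "... <= 722 / kappa^2"
   proof -
    have "kappa^2 <= 1" "0 < kappa^2" using par by (simp_all add: power_le_one)
    then have "1 <= 1 / kappa^2" by simp
    moreover have "720 / kappa^2 = 720 * (1 / kappa^2)" "722 / kappa^2 = 722 * (1 / kappa^2)" by auto
    ultimately show ?thesis by simp
   qed
   finally show ?thesis .
  next
   case True
   show ?thesis unfolding True by simp
  qed
 qed
 also have "... = 722 / kappa^2 * (real ?N)^2" using cV by simp
 finally have "card H0 * (n0 / (1042 / kappa) ^ 5) <= 722 / kappa^2 * (real ?N)^2" .
 then have 1: "card H0 * n0 <= (1042 / kappa) ^ 5 * (722 / kappa^2 * (real ?N)^2)" using par by (simp add: pos_divide_le_eq mult_ac)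
 have "1 / 2 * n0 <= (card H0 * n0) * h" using mult_right_mono[OF cH0 n0(1)] by (simp add: mult_ac)
 also have "... <= ((1042 / kappa) ^ 5 * (722 / kappa^2 * (real ?N)^2)) * h" using 1 par by (intro mult_right_mono) auto
 finally have "(8 * M) * (1 / 2 * n0) <= (8 * M) * (((1042 / kappa) ^ 5 * (722 / kappa^2 * (real ?N)^2)) * h)" using par by (intro mult_left_mono) auto
 moreover have "(8 * M) * (1 / 2 * n0) = k * ?n ^ 4" using n0(2) by simp
 ultimately show ?thesis by (simp only: mult_ac)
qed

end

section \<open>Return to covering numbers and the four inequalities\<close>

lemma ncell_le_covering:
 assumes "finite E" "0 < delta"
 shows "ncell delta E <= 2 * covering_number delta E"
proof -
 let ?P = "%n. EX X. finite X & card X = n & E <= (\<Union>x\<in>X. {x..x + delta})"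
 have "?P (card E)" using assms by force
 then have "?P (covering_number delta E)" unfolding covering_number_def by (rule LeastI)
 then obtain X where X: "finite X" "card X = covering_number delta E" "E <= (\<Union>x\<in>X. {x..x + delta})" by auto
 have "(%u. \<lfloor>u / delta\<rfloor>) ` E <= (\<Union>x\<in>X. {\<lfloor>x / delta\<rfloor>, \<lfloor>x / delta\<rfloor> + 1})"
 proof (rule image_subsetI)
  fix u assume "u \<in> E"
  then obtain x where x: "x \<in> X" "x <= u" "u <= x + delta" using X(3) by auto
  then have "x / delta <= u / delta" "u / delta <= x / delta + 1" using assms(2) by (auto simp: field_simps)
  then have "\<lfloor>u / delta\<rfloor> = \<lfloor>x / delta\<rfloor> | \<lfloor>u / delta\<rfloor> = \<lfloor>x / delta\<rfloor> + 1" by linarith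
  then show "\<lfloor>u / delta\<rfloor> \<in> (\<Union>x\<in>X. {\<lfloor>x / delta\<rfloor>, \<lfloor>x / delta\<rfloor> + 1})" using x(1) by auto
 qed
 then have "ncell delta E <= card (\<Union>x\<in>X. {\<lfloor>x / delta\<rfloor>, \<lfloor>x / delta\<rfloor> + 1})" unfolding ncell_def using X(1) by (intro card_mono) auto
 also have "... <= (\<Sum>x\<in>X. card {\<lfloor>x / delta\<rfloor>, \<lfloor>x / delta\<rfloor> + 1})" by (rule card_UN_le[OF X(1)])
 also have "... <= (\<Sum>x\<in>X. 2)" by simp
 finally show ?thesis using X(2) by simp
qed

text \<open>The factor \<open>K + 1\<close> stands in for the \<open>p\<close>-th root of
  \<open>K\<close>, which suffices because constants are free.\<close>

lemma power_lower:
 fixes T Y K :: real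
 assumes "0 <= T" "0 < Y" "0 < K" "1 <= p" "Y ^ p <= K * T ^ p"
 shows "Y <= (K + 1) * T"
proof (rule ccontr)
 assume no: "~ ?thesis"
 have "(K + 1) * T ^ p <= (K + 1) ^ p * T ^ p" using assms power_increasing[of 1 p "K + 1"] by (intro mult_right_mono) auto
 also have "... = ((K + 1) * T) ^ p" by (simp add: power_mult_distrib)
 also have "... < Y ^ p" using no assms by (intro power_strict_mono) auto
 also have "... <= K * T ^ p" by (rule assms(5))
 finally have "T ^ p < 0" by (simp add: distrib_right)
 then show False using assms(1) by simp
qed

lemma delta_sigma_set_pos: "0 < delta ==> delta_sigma_set delta sgm C A ==> delta powr (- sgm) <= C * card A"
proof -
 assume d: "0 < delta" and A: "delta_sigma_set delta sgm C A"
 then obtain a where a: "a \<in> A" "finite A" by (auto simp: delta_sigma_set_def)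
 have "a \<in> A Int cball a delta" using a d by simp
 then have "1 <= card (A Int cball a delta)" using a by (metis Suc_le_eq One_nat_def card_gt_0_iff empty_iff finite_Int)
 then have "1 <= real (card (A Int cball a delta))" by simp
 also have "... <= C * delta powr sgm * card A" using A by (simp add: delta_sigma_set_def)
 finally have "delta powr (- sgm) * 1 <= delta powr (- sgm) * (C * delta powr sgm * card A)" by (intro mult_left_mono) auto
 also have "... = (delta powr (- sgm) * delta powr sgm) * (C * card A)" by simp
 also have "delta powr (- sgm) * delta powr sgm = 1" using d by (simp flip: powr_add)
 finally show ?thesis by simp
qed

text \<open>The tube theorem is about one set in the unit interval, so \<open>A\<close> and
  \<open>s * A\<close> are joined into \<open>B\<close>, with \<open>phi\<close> mapping the
  interval from \<open>-2\<close> to \<open>2\<close> onto it. The exponent is lowered to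
  \<open>min sgm (1 / 2)\<close> to meet \<open>2 * sgm <= 1\<close>. By the choice of
  \<open>kappa\<close>, small \<open>dx\<close> accounts for at most \<open>1 / 8\<close> of the
  tuples, and thick pairs for another \<open>1 / 8\<close>.\<close>

lemma few_bad_pairs:
 fixes sgm C eps :: real
 assumes sig: "0 < sgm" "sgm < 1" and C: "0 < C" and eps: "0 < eps"
 obtains kappa delta1 :: real where "0 < kappa" "kappa <= 1" "0 < delta1" "16 * delta1 <= kappa"
  "!!delta A D s M k. delta < delta1 ==> delta_sigma_set delta sgm C A ==>
   dilation A D s delta kappa (4 * delta powr (2 * min sgm (1 / 2) - eps)) M k ==>
   card {w \<in> dilation.Q A. ~ dilation.good A s delta kappa (4 * delta powr (2 * min sgm (1 / 2) - eps)) w} <= real (card (dilation.Q A)) / 4"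
proof -
 define sgm' where "sgm' = min sgm (1 / 2)"
 define tau where "tau = 2 * sgm' - eps"
 have s': "0 < sgm'" "2 * sgm' <= 1" "sgm' <= sgm" using sig by (auto simp: sgm'_def)
 have "thin_tubes sgm' tau" using eps by (intro thin_tubes_all s') (simp add: tau_def)
 then obtain e d0 where e: "0 < e" "0 < d0" and S: "!!delta A. 0 < delta ==> delta < d0 ==> frostman delta sgm' (delta powr (- e)) A ==>
   card (thick_pairs A delta (delta powr tau)) <= delta powr e * (real (card (A \<times> A)))^2"
  unfolding thin_tubes_def by auto
 define kappa where "kappa = (1 / (8 * C + 8)) powr (1 / sgm)"
 have kap: "0 < kappa" "kappa <= 1" "C * kappa powr sgm <= 1 / 8"
 proof -
  show "0 < kappa" "kappa <= 1" using C sig by (auto simp: kappa_def intro!: powr_le1)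
  have "kappa powr sgm = 1 / (8 * C + 8)" using C sig by (simp add: kappa_def powr_powr)
  then have "C * kappa powr sgm = C / (8 * C + 8)" by simp
  also have "... <= 1 / 8" using C by simp
  finally show "C * kappa powr sgm <= 1 / 8" .
 qed
 define delta1 where "delta1 = min (min d0 (kappa / 16)) ((1 / (8 * C + 128)) powr (1 / e))"
 have d1: "0 < delta1" "16 * delta1 <= kappa" "delta1 <= d0" using kap e C by (auto simp: delta1_def)
 show thesis
 proof (rule that[OF kap(1,2) d1(1,2)], unfold sgm'_def[symmetric] tau_def[symmetric])
  fix delta A D s M k
  assume d: "delta < delta1" and dss: "delta_sigma_set delta sgm C A" and dil: "dilation A D s delta kappa (4 * delta powr tau) M k"
  interpret dilation A D s delta kappa "4 * delta powr tau" M k by (rule dil)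
  let ?n = "real (card A)"
  have ne: "A ~= {}" and ball: "!!x r. delta <= r ==> real (card (A Int cball x r)) <= C * r powr sgm * ?n"
   using dss by (auto simp: delta_sigma_set_def)
  have fA: "finite A" "A <= {1..2}" using A by auto
  have de: "delta powr e <= 1 / (8 * C + 128)"
  proof -
   have "delta powr e <= ((1 / (8 * C + 128)) powr (1 / e)) powr e" using d par e by (intro powr_mono2) (auto simp: delta1_def)
   then show ?thesis using e C by (simp add: powr_powr)
  qed
  define phi where "phi v = (v + 2) / 4" for v :: real
  have inj: "inj phi" by (auto simp: inj_on_def phi_def)
  have phi: "phi u - phi v = (u - v) / 4" for u v by (simp add: phi_def field_simps)
  have s0: "s * s = 1" using s by (cases "0 <= s") auto
  have quarter: "(u / 4) / (v / 4) = u / v" "u / 4 - m * (v / 4) = (u - m * v) / 4" "t = u / 4 ==> abs u <= 4 * delta ==> abs t <= delta"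
   for m t u v :: real by auto
  have inj_s: "u = v" if "s * u = s * v" for u v using arg_cong[OF that, of "%t. s * t"] s0 by auto
  define B where "B = phi ` (A Un (%a. s * a) ` A)"
  have B: "finite B" "B ~= {}" using ne fA(1) by (auto simp: B_def)
  have cB: "?n <= card B" "real (card B) <= 2 * ?n"
  proof -
   have "card (phi ` A) <= card B" using B by (intro card_mono) (auto simp: B_def)
   then show "?n <= card B" using inj by (simp add: card_image inj_on_subset)
   have "card B <= card (A Un (%a. s * a) ` A)" unfolding B_def by (intro card_image_le) (simp add: fA(1))
   also have "... <= card A + card A" using card_Un_le[of A "(%a. s * a) ` A"] card_image_le[OF fA(1), of "%a. s * a"] by simp
   finally show "real (card B) <= 2 * ?n" by simp
  qed
  have "frostman delta sgm' (delta powr (- e)) B" unfolding frostman_def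
  proof (intro conjI allI impI B)
   have "abs v <= 2" if "v \<in> A Un (%a. s * a) ` A" for v using that fA s by (auto simp: abs_mult)
   note bound = this
   show "B <= {0..1}" unfolding B_def
   proof (rule image_subsetI)
    fix v assume "v \<in> A Un (%a. s * a) ` A"
    from bound[OF this] show "phi v \<in> {0..1}" by (simp add: phi_def abs_le_iff)
   qed
   fix x r assume r: "delta <= r"
   have K: "8 * C + 128 <= delta powr (- e)"
    using de C par by (simp add: powr_minus field_simps)
   show "card (B Int {x - r..x + r}) <= delta powr (- e) * r powr sgm' * card B"
   proof (cases "r <= 1")
    case True
    let ?I = "%y. A Int cball y (4 * r)"
    have "B Int {x - r..x + r} <= phi ` ?I (4 * x - 2) Un (%a. phi (s * a)) ` ?I (s * (4 * x - 2))"
    proof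
     fix b assume b: "b \<in> B Int {x - r..x + r}"
     then obtain v where v: "v \<in> A Un (%a. s * a) ` A" "b = phi v" by (auto simp: B_def)
     have near: "abs (v - (4 * x - 2)) <= 4 * r" using b unfolding v(2) by (auto simp: phi_def)
     show "b \<in> phi ` ?I (4 * x - 2) Un (%a. phi (s * a)) ` ?I (s * (4 * x - 2))"
     proof (cases "v \<in> A")
      case True
      then have "v \<in> ?I (4 * x - 2)" using near by (simp add: dist_real_def)
      then show ?thesis using v(2) by simp
     next
      case False
      then obtain a where a: "a \<in> A" "v = s * a" using v(1) by auto
      have "s * (s * a - (4 * x - 2)) = a - s * (4 * x - 2)" unfolding right_diff_distrib mult.assoc[symmetric] s0 by simp
      then have "abs (a - s * (4 * x - 2)) = abs s * abs (v - (4 * x - 2))" unfolding a(2) abs_mult[symmetric] by simp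
      then have "a \<in> ?I (s * (4 * x - 2))" using a near s by (simp add: dist_real_def)
      then show ?thesis using a v(2) by simp
     qed
    qed
    then have "card (B Int {x - r..x + r}) <= card (phi ` ?I (4 * x - 2) Un (%a. phi (s * a)) ` ?I (s * (4 * x - 2)))"
     using fA(1) by (intro card_mono) auto
    also have "... <= card (?I (4 * x - 2)) + card (?I (s * (4 * x - 2)))"
     using fA(1) by (intro order_trans[OF card_Un_le] add_mono card_image_le) auto
    finally have "real (card (B Int {x - r..x + r})) <= 2 * (C * (4 * r) powr sgm * ?n)"
     using ball[of "4 * r" "4 * x - 2"] ball[of "4 * r" "s * (4 * x - 2)"] r par by linarith
    also have "... <= 2 * (C * (4 * r powr sgm') * card B)"
    proof -
     have "(4 * r) powr sgm = 4 powr sgm * r powr sgm" by (simp add: powr_mult)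
     also have "... <= 4 powr 1 * r powr sgm'" using sig s' True r par by (intro mult_mono powr_mono powr_mono') auto
     finally have "(4 * r) powr sgm <= 4 * r powr sgm'" by simp
     then show ?thesis using C cB by (intro mult_left_mono mult_mono) auto
    qed
    also have "... = (8 * C) * (r powr sgm' * card B)" by simp
    also have "... <= delta powr (- e) * (r powr sgm' * card B)" using K by (intro mult_right_mono) auto
    finally show ?thesis by simp
   next
    case False
    have "1 <= r powr sgm'" using False s' by (intro ge_one_powr_ge_zero) auto
    then have "1 * 1 <= delta powr (- e) * r powr sgm'" using K C by (intro mult_mono) auto
    then have "1 * real (card B) <= delta powr (- e) * r powr sgm' * card B" by (intro mult_right_mono) auto
    moreover have "card (B Int {x - r..x + r}) <= card B" using B by (intro card_mono) auto
    ultimately show ?thesis by simp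
   qed
  qed
  from S[OF par(1) _ this] d d1 have "card (thick_pairs B delta (delta powr tau)) <= delta powr e * (real (card (B \<times> B)))^2" by simp
  \<comment> \<open>The constant compensates for \<open>B\<close> having up to twice as many
    elements as \<open>A\<close>: \<open>(4 * n^2)^2 / 128 = n ^ 4 / 8\<close>.\<close>
  also have "... <= (1 / 128) * (4 * ?n^2)^2"
  proof (intro mult_mono power_mono)
   have "1 / (8 * C + 128) <= 1 / 128" using C by simp
   then show "delta powr e <= 1 / 128" using de by simp
   have "real (card (B \<times> B)) = real (card B) * real (card B)" by (simp add: card_cartesian_product)
   also have "... <= (2 * ?n) * (2 * ?n)" using cB by (intro mult_mono) auto
   finally show "real (card (B \<times> B)) <= 4 * ?n^2" by (simp add: power2_eq_square)
  qed auto
  also have "... = ?n ^ 4 / 8" by simp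
  finally have thick: "real (card (thick_pairs B delta (delta powr tau))) <= ?n ^ 4 / 8" .
  let ?near = "{w \<in> Q. abs (dx w) < kappa}" and ?heavy = "{w \<in> Q. kappa <= abs (dx w) & ~ good w}"
  have "real (card ?near) <= ?n ^ 4 / 8"
  proof -
   let ?R = "{(a, x). a \<in> A & x \<in> A & abs (x - s * a) < kappa}"
   have fR: "finite ?R" by (rule finite_subset[of _ "A \<times> A"]) (use fA(1) in auto)
   have "card ?near <= card (?R \<times> (A \<times> A))"
    by (rule card_inj_on_le[where f = "%w. ((fst (fst w), fst (snd w)), (snd (fst w), snd (snd w)))"])
     (use fR fA(1) in \<open>auto simp: inj_on_def Q_def dx_def prod_eq_iff\<close>)
   also have "... = card ?R * (card A * card A)" by (simp add: card_cartesian_product)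
   finally have "real (card ?near) <= real (card ?R) * (?n * ?n)" by (simp flip: of_nat_mult)
   also have "real (card ?R) = (\<Sum>a\<in>A. real (card {x \<in> A. abs (x - s * a) < kappa}))"
    using card_rel_bound[OF fA(1) fA(1), of "%a x. abs (x - s * a) < kappa"] by simp
   also have "... <= (\<Sum>a\<in>A. 1 / 8 * ?n)"
   proof (intro sum_mono)
    fix a
    have "card {x \<in> A. abs (x - s * a) < kappa} <= card (A Int cball (s * a) kappa)"
     using fA(1) by (intro card_mono) (auto simp: dist_real_def abs_minus_commute)
    also have "real ... <= C * kappa powr sgm * ?n" using par by (intro ball) simp
    also have "... <= 1 / 8 * ?n" using kap(3) by (intro mult_right_mono) auto
    finally show "real (card {x \<in> A. abs (x - s * a) < kappa}) <= 1 / 8 * ?n" by simp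
   qed
   finally show ?thesis by (simp add: power4_eq_xxxx mult_right_mono)
  qed
  moreover have "card ?heavy <= card (thick_pairs B delta (delta powr tau))"
  proof (rule card_inj_on_le[where f = "%w. ((phi (s * fst (fst w)), phi (s * snd (fst w))), (phi (fst (snd w)), phi (snd (snd w))))"])
   let ?psi = "%w. ((phi (s * fst (fst w)), phi (s * snd (fst w))), (phi (fst (snd w)), phi (snd (snd w))))"
   show "finite (thick_pairs B delta (delta powr tau))" using B by (simp add: thick_pairs_def)
   show "inj_on ?psi ?heavy"
   proof (rule inj_onI)
    fix w w' assume "?psi w = ?psi w'"
    then have "s * fst (fst w) = s * fst (fst w')" "s * snd (fst w) = s * snd (fst w')" "snd w = snd w'"
     unfolding prod.inject inj_eq[OF inj] by (simp_all add: prod_eq_iff)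
    then show "w = w'" using inj_s by (metis prod_eq_iff)
   qed
   show "?psi ` ?heavy <= thick_pairs B delta (delta powr tau)"
   proof (rule image_subsetI)
    fix w assume w: "w \<in> ?heavy"
    have mem: "?psi w \<in> (B \<times> B) \<times> (B \<times> B)" using w by (auto simp: Q_def B_def)
    have sl: "slope (?psi w) = dy w / dx w" unfolding slope_def fst_conv snd_conv phi dx_def dy_def by (rule quarter(1))
    let ?S = "{q \<in> A \<times> A. abs ((snd q - s * snd (fst w)) - dy w / dx w * (fst q - s * fst (fst w))) <= 4 * delta}"
    have "delta powr tau * real (card (B \<times> B)) <= delta powr tau * ((2 * ?n) * (2 * ?n))"
     unfolding card_cartesian_product of_nat_mult using cB by (intro mult_left_mono mult_mono) auto
    also have "... = 4 * delta powr tau * ?n^2" by (simp add: power2_eq_square)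
    also have "... <= card ?S" using w by (simp add: good_def not_less)
    also have "... <= card {q \<in> B \<times> B. abs (snd q - slope (?psi w) * fst q - icpt (?psi w)) <= delta}"
    proof (intro of_nat_mono card_inj_on_le[where f = "%q. (phi (fst q), phi (snd q))"])
     show "inj_on (%q. (phi (fst q), phi (snd q))) ?S" by (auto simp: inj_on_def inj_eq[OF inj])
     show "(%q. (phi (fst q), phi (snd q))) ` ?S <= {q \<in> B \<times> B. abs (snd q - slope (?psi w) * fst q - icpt (?psi w)) <= delta}"
     proof (rule image_subsetI)
      fix q assume q: "q \<in> ?S"
      have "phi (snd q) - slope (?psi w) * phi (fst q) - icpt (?psi w) =
       (phi (snd q) - phi (s * snd (fst w))) - slope (?psi w) * (phi (fst q) - phi (s * fst (fst w)))" by (simp add: icpt_def algebra_simps)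
      also have "... = ((snd q - s * snd (fst w)) - dy w / dx w * (fst q - s * fst (fst w))) / 4" unfolding sl phi by simp
      finally have "abs (phi (snd q) - slope (?psi w) * phi (fst q) - icpt (?psi w)) <= delta" using q by auto
      moreover have "phi (fst q) \<in> B" "phi (snd q) \<in> B" using q by (auto simp: B_def)
      ultimately show "(phi (fst q), phi (snd q)) \<in> {q \<in> B \<times> B. abs (snd q - slope (?psi w) * fst q - icpt (?psi w)) <= delta}" by simp
     qed
    qed (use B in simp)
    finally show "?psi w \<in> thick_pairs B delta (delta powr tau)" using mem by (simp add: thick_pairs_def)
   qed
  qed
  moreover have "card {w \<in> Q. ~ good w} <= card ?near + card ?heavy"
  proof -
   have "{w \<in> Q. ~ good w} = ?near Un ?heavy" by (auto simp: good_def)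
   then show ?thesis using card_Un_le[of ?near ?heavy] by simp
  qed
  moreover have "real (card Q) = ?n ^ 4" by (simp add: Q_def card_cartesian_product power4_eq_xxxx)
  ultimately show "real (card {w \<in> Q. ~ good w}) <= real (card Q) / 4" using thick by simp
 qed
qed

lemma sum_product_quotient:
 fixes sgm C eps :: real
 assumes sig: "0 < sgm" "sgm < 1" and C: "0 < C" and eps: "0 < eps"
 obtains K delta1 :: real where "0 < K" "0 < delta1" "delta1 < 1"
  "!!delta A s. 0 < delta ==> delta < delta1 ==> delta_sigma_set delta sgm C A ==> A <= {1..2} ==> abs s = 1 ==>
   delta powr (eps - sgm - min sgm (1 - sgm) / 6) <= K * (real (covering_number delta {x - s * a |x a. x \<in> A & a \<in> A})
    + real (covering_number delta {a * b |a b. a \<in> A & b \<in> A})) &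
   delta powr (eps - sgm - min sgm (1 - sgm) / 5) <= K * (real (covering_number delta {x - s * a |x a. x \<in> A & a \<in> A})
    + real (covering_number delta {a / b |a b. a \<in> A & b \<in> A}))"
proof -
 define tau where "tau = 2 * min sgm (1 / 2) - eps"
 obtain kappa d1 where kap: "0 < kappa" "kappa <= 1" and d1: "0 < d1" "16 * d1 <= kappa" and bad: "!!delta A D s M k. delta < d1 ==> delta_sigma_set delta sgm C A ==>
   dilation A D s delta kappa (4 * delta powr tau) M k ==>
   card {w \<in> dilation.Q A. ~ dilation.good A s delta kappa (4 * delta powr tau) w} <= real (card (dilation.Q A)) / 4"
  unfolding tau_def by (rule few_bad_pairs[OF sig C eps]) blast
 define K0 where "K0 = 8 * (1042 / kappa) ^ 5 * (722 / kappa^2) * 4"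
 define K1 where "K1 = K0 * 64 * (C ^ 5 + C ^ 4)"
 have K: "0 < K0" "0 < K1"
 proof -
  show "0 < K0" using kap by (simp add: K0_def)
  moreover have "0 < C ^ 5 + C ^ 4" using C by (intro add_pos_pos) auto
  ultimately show "0 < K1" by (simp add: K1_def)
 qed
 show thesis
 proof (rule that[of "K1 + 1" "min d1 (1 / 2)"])
  fix delta A and s :: real
  assume d: "0 < delta" "delta < min d1 (1 / 2)" and dss: "delta_sigma_set delta sgm C A" and A12: "A <= {1..2}" and s: "abs s = 1"
  let ?n = "real (card A)" and ?S = "{x - s * a |x a. x \<in> A & a \<in> A}"
  let ?P = "{a * b |a b. a \<in> A & b \<in> A}" and ?R = "{a / b |a b. a \<in> A & b \<in> A}"
  let ?fl = "%u. \<lfloor>u / delta\<rfloor>"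
  have fA: "finite A" "A ~= {}" and sep: "separated delta A"
   using dss by (auto simp: delta_sigma_set_def delta_separated_def separated_def dist_real_def)
  have card_pos: "0 < ?n" using fA by auto
  have n: "delta powr (- sgm) <= C * ?n" by (rule delta_sigma_set_pos[OF d(1) dss])
  have "?S = (%(x, a). x - s * a) ` (A \<times> A)" "?P = (%(x, a). x * a) ` (A \<times> A)" "?R = (%(x, a). x / a) ` (A \<times> A)" by auto
  then have finS: "finite ?S" "finite ?P" "finite ?R" using fA by auto
  have "?P ~= {}" "?R ~= {}" using fA by auto
  then have ne: "1 <= ncell delta ?P" "1 <= ncell delta ?R" using ncell_pos finS by auto
  have cov: "real (ncell delta E) <= 2 * real (covering_number delta E)" if "finite E" for E
   using of_nat_mono[OF ncell_le_covering[OF that d(1)], where 'a = real] by simp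
  have A_unit: "x \<in> A ==> 1 <= x & x <= 2" for x using A12 by auto
  have main: "real k * ?n ^ 4 <= K0 * delta powr tau * M * (real (ncell delta ?S))^2"
   if D: "!!x. x \<in> A ==> finite (D x) & card (D x) = k & D x <= {1 / 2..2}" "separated (delta / 4) (\<Union>x\<in>A. D x)"
    and M: "1 <= M" "card (dilation.cell delta ` dilation.Z A D) <= M" and k: "1 <= k" for D k and M :: real
  proof -
   have dil: "dilation A D s delta kappa (4 * delta powr tau) M k"
    by unfold_locales (use fA A12 sep s d kap d1 D M in auto)
   interpret dilation A D s delta kappa "4 * delta powr tau" M k by (rule dil)
   have "real k * ?n ^ 4 <= 8 * (1042 / kappa) ^ 5 * (722 / kappa^2) * (4 * delta powr tau) * M * (real (ncell delta ?S))^2"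
    using d by (intro dilation_bound M(2) bad[OF _ dss dil] fA(2) k) auto
   then show ?thesis by (simp add: K0_def)
  qed
  \<comment> \<open>\<open>p\<close> counts the covering factors and \<open>j = p - 1\<close> the
    powers of \<open>|A|\<close>. The identity
    \<open>2 * min sgm (1 / 2) - sgm = min sgm (1 - sgm)\<close> turns the surplus of
    \<open>tau\<close> over \<open>sgm\<close> into the stated gain.\<close>
  have lower: "delta powr (eps - sgm - min sgm (1 - sgm) / p) <= (K1 + 1) * T"
   if p: "real p = real j + 1" "1 <= p" "?n ^ j <= K0 * 64 * delta powr tau * T ^ p" "0 <= T" "C ^ j <= C ^ 5 + C ^ 4" for p j and T :: real
  proof (rule power_lower[OF p(4) _ K(2) p(2)])
   have g: "2 * min sgm (1 / 2) - sgm = min sgm (1 - sgm)" by simp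
   have "(delta powr (eps - sgm - min sgm (1 - sgm) / p)) ^ p = delta powr ((eps - sgm - min sgm (1 - sgm) / p) * p)" using d by (simp add: powr_power mult.commute)
   also have "(eps - sgm - min sgm (1 - sgm) / p) * p = p * eps - p * sgm - min sgm (1 - sgm)" using p(2) by (simp add: field_simps)
   also have "delta powr (p * eps - p * sgm - min sgm (1 - sgm)) <= delta powr (- tau + - (sgm * j))"
   proof (intro powr_mono')
    have "1 * eps <= p * eps" using p(2) eps by simp
    then show "- tau + - (sgm * j) <= p * eps - p * sgm - min sgm (1 - sgm)" using g unfolding p(1) by (simp add: tau_def algebra_simps)
   qed (use d in auto)
   also have "... = delta powr (- tau) * (delta powr (- sgm)) ^ j" using d by (simp add: powr_power mult.commute flip: powr_add)
   also have "... <= delta powr (- tau) * (C * ?n) ^ j" using n by (intro mult_left_mono power_mono) auto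
   also have "... = C ^ j * (delta powr (- tau) * ?n ^ j)" by (simp add: power_mult_distrib)
   also have "... <= C ^ j * (delta powr (- tau) * (K0 * 64 * delta powr tau * T ^ p))" using p(3) C by (intro mult_left_mono) auto
   also have "... = C ^ j * ((delta powr (- tau) * delta powr tau) * (K0 * 64) * T ^ p)" by simp
   also have "delta powr (- tau) * delta powr tau = 1" using d by (simp flip: powr_add)
   also have "C ^ j * (1 * (K0 * 64) * T ^ p) = C ^ j * (K0 * 64 * T ^ p)" by simp
   also have "... <= (C ^ 5 + C ^ 4) * (K0 * 64 * T ^ p)" using p(4,5) K by (intro mult_right_mono) auto
   finally show "(delta powr (eps - sgm - min sgm (1 - sgm) / p)) ^ p <= K1 * T ^ p" by (simp add: K1_def mult_ac)
  qed (use d in auto)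
  have step: "X * m ^ a * (real (ncell delta ?S))^2 <= X * 64 * T ^ (a + 2)"
   if X: "0 <= X" "0 <= m" "m <= 2 * t" "0 <= t" "T = real (covering_number delta ?S) + t" "a <= 4" for X m t T :: real and a
  proof -
   have "m ^ a * (real (ncell delta ?S))^2 <= (2 * T) ^ a * (2 * T)^2"
    using X cov[OF finS(1)] by (intro mult_mono power_mono) auto
   also have "... = 2 ^ (a + 2) * T ^ (a + 2)" by (simp add: power2_eq_square)
   also have "... <= 2 ^ 6 * T ^ (a + 2)" using X by (intro mult_right_mono power_increasing) auto
   finally have "X * (m ^ a * (real (ncell delta ?S))^2) <= X * (2 ^ 6 * T ^ (a + 2))" using X(1) by (rule mult_left_mono)
   moreover have "(2 :: real) ^ 6 = 64" by simp
   ultimately show ?thesis by simp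
  qed
  have "?n ^ 5 <= K0 * delta powr tau * real (ncell delta ?P) ^ 4 * (real (ncell delta ?S))^2"
  proof -
   have "real (card A) * ?n ^ 4 <= K0 * delta powr tau * real (ncell delta ?P) ^ 4 * (real (ncell delta ?S))^2"
   \<comment> \<open>All four scaled entries lie in the product set, whence the fourth power; the
     \<open>card A\<close> choices of the factor supply the fifth power of
     \<open>|A|\<close>.\<close>
   proof (rule main[where D = "%_. A"])
    show "finite A & card A = card A & A <= {1 / 2..2}" using fA A_unit by force
    show "separated (delta / 4) (\<Union>x\<in>A. A)" using sep d by (force simp: separated_def)
    interpret dilation A "%_. A" s delta kappa "1" "1" "card A"
     by unfold_locales (use fA A12 sep s d kap d1 A_unit in \<open>force simp: separated_def\<close>)+
    have "?fl (u * v) \<in> ?fl ` ?P" if "u \<in> A" "v \<in> A" for u v using that by auto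
    then have "cell ` Z <= ((?fl ` ?P \<times> ?fl ` ?P) \<times> (?fl ` ?P \<times> ?fl ` ?P))" by (simp add: image_subset_iff cell_def Z_def Q_def)
    then have "card (cell ` Z) <= card ((?fl ` ?P \<times> ?fl ` ?P) \<times> (?fl ` ?P \<times> ?fl ` ?P))" by (intro card_mono finite_cartesian_product finite_imageI finS)
    then show "real (card (cell ` Z)) <= real (ncell delta ?P) ^ 4"
     by (simp add: card_cartesian_product ncell_def power4_eq_xxxx mult.assoc flip: of_nat_mult)
    show "1 <= card A" using card_pos by simp
   qed (use ne in simp)
   then show ?thesis by (simp add: power_numeral_reduce)
  qed
  also have "... <= K0 * delta powr tau * 64 * (real (covering_number delta ?S) + real (covering_number delta ?P)) ^ (4 + 2)"
   using K by (intro step[OF _ _ cov[OF finS(2)]]) auto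
  finally have P6: "delta powr (eps - sgm - min sgm (1 - sgm) / 6) <= (K1 + 1) * (real (covering_number delta ?S) + real (covering_number delta ?P))"
   using lower[of 6 5 "real (covering_number delta ?S) + real (covering_number delta ?P)"] by simp
  have "?n ^ 4 <= K0 * delta powr tau * real (ncell delta ?R) ^ 3 * (real (ncell delta ?S))^2"
  proof -
   have inv: "separated (delta / 4) (\<Union>x\<in>A. {1 / x})" unfolding separated_def
   proof (intro ballI impI)
    fix u v assume "u \<in> (\<Union>x\<in>A. {1 / x})" "v \<in> (\<Union>x\<in>A. {1 / x})" "u ~= v"
    then obtain x y where xy: "x \<in> A" "y \<in> A" "u = 1 / x" "v = 1 / y" "x ~= y" by auto
    have p: "x * y <= 2 * 2" "0 < x * y"
     using A_unit[OF xy(1)] A_unit[OF xy(2)] mult_mono[of x 2 y 2] by auto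
    have "abs (u - v) = abs (x - y) / (x * y)" using A_unit[OF xy(1)] A_unit[OF xy(2)] unfolding xy by (simp add: field_simps)

    moreover have "delta / 4 <= abs (x - y) / (x * y)" using sep xy p by (intro frac_le) (auto simp: separated_def)
    ultimately show "delta / 4 <= abs (u - v)" by simp
   qed
   have D: "finite {1 / x} & card {1 / x} = 1 & {1 / x} <= {1 / 2..2}" if "x \<in> A" for x using A_unit[OF that] by (auto simp: field_simps)
   have "real 1 * ?n ^ 4 <= K0 * delta powr tau * real (ncell delta ?R) ^ 3 * (real (ncell delta ?S))^2"
   \<comment> \<open>Dividing by \<open>x\<close> makes the third entry \<open>1\<close>, so only
     three quotient cells vary, at the price of a single factor per tuple.\<close>
   proof (rule main[where D = "%x. {1 / x}", OF D inv])
    interpret dilation A "%x. {1 / x}" s delta kappa "1" "1" 1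
     by unfold_locales (use fA A12 sep s d kap d1 D inv in auto)
    have "cell ` Z <= ((?fl ` ?R \<times> ?fl ` ?R) \<times> ({?fl 1} \<times> ?fl ` ?R))"
    proof (rule image_subsetI)
     fix z assume z: "z \<in> Z"
     then have "fst (snd (fst z)) \<in> A" "snd z = 1 / fst (snd (fst z))" by (auto simp: Z_def Q_def)
     then have "fst (snd (fst z)) * snd z = 1" using A_unit by force
     then have "?fl (fst (snd (fst z)) * snd z) = ?fl 1" by simp
     moreover have "?fl (u / v) \<in> ?fl ` ?R" if "u \<in> A" "v \<in> A" for u v using that by blast
     ultimately show "cell z \<in> ((?fl ` ?R \<times> ?fl ` ?R) \<times> ({?fl 1} \<times> ?fl ` ?R))" using z by (auto simp: cell_def Z_def Q_def)
    qed
    then have "card (cell ` Z) <= card ((?fl ` ?R \<times> ?fl ` ?R) \<times> ({?fl 1} \<times> ?fl ` ?R))" by (intro card_mono finite_cartesian_product finite_imageI finS) auto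
    then show "real (card (cell ` Z)) <= real (ncell delta ?R) ^ 3"
     by (simp add: card_cartesian_product ncell_def power3_eq_cube flip: of_nat_mult)
   qed (use ne in auto)
   then show ?thesis by simp
  qed
  moreover have "K0 * delta powr tau * real (ncell delta ?R) ^ 3 * (real (ncell delta ?S))^2
    <= K0 * delta powr tau * 64 * (real (covering_number delta ?S) + real (covering_number delta ?R)) ^ (3 + 2)"
   using K by (intro step[OF _ _ cov[OF finS(3)]]) auto
  ultimately have "delta powr (eps - sgm - min sgm (1 - sgm) / 5) <= (K1 + 1) * (real (covering_number delta ?S) + real (covering_number delta ?R))"
   using lower[of 5 4 "real (covering_number delta ?S) + real (covering_number delta ?R)"] C by simp
  with P6 show "delta powr (eps - sgm - min sgm (1 - sgm) / 6) <= (K1 + 1) * (real (covering_number delta ?S) + real (covering_number delta ?P)) &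
   delta powr (eps - sgm - min sgm (1 - sgm) / 5) <= (K1 + 1) * (real (covering_number delta ?S) + real (covering_number delta ?R))" by simp
 qed (use K d1 in auto)
qed

theorem theorem1p4:
  fixes \<sigma> C c c' \<epsilon> :: real
  assumes "0 < \<sigma>" and "\<sigma> < 1" and "C > 0"
    and "c = min \<sigma> (1 - \<sigma>) / 6"
    and "c' = min \<sigma> (1 - \<sigma>) / 5"
    and "0 < \<epsilon>" and "\<epsilon> < 1"
  shows "\<exists>K>0. \<forall>\<delta>. \<forall>A :: real set.
    0 < \<delta> \<and> \<delta> < 1 \<and> delta_sigma_set \<delta> \<sigma> C A \<and> A \<subseteq> {1..2} \<longrightarrow>
      real (covering_number \<delta> {a + b |a b. a \<in> A \<and> b \<in> A})
        + real (covering_number \<delta> {a * b |a b. a \<in> A \<and> b \<in> A})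
        \<ge> inverse K * \<delta> powr \<epsilon> * \<delta> powr (- \<sigma> - c) \<and>
      real (covering_number \<delta> {a - b |a b. a \<in> A \<and> b \<in> A})
        + real (covering_number \<delta> {a * b |a b. a \<in> A \<and> b \<in> A})
        \<ge> inverse K * \<delta> powr \<epsilon> * \<delta> powr (- \<sigma> - c) \<and>
      real (covering_number \<delta> {a + b |a b. a \<in> A \<and> b \<in> A})
        + real (covering_number \<delta> {a / b |a b. a \<in> A \<and> b \<in> A})
        \<ge> inverse K * \<delta> powr \<epsilon> * \<delta> powr (- \<sigma> - c') \<and>
      real (covering_number \<delta> {a - b |a b. a \<in> A \<and> b \<in> A})
        + real (covering_number \<delta> {a / b |a b. a \<in> A \<and> b \<in> A})
        \<ge> inverse K * \<delta> powr \<epsilon> * \<delta> powr (- \<sigma> - c')"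
proof -
 obtain K \<delta>1 :: real where K: "0 < K" "0 < \<delta>1" "\<delta>1 < 1" and small: "!!\<delta> A s. 0 < \<delta> ==> \<delta> < \<delta>1 ==> delta_sigma_set \<delta> \<sigma> C A ==>
   A <= {1..2} ==> abs s = 1 ==>
   \<delta> powr (\<epsilon> - \<sigma> - c) <= K * (real (covering_number \<delta> {x - s * a |x a. x \<in> A & a \<in> A})
    + real (covering_number \<delta> {a * b |a b. a \<in> A & b \<in> A})) &
   \<delta> powr (\<epsilon> - \<sigma> - c') <= K * (real (covering_number \<delta> {x - s * a |x a. x \<in> A & a \<in> A})
    + real (covering_number \<delta> {a / b |a b. a \<in> A & b \<in> A}))"
  unfolding assms(4,5) by (rule sum_product_quotient[OF assms(1,2,3,6)]) blast
 \<comment> \<open>For \<open>\<delta> >= \<delta>1\<close> the power on the left is at most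
   \<open>\<delta>1 powr (- 2)\<close>, because its exponent is at least \<open>- 2\<close>, while a
   covering number of a non-empty set is at least \<open>1\<close>.\<close>
 define K' where "K' = max K (\<delta>1 powr (- 2))"
 have K': "0 < K'" "K <= K'" "\<delta>1 powr (- 2) <= K'" using K by (auto simp: K'_def)
 have bound: "inverse K' * \<delta> powr \<epsilon> * \<delta> powr (- \<sigma> - c) <= real (covering_number \<delta> {x - s * a |x a. x \<in> A & a \<in> A})
    + real (covering_number \<delta> {a * b |a b. a \<in> A & b \<in> A}) &
   inverse K' * \<delta> powr \<epsilon> * \<delta> powr (- \<sigma> - c') <= real (covering_number \<delta> {x - s * a |x a. x \<in> A & a \<in> A})
    + real (covering_number \<delta> {a / b |a b. a \<in> A & b \<in> A})" (is "_ * _ * _ <= ?S + ?P & _ * _ * _ <= _ + ?R")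
  if d: "0 < \<delta>" "\<delta> < 1" and A: "delta_sigma_set \<delta> \<sigma> C A" "A <= {1..2}" and s: "abs s = 1" for \<delta> A and s :: real
 proof -
  have "\<delta> powr (\<epsilon> - \<sigma> - e) <= K' * (?S + t)" if t: "0 <= t" "\<delta> < \<delta>1 ==> \<delta> powr (\<epsilon> - \<sigma> - e) <= K * (?S + t)" "e <= 1" for e t
  proof (cases "\<delta> < \<delta>1")
   case True
   have "K * (?S + t) <= K' * (?S + t)" using K'(2) t(1) by (intro mult_right_mono) auto
   then show ?thesis using t(2)[OF True] by simp
  next
   case False
   have "\<delta> powr (\<epsilon> - \<sigma> - e) <= \<delta> powr (- 2)" using d assms(2,6) t(3) by (intro powr_mono') auto
   also have "... <= \<delta>1 powr (- 2)" using False K by (intro powr_mono2') auto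
   also have "... <= K' * 1" using K'(3) by simp
   also have "... <= K' * (?S + t)"
   proof (intro mult_left_mono)
    have fA: "finite A" "A ~= {}" using A(1) by (auto simp: delta_sigma_set_def)
    have "{x - s * a |x a. x \<in> A & a \<in> A} = (%(x, a). x - s * a) ` (A \<times> A)" by auto
    then have f: "finite {x - s * a |x a. x \<in> A & a \<in> A}" using fA by simp
    have "{x - s * a |x a. x \<in> A & a \<in> A} ~= {}" using fA by auto
    then have "1 <= 2 * covering_number \<delta> {x - s * a |x a. x \<in> A & a \<in> A}"
     by (rule order_trans[OF ncell_pos[OF f] ncell_le_covering[OF f d(1)]])
    then have "1 <= covering_number \<delta> {x - s * a |x a. x \<in> A & a \<in> A}" by simp
    then show "1 <= ?S + t" using t(1) by simp
   qed (use K' in simp)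
   finally show ?thesis .
  qed
  note large = this
  have scale: "inverse K' * \<delta> powr \<epsilon> * \<delta> powr (- \<sigma> - e) <= T" if "\<delta> powr (\<epsilon> - \<sigma> - e) <= K' * T" for e T
  proof -
   have "inverse K' * \<delta> powr (\<epsilon> - \<sigma> - e) <= T" using that K' by (simp add: field_simps)
   moreover have "\<delta> powr (\<epsilon> - \<sigma> - e) = \<delta> powr \<epsilon> * \<delta> powr (- \<sigma> - e)" unfolding powr_add[symmetric] by (rule arg_cong[of _ _ "%y. \<delta> powr y"]) simp
   ultimately show ?thesis by simp
  qed
  have "c <= 1" "c' <= 1" using assms by auto
  then show ?thesis using small[OF d(1) _ A s] by (intro conjI scale large) auto
 qed
 show ?thesis
 proof (rule exI[of _ K'], intro conjI K'(1) allI impI, goal_cases)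
  case (1 \<delta> A)
  then show ?case using bound[of \<delta> A "- 1"] by simp
 next
  case (2 \<delta> A)
  then show ?case using bound[of \<delta> A 1] by simp
 next
  case (3 \<delta> A)
  then show ?case using bound[of \<delta> A "- 1"] by simp
 next
  case (4 \<delta> A)
  then show ?case using bound[of \<delta> A 1] by simp
 qed
qed

end
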